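(* Let $H_D(\bullet)$ denote the functor taking a module to its Dirac cohomology. The diagram with top arrow $$F:\ \mathbb{H}(G(m,1,n))\text{-mod}\to\bigoplus_{\underline a\in A}\mathbb{H}(S_{a_0})\otimes\cdots\otimes\mathbb{H}(S_{a_{m-1}})\text{-mod},$$ vertical arrows $$H_D(\bullet):\mathbb{H}(G(m,1,n))\text{-mod}\to\mathbb{C}[\widetilde{G(m,1,n)}]\text{-mod},\qquad H_D(\bullet):\bigoplus_{\underline a\in A}\mathbb{H}(S_{a_0})\otimes\cdots\otimes\mathbb{H}(S_{a_{m-1}})\text{-mod}\to\bigoplus_{\underline a\in A}\mathbb{C}[\widetilde{S_{\underline a}}]\text{-mod},$$ and bottom arrow $$\widetilde F^{-1}:\ \bigoplus_{\underline a\in A}\mathbb{C}[\widetilde{S_{\underline a}}]\text{-mod}\to\mathbb{C}[\widetilde{G(m,1,n)}]\text{-mod}$$ commutes: $H_D(\bullet)\cong\widetilde F^{-1}\circ H_D(\bullet)\circ F$ as functors $\mathbb{H}(G(m,1,n))\text{-mod}\to\mathbb{C}[\widetilde{G(m,1,n)}]\text{-mod}$.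
   Context: Fix integers $m,n\ge 1$, $\mathbf{k}\in\mathbb{C}$, and a primitive $m$-th root of unity $\eta$. Let $G=G(m,1,n)=S_n\ltimes T$, $T=(\mathbb{Z}/m\mathbb{Z})^n$ generated by commuting $g_1,\dots,g_n$ of order $m$, with $wg_iw^{-1}=g_{w(i)}$; $s_{i,j}$ is a transposition, $s_i=s_{i,i+1}$. $\mathbb{H}(G(m,1,n))=\mathbb{H}_{DO}$ is the unital associative $\mathbb{C}$-algebra generated by $\mathbb{C}[G]$ and $z_1,\dots,z_n$ subject to $[z_i,z_j]=0$; $[z_i,g_r]=0$; $[z_j,s_i]=0$ for $j\ne i,i+1$; $z_is_i=s_iz_{i+1}-\mathbf{k}\sum_{l=0}^{m-1}g_i^lg_{i+1}^{-l}$. $\mathbb{H}(S_k)$ is the graded Hecke algebra with parameter $m\mathbf{k}$: generated by $\mathbb{C}[S_k]$ and commuting $z_1,\dots,z_k$ with $[z_j,s_i]=0$ for $j\neq i,i+1$ and $z_is_i=s_iz_{i+1}-m\mathbf{k}$ ($\mathbb{H}(S_0)=\mathbb{C}$). $A=\{\underline a\in\mathbb{N}^m:\sum a_i=n\}$; $B_i=\{j:\sum_{r<i}a_r<j\le\sum_{r\le i}a_r\}$; $\mu_{\underline a}$ is the character of $T$ with $\mu_{\underline a}(g_j)=\eta^i$ for $j\in B_i$; $S_{\underline a}=S_{a_0}\times\cdots\times S_{a_{m-1}}\subset S_n$ is the subgroup preserving each $B_i$. The functor $F$ sends $M$ to the family of weight spaces $(M_{\mu_{\underline a}})_{\underline a\in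 A}$, $M_{\mu_{\underline a}}=\{v\in M:tv=\mu_{\underline a}(t)v\ \forall t\in T\}$; this is stable under $z_1,\dots,z_n$ and $S_{\underline a}$, which make it an $\mathbb{H}(S_{a_0})\otimes\cdots\otimes\mathbb{H}(S_{a_{m-1}})$-module, where $z_j$ ($j\in B_i$) acts as the generator $z_{j-\sum_{r<i}a_r}$ of the $i$-th factor. Elements of this tensor product are written with the indices $j\in\{1,\dots,n\}$ below. Clifford algebra: let $E=\mathbb{C}^n$ with orthonormal basis $z_1^*,\dots,z_n^*$ permuted by $S_n$; $C(E)$ is generated by $E$ with $vv'+v'v=-2\langle v,v'\rangle$, with parity automorphism $\varepsilon$. With $v^t=-v$ extended to an anti-automorphism, $\mathrm{Pin}(E)=\{a\in C(E)^\times:\varepsilon(a)Ea^{-1}\subset E,\ a^t=a^{-1}\}$ and $p:\mathrm{Pin}(E)\to O(E)$, $p(a)(v)=\varepsilon(a)va^{-1}$. Put $\widetilde{S_n}=p^{-1}(S_n)$, $\widetilde{S_{\underline a}}=p^{-1}(S_{\underline a})$ and $\widetilde G=\widetilde{G(m,1,n)}=T\rtimes\widetilde{S_n}$ ($\widetilde{S_n}$ acting on $T$ through $S_n$). Fix a spinor module $S$ of $C(E)$. For an $\mathbb{H}_{DO}$-module $M$, $\widetilde G$ acts on $M\otimes S$ by $h\tilde g\mapsto hp(\tilde g)\otimes\tilde g$ ($h\in T$, $\tilde g\in\widetilde{S_n}$); for an $\mathbb{H}(S_{a_0})\otimes\cdots\otimes\mathbb{H}(S_{a_{m-1}})$-module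 $N$, $\widetilde{S_{\underline a}}$ acts on $N\otimes S$ by $\tilde g\mapsto p(\tilde g)\otimes\tilde g$. Dirac operators: $M_i=\sum_{r<i}\sum_{l=0}^{m-1}s_{r,i}g_r^{-l}g_i^l$, $\underline M_i=\sum_{r>i}\sum_{l=0}^{m-1}s_{i,r}g_i^{-l}g_r^l$, $\mathcal{D}_{DO}=\sum_{i=1}^n\bigl(z_i+\frac{\mathbf{k}}2(\underline M_i-M_i)\bigr)\otimes z_i^*$, and $$\mathcal{D}_{S_{a_0}\times\cdots\times S_{a_{m-1}}}=\sum_{i=0}^{m-1}\sum_{j\in B_i}\Bigl(z_j+\tfrac{m\mathbf{k}}2\sum_{r\in B_i,\,r>j}s_{j,r}-\tfrac{m\mathbf{k}}2\sum_{r\in B_i,\,r<j}s_{j,r}\Bigr)\otimes z_j^*.$$ $H_D$ of a module is $\ker\mathcal{D}/(\operatorname{im}\mathcal{D}\cap\ker\mathcal{D})$ for the respective operator acting on (module) $\otimes S$, with its induced $\widetilde G$- (respectively $\widetilde{S_{\underline a}}$-) action. The functor $\widetilde F^{-1}$ sends a family $(N_{\underline a})_{\underline a\in A}$ of $\widetilde{S_{\underline a}}$-modules to $\bigoplus_{\underline a}\mathrm{Ind}_{T\rtimes\widetilde{S_{\underline a}}}^{\widetilde G}(\mu_{\underline a}\otimes N_{\underline a})$, where $T$ acts on $\mu_{\underline a}\otimes N_{\underline a}$ by $\mu_{\underline a}$ and $\widetilde{S_{\underline a}}$ by its action on $N_{\underline a}$. *)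

theory Defs
  imports Complex_Main "HOL-Algebra.Algebra" "HOL-Algebra.Product_Groups"
    "HOL-Algebra.Elementary_Groups" "HOL-Algebra.Algebraic_Closure_Type"
begin

section \<open>Categories and functors\<close>

text \<open>Identities and composites take the objects involved as arguments, because morphisms of
  modules are functions that are extensional on the carrier of their source.\<close>

record ('o, 'm) cat =
  Ob :: "'o set"
  Hom :: "'o \<Rightarrow> 'o \<Rightarrow> 'm set"
  Idn :: "'o \<Rightarrow> 'm"
  Cmp :: "'o \<Rightarrow> 'o \<Rightarrow> 'o \<Rightarrow> 'm \<Rightarrow> 'm \<Rightarrow> 'm"

record ('o, 'm, 'p, 'q) functr =
  omap :: "'o \<Rightarrow> 'p"
  mmap :: "'o \<Rightarrow> 'o \<Rightarrow> 'm \<Rightarrow> 'q"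

definition is_functor ::
  "('o, 'm) cat \<Rightarrow> ('p, 'q) cat \<Rightarrow> ('o, 'm, 'p, 'q) functr \<Rightarrow> bool" where
  "is_functor C D F \<longleftrightarrow>
     (\<forall>U\<in>Ob C. omap F U \<in> Ob D) \<and>
     (\<forall>U\<in>Ob C. \<forall>V\<in>Ob C. \<forall>f\<in>Hom C U V. mmap F U V f \<in> Hom D (omap F U) (omap F V)) \<and>
     (\<forall>U\<in>Ob C. mmap F U U (Idn C U) = Idn D (omap F U)) \<and>
     (\<forall>U\<in>Ob C. \<forall>V\<in>Ob C. \<forall>W\<in>Ob C. \<forall>f\<in>Hom C U V. \<forall>g\<in>Hom C V W.
        mmap F U W (Cmp C U V W g f) =
        Cmp D (omap F U) (omap F V) (omap F W) (mmap F V W g) (mmap F U V f))"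

definition functor_comp ::
  "('p, 'q, 'r, 's) functr \<Rightarrow> ('o, 'm, 'p, 'q) functr \<Rightarrow> ('o, 'm, 'r, 's) functr" where
  "functor_comp G F =
     \<lparr>omap = (\<lambda>U. omap G (omap F U)),
      mmap = (\<lambda>U V f. mmap G (omap F U) (omap F V) (mmap F U V f))\<rparr>"

text \<open>For finite \<open>I\<close> and additive categories this is the direct sum of the \<open>C i\<close>.\<close>

definition prod_cat ::
  "'i set \<Rightarrow> ('i \<Rightarrow> ('o, 'm) cat) \<Rightarrow> ('i \<Rightarrow> 'o, 'i \<Rightarrow> 'm) cat" where
  "prod_cat I C =
     \<lparr>Ob = (\<Pi>\<^sub>E i\<in>I. Ob (C i)),
      Hom = (\<lambda>U V. \<Pi>\<^sub>E i\<in>I. Hom (C i) (U i) (V i)),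
      Idn = (\<lambda>U. \<lambda>i\<in>I. Idn (C i) (U i)),
      Cmp = (\<lambda>U V W g f. \<lambda>i\<in>I. Cmp (C i) (U i) (V i) (W i) (g i) (f i))\<rparr>"

definition prod_functor ::
  "'i set \<Rightarrow> ('i \<Rightarrow> ('o, 'm, 'p, 'q) functr) \<Rightarrow>
     ('i \<Rightarrow> 'o, 'i \<Rightarrow> 'm, 'i \<Rightarrow> 'p, 'i \<Rightarrow> 'q) functr" where
  "prod_functor I F =
     \<lparr>omap = (\<lambda>U. \<lambda>i\<in>I. omap (F i) (U i)),
      mmap = (\<lambda>U V f. \<lambda>i\<in>I. mmap (F i) (U i) (V i) (f i))\<rparr>"


section \<open>Complex vector spaces\<close>

text \<open>A complex vector space is a \<^const>\<open>module\<close> over \<open>CC\<close>.  The record of the library also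
  has the fields \<^const>\<open>monoid.mult\<close> and \<^const>\<open>monoid.one\<close>; they are irrelevant unless the
  record is used as an algebra.\<close>

abbreviation CC :: "complex ring" where
  "CC \<equiv> ring_of_type_algebra"

definition lin_maps ::
  "(complex, 'v, 'y) module_scheme \<Rightarrow> (complex, 'w, 'z) module_scheme \<Rightarrow> ('v \<Rightarrow> 'w) set" where
  "lin_maps V W = {f \<in> carrier V \<rightarrow> carrier W.
     (\<forall>x\<in>carrier V. \<forall>y\<in>carrier V. f (x \<oplus>\<^bsub>V\<^esub> y) = f x \<oplus>\<^bsub>W\<^esub> f y) \<and>
     (\<forall>c. \<forall>x\<in>carrier V. f (c \<odot>\<^bsub>V\<^esub> x) = c \<odot>\<^bsub>W\<^esub> f x)}"

definition lin_span :: "(complex, 'v, 'z) module_scheme \<Rightarrow> 'v set \<Rightarrow> 'v set" where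
  "lin_span V R = \<Inter>{H. submodule H CC V \<and> R \<subseteq> H}"

text \<open>The map on cosets induced by \<open>f\<close>, with values in the cosets of \<open>N\<close> in \<open>W\<close>.\<close>

definition coset_map ::
  "(complex, 'w, 'z) module_scheme \<Rightarrow> 'w set \<Rightarrow> ('v \<Rightarrow> 'w) \<Rightarrow> 'v set \<Rightarrow> 'w set" where
  "coset_map W N f U = (\<Union>x\<in>U. N +>\<^bsub>W\<^esub> f x)"

definition quot_mod ::
  "(complex, 'v, 'z) module_scheme \<Rightarrow> 'v set \<Rightarrow> (complex, 'v set) module" where
  "quot_mod V N =
     \<lparr>carrier = a_rcosets\<^bsub>V\<^esub> N, monoid.mult = rcoset_mult V N, one = N +>\<^bsub>V\<^esub> \<one>\<^bsub>V\<^esub>,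
      ring.zero = N, ring.add = set_add V, module.smult = (\<lambda>c. coset_map V N (\<lambda>x. c \<odot>\<^bsub>V\<^esub> x))\<rparr>"

definition delta :: "'b \<Rightarrow> 'b \<Rightarrow> complex" where
  "delta x = (\<lambda>y. if y = x then 1 else 0)"

text \<open>The vector space with basis \<open>B\<close>; \<^term>\<open>delta b\<close> is the basis vector of \<open>b\<close>.\<close>

definition free_vs :: "'b set \<Rightarrow> (complex, 'b \<Rightarrow> complex) module" where
  "free_vs B =
     \<lparr>carrier = {f. finite {x. f x \<noteq> 0} \<and> {x. f x \<noteq> 0} \<subseteq> B},
      monoid.mult = (\<lambda>f g x. 0), one = (\<lambda>x. 0), ring.zero = (\<lambda>x. 0),
      ring.add = (\<lambda>f g x. f x + g x), module.smult = (\<lambda>c f x. c * f x)\<rparr>"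

definition push_forward :: "('b \<Rightarrow> 'c) \<Rightarrow> ('b \<Rightarrow> complex) \<Rightarrow> 'c \<Rightarrow> complex" where
  "push_forward h f = (\<lambda>y. \<Sum>x | f x \<noteq> 0 \<and> h x = y. f x)"

definition tensor_rels ::
  "(complex, 'v, 'y) module_scheme \<Rightarrow> (complex, 's, 'z) module_scheme \<Rightarrow> ('v \<times> 's \<Rightarrow> complex) set" where
  "tensor_rels V S =
     {\<lambda>u. delta (v \<oplus>\<^bsub>V\<^esub> v', s) u - delta (v, s) u - delta (v', s) u | v v' s.
        v \<in> carrier V \<and> v' \<in> carrier V \<and> s \<in> carrier S} \<union>
     {\<lambda>u. delta (v, s \<oplus>\<^bsub>S\<^esub> s') u - delta (v, s) u - delta (v, s') u | v s s'.
        v \<in> carrier V \<and> s \<in> carrier S \<and> s' \<in> carrier S} \<union>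
     {\<lambda>u. delta (c \<odot>\<^bsub>V\<^esub> v, s) u - c * delta (v, s) u | c v s.
        v \<in> carrier V \<and> s \<in> carrier S} \<union>
     {\<lambda>u. delta (v, c \<odot>\<^bsub>S\<^esub> s) u - c * delta (v, s) u | c v s.
        v \<in> carrier V \<and> s \<in> carrier S}"

definition tensor_null ::
  "(complex, 'v, 'y) module_scheme \<Rightarrow> (complex, 's, 'z) module_scheme \<Rightarrow> ('v \<times> 's \<Rightarrow> complex) set" where
  "tensor_null V S = lin_span (free_vs (carrier V \<times> carrier S)) (tensor_rels V S)"

definition tensor ::
  "(complex, 'v, 'y) module_scheme \<Rightarrow> (complex, 's, 'z) module_scheme \<Rightarrow>
     (complex, ('v \<times> 's \<Rightarrow> complex) set) module" where
  "tensor V S = quot_mod (free_vs (carrier V \<times> carrier S)) (tensor_null V S)"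

text \<open>\<open>tensor_map W S A B\<close> is \<open>A \<otimes> B\<close> for linear maps \<open>A\<close>, \<open>B\<close> with targets \<open>W\<close>, \<open>S\<close>.\<close>

definition tensor_map ::
  "(complex, 'w, 'y) module_scheme \<Rightarrow> (complex, 's, 'z) module_scheme \<Rightarrow> ('v \<Rightarrow> 'w) \<Rightarrow> ('r \<Rightarrow> 's) \<Rightarrow>
     ('v \<times> 'r \<Rightarrow> complex) set \<Rightarrow> ('w \<times> 's \<Rightarrow> complex) set" where
  "tensor_map W S A B =
     coset_map (free_vs (carrier W \<times> carrier S)) (tensor_null W S) (push_forward (map_prod A B))"

text \<open>The direct sum of a finite family.\<close>

definition dir_sum ::
  "'i set \<Rightarrow> ('i \<Rightarrow> (complex, 'v, 'z) module_scheme) \<Rightarrow> (complex, 'i \<Rightarrow> 'v) module" where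
  "dir_sum I V =
     \<lparr>carrier = (\<Pi>\<^sub>E i\<in>I. carrier (V i)),
      monoid.mult = (\<lambda>x y. \<lambda>i\<in>I. x i \<otimes>\<^bsub>V i\<^esub> y i), one = (\<lambda>i\<in>I. \<one>\<^bsub>V i\<^esub>),
      ring.zero = (\<lambda>i\<in>I. \<zero>\<^bsub>V i\<^esub>), ring.add = (\<lambda>x y. \<lambda>i\<in>I. x i \<oplus>\<^bsub>V i\<^esub> y i),
      module.smult = (\<lambda>c x. \<lambda>i\<in>I. c \<odot>\<^bsub>V i\<^esub> x i)\<rparr>"


section \<open>Algebras, modules and representations\<close>

text \<open>An associative unital complex algebra is given by a \<open>(complex, 'a) module\<close> record in which all
  fields are meaningful.\<close>

definition monoid_alg :: "('b, 'z) monoid_scheme \<Rightarrow> (complex, 'b \<Rightarrow> complex) module" where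
  "monoid_alg G = (free_vs (carrier G))
     \<lparr>monoid.mult := (\<lambda>f g z. \<Sum>x | f x \<noteq> 0. \<Sum>y | g y \<noteq> 0. if x \<otimes>\<^bsub>G\<^esub> y = z then f x * g y else 0),
      one := delta \<one>\<^bsub>G\<^esub>\<rparr>"

definition free_alg :: "'x set \<Rightarrow> (complex, 'x list \<Rightarrow> complex) module" where
  "free_alg U = monoid_alg \<lparr>carrier = lists U, monoid.mult = (@), one = []\<rparr>"

text \<open>A set of relations is a set of pairs \<open>(f, g)\<close>, standing for \<open>f = g\<close>.  The quotient is by the
  two-sided ideal generated by all \<open>f - g\<close>.\<close>

definition rel_ideal :: "(complex, 'a, 'z) module_scheme \<Rightarrow> ('a \<times> 'a) set \<Rightarrow> 'a set" where
  "rel_ideal A R = Idl\<^bsub>A\<^esub> {f \<ominus>\<^bsub>A\<^esub> g | f g. (f, g) \<in> R}"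

definition alg_quot ::
  "(complex, 'a, 'z) module_scheme \<Rightarrow> ('a \<times> 'a) set \<Rightarrow> (complex, 'a set) module" where
  "alg_quot A R = quot_mod A (rel_ideal A R)"

definition alg_class ::
  "(complex, 'a, 'z) module_scheme \<Rightarrow> ('a \<times> 'a) set \<Rightarrow> 'a \<Rightarrow> 'a set" where
  "alg_class A R f = rel_ideal A R +>\<^bsub>A\<^esub> f"

text \<open>The tensor product \<open>\<Otimes>\<^sub>i A\<^sub>i\<close> of algebras: formal combinations of tuples modulo
  multilinearity, with componentwise multiplication of tuples.\<close>

definition multilinear_rels ::
  "'i set \<Rightarrow> ('i \<Rightarrow> (complex, 'a, 'z) module_scheme) \<Rightarrow>
     ((('i \<Rightarrow> 'a) \<Rightarrow> complex) \<times> (('i \<Rightarrow> 'a) \<Rightarrow> complex)) set" where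
  "multilinear_rels I A =
     {(delta (t(i := x \<oplus>\<^bsub>A i\<^esub> y)), \<lambda>u. delta (t(i := x)) u + delta (t(i := y)) u) | t i x y.
        t \<in> (\<Pi>\<^sub>E i\<in>I. carrier (A i)) \<and> i \<in> I \<and> x \<in> carrier (A i) \<and> y \<in> carrier (A i)} \<union>
     {(delta (t(i := c \<odot>\<^bsub>A i\<^esub> x)), \<lambda>u. c * delta (t(i := x)) u) | t i c x.
        t \<in> (\<Pi>\<^sub>E i\<in>I. carrier (A i)) \<and> i \<in> I \<and> x \<in> carrier (A i)}"

definition tensor_alg ::
  "'i set \<Rightarrow> ('i \<Rightarrow> (complex, 'a, 'z) module_scheme) \<Rightarrow>
     (complex, (('i \<Rightarrow> 'a) \<Rightarrow> complex) set) module" where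
  "tensor_alg I A = alg_quot (monoid_alg (product_group I A)) (multilinear_rels I A)"

definition pure_tensor ::
  "'i set \<Rightarrow> ('i \<Rightarrow> (complex, 'a, 'z) module_scheme) \<Rightarrow> ('i \<Rightarrow> 'a) \<Rightarrow>
     (('i \<Rightarrow> 'a) \<Rightarrow> complex) set" where
  "pure_tensor I A t =
     alg_class (monoid_alg (product_group I A)) (multilinear_rels I A) (delta (\<lambda>i\<in>I. t i))"

definition tensor_factor ::
  "'i set \<Rightarrow> ('i \<Rightarrow> (complex, 'a, 'z) module_scheme) \<Rightarrow> 'i \<Rightarrow> 'a \<Rightarrow>
     (('i \<Rightarrow> 'a) \<Rightarrow> complex) set" where
  "tensor_factor I A i x = pure_tensor I A (\<lambda>r. if r = i then x else \<one>\<^bsub>A r\<^esub>)"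

record ('a, 'v) lmod = "(complex, 'v) module" +
  act :: "'a \<Rightarrow> 'v \<Rightarrow> 'v"

definition with_act ::
  "(complex, 'v, 'z) module_scheme \<Rightarrow> ('a \<Rightarrow> 'v \<Rightarrow> 'v) \<Rightarrow> ('a, 'v) lmod" where
  "with_act V \<alpha> =
     \<lparr>carrier = carrier V, monoid.mult = monoid.mult V, one = monoid.one V, ring.zero = ring.zero V, ring.add = ring.add V,
      module.smult = module.smult V, act = \<alpha>\<rparr>"

definition alg_module ::
  "(complex, 'a, 'z) module_scheme \<Rightarrow> ('a, 'v) lmod \<Rightarrow> bool" where
  "alg_module A V \<longleftrightarrow> module CC V \<and>
     (\<forall>a\<in>carrier A. act V a \<in> lin_maps V V) \<and>
     (\<forall>v\<in>carrier V.
        (\<forall>a\<in>carrier A. \<forall>b\<in>carrier A. act V (a \<oplus>\<^bsub>A\<^esub> b) v = act V a v \<oplus>\<^bsub>V\<^esub> act V b v) \<and>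
        (\<forall>c. \<forall>a\<in>carrier A. act V (c \<odot>\<^bsub>A\<^esub> a) v = c \<odot>\<^bsub>V\<^esub> act V a v) \<and>
        (\<forall>a\<in>carrier A. \<forall>b\<in>carrier A. act V (a \<otimes>\<^bsub>A\<^esub> b) v = act V a (act V b v)) \<and>
        act V \<one>\<^bsub>A\<^esub> v = v)"

definition group_rep :: "('g, 'z) monoid_scheme \<Rightarrow> ('g, 'v) lmod \<Rightarrow> bool" where
  "group_rep G V \<longleftrightarrow> module CC V \<and>
     (\<forall>g\<in>carrier G. act V g \<in> lin_maps V V) \<and>
     (\<forall>v\<in>carrier V.
        (\<forall>g\<in>carrier G. \<forall>h\<in>carrier G. act V (g \<otimes>\<^bsub>G\<^esub> h) v = act V g (act V h v)) \<and>
        act V \<one>\<^bsub>G\<^esub> v = v)"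

definition equivariant_maps ::
  "'a set \<Rightarrow> ('a, 'v) lmod \<Rightarrow> ('a, 'w) lmod \<Rightarrow> ('v \<Rightarrow> 'w) set" where
  "equivariant_maps U V W = {f \<in> lin_maps V W \<inter> extensional (carrier V).
     \<forall>a\<in>U. \<forall>v\<in>carrier V. f (act V a v) = act W a (f v)}"

text \<open>The modules over \<open>A\<close> (respectively over the group algebra of \<open>G\<close>) whose underlying set is
  contained in the type \<open>'v\<close>.\<close>

definition module_cat ::
  "(complex, 'a, 'z) module_scheme \<Rightarrow> (('a, 'v) lmod, 'v \<Rightarrow> 'v) cat" where
  "module_cat A =
     \<lparr>Ob = {V. alg_module A V}, Hom = equivariant_maps (carrier A),
      Idn = (\<lambda>V. \<lambda>v\<in>carrier V. v), Cmp = (\<lambda>U V W g f. compose (carrier U) g f)\<rparr>"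

definition rep_cat :: "('g, 'z) monoid_scheme \<Rightarrow> (('g, 'v) lmod, 'v \<Rightarrow> 'v) cat" where
  "rep_cat G =
     \<lparr>Ob = {V. group_rep G V}, Hom = equivariant_maps (carrier G),
      Idn = (\<lambda>V. \<lambda>v\<in>carrier V. v), Cmp = (\<lambda>U V W g f. compose (carrier U) g f)\<rparr>"

text \<open>Two functors \<open>P\<close>, \<open>Q\<close> from \<open>C\<close> to representations of \<open>G\<close> are naturally isomorphic.  They may take
  values in representations on different types.\<close>

definition naturally_isomorphic ::
  "('o, 'm) cat \<Rightarrow> ('g, 'z) monoid_scheme \<Rightarrow> ('o, 'm, ('g, 'v) lmod, 'v \<Rightarrow> 'v) functr \<Rightarrow>
     ('o, 'm, ('g, 'w) lmod, 'w \<Rightarrow> 'w) functr \<Rightarrow> bool" where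
  "naturally_isomorphic C G P Q \<longleftrightarrow>
     is_functor C (rep_cat G) P \<and> is_functor C (rep_cat G) Q \<and>
     (\<exists>\<theta>. (\<forall>M\<in>Ob C. \<theta> M \<in> equivariant_maps (carrier G) (omap P M) (omap Q M) \<and>
                    bij_betw (\<theta> M) (carrier (omap P M)) (carrier (omap Q M))) \<and>
          (\<forall>M\<in>Ob C. \<forall>N\<in>Ob C. \<forall>f\<in>Hom C M N. \<forall>x\<in>carrier (omap P M).
             \<theta> N (mmap P M N f x) = mmap Q M N f (\<theta> M x)))"

text \<open>If basis elements \<open>b\<close> of a free vector space act by \<open>\<beta> b\<close>, then \<open>lin_ext\<close> is the linear
  extension of \<open>\<beta>\<close>, and \<open>quot_act\<close> is the induced action of a quotient of the free space (independent
  of the representative provided the relations act by zero).\<close>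

definition lin_ext ::
  "(complex, 'v, 'z) module_scheme \<Rightarrow> ('b \<Rightarrow> 'v \<Rightarrow> 'v) \<Rightarrow> ('b \<Rightarrow> complex) \<Rightarrow> 'v \<Rightarrow> 'v" where
  "lin_ext V \<beta> f v = (\<Oplus>\<^bsub>V\<^esub>b\<in>{b. f b \<noteq> 0}. f b \<odot>\<^bsub>V\<^esub> \<beta> b v)"

definition quot_act ::
  "(complex, 'v, 'z) module_scheme \<Rightarrow> ('b \<Rightarrow> 'v \<Rightarrow> 'v) \<Rightarrow> ('b \<Rightarrow> complex) set \<Rightarrow> 'v \<Rightarrow> 'v" where
  "quot_act V \<beta> U = lin_ext V \<beta> (SOME f. f \<in> U)"

text \<open>The induced representation of a subgroup \<open>H\<close> of a finite group \<open>G\<close> in its function model;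
  \<open>f\<close> corresponds to the sum of all \<open>g \<otimes> f g\<close>, \<open>g\<close> running over representatives of \<open>G/H\<close>, in
  the tensor product of \<open>\<complex>[G]\<close> and \<open>N\<close> over \<open>\<complex>[H]\<close>.\<close>

definition induced ::
  "('g, 'z) monoid_scheme \<Rightarrow> 'g set \<Rightarrow> ('g, 'v) lmod \<Rightarrow> ('g, 'g \<Rightarrow> 'v) lmod" where
  "induced G H N = with_act
     ((dir_sum (carrier G) (\<lambda>_. N))\<lparr>carrier :=
        {f \<in> carrier G \<rightarrow>\<^sub>E carrier N.
           \<forall>g\<in>carrier G. \<forall>h\<in>H. f (g \<otimes>\<^bsub>G\<^esub> h) = act N (inv\<^bsub>G\<^esub> h) (f g)}\<rparr>)
     (\<lambda>x f. \<lambda>g\<in>carrier G. f (inv\<^bsub>G\<^esub> x \<otimes>\<^bsub>G\<^esub> g))"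


section \<open>The groups\<close>

definition semidirect ::
  "('t, 'y) monoid_scheme \<Rightarrow> ('q, 'z) monoid_scheme \<Rightarrow> ('q \<Rightarrow> 't \<Rightarrow> 't) \<Rightarrow> ('t \<times> 'q) monoid" where
  "semidirect T Q \<alpha> =
     \<lparr>carrier = carrier T \<times> carrier Q,
      monoid.mult = (\<lambda>(t, q) (t', q'). (t \<otimes>\<^bsub>T\<^esub> \<alpha> q t', q \<otimes>\<^bsub>Q\<^esub> q')),
      one = (\<one>\<^bsub>T\<^esub>, \<one>\<^bsub>Q\<^esub>)\<rparr>"

definition torus :: "nat \<Rightarrow> nat \<Rightarrow> (nat \<Rightarrow> int) monoid" where
  "torus m n = product_group {1..n} (\<lambda>_. integer_mod_group m)"

text \<open>Permutation of coordinates, so that \<open>w g\<^sub>i w\<^sup>-\<^sup>1\<close> is the generator with index \<open>w i\<close>.\<close>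

definition permute_coords :: "nat \<Rightarrow> (nat \<Rightarrow> nat) \<Rightarrow> (nat \<Rightarrow> 'c) \<Rightarrow> nat \<Rightarrow> 'c" where
  "permute_coords n w t = (\<lambda>j\<in>{1..n}. t (inv_into UNIV w j))"

type_synonym gelt = "(nat \<Rightarrow> int) \<times> (nat \<Rightarrow> nat)"

definition refl_group :: "nat \<Rightarrow> nat \<Rightarrow> gelt monoid" where
  "refl_group m n = semidirect (torus m n) (sym_group n) (permute_coords n)"

definition g_gen :: "nat \<Rightarrow> nat \<Rightarrow> nat \<Rightarrow> gelt" where
  "g_gen m n i = ((\<lambda>j\<in>{1..n}. if j = i then 1 mod int m else 0), id)"

definition of_perm :: "nat \<Rightarrow> nat \<Rightarrow> (nat \<Rightarrow> nat) \<Rightarrow> gelt" where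
  "of_perm m n w = (\<one>\<^bsub>torus m n\<^esub>, w)"

definition of_torus :: "(nat \<Rightarrow> int) \<Rightarrow> gelt" where
  "of_torus t = (t, id)"

definition comps :: "nat \<Rightarrow> nat \<Rightarrow> (nat \<Rightarrow> nat) set" where
  "comps m n = {a \<in> {..<m} \<rightarrow>\<^sub>E UNIV. (\<Sum>i<m. a i) = n}"

definition offset :: "(nat \<Rightarrow> nat) \<Rightarrow> nat \<Rightarrow> nat" where
  "offset a i = (\<Sum>r<i. a r)"

definition block :: "(nat \<Rightarrow> nat) \<Rightarrow> nat \<Rightarrow> nat set" where
  "block a i = {j. (\<Sum>r<i. a r) < j \<and> j \<le> (\<Sum>r\<le>i. a r)}"

definition mu :: "nat \<Rightarrow> complex \<Rightarrow> (nat \<Rightarrow> nat) \<Rightarrow> (nat \<Rightarrow> int) \<Rightarrow> complex" where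
  "mu m \<eta> a t = (\<Prod>i<m. \<Prod>j\<in>block a i. (\<eta> ^ i) powi (t j))"

definition young_subgroup :: "nat \<Rightarrow> nat \<Rightarrow> (nat \<Rightarrow> nat) \<Rightarrow> (nat \<Rightarrow> nat) set" where
  "young_subgroup m n a = {w \<in> carrier (sym_group n). \<forall>i<m. w ` block a i = block a i}"


section \<open>The Hecke algebras\<close>

datatype 'g gen = Elt 'g | Z nat

definition hecke_gens :: "('g, 'z) monoid_scheme \<Rightarrow> nat \<Rightarrow> 'g gen set" where
  "hecke_gens G n = Elt ` carrier G \<union> Z ` {1..n}"

text \<open>Relations common to the algebras below: \<open>\<complex>[G]\<close> is generated by the elements of \<open>G\<close>, the
  \<open>z\<^sub>i\<close> commute with each other, \<open>z\<^sub>j\<close> commutes with \<open>s\<^sub>i\<close> for \<open>j \<noteq> i, i + 1\<close>, and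
  \<open>z\<^sub>i s\<^sub>i = s\<^sub>i z\<^sub>i\<^sub>+\<^sub>1 - Y i\<close>.\<close>

definition hecke_rels ::
  "('g, 'z) monoid_scheme \<Rightarrow> nat \<Rightarrow> (nat \<Rightarrow> 'g) \<Rightarrow> (nat \<Rightarrow> 'g gen list \<Rightarrow> complex) \<Rightarrow>
     (('g gen list \<Rightarrow> complex) \<times> ('g gen list \<Rightarrow> complex)) set" where
  "hecke_rels G n s Y =
     {(delta [Elt g, Elt h], delta [Elt (g \<otimes>\<^bsub>G\<^esub> h)]) | g h. g \<in> carrier G \<and> h \<in> carrier G} \<union>
     {(delta [Elt \<one>\<^bsub>G\<^esub>], delta [])} \<union>
     {(delta [Z i, Z j], delta [Z j, Z i]) | i j. i \<in> {1..n} \<and> j \<in> {1..n}} \<union>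
     {(delta [Z j, Elt (s i)], delta [Elt (s i), Z j]) | i j.
        i \<in> {1..<n} \<and> j \<in> {1..n} \<and> j \<noteq> i \<and> j \<noteq> i + 1} \<union>
     {(delta [Z i, Elt (s i)], \<lambda>u. delta [Elt (s i), Z (i + 1)] u - Y i u) | i. i \<in> {1..<n}}"

definition do_rels :: "nat \<Rightarrow> nat \<Rightarrow> complex \<Rightarrow>
     ((gelt gen list \<Rightarrow> complex) \<times> (gelt gen list \<Rightarrow> complex)) set" where
  "do_rels m n k =
     hecke_rels (refl_group m n) n (\<lambda>i. of_perm m n (transpose i (i + 1)))
       (\<lambda>i u. k * (\<Sum>l<m. delta
          [Elt (g_gen m n i [^]\<^bsub>refl_group m n\<^esub> int l
                \<otimes>\<^bsub>refl_group m n\<^esub> g_gen m n (i + 1) [^]\<^bsub>refl_group m n\<^esub> (- int l))] u)) \<union>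
     {(delta [Z i, Elt (g_gen m n r)], delta [Elt (g_gen m n r), Z i]) | i r.
        i \<in> {1..n} \<and> r \<in> {1..n}}"

type_synonym do_alg = "(gelt gen list \<Rightarrow> complex) set"

definition do_hecke :: "nat \<Rightarrow> nat \<Rightarrow> complex \<Rightarrow> (complex, do_alg) module" where
  "do_hecke m n k = alg_quot (free_alg (hecke_gens (refl_group m n) n)) (do_rels m n k)"

definition do_gen :: "nat \<Rightarrow> nat \<Rightarrow> complex \<Rightarrow> gelt gen \<Rightarrow> do_alg" where
  "do_gen m n k x =
     alg_class (free_alg (hecke_gens (refl_group m n) n)) (do_rels m n k) (delta [x])"

text \<open>The graded Hecke algebra of the symmetric group on \<open>{1..d}\<close> with parameter \<open>c\<close>.\<close>

definition graded_rels :: "complex \<Rightarrow> nat \<Rightarrow>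
     (((nat \<Rightarrow> nat) gen list \<Rightarrow> complex) \<times> ((nat \<Rightarrow> nat) gen list \<Rightarrow> complex)) set" where
  "graded_rels c d =
     hecke_rels (sym_group d) d (\<lambda>i. transpose i (i + 1)) (\<lambda>i u. c * delta [] u)"

type_synonym graded_alg = "((nat \<Rightarrow> nat) gen list \<Rightarrow> complex) set"

definition graded_hecke :: "complex \<Rightarrow> nat \<Rightarrow> (complex, graded_alg) module" where
  "graded_hecke c d = alg_quot (free_alg (hecke_gens (sym_group d) d)) (graded_rels c d)"

definition graded_gen :: "complex \<Rightarrow> nat \<Rightarrow> (nat \<Rightarrow> nat) gen \<Rightarrow> graded_alg" where
  "graded_gen c d x =
     alg_class (free_alg (hecke_gens (sym_group d) d)) (graded_rels c d) (delta [x])"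

type_synonym young_alg = "((nat \<Rightarrow> graded_alg) \<Rightarrow> complex) set"

abbreviation factors :: "nat \<Rightarrow> complex \<Rightarrow> (nat \<Rightarrow> nat) \<Rightarrow> nat \<Rightarrow> (complex, graded_alg) module" where
  "factors m k a \<equiv> (\<lambda>i. graded_hecke (of_nat m * k) (a i))"

definition young_hecke :: "nat \<Rightarrow> complex \<Rightarrow> (nat \<Rightarrow> nat) \<Rightarrow> (complex, young_alg) module" where
  "young_hecke m k a = tensor_alg {..<m} (factors m k a)"

text \<open>The elements of the tensor product corresponding to \<open>z\<^sub>j\<close> and \<open>s\<^sub>j\<^sub>,\<^sub>r\<close> with
  \<open>j\<close>, \<open>r\<close> in the \<open>i\<close>-th block, and to a permutation \<open>w\<close> preserving the blocks.\<close>

definition young_z :: "nat \<Rightarrow> complex \<Rightarrow> (nat \<Rightarrow> nat) \<Rightarrow> nat \<Rightarrow> nat \<Rightarrow> young_alg" where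
  "young_z m k a i j = tensor_factor {..<m} (factors m k a) i
     (graded_gen (of_nat m * k) (a i) (Z (j - offset a i)))"

definition young_s :: "nat \<Rightarrow> complex \<Rightarrow> (nat \<Rightarrow> nat) \<Rightarrow> nat \<Rightarrow> nat \<Rightarrow> nat \<Rightarrow> young_alg" where
  "young_s m k a i j r = tensor_factor {..<m} (factors m k a) i
     (graded_gen (of_nat m * k) (a i) (Elt (transpose (j - offset a i) (r - offset a i))))"

definition block_part :: "nat \<Rightarrow> nat \<Rightarrow> (nat \<Rightarrow> nat) \<Rightarrow> nat \<Rightarrow> nat" where
  "block_part o' d w j = (if 1 \<le> j \<and> j \<le> d then w (j + o') - o' else j)"

definition block_shift :: "nat \<Rightarrow> nat \<Rightarrow> (nat \<Rightarrow> nat) \<Rightarrow> nat \<Rightarrow> nat" where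
  "block_shift o' d w j = (if o' < j \<and> j \<le> o' + d then w (j - o') + o' else j)"

definition young_perm :: "nat \<Rightarrow> complex \<Rightarrow> (nat \<Rightarrow> nat) \<Rightarrow> (nat \<Rightarrow> nat) \<Rightarrow> young_alg" where
  "young_perm m k a w = pure_tensor {..<m} (factors m k a)
     (\<lambda>i. graded_gen (of_nat m * k) (a i) (Elt (block_part (offset a i) (a i) w)))"


section \<open>The functor to weight spaces\<close>

definition weight_space ::
  "nat \<Rightarrow> nat \<Rightarrow> complex \<Rightarrow> complex \<Rightarrow> (nat \<Rightarrow> nat) \<Rightarrow> (do_alg, 'v) lmod \<Rightarrow> 'v set" where
  "weight_space m n k \<eta> a M = {v \<in> carrier M.
     \<forall>t\<in>carrier (torus m n). act M (do_gen m n k (Elt (of_torus t))) v = mu m \<eta> a t \<odot>\<^bsub>M\<^esub> v}"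

text \<open>How the generators of the \<open>i\<close>-th tensor factor act on the weight space.\<close>

fun block_gen_act ::
  "nat \<Rightarrow> nat \<Rightarrow> complex \<Rightarrow> (nat \<Rightarrow> nat) \<Rightarrow> (do_alg, 'v) lmod \<Rightarrow> nat \<Rightarrow> (nat \<Rightarrow> nat) gen \<Rightarrow> 'v \<Rightarrow> 'v"
where
  "block_gen_act m n k a M i (Elt w) =
     act M (do_gen m n k (Elt (of_perm m n (block_shift (offset a i) (a i) w))))"
| "block_gen_act m n k a M i (Z r) = act M (do_gen m n k (Z (offset a i + r)))"

text \<open>A word in the generators of a factor acts by composition, and so does a pure tensor.\<close>

definition weight_module ::
  "nat \<Rightarrow> nat \<Rightarrow> complex \<Rightarrow> complex \<Rightarrow> (nat \<Rightarrow> nat) \<Rightarrow> (do_alg, 'v) lmod \<Rightarrow> (young_alg, 'v) lmod" where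
  "weight_module m n k \<eta> a M = (let W = M\<lparr>carrier := weight_space m n k \<eta> a M\<rparr> in
     with_act W
       (quot_act W (\<lambda>t. foldr (\<lambda>i. quot_act W (foldr (block_gen_act m n k a M i)) (t i)) [0..<m])))"

definition weight_functor ::
  "nat \<Rightarrow> nat \<Rightarrow> complex \<Rightarrow> complex \<Rightarrow>
     ((do_alg, 'v) lmod, 'v \<Rightarrow> 'v, (nat \<Rightarrow> nat) \<Rightarrow> (young_alg, 'v) lmod, (nat \<Rightarrow> nat) \<Rightarrow> 'v \<Rightarrow> 'v) functr"
where
  "weight_functor m n k \<eta> =
     \<lparr>omap = (\<lambda>M. \<lambda>a\<in>comps m n. weight_module m n k \<eta> a M),
      mmap = (\<lambda>M M' f. \<lambda>a\<in>comps m n. restrict f (weight_space m n k \<eta> a M))\<rparr>"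


section \<open>Clifford algebra and Pin cover\<close>

text \<open>\<open>E = \<complex>\<^sup>n\<close> consists of the functions on \<open>{1..n}\<close>; the form is complex bilinear.\<close>

definition vecs :: "nat \<Rightarrow> (nat \<Rightarrow> complex) set" where
  "vecs n = {1..n} \<rightarrow>\<^sub>E UNIV"

definition basis_vec :: "nat \<Rightarrow> nat \<Rightarrow> nat \<Rightarrow> complex" where
  "basis_vec n i = (\<lambda>j\<in>{1..n}. if j = i then 1 else 0)"

definition cliff_rels :: "nat \<Rightarrow>
     (((nat \<Rightarrow> complex) list \<Rightarrow> complex) \<times> ((nat \<Rightarrow> complex) list \<Rightarrow> complex)) set" where
  "cliff_rels n =
     {(delta [\<lambda>j\<in>{1..n}. v j + v' j], \<lambda>u. delta [v] u + delta [v'] u) | v v'.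
        v \<in> vecs n \<and> v' \<in> vecs n} \<union>
     {(delta [\<lambda>j\<in>{1..n}. c * v j], \<lambda>u. c * delta [v] u) | c v. v \<in> vecs n} \<union>
     {(\<lambda>u. delta [v, v'] u + delta [v', v] u, \<lambda>u. - 2 * (\<Sum>j=1..n. v j * v' j) * delta [] u) | v v'.
        v \<in> vecs n \<and> v' \<in> vecs n}"

type_synonym cliff_alg = "((nat \<Rightarrow> complex) list \<Rightarrow> complex) set"

definition clifford :: "nat \<Rightarrow> (complex, cliff_alg) module" where
  "clifford n = alg_quot (free_alg (vecs n)) (cliff_rels n)"

definition cliff_vec :: "nat \<Rightarrow> (nat \<Rightarrow> complex) \<Rightarrow> cliff_alg" where
  "cliff_vec n v = alg_class (free_alg (vecs n)) (cliff_rels n) (delta [v])"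

text \<open>The (anti-)automorphisms induced by \<open>v \<mapsto> -v\<close>.  On the free algebra they are involutions
  preserving the ideal of relations, so they may be applied elementwise to cosets.\<close>

definition parity :: "cliff_alg \<Rightarrow> cliff_alg" where
  "parity U = (\<lambda>f w. (- 1) ^ length w * f w) ` U"

definition cliff_transpose :: "cliff_alg \<Rightarrow> cliff_alg" where
  "cliff_transpose U = (\<lambda>f w. (- 1) ^ length w * f (rev w)) ` U"

definition twisted_conj :: "nat \<Rightarrow> cliff_alg \<Rightarrow> (nat \<Rightarrow> complex) \<Rightarrow> cliff_alg" where
  "twisted_conj n x v =
     parity x \<otimes>\<^bsub>clifford n\<^esub> cliff_vec n v \<otimes>\<^bsub>clifford n\<^esub> inv\<^bsub>clifford n\<^esub> x"

definition Pin :: "nat \<Rightarrow> cliff_alg set" where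
  "Pin n = {x \<in> Units (clifford n).
     twisted_conj n x ` vecs n \<subseteq> cliff_vec n ` vecs n \<and>
     cliff_transpose x = inv\<^bsub>clifford n\<^esub> x}"

definition pin_proj :: "nat \<Rightarrow> cliff_alg \<Rightarrow> (nat \<Rightarrow> complex) \<Rightarrow> nat \<Rightarrow> complex" where
  "pin_proj n x = (\<lambda>v\<in>vecs n. THE v'. v' \<in> vecs n \<and> cliff_vec n v' = twisted_conj n x v)"

text \<open>Permutations as elements of \<open>O(E)\<close>, mapping the \<open>i\<close>-th basis vector to the \<open>w i\<close>-th.\<close>

definition perm_map :: "nat \<Rightarrow> (nat \<Rightarrow> nat) \<Rightarrow> (nat \<Rightarrow> complex) \<Rightarrow> nat \<Rightarrow> complex" where
  "perm_map n w = (\<lambda>v\<in>vecs n. permute_coords n w v)"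

definition pin_cover :: "nat \<Rightarrow> (nat \<Rightarrow> nat) set \<Rightarrow> cliff_alg monoid" where
  "pin_cover n W =
     \<lparr>carrier = {x \<in> Pin n. pin_proj n x \<in> perm_map n ` W},
      monoid.mult = monoid.mult (clifford n), one = \<one>\<^bsub>clifford n\<^esub>\<rparr>"

definition cover_perm :: "nat \<Rightarrow> cliff_alg \<Rightarrow> nat \<Rightarrow> nat" where
  "cover_perm n x = (THE w. w \<in> carrier (sym_group n) \<and> pin_proj n x = perm_map n w)"

abbreviation sym_cover :: "nat \<Rightarrow> cliff_alg monoid" where
  "sym_cover n \<equiv> pin_cover n (carrier (sym_group n))"

abbreviation young_cover :: "nat \<Rightarrow> nat \<Rightarrow> (nat \<Rightarrow> nat) \<Rightarrow> cliff_alg monoid" where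
  "young_cover m n a \<equiv> pin_cover n (young_subgroup m n a)"

definition refl_cover :: "nat \<Rightarrow> nat \<Rightarrow> ((nat \<Rightarrow> int) \<times> cliff_alg) monoid" where
  "refl_cover m n =
     semidirect (torus m n) (sym_cover n) (\<lambda>x. permute_coords n (cover_perm n x))"

definition spinor_module :: "nat \<Rightarrow> (cliff_alg, 's) lmod \<Rightarrow> bool" where
  "spinor_module n S \<longleftrightarrow> alg_module (clifford n) S \<and> carrier S \<noteq> {\<zero>\<^bsub>S\<^esub>} \<and>
     (\<forall>W. submodule W CC S \<and> (\<forall>x\<in>carrier (clifford n). \<forall>w\<in>W. act S x w \<in> W) \<longrightarrow>
        W = {\<zero>\<^bsub>S\<^esub>} \<or> W = carrier S)"


section \<open>Dirac operators and Dirac cohomology\<close>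

definition do_lower :: "nat \<Rightarrow> nat \<Rightarrow> complex \<Rightarrow> nat \<Rightarrow> do_alg" where
  "do_lower m n k i = (let G = refl_group m n in
     \<Oplus>\<^bsub>do_hecke m n k\<^esub>r\<in>{1..<i}. \<Oplus>\<^bsub>do_hecke m n k\<^esub>l\<in>{..<m}.
       do_gen m n k (Elt (of_perm m n (transpose r i)
         \<otimes>\<^bsub>G\<^esub> g_gen m n r [^]\<^bsub>G\<^esub> (- int l) \<otimes>\<^bsub>G\<^esub> g_gen m n i [^]\<^bsub>G\<^esub> int l)))"

definition do_upper :: "nat \<Rightarrow> nat \<Rightarrow> complex \<Rightarrow> nat \<Rightarrow> do_alg" where
  "do_upper m n k i = (let G = refl_group m n in
     \<Oplus>\<^bsub>do_hecke m n k\<^esub>r\<in>{i<..n}. \<Oplus>\<^bsub>do_hecke m n k\<^esub>l\<in>{..<m}.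
       do_gen m n k (Elt (of_perm m n (transpose i r)
         \<otimes>\<^bsub>G\<^esub> g_gen m n i [^]\<^bsub>G\<^esub> (- int l) \<otimes>\<^bsub>G\<^esub> g_gen m n r [^]\<^bsub>G\<^esub> int l)))"

definition do_dirac ::
  "nat \<Rightarrow> nat \<Rightarrow> complex \<Rightarrow> (cliff_alg, 's) lmod \<Rightarrow> (do_alg, 'v) lmod \<Rightarrow>
     ('v \<times> 's \<Rightarrow> complex) set \<Rightarrow> ('v \<times> 's \<Rightarrow> complex) set" where
  "do_dirac m n k S M x = (let H = do_hecke m n k in
     \<Oplus>\<^bsub>tensor M S\<^esub>i\<in>{1..n}.
       tensor_map M S
         (act M (do_gen m n k (Z i) \<oplus>\<^bsub>H\<^esub>
                 (k / 2) \<odot>\<^bsub>H\<^esub> (do_upper m n k i \<ominus>\<^bsub>H\<^esub> do_lower m n k i)))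
         (act S (cliff_vec n (basis_vec n i))) x)"

definition young_dirac ::
  "nat \<Rightarrow> nat \<Rightarrow> complex \<Rightarrow> (nat \<Rightarrow> nat) \<Rightarrow> (cliff_alg, 's) lmod \<Rightarrow> (young_alg, 'v) lmod \<Rightarrow>
     ('v \<times> 's \<Rightarrow> complex) set \<Rightarrow> ('v \<times> 's \<Rightarrow> complex) set" where
  "young_dirac m n k a S N x = (let H = young_hecke m k a; c = of_nat m * k / 2 in
     \<Oplus>\<^bsub>tensor N S\<^esub>i\<in>{..<m}. \<Oplus>\<^bsub>tensor N S\<^esub>j\<in>block a i.
       tensor_map N S
         (act N (young_z m k a i j
            \<oplus>\<^bsub>H\<^esub> c \<odot>\<^bsub>H\<^esub> (\<Oplus>\<^bsub>H\<^esub>r\<in>{r \<in> block a i. r > j}. young_s m k a i j r)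
            \<ominus>\<^bsub>H\<^esub> c \<odot>\<^bsub>H\<^esub> (\<Oplus>\<^bsub>H\<^esub>r\<in>{r \<in> block a i. r < j}. young_s m k a i j r)))
         (act S (cliff_vec n (basis_vec n j))) x)"

definition do_cover_act ::
  "nat \<Rightarrow> nat \<Rightarrow> complex \<Rightarrow> (cliff_alg, 's) lmod \<Rightarrow> (do_alg, 'v) lmod \<Rightarrow>
     (nat \<Rightarrow> int) \<times> cliff_alg \<Rightarrow> ('v \<times> 's \<Rightarrow> complex) set \<Rightarrow> ('v \<times> 's \<Rightarrow> complex) set" where
  "do_cover_act m n k S M = (\<lambda>(t, x).
     tensor_map M S (act M (do_gen m n k (Elt (t, cover_perm n x)))) (act S x))"

definition young_cover_act ::
  "nat \<Rightarrow> nat \<Rightarrow> complex \<Rightarrow> (nat \<Rightarrow> nat) \<Rightarrow> (cliff_alg, 's) lmod \<Rightarrow> (young_alg, 'v) lmod \<Rightarrow>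
     cliff_alg \<Rightarrow> ('v \<times> 's \<Rightarrow> complex) set \<Rightarrow> ('v \<times> 's \<Rightarrow> complex) set" where
  "young_cover_act m n k a S N x =
     tensor_map N S (act N (young_perm m k a (cover_perm n x))) (act S x)"

definition dirac_ker ::
  "(complex, 'w, 'z) module_scheme \<Rightarrow> ('w \<Rightarrow> 'w) \<Rightarrow> 'w set" where
  "dirac_ker V D = {x \<in> carrier V. D x = \<zero>\<^bsub>V\<^esub>}"

definition dirac_im_ker ::
  "(complex, 'w, 'z) module_scheme \<Rightarrow> ('w \<Rightarrow> 'w) \<Rightarrow> 'w set" where
  "dirac_im_ker V D = D ` carrier V \<inter> dirac_ker V D"

text \<open>\<open>H\<^sub>D\<close>, for a family \<open>D\<close> of operators on \<open>M \<otimes> S\<close> and a family \<open>\<rho>\<close> of group actions.\<close>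

definition dirac_cohomology ::
  "(cliff_alg, 's) lmod \<Rightarrow>
   (('a, 'v) lmod \<Rightarrow> ('v \<times> 's \<Rightarrow> complex) set \<Rightarrow> ('v \<times> 's \<Rightarrow> complex) set) \<Rightarrow>
   (('a, 'v) lmod \<Rightarrow> 'g \<Rightarrow> ('v \<times> 's \<Rightarrow> complex) set \<Rightarrow> ('v \<times> 's \<Rightarrow> complex) set) \<Rightarrow>
   (('a, 'v) lmod, 'v \<Rightarrow> 'v, ('g, ('v \<times> 's \<Rightarrow> complex) set set) lmod,
    ('v \<times> 's \<Rightarrow> complex) set set \<Rightarrow> ('v \<times> 's \<Rightarrow> complex) set set) functr" where
  "dirac_cohomology S D \<rho> =
     (let HD = (\<lambda>M. quot_mod ((tensor M S)\<lparr>carrier := dirac_ker (tensor M S) (D M)\<rparr>)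
                     (dirac_im_ker (tensor M S) (D M)));
          ind = (\<lambda>M'. coset_map (tensor M' S) (dirac_im_ker (tensor M' S) (D M')))
      in \<lparr>omap = (\<lambda>M. with_act (HD M) (\<lambda>g. ind M (\<rho> M g))),
          mmap = (\<lambda>M M' f. \<lambda>U\<in>carrier (HD M). ind M' (tensor_map M' S f id) U)\<rparr>)"

definition do_cohomology where
  "do_cohomology m n k S = dirac_cohomology S (do_dirac m n k S) (do_cover_act m n k S)"

definition young_cohomology where
  "young_cohomology m n k S = prod_functor (comps m n)
     (\<lambda>a. dirac_cohomology S (young_dirac m n k a S) (young_cover_act m n k a S))"


section \<open>The functor back\<close>

definition mu_twist ::
  "nat \<Rightarrow> complex \<Rightarrow> (nat \<Rightarrow> nat) \<Rightarrow> (cliff_alg, 'w) lmod \<Rightarrow> ((nat \<Rightarrow> int) \<times> cliff_alg, 'w) lmod" where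
  "mu_twist m \<eta> a N = with_act N (\<lambda>(t, x) v. mu m \<eta> a t \<odot>\<^bsub>N\<^esub> act N x v)"

definition induction_functor ::
  "nat \<Rightarrow> nat \<Rightarrow> complex \<Rightarrow>
     ((nat \<Rightarrow> nat) \<Rightarrow> (cliff_alg, 'w) lmod, (nat \<Rightarrow> nat) \<Rightarrow> 'w \<Rightarrow> 'w,
      ((nat \<Rightarrow> int) \<times> cliff_alg, (nat \<Rightarrow> nat) \<Rightarrow> (nat \<Rightarrow> int) \<times> cliff_alg \<Rightarrow> 'w) lmod,
      ((nat \<Rightarrow> nat) \<Rightarrow> (nat \<Rightarrow> int) \<times> cliff_alg \<Rightarrow> 'w) \<Rightarrow>
      ((nat \<Rightarrow> nat) \<Rightarrow> (nat \<Rightarrow> int) \<times> cliff_alg \<Rightarrow> 'w)) functr" where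
  "induction_functor m n \<eta> =
     (let G = refl_cover m n; A = comps m n;
          Ind = (\<lambda>N a. induced G (carrier (torus m n) \<times> carrier (young_cover m n a))
                         (mu_twist m \<eta> a (N a)))
      in \<lparr>omap = (\<lambda>N. with_act (dir_sum A (Ind N)) (\<lambda>x F. \<lambda>a\<in>A. act (Ind N a) x (F a))),
          mmap = (\<lambda>N N' \<phi>. \<lambda>F\<in>carrier (dir_sum A (Ind N)).
                    \<lambda>a\<in>A. \<lambda>g\<in>carrier G. \<phi> a (F a g))\<rparr>)"

definition primitive_root :: "nat \<Rightarrow> complex \<Rightarrow> bool" where
  "primitive_root m \<eta> \<longleftrightarrow> \<eta> ^ m = 1 \<and> (\<forall>d. 0 < d \<and> d < m \<longrightarrow> \<eta> ^ d \<noteq> 1)"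

end

theory Submission
 imports Defs "HOL-Combinatorics.Permutations"
begin

text \<open>Let \<open>D\<close> be the Dirac operator on \<open>M \<otimes> S\<close>.  It is the sum of \<open>d\<^sub>i \<otimes> z\<^sub>i\<^sup>*\<close> for elements \<open>d\<^sub>i\<close> of the algebra that are
 permuted by the group: \<open>w d\<^sub>i w\<^sup>-\<^sup>1 = d\<^sub>w\<^sub>i\<close> and \<open>t d\<^sub>i t\<^sup>-\<^sup>1 = d\<^sub>i\<close> for \<open>t\<close> in the torus \<open>T\<close> (\<open>do_elt_conj\<close>).  Lifts of
 permutations to the Pin group permute the \<open>z\<^sub>i\<^sup>*\<close> up to a sign, so the cover acts on the cohomology of \<open>D\<close>; \<open>young_elt_conj\<close>
 is the analogue for a product of symmetric groups.  That both cohomologies are functors is proved once, in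
 \<open>dirac_cohomology_functor\<close>, for the common situation \<open>dirac_datum\<close>.

 On the weight space of \<open>\<mu>\<^sub>a\<close> the sum of all \<open>g\<^sub>i\<^sup>l g\<^sub>j\<^sup>-\<^sup>l\<close> acts by \<open>m\<close> if \<open>i\<close> and \<open>j\<close> lie in the same block and by \<open>0\<close> otherwise
 (\<open>refl_sum_weight\<close>).  This turns the relations of the algebra into those of the graded Hecke algebras, and the
 element \<open>d\<^sub>i\<close> into the one that defines the Dirac operator of the product of symmetric groups (\<open>act_young_elt\<close>).  Since
 \<open>T\<close> commutes with \<open>D\<close> and acts on the first factor of \<open>M \<otimes> S\<close> only, the inclusion of the weight space and the projection
 to it induce maps in cohomology, which identify the cohomology of the weight space with the \<open>\<mu>\<^sub>a\<close>-isotypic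
 part of the cohomology of \<open>M\<close> (\<open>coh_proj_incl\<close> and \<open>coh_incl_proj\<close>).

 It remains to recover a representation \<open>V\<close> of the semidirect product of \<open>T\<close> with the cover of the symmetric group from
 its isotypic parts.  Every character of \<open>T\<close> is conjugate to exactly one \<open>\<mu>\<^sub>a\<close> (\<open>orbit_exists\<close>, \<open>orbit_unique\<close>), and the
 stabiliser of \<open>\<mu>\<^sub>a\<close> is the product of \<open>T\<close> with the cover of the corresponding product of symmetric groups.  If \<open>\<psi>\<^sub>a\<close>
 denotes the projection to the isotypic part of \<open>\<mu>\<^sub>a\<close>, then \<open>v \<mapsto> (g \<mapsto> \<psi>\<^sub>a (g\<^sup>-\<^sup>1 v))\<^sub>a\<close> is therefore an isomorphism from \<open>V\<close> to the
 sum of the induced representations (\<open>\<theta>_bij\<close>).  It is visibly natural.\<close>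

section \<open>Notation\<close>

text \<open>Subscripts abbreviate the index of a structure, and \<open>x :. V\<close> is membership in the carrier of \<open>V\<close>.\<close>

syntax "_index" :: "logic \<Rightarrow> index" ("\<^sub>_" [1000] 1000)

abbreviation (input) in_carrier :: "'a \<Rightarrow> ('a, 'z) partial_object_scheme \<Rightarrow> bool" (infix ":." 50) where
 "x :. V \<equiv> x \<in> carrier V"

abbreviation (input) "pcoords == permute_coords"
abbreviation (input) "ysub == young_subgroup"

section \<open>Complex vector spaces\<close>

lemma CC_simps [simp]: "carrier CC = UNIV" "a \<oplus>\<^sub>CC b = a + b" "a \<otimes>\<^sub>CC b = a * b" "\<one>\<^sub>CC = 1" "\<zero>\<^sub>CC = 0"
 by(simp_all add: ring_of_type_algebra_def)

lemma CC_minus [simp]: "\<ominus>\<^sub>CC a = - a"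
proof -
 interpret cring CC by(rule cring_from_type_algebra)
 show ?thesis using minus_equality[of "-a" a] by simp
qed

abbreviation cspace :: "(complex, 'v, 'z) module_scheme => bool" where "cspace V == module CC V"

lemma cspaceI:
 assumes "!!x y. x :. V ==> y :. V ==> x \<oplus>\<^sub>V y :. V" and "\<zero>\<^sub>V :. V"
  and "!!x y z. x :. V ==> y :. V ==> z :. V ==> (x \<oplus>\<^sub>V y) \<oplus>\<^sub>V z = x \<oplus>\<^sub>V (y \<oplus>\<^sub>V z)"
  and "!!x y. x :. V ==> y :. V ==> x \<oplus>\<^sub>V y = y \<oplus>\<^sub>V x" and "!!x. x :. V ==> \<zero>\<^sub>V \<oplus>\<^sub>V x = x"
  and "!!c x. x :. V ==> c \<odot>\<^sub>V x :. V" and "!!a b x. x :. V ==> (a + b) \<odot>\<^sub>V x = a \<odot>\<^sub>V x \<oplus>\<^sub>V b \<odot>\<^sub>V x"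
  and "!!a x y. x :. V ==> y :. V ==> a \<odot>\<^sub>V (x \<oplus>\<^sub>V y) = a \<odot>\<^sub>V x \<oplus>\<^sub>V a \<odot>\<^sub>V y"
  and "!!a b x. x :. V ==> (a * b) \<odot>\<^sub>V x = a \<odot>\<^sub>V (b \<odot>\<^sub>V x)" and "!!x. x :. V ==> 1 \<odot>\<^sub>V x = x"
  and "!!x. x :. V ==> 0 \<odot>\<^sub>V x = \<zero>\<^sub>V"
 shows "cspace V"
proof (rule moduleI)
 show "cring CC" by(rule cring_from_type_algebra)
 show "abelian_group V"
 proof (rule abelian_groupI)
  fix x assume x: "x :. V"
  have "(-1) \<odot>\<^sub>V x \<oplus>\<^sub>V x = (-1 + 1) \<odot>\<^sub>V x" by(subst assms(7)) (simp_all add: x assms)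
  also have "... = \<zero>\<^sub>V" by(simp add: x assms)
  finally show "\<exists>y\<in>carrier V. y \<oplus>\<^sub>V x = \<zero>\<^sub>V" using assms(6)[OF x] by blast
 qed (fact assms)+
qed (use assms in simp_all)

lemma csubmoduleI:
 assumes "cspace V" "H <= carrier V" "\<zero>\<^sub>V : H" and "!!a b. a : H ==> b : H ==> a \<oplus>\<^sub>V b : H"
  and "!!c x. x : H ==> c \<odot>\<^sub>V x : H"
 shows "submodule H CC V"
proof -
 interpret V: module CC V by fact
 show ?thesis
 proof (rule V.submoduleI)
  fix a assume a: "a : H"
  hence ac: "a :. V" using assms(2) by blast
  have "\<ominus>\<^sub>V a = (-1) \<odot>\<^sub>V a" using V.smult_l_minus[of 1 a] V.smult_one ac by simp
  thus "\<ominus>\<^sub>V a : H" using assms(5)[OF a] by simp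
 qed (use assms in auto)
qed

lemma csubmoduleD:
 assumes "cspace V" "submodule H CC V"
 shows "H <= carrier V" "\<zero>\<^sub>V : H" "!!a b. a : H ==> b : H ==> a \<oplus>\<^sub>V b : H"
  "!!a b. a : H ==> b : H ==> a \<ominus>\<^sub>V b : H" "!!a. a : H ==> \<ominus>\<^sub>V a : H" "!!c x. x : H ==> c \<odot>\<^sub>V x : H"
proof -
 interpret V: module CC V by fact
 note E = V.submoduleE[OF assms(2)]
 show "H <= carrier V" by(rule E)
 show "\<zero>\<^sub>V : H" using subgroup.one_closed[OF submodule.axioms(1)[OF assms(2)]] by simp
 show "!!a b. a : H ==> b : H ==> a \<oplus>\<^sub>V b : H" by(rule E)
 show "!!a b. a : H ==> b : H ==> a \<ominus>\<^sub>V b : H" using E by(simp add: a_minus_def)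
 show "!!a. a : H ==> \<ominus>\<^sub>V a : H" by(rule E)
 show "!!c x. x : H ==> c \<odot>\<^sub>V x : H" using E by simp
qed

lemma cspace_restrict: "cspace V ==> submodule H CC V ==> cspace (V\<lparr>carrier := H\<rparr>)"
 by(rule submodule.submodule_is_module)

lemma cspace_eq_iff_minus:
 assumes "cspace V" "x :. V" "y :. V"
 shows "x \<ominus>\<^sub>V y = \<zero>\<^sub>V \<longleftrightarrow> x = y"
proof -
 interpret V: module CC V by fact
 show ?thesis using assms V.M.minus_equality[of x "\<ominus>\<^sub>V y"] V.M.minus_minus V.M.r_neg by(auto simp: a_minus_def)
qed

section \<open>Linear maps\<close>

lemma lin_mapsI:
 assumes "!!x. x :. V ==> f x :. W" and "!!x y. x :. V ==> y :. V ==> f (x \<oplus>\<^sub>V y) = f x \<oplus>\<^sub>W f y"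
  and "!!c x. x :. V ==> f (c \<odot>\<^sub>V x) = c \<odot>\<^sub>W f x"
 shows "f : lin_maps V W" using assms by(auto simp: lin_maps_def)

lemma lin_closed: "f : lin_maps V W ==> x :. V ==> f x :. W"
 and lin_add: "f : lin_maps V W ==> x :. V ==> y :. V ==> f (x \<oplus>\<^sub>V y) = f x \<oplus>\<^sub>W f y"
 and lin_smult: "f : lin_maps V W ==> x :. V ==> f (c \<odot>\<^sub>V x) = c \<odot>\<^sub>W f x" by(auto simp: lin_maps_def)

lemma lin_zero:
 assumes "cspace V" "cspace W" "f : lin_maps V W"
 shows "f \<zero>\<^sub>V = \<zero>\<^sub>W"
proof -
 interpret V: module CC V by fact
 interpret W: module CC W by fact
 have "f \<zero>\<^sub>V = f (0 \<odot>\<^sub>V \<zero>\<^sub>V)" using V.smult_r_null[of 0] by simp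
 also have "... = 0 \<odot>\<^sub>W f \<zero>\<^sub>V" by(rule lin_smult[OF assms(3)]) simp
 also have "... = \<zero>\<^sub>W" using W.smult_l_null[of "f \<zero>\<^sub>V"] lin_closed[OF assms(3)] by simp
 finally show ?thesis .
qed

lemma smult_minus_one:
 assumes "cspace V" "x :. V"
 shows "(-1) \<odot>\<^sub>V x = \<ominus>\<^sub>V x"
proof -
 interpret V: module CC V by fact
 show ?thesis using V.smult_l_minus[of 1 x] V.smult_one assms by simp
qed

lemma lin_minus:
 assumes "cspace V" "cspace W" "f : lin_maps V W" "x :. V" "y :. V"
 shows "f (x \<ominus>\<^sub>V y) = f x \<ominus>\<^sub>W f y"
proof -
 interpret V: module CC V by fact
 have "f (x \<oplus>\<^sub>V (-1) \<odot>\<^sub>V y) = f x \<oplus>\<^sub>W (-1) \<odot>\<^sub>W f y" using assms V.smult_closed by(simp add: lin_add lin_smult)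
 thus ?thesis using assms by(simp add: smult_minus_one a_minus_def lin_closed)
qed

lemma lin_finsum:
 assumes "cspace V" "cspace W" "f : lin_maps V W" "finite A" "!!i. i : A ==> g i :. V"
 shows "f (\<Oplus>\<^sub>V i\<in>A. g i) = (\<Oplus>\<^sub>W i\<in>A. f (g i))"
proof -
 interpret V: module CC V by fact
 interpret W: module CC W by fact
 show ?thesis using assms(4,5)
 proof (induction A rule: finite_induct)
  case empty
  thus ?case using lin_zero[OF assms(1-3)] by simp
 next
  case (insert i A)
  thus ?case using assms by(simp add: lin_add lin_closed Pi_def V.M.finsum_closed)
 qed
qed

lemma lin_comp: "f : lin_maps V W ==> g : lin_maps W U ==> (%x. g (f x)) : lin_maps V U"
 by(auto simp: lin_maps_def Pi_def)

lemma lin_id: "(%x. x) : lin_maps V V" by(auto simp: lin_maps_def)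

lemma lin_cong:
 assumes "cspace V" "f : lin_maps V W" "!!x. x :. V ==> f x = g x"
 shows "g : lin_maps V W"
proof -
 interpret V: module CC V by fact
 show ?thesis using assms(2,3) V.smult_closed by(auto simp: lin_maps_def Pi_def)
qed

lemma lin_const_smult:
 assumes "cspace W" "f : lin_maps V W"
 shows "(%x. c \<odot>\<^sub>W f x) : lin_maps V W"
proof -
 interpret W: module CC W by fact
 show ?thesis using assms(2) W.smult_closed W.smult_r_distr W.smult_assoc1[of c] W.smult_assoc1[of _ c]
  by(intro lin_mapsI) (auto simp: lin_closed lin_add lin_smult mult.commute simp flip: )
qed

lemma lin_plus:
 assumes "cspace W" "f : lin_maps V W" "g : lin_maps V W"
 shows "(%x. f x \<oplus>\<^sub>W g x) : lin_maps V W"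
proof -
 interpret W: module CC W by fact
 show ?thesis using assms W.smult_r_distr by(intro lin_mapsI) (auto simp: lin_closed lin_add lin_smult W.a_ac)
qed

lemma lin_zero_map: "cspace W ==> (%x. \<zero>\<^sub>W) : lin_maps V W"
proof -
 assume "cspace W"
 then interpret W: module CC W .
 show ?thesis using W.smult_r_null by(intro lin_mapsI) auto
qed

lemma lin_finsum_map:
 assumes "cspace W" "cspace V" "finite A" "!!i. i : A ==> f i : lin_maps V W"
 shows "(%x. \<Oplus>\<^sub>W i\<in>A. f i x) : lin_maps V W"
proof -
 interpret W: module CC W by fact
 show ?thesis using assms(3,4)
 proof (induction A rule: finite_induct)
  case empty
  thus ?case using lin_zero_map[OF assms(1)] by simp
 next
  case (insert i A)
  show ?case
  proof (rule lin_cong[OF assms(2)])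
   show "(%x. f i x \<oplus>\<^sub>W (\<Oplus>\<^sub>W i\<in>A. f i x)) : lin_maps V W" using insert by(intro lin_plus[OF assms(1)]) auto
   show "f i x \<oplus>\<^sub>W (\<Oplus>\<^sub>W i\<in>A. f i x) = (\<Oplus>\<^sub>W i\<in>insert i A. f i x)" if "x :. V" for x
    using insert that lin_closed by(subst W.M.finsum_insert) fastforce+
  qed
 qed
qed

lemma lin_restrict_source: "f : lin_maps V W ==> H <= carrier V ==> f : lin_maps (V\<lparr>carrier := H\<rparr>) W"
 by(rule lin_mapsI) (auto simp: lin_closed lin_add lin_smult subset_iff)

lemma lin_restrict_target: "f : lin_maps V W ==> f ` carrier V <= H ==> f : lin_maps V (W\<lparr>carrier := H\<rparr>)"
 by(auto simp: lin_maps_def)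

lemma lin_inclusion: "H <= carrier V ==> (%x. x) : lin_maps (V\<lparr>carrier := H\<rparr>) V" by(auto simp: lin_maps_def)

lemma lin_vimage_submodule:
 assumes "cspace V" "cspace W" "f : lin_maps V W" "submodule H CC W"
 shows "submodule {x \<in> carrier V. f x : H} CC V"
proof -
 interpret V: module CC V by fact
 note H = csubmoduleD[OF assms(2,4)]
 show ?thesis by(rule csubmoduleI) (use assms H V.smult_closed in \<open>auto simp: lin_add lin_smult lin_zero\<close>)
qed

lemma lin_image_submodule:
 assumes "cspace V" "cspace W" "f : lin_maps V W"
 shows "submodule (f ` carrier V) CC W"
proof -
 interpret V: module CC V by fact
 show ?thesis
 proof (rule csubmoduleI[OF assms(2)])
  show "\<zero>\<^sub>W : f ` carrier V" using lin_zero[OF assms] V.zero_closed by(metis imageI)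
  show "!!a b. a : f ` carrier V ==> b : f ` carrier V ==> a \<oplus>\<^sub>W b : f ` carrier V"
   using assms by(auto simp flip: lin_add)
  show "!!c x. x : f ` carrier V ==> c \<odot>\<^sub>W x : f ` carrier V"
   using assms V.smult_closed by(auto simp flip: lin_smult)
 qed (use assms in \<open>auto simp: lin_closed\<close>)
qed

lemma submodule_zero: "cspace V ==> submodule {\<zero>\<^sub>V} CC V"
proof -
 assume V: "cspace V"
 then interpret V: module CC V .
 show ?thesis by(rule csubmoduleI[OF V]) (use V.smult_r_null in auto)
qed

lemma submodule_inter:
 assumes "cspace V" "submodule H CC V" "submodule K CC V"
 shows "submodule (H \<inter> K) CC V"
 using csubmoduleD[OF assms(1,2)] csubmoduleD[OF assms(1,3)] by(intro csubmoduleI[OF assms(1)]) auto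

section \<open>Quotients\<close>

lemma a_r_coset_restrict [simp]: "a_r_coset (V\<lparr>carrier := K\<rparr>) = a_r_coset V"
 by(intro ext) (simp add: a_r_coset_def r_coset_def)

lemma coset_map_restrict [simp]: "coset_map (V\<lparr>carrier := K\<rparr>) N f = coset_map V N f"
 by(intro ext) (simp add: coset_map_def)

lemma submodule_abelian_subgroup:
 assumes "cspace V" "submodule N CC V"
 shows "abelian_subgroup N V"
proof -
 interpret V: module CC V by fact
 show ?thesis by(rule abelian_subgroupI3[OF additive_subgroupI])
   (use submodule.axioms(1)[OF assms(2)] V.abelian_group_axioms in auto)
qed

lemma coset_eq_iff:
 assumes "cspace V" "submodule N CC V" "x :. V" "y :. V"
 shows "N +>\<^sub>V x = N +>\<^sub>V y \<longleftrightarrow> x \<ominus>\<^sub>V y : N"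
proof -
 interpret V: module CC V by fact
 interpret N: abelian_subgroup N V by(rule submodule_abelian_subgroup[OF assms(1,2)])
 have "x \<ominus>\<^sub>V y : N \<longleftrightarrow> x : N +>\<^sub>V y" using N.a_rcos_module[OF assms(4,3)] by(simp add: a_minus_def)
 also have "... \<longleftrightarrow> N +>\<^sub>V x = N +>\<^sub>V y"
  using N.a_rcos_self[OF assms(3)] V.a_repr_independence[OF _ assms(4) N.a_subgroup] by metis
 finally show ?thesis ..
qed

lemma coset_self:
 assumes "cspace V" "submodule N CC V" "x :. V"
 shows "x : N +>\<^sub>V x"
proof -
 interpret N: abelian_subgroup N V by(rule submodule_abelian_subgroup[OF assms(1,2)])
 show ?thesis by(rule N.a_rcos_self[OF assms(3)])
qed

lemma coset_zero:
 assumes "cspace V" "submodule N CC V"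
 shows "N +>\<^sub>V \<zero>\<^sub>V = N"
proof -
 interpret V: module CC V by fact
 show ?thesis using csubmoduleD(1)[OF assms] by simp
qed

lemma coset_memD:
 assumes "cspace V" "submodule N CC V" "x :. V" "y : N +>\<^sub>V x"
 shows "y :. V" "N +>\<^sub>V y = N +>\<^sub>V x"
proof -
 interpret V: module CC V by fact
 interpret N: abelian_subgroup N V by(rule submodule_abelian_subgroup[OF assms(1,2)])
 show "y :. V" using V.a_r_coset_subset_G[OF _ assms(3)] N.a_subset assms(4) by blast
 show "N +>\<^sub>V y = N +>\<^sub>V x" using V.a_repr_independence[OF assms(4,3) N.a_subgroup] by simp
qed

lemma coset_map_coset:
 assumes "cspace V" "submodule N CC V" "cspace W" "submodule N' CC W"
  and "f : lin_maps V W" "f ` N <= N'" "x :. V"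
 shows "coset_map W N' f (N +>\<^sub>V x) = N' +>\<^sub>W f x"
proof -
 have "N' +>\<^sub>W f y = N' +>\<^sub>W f x" if y: "y : N +>\<^sub>V x" for y
 proof -
  note yy = coset_memD[OF assms(1,2,7) y]
  hence "y \<ominus>\<^sub>V x : N" using coset_eq_iff[OF assms(1,2)] assms(7) by blast
  hence "f (y \<ominus>\<^sub>V x) : N'" using assms(6) by blast
  thus ?thesis using coset_eq_iff[OF assms(3,4)] lin_minus[OF assms(1,3,5) yy(1) assms(7)]
    lin_closed[OF assms(5)] yy(1) assms(7) by simp
 qed
 thus ?thesis unfolding coset_map_def using coset_self[OF assms(1,2,7)] by(intro SUP_eq_const) blast
qed

lemma quot_mod_simps: "ring.add (quot_mod V N) = set_add V" "\<zero>\<^sub>(quot_mod V N) = N"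
 "monoid.mult (quot_mod V N) = rcoset_mult V N" "\<one>\<^sub>(quot_mod V N) = N +>\<^sub>V \<one>\<^sub>V" by(simp_all add: quot_mod_def)

lemma quot_mod_carrier: "carrier (quot_mod V N) = (%x. N +>\<^sub>V x) ` carrier V"
 by(auto simp: quot_mod_def A_RCOSETS_def')

lemma quot_mod_add:
 assumes "cspace V" "submodule N CC V" "x :. V" "y :. V"
 shows "(N +>\<^sub>V x) \<oplus>\<^sub>(quot_mod V N) (N +>\<^sub>V y) = N +>\<^sub>V (x \<oplus>\<^sub>V y)"
proof -
 interpret N: abelian_subgroup N V by(rule submodule_abelian_subgroup[OF assms(1,2)])
 show ?thesis using N.a_rcos_sum[OF assms(3,4)] by(simp add: quot_mod_simps)
qed

lemma quot_mod_smult: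
 assumes "cspace V" "submodule N CC V" "x :. V"
 shows "c \<odot>\<^sub>(quot_mod V N) (N +>\<^sub>V x) = N +>\<^sub>V (c \<odot>\<^sub>V x)"
 using coset_map_coset[OF assms(1,2,1,2) lin_const_smult[OF assms(1) lin_id] _ assms(3)]
  csubmoduleD(6)[OF assms(1,2)] by(auto simp: quot_mod_def)

lemma cspace_quot_mod:
 assumes "cspace V" "submodule N CC V"
 shows "cspace (quot_mod V N)"
proof -
 interpret V: module CC V by fact
 note q = quot_mod_add[OF assms] quot_mod_smult[OF assms]
 have zero: "\<zero>\<^sub>(quot_mod V N) = N +>\<^sub>V \<zero>\<^sub>V" by(simp only: quot_mod_simps coset_zero[OF assms])
 note V.smult_closed[simplified, simp] V.smult_l_distr[simplified, simp]
  V.smult_r_distr[simplified, simp] V.smult_assoc1[simplified, simp] V.smult_one[simplified, simp]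
  V.smult_l_null[simplified, simp]
 show ?thesis by(rule cspaceI) (auto simp: quot_mod_carrier q zero V.a_ac)
qed

lemma coset_lin:
 assumes "cspace V" "submodule N CC V"
 shows "(%x. N +>\<^sub>V x) : lin_maps V (quot_mod V N)"
 by(intro lin_mapsI) (auto simp: quot_mod_carrier quot_mod_add[OF assms] quot_mod_smult[OF assms])

lemma coset_map_lin:
 assumes "cspace V" "submodule N CC V" "cspace W" "submodule N' CC W" and "f : lin_maps V W" "f ` N <= N'"
 shows "coset_map W N' f : lin_maps (quot_mod V N) (quot_mod W N')"
proof -
 interpret V: module CC V by fact
 show ?thesis by(rule lin_mapsI)
   (use V.smult_closed in \<open>auto simp: quot_mod_carrier quot_mod_add[OF assms(1,2)]
    quot_mod_smult[OF assms(1,2)] coset_map_coset[OF assms] quot_mod_add[OF assms(3,4)]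
    quot_mod_smult[OF assms(3,4)] lin_closed[OF assms(5)] lin_add[OF assms(5)] lin_smult[OF assms(5)]\<close>)
qed

section \<open>Free spaces\<close>

lemma free_vs_carrier: "carrier (free_vs B) = {f. finite {x. f x ~= 0} & {x. f x ~= 0} <= B}"
 by(simp add: free_vs_def)

lemma free_vs_support:
 assumes "f :. free_vs B"
 shows "finite {x. f x ~= 0}" "{x. f x ~= 0} <= B" "f x ~= 0 ==> x : B"
 using assms by(auto simp: free_vs_carrier)

lemma free_vs_simps [simp]: "f \<oplus>\<^sub>(free_vs B) g = (%x. f x + g x)" "\<zero>\<^sub>(free_vs B) = (%x. 0)"
 "c \<odot>\<^sub>(free_vs B) f = (%x. c * f x)" by(simp_all add: free_vs_def)

lemma free_vs_closed [simp, intro]: "f :. free_vs B ==> g :. free_vs B ==> (%x. f x + g x) :. free_vs B"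
 "f :. free_vs B ==> g :. free_vs B ==> (%x. f x - g x) :. free_vs B"
 "f :. free_vs B ==> (%x. c * f x) :. free_vs B" "(%x. 0) :. free_vs B"
 by(auto simp: free_vs_carrier subset_iff intro: finite_subset[of _ "{x. f x ~= 0}"]
   finite_subset[of _ "{x. f x ~= 0} \<union> {x. g x ~= 0}"]) (metis add.right_neutral)+

lemma cspace_free_vs: "cspace (free_vs B)" by(rule cspaceI) (auto simp: algebra_simps)

lemma free_vs_minus:
 assumes "f :. free_vs B" "g :. free_vs B"
 shows "f \<ominus>\<^sub>(free_vs B) g = (%x. f x - g x)"
 by(simp add: a_minus_def smult_minus_one[OF cspace_free_vs assms(2), symmetric])

lemma delta_in_free_vs [simp]: "delta b :. free_vs B \<longleftrightarrow> b : B" by(auto simp: delta_def free_vs_carrier)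

lemma free_vs_induct [consumes 1, case_names zero delta add smult]:
 assumes f: "f :. free_vs B" and zero: "P (%x. 0)" and delta: "!!b. b : B ==> P (delta b)"
  and add: "!!f g. f :. free_vs B ==> g :. free_vs B ==> P f ==> P g ==> P (%x. f x + g x)"
  and smult: "!!c f. f :. free_vs B ==> P f ==> P (%x. c * f x)"
 shows "P f"
proof -
 have "finite F ==> F <= B ==> {x. f x ~= 0} <= F ==> P f" for F
 proof (induction F arbitrary: f rule: finite_induct)
  case empty
  hence "f = (%x. 0)" by auto
  thus ?case using zero by simp
 next
  case (insert b F)
  define g where "g = f(b := 0)"
  have g: "{x. g x ~= 0} <= F" using insert by(auto simp: g_def)
  have "g :. free_vs B" using g insert finite_subset by(auto simp: free_vs_carrier)
  moreover have "P g" using insert.IH[OF _ g] insert by auto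
  moreover have "f = (%x. f b * delta b x + g x)" by(auto simp: g_def delta_def)
  ultimately show ?case
   using add[of "%x. f b * delta b x" g] smult[of "delta b" "f b"] delta[of b] insert.prems by auto
 qed
 from this[OF free_vs_support(1,2)[OF f] subset_refl] show ?thesis .
qed

lemma free_vs_lin_eqI:
 assumes "cspace W" "f : lin_maps (free_vs B) W" "g : lin_maps (free_vs B) W"
  and "!!b. b : B ==> f (delta b) = g (delta b)" "x :. free_vs B"
 shows "f x = g x" using assms(5)
proof (induction x rule: free_vs_induct)
 case zero
 show ?case using lin_zero[OF cspace_free_vs assms(1,2)] lin_zero[OF cspace_free_vs assms(1,3)] by simp
next
 case (delta b)
 thus ?case by(rule assms(4))
next
 case (add u v)
 thus ?case using lin_add[OF assms(2), of u v] lin_add[OF assms(3), of u v] by simp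
next
 case (smult c u)
 thus ?case using lin_smult[OF assms(2), of u c] lin_smult[OF assms(3), of u c] by simp
qed

lemma lin_ext_superset:
 assumes "cspace V" "finite C" "{b. f b ~= 0} <= C" "!!b. b : C ==> \<beta> b v :. V"
 shows "lin_ext V \<beta> f v = (\<Oplus>\<^sub>V b\<in>C. f b \<odot>\<^sub>V \<beta> b v)"
proof -
 interpret V: module CC V by fact
 show ?thesis unfolding lin_ext_def by(rule V.M.add.finprod_mono_neutral_cong_left)
   (use assms V.smult_closed V.smult_l_null in auto)
qed

lemma lin_ext_lin:
 assumes "cspace V" "!!b. b : B ==> \<beta> b v :. V"
 shows "(%f. lin_ext V \<beta> f v) : lin_maps (free_vs B) V"
proof -
 interpret V: module CC V by fact
 show ?thesis
 proof (rule lin_mapsI)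
  fix f assume f: "f :. free_vs B"
  show "lin_ext V \<beta> f v :. V"
   unfolding lin_ext_def using free_vs_support[OF f] assms V.smult_closed by(intro V.M.finsum_closed) auto
  fix c
  have *: "{b. c * f b ~= 0} <= {b. f b ~= 0}" by auto
  show "lin_ext V \<beta> (c \<odot>\<^sub>(free_vs B) f) v = c \<odot>\<^sub>V lin_ext V \<beta> f v" using free_vs_support[OF f] assms(2) *
   by(subst (1 2) lin_ext_superset[OF assms(1), of "{b. f b ~= 0}"])
    (auto simp: V.finsum_smult_ldistr V.smult_closed V.smult_assoc1[simplified] subset_iff Pi_def
     intro!: V.M.finsum_cong')
  fix g assume g: "g :. free_vs B"
  let ?C = "{b. f b ~= 0} \<union> {b. g b ~= 0}"
  have C: "?C <= B" "finite ?C" using free_vs_support[OF f] free_vs_support[OF g] by auto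
  show "lin_ext V \<beta> (f \<oplus>\<^sub>(free_vs B) g) v = lin_ext V \<beta> f v \<oplus>\<^sub>V lin_ext V \<beta> g v"
  proof -
   have c: "f b \<odot>\<^sub>V \<beta> b v :. V" "g b \<odot>\<^sub>V \<beta> b v :. V" if "b : ?C" for b
    using assms(2) C that V.smult_closed by auto
   have e: "lin_ext V \<beta> h v = (\<Oplus>\<^sub>V b\<in>?C. h b \<odot>\<^sub>V \<beta> b v)" if "{b. h b ~= 0} <= ?C" for h
    by(rule lin_ext_superset[OF assms(1) C(2) that]) (use assms(2) C in blast)
   have "lin_ext V \<beta> (f \<oplus>\<^sub>(free_vs B) g) v = (\<Oplus>\<^sub>V b\<in>?C. (f b + g b) \<odot>\<^sub>V \<beta> b v)" by(subst e) auto
   also have "... = (\<Oplus>\<^sub>V b\<in>?C. f b \<odot>\<^sub>V \<beta> b v \<oplus>\<^sub>V g b \<odot>\<^sub>V \<beta> b v)"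
    using c C assms(2) by(intro V.M.finsum_cong') (auto simp: V.smult_l_distr[simplified] subset_iff)
   also have "... = (\<Oplus>\<^sub>V b\<in>?C. f b \<odot>\<^sub>V \<beta> b v) \<oplus>\<^sub>V (\<Oplus>\<^sub>V b\<in>?C. g b \<odot>\<^sub>V \<beta> b v)" using c by(intro V.M.finsum_addf) auto
   also have "... = lin_ext V \<beta> f v \<oplus>\<^sub>V lin_ext V \<beta> g v" using e[of f] e[of g] by simp
   finally show ?thesis .
  qed
 qed
qed

lemma lin_ext_delta:
 assumes "cspace V" "\<beta> b v :. V"
 shows "lin_ext V \<beta> (delta b) v = \<beta> b v"
proof -
 interpret V: module CC V by fact
 show ?thesis by(subst lin_ext_superset[OF assms(1), of "{b}"])
   (use assms(2) V.smult_one in \<open>auto simp: delta_def Pi_def\<close>)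
qed

lemma lin_ext_lin_vector:
 assumes "cspace V" "!!b. b : B ==> \<beta> b : lin_maps V W" "f :. free_vs B" "cspace W"
 shows "lin_ext W \<beta> f : lin_maps V W" unfolding lin_ext_def[abs_def]
 using assms(2) free_vs_support[OF assms(3)] by(auto intro!: lin_finsum_map[OF assms(4,1)] lin_const_smult[OF assms(4)])

lemma push_forward_superset:
 assumes "finite C" "{x. f x ~= 0} <= C"
 shows "push_forward h f y = (\<Sum>x\<in>C. if h x = y then f x else 0)"
proof -
 have "(\<Sum>x\<in>C. if h x = y then f x else 0) = (\<Sum>x\<in>{x\<in>C. h x = y}. f x)"
  using assms(1) by(simp add: sum.If_cases Int_def)
 also have "... = push_forward h f y"
  unfolding push_forward_def by(rule sum.mono_neutral_right) (use assms in auto)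
 finally show ?thesis ..
qed

lemma push_forward_delta [simp]: "push_forward h (delta b) = delta (h b)"
 by(rule ext, subst push_forward_superset[of "{b}"]) (auto simp: delta_def)

lemma push_forward_lin:
 assumes "!!b. b : B ==> h b : C"
 shows "push_forward h : lin_maps (free_vs B) (free_vs C)"
proof (rule lin_mapsI)
 have add: "push_forward h (%x. f x + g x) = (%x. push_forward h f x + push_forward h g x)"
  if "f :. free_vs B" "g :. free_vs B" for f g using free_vs_support[OF that(1)] free_vs_support[OF that(2)]
  by(intro ext, subst (1 2 3) push_forward_superset[of "{b. f b ~= 0} \<union> {b. g b ~= 0}"])
   (auto simp: sum.distrib[symmetric] intro!: sum.cong)
 have smult: "push_forward h (%x. c * f x) = (%x. c * push_forward h f x)" if "f :. free_vs B" for f c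
  using free_vs_support[OF that] by(intro ext, subst (1 2) push_forward_superset[of "{b. f b ~= 0}"])
   (auto simp: sum_distrib_left intro!: sum.cong)
 show "push_forward h (f \<oplus>\<^sub>(free_vs B) g) = push_forward h f \<oplus>\<^sub>(free_vs C) push_forward h g"
  if "f :. free_vs B" "g :. free_vs B" for f g using add[OF that] by simp
 show "push_forward h (c \<odot>\<^sub>(free_vs B) f) = c \<odot>\<^sub>(free_vs C) push_forward h f" if "f :. free_vs B" for f c
  using smult[OF that] by simp
 show "push_forward h f :. free_vs C" if "f :. free_vs B" for f using that
 proof (induction f rule: free_vs_induct)
  case zero
  have "push_forward h (%x. 0) = (%x. 0)" by(simp add: push_forward_def)
  thus ?case by simp
 qed (use assms in \<open>simp_all add: add smult\<close>)
qed

lemma lin_span_submodule: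
 assumes "cspace V" "R <= carrier V"
 shows "submodule (lin_span V R) CC V" "R <= lin_span V R"
proof -
 interpret V: module CC V by fact
 show "R <= lin_span V R" by(auto simp: lin_span_def)
 have c: "carrier V : {H. submodule H CC V & R <= H}" using V.carrier_is_submodule assms by auto
 note D = csubmoduleD[OF assms(1)]
 show "submodule (lin_span V R) CC V" unfolding lin_span_def
 proof (rule csubmoduleI[OF assms(1)])
  show "\<Inter> {H. submodule H CC V & R <= H} <= carrier V" using c by(rule Inter_lower)
 qed (use D in auto)
qed

lemma lin_span_least: "submodule H CC V ==> R <= H ==> lin_span V R <= H" by(auto simp: lin_span_def)

section \<open>Tensor products\<close>

definition ptensor ::
 "(complex, 'v, 'y) module_scheme => (complex, 's, 'z) module_scheme => 'v => 's => ('v \<times> 's => complex) set"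
 where "ptensor V S v s = tensor_null V S +>\<^sub>(free_vs (carrier V \<times> carrier S)) delta (v, s)"

lemma tensor_rels_closed:
 assumes "cspace V" "cspace S"
 shows "tensor_rels V S <= carrier (free_vs (carrier V \<times> carrier S))"
proof -
 interpret V: module CC V by fact
 interpret S: module CC S by fact
 show ?thesis unfolding tensor_rels_def by(auto intro!: free_vs_closed simp: V.smult_closed S.smult_closed)
qed

lemma tensor_null_submodule:
 assumes "cspace V" "cspace S"
 shows "submodule (tensor_null V S) CC (free_vs (carrier V \<times> carrier S))" "tensor_rels V S <= tensor_null V S"
 using lin_span_submodule[OF cspace_free_vs tensor_rels_closed[OF assms]] by(simp_all add: tensor_null_def)

lemma cspace_tensor: "cspace V ==> cspace S ==> cspace (tensor V S)"
 unfolding tensor_def by(intro cspace_quot_mod cspace_free_vs tensor_null_submodule)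

lemma ptensor_closed [simp]: "v :. V ==> s :. S ==> ptensor V S v s :. tensor V S"
 by(auto simp: ptensor_def tensor_def quot_mod_carrier)

lemma
 assumes V: "cspace V" and S: "cspace S" and v: "v :. V" and s: "s :. S"
 shows ptensor_add_left: "v' :. V ==>
   ptensor V S (v \<oplus>\<^sub>V v') s = ptensor V S v s \<oplus>\<^sub>(tensor V S) ptensor V S v' s"
  and ptensor_add_right: "s' :. S ==>
   ptensor V S v (s \<oplus>\<^sub>S s') = ptensor V S v s \<oplus>\<^sub>(tensor V S) ptensor V S v s'"
  and ptensor_smult_left: "ptensor V S (c \<odot>\<^sub>V v) s = c \<odot>\<^sub>(tensor V S) ptensor V S v s"
  and ptensor_smult_right: "ptensor V S v (c \<odot>\<^sub>S s) = c \<odot>\<^sub>(tensor V S) ptensor V S v s"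
proof -
 interpret V: module CC V by fact
 interpret S: module CC S by fact
 let ?F = "free_vs (carrier V \<times> carrier S)"
 note N = tensor_null_submodule[OF V S]
 have eq: "tensor_null V S +>\<^sub>?F f = tensor_null V S +>\<^sub>?F g"
  if "f :. ?F" "g :. ?F" "(%u. f u - g u) : tensor_rels V S" for f g
  using coset_eq_iff[OF cspace_free_vs N(1) that(1,2)] N(2) that by(auto simp: free_vs_minus)
 have add: "(a +>\<^sub>?F f) \<oplus>\<^sub>(tensor V S) (a +>\<^sub>?F g) = a +>\<^sub>?F (%u. f u + g u)"
  if "a = tensor_null V S" "f :. ?F" "g :. ?F" for a f g
  using quot_mod_add[OF cspace_free_vs N(1)] that by(simp add: tensor_def)
 have smult: "c \<odot>\<^sub>(tensor V S) (a +>\<^sub>?F f) = a +>\<^sub>?F (%u. c * f u)" if "a = tensor_null V S" "f :. ?F" for a f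
  using quot_mod_smult[OF cspace_free_vs N(1)] that by(simp add: tensor_def)
 show "ptensor V S (v \<oplus>\<^sub>V v') s = ptensor V S v s \<oplus>\<^sub>(tensor V S) ptensor V S v' s" if v': "v' :. V"
 proof -
  have "(%u. delta (v \<oplus>\<^sub>V v', s) u - delta (v, s) u - delta (v', s) u) : tensor_rels V S"
   unfolding tensor_rels_def using v s v' by blast
  thus ?thesis unfolding ptensor_def using v s v' by(subst add, simp_all, intro eq) (auto simp: diff_diff_eq)
 qed
 show "ptensor V S v (s \<oplus>\<^sub>S s') = ptensor V S v s \<oplus>\<^sub>(tensor V S) ptensor V S v s'" if s': "s' :. S"
 proof -
  have "(%u. delta (v, s \<oplus>\<^sub>S s') u - delta (v, s) u - delta (v, s') u) : tensor_rels V S"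
   unfolding tensor_rels_def using v s s' by blast
  thus ?thesis unfolding ptensor_def using v s s' by(subst add, simp_all, intro eq) (auto simp: diff_diff_eq)
 qed
 show "ptensor V S (c \<odot>\<^sub>V v) s = c \<odot>\<^sub>(tensor V S) ptensor V S v s"
 proof -
  have "(%u. delta (c \<odot>\<^sub>V v, s) u - c * delta (v, s) u) : tensor_rels V S"
   unfolding tensor_rels_def using v s by blast
  thus ?thesis unfolding ptensor_def using v s V.smult_closed by(subst smult, simp_all, intro eq) auto
 qed
 show "ptensor V S v (c \<odot>\<^sub>S s) = c \<odot>\<^sub>(tensor V S) ptensor V S v s"
 proof -
  have "(%u. delta (v, c \<odot>\<^sub>S s) u - c * delta (v, s) u) : tensor_rels V S"
   unfolding tensor_rels_def using v s by blast
  thus ?thesis unfolding ptensor_def using v s S.smult_closed by(subst smult, simp_all, intro eq) auto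
 qed
qed

text \<open>Sums of pure tensors exhaust the tensor product: a scalar can be moved into the first factor.\<close>

lemma tensor_induct [consumes 3, case_names pure add]:
 assumes V: "cspace V" and S: "cspace S" and x: "x :. tensor V S"
  and pure: "!!v s. v :. V ==> s :. S ==> P (ptensor V S v s)"
  and add: "!!x y. x :. tensor V S ==> y :. tensor V S ==> P x ==> P y ==> P (x \<oplus>\<^sub>(tensor V S) y)"
 shows "P x"
proof -
 interpret V: module CC V by fact
 interpret S: module CC S by fact
 let ?F = "free_vs (carrier V \<times> carrier S)" and ?N = "tensor_null V S"
 note N = tensor_null_submodule[OF V S]
 note q = quot_mod_add[OF cspace_free_vs N(1)] quot_mod_smult[OF cspace_free_vs N(1)]
 interpret T: module CC "tensor V S" by(rule cspace_tensor[OF V S])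
 have "P (?N +>\<^sub>?F (%u. c * f u))" if "f :. ?F" for f c using that
 proof (induction f arbitrary: c rule: free_vs_induct)
  case zero
  have "P (ptensor V S \<zero>\<^sub>V \<zero>\<^sub>S)" by(rule pure) auto
  also have "ptensor V S \<zero>\<^sub>V \<zero>\<^sub>S = ptensor V S (0 \<odot>\<^sub>V \<zero>\<^sub>V) \<zero>\<^sub>S" using V.smult_r_null by simp
  also have "... = 0 \<odot>\<^sub>(tensor V S) ptensor V S \<zero>\<^sub>V \<zero>\<^sub>S" by(rule ptensor_smult_left[OF V S]) auto
  also have "... = \<zero>\<^sub>(tensor V S)" by(rule T.smult_l_null[simplified]) simp
  also have "... = ?N +>\<^sub>?F (%u. c * 0)"
   using coset_zero[OF cspace_free_vs N(1)] by(simp add: tensor_def quot_mod_simps)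
  finally show ?case .
 next
  case (delta b)
  then obtain v s where b: "b = (v, s)" "v :. V" "s :. S" by auto
  have "P (ptensor V S (c \<odot>\<^sub>V v) s)" using b V.smult_closed by(intro pure) auto
  thus ?case using b by(simp add: ptensor_smult_left[OF V S]) (simp add: tensor_def ptensor_def q)
 next
  case (add f g)
  have "P ((?N +>\<^sub>?F (%u. c * f u)) \<oplus>\<^sub>(tensor V S) (?N +>\<^sub>?F (%u. c * g u)))"
   using add by(intro assms(5)) (auto simp: tensor_def quot_mod_carrier)
  thus ?case using add by(simp add: tensor_def q distrib_left)
 next
  case (smult d f)
  thus ?case using smult.IH[of "c * d"] by(simp add: mult.assoc)
 qed
 from this[of _ 1] show ?thesis using x by(auto simp: tensor_def quot_mod_carrier)
qed

lemma tensor_lin_eqI: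
 assumes "cspace V" "cspace S" "f : lin_maps (tensor V S) U" "g : lin_maps (tensor V S) U"
  and "!!v s. v :. V ==> s :. S ==> f (ptensor V S v s) = g (ptensor V S v s)" and "x :. tensor V S"
 shows "f x = g x" using assms(1,2,6) 
proof (induction x rule: tensor_induct)
 case (pure v s)
 thus ?case by(rule assms(5))
next
 case (add x y)
 thus ?case using lin_add[OF assms(3)] lin_add[OF assms(4)] by simp
qed

lemma
 assumes V: "cspace V" and R: "cspace R" and W: "cspace W" and S: "cspace S"
  and A: "A : lin_maps V W" and B: "B : lin_maps R S"
 shows tensor_map_lin: "tensor_map W S A B : lin_maps (tensor V R) (tensor W S)"
  and tensor_map_ptensor: "v :. V ==> r :. R ==>
   tensor_map W S A B (ptensor V R v r) = ptensor W S (A v) (B r)"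
proof -
 interpret V: module CC V by fact
 interpret R: module CC R by fact
 let ?F = "free_vs (carrier V \<times> carrier R)" and ?F' = "free_vs (carrier W \<times> carrier S)"
 let ?p = "push_forward (map_prod A B)"
 note N = tensor_null_submodule[OF V R] and N' = tensor_null_submodule[OF W S]
 have p: "?p : lin_maps ?F ?F'" by(rule push_forward_lin) (use A B in \<open>auto simp: lin_closed\<close>)
 have pm: "?p (%u. f u - g u) = (%u. ?p f u - ?p g u)" if "f :. ?F" "g :. ?F" for f g
  using lin_minus[OF cspace_free_vs cspace_free_vs p that]
   lin_closed[OF p that(1)] lin_closed[OF p that(2)] that by(simp add: free_vs_minus)
 have ps: "?p (%u. c * f u) = (%u. c * ?p f u)" if "f :. ?F" for f c using lin_smult[OF p that, of c] by simp
 have rels: "?p f : tensor_rels W S" if "f : tensor_rels V R" for f using that unfolding tensor_rels_def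
 proof (elim UnE CollectE exE conjE, goal_cases)
  case (1 v v' s)
  have "?p f = (%u. delta (A v \<oplus>\<^sub>W A v', B s) u - delta (A v, B s) u - delta (A v', B s) u)"
   using 1 A by(simp add: pm lin_add)
  thus ?case using 1 A B by(blast intro: lin_closed)
 next
  case (2 v s s')
  have "?p f = (%u. delta (A v, B s \<oplus>\<^sub>S B s') u - delta (A v, B s) u - delta (A v, B s') u)"
   using 2 B by(simp add: pm lin_add)
  thus ?case using 2 A B by(blast intro: lin_closed)
 next
  case (3 c v s)
  have "?p f = (%u. delta (c \<odot>\<^sub>W A v, B s) u - c * delta (A v, B s) u)"
   using 3 A V.smult_closed by(simp add: pm ps lin_smult)
  thus ?case using 3 A B by(blast intro: lin_closed)
 next
  case (4 c v s)
  have "?p f = (%u. delta (A v, c \<odot>\<^sub>S B s) u - c * delta (A v, B s) u)"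
   using 4 B R.smult_closed by(simp add: pm ps lin_smult)
  thus ?case using 4 A B by(blast intro: lin_closed)
 qed
 have "tensor_null V R <= {f \<in> carrier ?F. ?p f : tensor_null W S}" unfolding tensor_null_def[of V R]
  by(rule lin_span_least[OF lin_vimage_submodule[OF cspace_free_vs cspace_free_vs p N'(1)]])
   (use rels N'(2) tensor_rels_closed[OF V R] in blast)
 hence null: "?p ` tensor_null V R <= tensor_null W S" by blast
 show "tensor_map W S A B : lin_maps (tensor V R) (tensor W S)" unfolding tensor_map_def tensor_def
  by(rule coset_map_lin[OF cspace_free_vs N(1) cspace_free_vs N'(1) p null])
 show "tensor_map W S A B (ptensor V R v r) = ptensor W S (A v) (B r)" if "v :. V" "r :. R"
  unfolding tensor_map_def ptensor_def
  by(subst coset_map_coset[OF cspace_free_vs N(1) cspace_free_vs N'(1) p null]) (use that in auto)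
qed

lemma tensor_map_comp:
 assumes "cspace V" "cspace R" "cspace W" "cspace Q" "cspace U" "cspace S"
  "A : lin_maps V W" "B : lin_maps R Q" "A' : lin_maps W U" "B' : lin_maps Q S" "x :. tensor V R"
 shows "tensor_map U S A' B' (tensor_map W Q A B x) = tensor_map U S (%v. A' (A v)) (%r. B' (B r)) x"
proof (rule tensor_lin_eqI[where x = x])
 show "(%x. tensor_map U S A' B' (tensor_map W Q A B x)) : lin_maps (tensor V R) (tensor U S)"
  using assms by(blast intro: lin_comp tensor_map_lin)
 show "tensor_map U S (%v. A' (A v)) (%r. B' (B r)) : lin_maps (tensor V R) (tensor U S)"
  using assms by(blast intro: lin_comp tensor_map_lin)
 show "tensor_map U S A' B' (tensor_map W Q A B (ptensor V R v s)) =
   tensor_map U S (%v. A' (A v)) (%r. B' (B r)) (ptensor V R v s)" if "v :. V" "s :. R" for v s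
  using assms that lin_comp[OF assms(7,9)] lin_comp[OF assms(8,10)]
  by(simp add: tensor_map_ptensor lin_closed)
qed (use assms in auto)

lemma tensor_map_cong:
 assumes "cspace V" "cspace R" "cspace W" "cspace S" "A : lin_maps V W" "B : lin_maps R S"
  and "!!v. v :. V ==> A v = A' v" "!!r. r :. R ==> B r = B' r" and "x :. tensor V R"
 shows "tensor_map W S A B x = tensor_map W S A' B' x"
proof -
 have A': "A' : lin_maps V W" by(rule lin_cong[OF assms(1,5,7)])
 have B': "B' : lin_maps R S" by(rule lin_cong[OF assms(2,6,8)])
 show ?thesis by(rule tensor_lin_eqI[OF assms(1,2) tensor_map_lin tensor_map_lin _ assms(9)])
   (use assms A' B' in \<open>auto simp: tensor_map_ptensor\<close>)
qed

lemma tensor_map_id: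
 assumes "cspace V" "cspace S" "!!v. v :. V ==> A v = v" "!!s. s :. S ==> B s = s" and "x :. tensor V S"
 shows "tensor_map V S A B x = x"
proof -
 have A: "A : lin_maps V V" by(rule lin_cong[OF assms(1) lin_id]) (simp add: assms)
 have B: "B : lin_maps S S" by(rule lin_cong[OF assms(2) lin_id]) (simp add: assms)
 show ?thesis by(rule tensor_lin_eqI[OF assms(1,2) tensor_map_lin lin_id _ assms(5)])
   (use assms A B in \<open>auto simp: tensor_map_ptensor\<close>)
qed

section \<open>Algebras\<close>

locale calg = ring A for A :: "(complex, 'a, 'z) module_scheme" (structure) +
 assumes cspace: "cspace A" and smult_mult_left: "x :. A ==> y :. A ==> (c \<odot> x) \<otimes> y = c \<odot> (x \<otimes> y)"
  and smult_mult_right: "x :. A ==> y :. A ==> x \<otimes> (c \<odot> y) = c \<odot> (x \<otimes> y)"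

lemma calgI:
 assumes "cspace A" "\<one>\<^sub>A :. A" and "!!x y. x :. A ==> y :. A ==> x \<otimes>\<^sub>A y :. A"
  and "!!x y z. x :. A ==> y :. A ==> z :. A ==> (x \<otimes>\<^sub>A y) \<otimes>\<^sub>A z = x \<otimes>\<^sub>A (y \<otimes>\<^sub>A z)"
  and "!!x. x :. A ==> \<one>\<^sub>A \<otimes>\<^sub>A x = x" "!!x. x :. A ==> x \<otimes>\<^sub>A \<one>\<^sub>A = x"
  and "!!y. y :. A ==> (%x. x \<otimes>\<^sub>A y) : lin_maps A A" and "!!x. x :. A ==> (%y. x \<otimes>\<^sub>A y) : lin_maps A A"
 shows "calg A"
proof -
 interpret A: module CC A by fact
 show ?thesis
 proof (rule calg.intro)
  show "ring A" by(rule ringI[OF A.M.abelian_group_axioms monoidI])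
    (use assms lin_add[OF assms(7)] lin_add[OF assms(8)] in auto)
  show "calg_axioms A" by unfold_locales (use assms(1) lin_smult[OF assms(7)] lin_smult[OF assms(8)] in auto)
 qed
qed

lemma (in calg) lin_mult: "y :. A ==> (%x. x \<otimes> y) : lin_maps A A" "x :. A ==> (%y. x \<otimes> y) : lin_maps A A"
 by(auto intro!: lin_mapsI simp: smult_mult_left smult_mult_right l_distr r_distr)

lemma (in calg) smult_closed' [simp, intro]: "x :. A ==> c \<odot> x :. A"
 using module.smult_closed[OF cspace, of c] by simp

lemma (in calg) ideal_submodule:
 assumes "ideal I A"
 shows "submodule I CC A"
proof -
 interpret I: ideal I A by fact
 show ?thesis
 proof (rule csubmoduleI[OF cspace])
  show "I <= carrier A" by(rule I.a_subset)
  fix c x assume x: "x : I"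
  hence xc: "x :. A" using I.a_subset by blast
  have "(c \<odot> \<one>) \<otimes> x : I" using x by(intro I.I_l_closed) auto
  thus "c \<odot> x : I" using xc by(simp add: smult_mult_left)
 qed auto
qed

subsection \<open>Monoid algebras\<close>

lemma monoid_alg_simps [simp]: "carrier (monoid_alg G) = carrier (free_vs (carrier G))"
 "ring.add (monoid_alg G) = (%f g x. f x + g x)" "\<zero>\<^sub>(monoid_alg G) = (%x. 0)"
 "c \<odot>\<^sub>(monoid_alg G) f = (%x. c * f x)" "\<one>\<^sub>(monoid_alg G) = delta \<one>\<^sub>G"
 by(simp_all add: monoid_alg_def free_vs_def)

lemma lin_monoid_alg [simp]: "lin_maps (monoid_alg G) V = lin_maps (free_vs (carrier G)) V"
 "lin_maps V (monoid_alg G) = lin_maps V (free_vs (carrier G))" by(simp_all add: lin_maps_def)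

lemma monoid_alg_mult_superset:
 assumes "finite C" "finite D" "{x. f x ~= 0} <= C" "{y. g y ~= 0} <= D"
 shows "(f \<otimes>\<^sub>(monoid_alg G) g) z = (\<Sum>x\<in>C. \<Sum>y\<in>D. if x \<otimes>\<^sub>G y = z then f x * g y else 0)"
proof -
 have "(f \<otimes>\<^sub>(monoid_alg G) g) z = (\<Sum>x | f x ~= 0. \<Sum>y | g y ~= 0. if x \<otimes>\<^sub>G y = z then f x * g y else 0)"
  by(simp add: monoid_alg_def)
 also have "... = (\<Sum>x | f x ~= 0. \<Sum>y\<in>D. if x \<otimes>\<^sub>G y = z then f x * g y else 0)"
  using assms by(intro sum.cong refl sum.mono_neutral_left) auto
 also have "... = (\<Sum>x\<in>C. \<Sum>y\<in>D. if x \<otimes>\<^sub>G y = z then f x * g y else 0)"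
  using assms by(intro sum.mono_neutral_left ballI sum.neutral) auto
 finally show ?thesis .
qed

lemma monoid_alg_mult_delta: "delta x \<otimes>\<^sub>(monoid_alg G) delta y = delta (x \<otimes>\<^sub>G y)"
 by(rule ext, subst monoid_alg_mult_superset[of "{x}" "{y}"]) (auto simp: delta_def)

lemma monoid_alg_mult_closed:
 assumes "monoid G" "f :. free_vs (carrier G)" "g :. free_vs (carrier G)"
 shows "f \<otimes>\<^sub>(monoid_alg G) g :. free_vs (carrier G)"
proof -
 interpret G: monoid G by fact
 note f = free_vs_support[OF assms(2)] and g = free_vs_support[OF assms(3)]
 let ?C = "(\<lambda>(x, y). x \<otimes>\<^sub>G y) ` ({x. f x ~= 0} \<times> {y. g y ~= 0})"
 have "{z. (f \<otimes>\<^sub>(monoid_alg G) g) z ~= 0} <= ?C"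
 proof
  fix z assume "z : {z. (f \<otimes>\<^sub>(monoid_alg G) g) z ~= 0}"
  hence "(\<Sum>x | f x ~= 0. \<Sum>y | g y ~= 0. if x \<otimes>\<^sub>G y = z then f x * g y else 0) ~= 0"
   by(simp add: monoid_alg_def)
  then obtain x where x: "f x ~= 0" "(\<Sum>y | g y ~= 0. if x \<otimes>\<^sub>G y = z then f x * g y else 0) ~= 0"
   by(rule sum.not_neutral_contains_not_neutral) simp
  from x(2) obtain y where "g y ~= 0" "x \<otimes>\<^sub>G y = z"
   by(rule sum.not_neutral_contains_not_neutral) (simp split: if_splits)
  with x(1) show "z : ?C" by(auto intro!: image_eqI[of _ _ "(x, y)"])
 qed
 moreover have "finite ?C" using f g by auto
 moreover have "?C <= carrier G" using f(3) g(3) by auto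
 ultimately show ?thesis by(auto simp: free_vs_carrier intro: finite_subset)
qed

lemma monoid_alg_mult_lin:
 assumes "monoid G"
 shows "g :. free_vs (carrier G) ==>
   (%f. f \<otimes>\<^sub>(monoid_alg G) g) : lin_maps (free_vs (carrier G)) (free_vs (carrier G))"
  and "f :. free_vs (carrier G) ==>
   (%g. f \<otimes>\<^sub>(monoid_alg G) g) : lin_maps (free_vs (carrier G)) (free_vs (carrier G))"
proof -
 let ?F = "free_vs (carrier G)"
 show "(%f. f \<otimes>\<^sub>(monoid_alg G) g) : lin_maps ?F ?F" if g: "g :. ?F" for g
 proof (rule lin_mapsI)
  fix f assume f: "f :. ?F"
  note s = free_vs_support[OF g] free_vs_support[OF f]
  show "(c \<odot>\<^sub>?F f) \<otimes>\<^sub>(monoid_alg G) g = c \<odot>\<^sub>?F (f \<otimes>\<^sub>(monoid_alg G) g)" for c unfolding free_vs_simps using s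
   by(intro ext, subst (1 2) monoid_alg_mult_superset[of "{x. f x ~= 0}" "{x. g x ~= 0}"])
    (auto simp: sum_distrib_left intro!: sum.cong)
  fix h assume h: "h :. ?F"
  note s = s free_vs_support[OF h]
  show "(f \<oplus>\<^sub>?F h) \<otimes>\<^sub>(monoid_alg G) g = f \<otimes>\<^sub>(monoid_alg G) g \<oplus>\<^sub>?F h \<otimes>\<^sub>(monoid_alg G) g"
   unfolding free_vs_simps using s
   by(intro ext, subst (1 2 3) monoid_alg_mult_superset[of "{x. f x ~= 0} \<union> {x. h x ~= 0}" "{x. g x ~= 0}"])
    (auto simp: sum.distrib[symmetric] algebra_simps intro!: sum.cong)
 qed (use monoid_alg_mult_closed[OF assms _ g] in auto)
 show "(%g. f \<otimes>\<^sub>(monoid_alg G) g) : lin_maps ?F ?F" if f: "f :. ?F" for f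
 proof (rule lin_mapsI)
  fix g assume g: "g :. ?F"
  note s = free_vs_support[OF g] free_vs_support[OF f]
  show "f \<otimes>\<^sub>(monoid_alg G) (c \<odot>\<^sub>?F g) = c \<odot>\<^sub>?F (f \<otimes>\<^sub>(monoid_alg G) g)" for c unfolding free_vs_simps using s
   by(intro ext, subst (1 2) monoid_alg_mult_superset[of "{x. f x ~= 0}" "{x. g x ~= 0}"])
    (auto simp: sum_distrib_left intro!: sum.cong)
  fix h assume h: "h :. ?F"
  note s = s free_vs_support[OF h]
  show "f \<otimes>\<^sub>(monoid_alg G) (g \<oplus>\<^sub>?F h) = f \<otimes>\<^sub>(monoid_alg G) g \<oplus>\<^sub>?F f \<otimes>\<^sub>(monoid_alg G) h"
   unfolding free_vs_simps using s
   by(intro ext, subst (1 2 3) monoid_alg_mult_superset[of "{x. f x ~= 0}" "{x. g x ~= 0} \<union> {x. h x ~= 0}"])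
    (auto simp: sum.distrib[symmetric] algebra_simps intro!: sum.cong)
 qed (use monoid_alg_mult_closed[OF assms f] in auto)
qed

lemma monoid_alg_calg:
 assumes "monoid G"
 shows "calg (monoid_alg G)"
proof -
 interpret G: monoid G by fact
 let ?F = "free_vs (carrier G)" and ?A = "monoid_alg G"
 note l = monoid_alg_mult_lin[OF assms] and cl = monoid_alg_mult_closed[OF assms]
 note eqI = free_vs_lin_eqI[OF cspace_free_vs, of _ "carrier G" "carrier G"]
 have assoc1: "(delta a \<otimes>\<^sub>?A delta b) \<otimes>\<^sub>?A h = delta a \<otimes>\<^sub>?A (delta b \<otimes>\<^sub>?A h)"
  if "a :. G" "b :. G" "h :. ?F" for a b h by(rule eqI[OF l(2) lin_comp[OF l(2) l(2)]])
   (use that in \<open>auto simp: monoid_alg_mult_delta G.m_assoc cl\<close>)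
 have assoc2: "(delta a \<otimes>\<^sub>?A g) \<otimes>\<^sub>?A h = delta a \<otimes>\<^sub>?A (g \<otimes>\<^sub>?A h)" if "a :. G" "g :. ?F" "h :. ?F" for a g h
  by(rule eqI[OF lin_comp[OF l(2) l(1)] lin_comp[OF l(1) l(2)], where x = g]) (use that assoc1 in auto)
 have assoc: "(f \<otimes>\<^sub>?A g) \<otimes>\<^sub>?A h = f \<otimes>\<^sub>?A (g \<otimes>\<^sub>?A h)" if "f :. ?F" "g :. ?F" "h :. ?F" for f g h
  by(rule eqI[OF lin_comp[OF l(1) l(1)] l(1), where x = f]) (use that assoc2 cl in auto)
 have one_l: "delta \<one>\<^sub>G \<otimes>\<^sub>?A f = f" if "f :. ?F" for f
  by(rule eqI[OF l(2) lin_id, where x = f]) (use that in \<open>auto simp: monoid_alg_mult_delta\<close>)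
 have one_r: "f \<otimes>\<^sub>?A delta \<one>\<^sub>G = f" if "f :. ?F" for f
  by(rule eqI[OF l(1) lin_id, where x = f]) (use that in \<open>auto simp: monoid_alg_mult_delta\<close>)
 have "cspace ?A" by(rule cspaceI) (auto simp: algebra_simps)
 thus ?thesis by(rule calgI) (use assoc one_l one_r cl l in auto)
qed

lemma monoid_alg_minus:
 assumes "monoid G" "f :. free_vs (carrier G)" "g :. free_vs (carrier G)"
 shows "f \<ominus>\<^sub>(monoid_alg G) g = (%x. f x - g x)"
proof -
 interpret calg "monoid_alg G" by(rule monoid_alg_calg) fact
 show ?thesis using assms by(simp add: a_minus_def smult_minus_one[OF cspace, symmetric])
qed

subsection \<open>Quotient algebras\<close>

lemma
 assumes "calg A" and R: "R <= carrier A \<times> carrier A"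
 shows rel_ideal_ideal: "ideal (rel_ideal A R) A" and rel_ideal_submodule: "submodule (rel_ideal A R) CC A"
  and rel_ideal_rel: "(f, g) : R ==> f \<ominus>\<^sub>A g : rel_ideal A R"
proof -
 interpret A: calg A by fact
 have *: "{f \<ominus>\<^sub>A g | f g. (f, g) : R} <= carrier A" using R by auto
 show "ideal (rel_ideal A R) A" unfolding rel_ideal_def by(rule A.genideal_ideal[OF *])
 thus "submodule (rel_ideal A R) CC A" by(rule A.ideal_submodule)
 show "(f, g) : R ==> f \<ominus>\<^sub>A g : rel_ideal A R" unfolding rel_ideal_def using A.genideal_self[OF *] by blast
qed

lemma rel_ideal_minimal:
 assumes "calg A" "ideal I A" "!!f g. (f, g) : R ==> f \<ominus>\<^sub>A g : I"
 shows "rel_ideal A R <= I"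
proof -
 interpret A: calg A by fact
 show ?thesis unfolding rel_ideal_def by(rule A.genideal_minimal) (use assms in auto)
qed

lemma
 assumes A: "calg A" and R: "R <= carrier A \<times> carrier A"
 shows alg_quot_carrier: "carrier (alg_quot A R) = alg_class A R ` carrier A"
  and alg_class_lin: "alg_class A R : lin_maps A (alg_quot A R)" and alg_class_mult: "x :. A ==> y :. A ==>
   alg_class A R x \<otimes>\<^sub>(alg_quot A R) alg_class A R y = alg_class A R (x \<otimes>\<^sub>A y)"
  and alg_class_one: "\<one>\<^sub>(alg_quot A R) = alg_class A R \<one>\<^sub>A"
  and alg_class_rel: "(f, g) : R ==> alg_class A R f = alg_class A R g"
  and alg_class_eq_iff: "x :. A ==> y :. A ==> alg_class A R x = alg_class A R y \<longleftrightarrow> x \<ominus>\<^sub>A y : rel_ideal A R"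
  and alg_quot_calg: "calg (alg_quot A R)"
proof -
 interpret A: calg A by fact
 note I = rel_ideal_ideal[OF A R] and N = rel_ideal_submodule[OF A R]
 interpret I: ideal "rel_ideal A R" A by(rule I)
 let ?q = "alg_class A R" and ?Q = "alg_quot A R"
 show car: "carrier ?Q = ?q ` carrier A" by(auto simp: alg_quot_def alg_class_def quot_mod_carrier)
 show lin: "?q : lin_maps A ?Q"
  using coset_lin[OF A.cspace N] by(simp add: alg_quot_def alg_class_def[abs_def])
 show mult: "?q x \<otimes>\<^sub>?Q ?q y = ?q (x \<otimes>\<^sub>A y)" if "x :. A" "y :. A" for x y
  using I.rcoset_mult_add[OF that] by(simp add: alg_quot_def alg_class_def quot_mod_simps)
 show one: "\<one>\<^sub>?Q = ?q \<one>\<^sub>A" by(simp add: alg_quot_def alg_class_def quot_mod_simps)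
 show "?q f = ?q g" if "(f, g) : R"
  using that R rel_ideal_rel[OF A R that] coset_eq_iff[OF A.cspace N, of f g] by(auto simp: alg_class_def)
 show "?q x = ?q y \<longleftrightarrow> x \<ominus>\<^sub>A y : rel_ideal A R" if "x :. A" "y :. A"
  using coset_eq_iff[OF A.cspace N that] by(simp add: alg_class_def)
 have add: "?q x \<oplus>\<^sub>?Q ?q y = ?q (x \<oplus>\<^sub>A y)" if "x :. A" "y :. A" for x y using lin_add[OF lin that] by simp
 have smult: "c \<odot>\<^sub>?Q ?q x = ?q (c \<odot>\<^sub>A x)" if "x :. A" for c x using lin_smult[OF lin that] by simp
 have "cspace ?Q" unfolding alg_quot_def by(rule cspace_quot_mod[OF A.cspace N])
 thus "calg ?Q" by(rule calgI)
   (auto simp: car mult one add smult A.m_assoc A.smult_mult_left A.smult_mult_right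
    A.l_distr A.r_distr intro!: lin_mapsI)
qed

subsection \<open>Modules over algebras\<close>

lemma with_act_simps [simp]: "carrier (with_act V \<alpha>) = carrier V" "ring.add (with_act V \<alpha>) = ring.add V"
 "\<zero>\<^sub>(with_act V \<alpha>) = \<zero>\<^sub>V" "module.smult (with_act V \<alpha>) = module.smult V" "act (with_act V \<alpha>) = \<alpha>"
 by(simp_all add: with_act_def)

lemma lin_with_act [simp]:
 "lin_maps (with_act V \<alpha>) W = lin_maps V W" "lin_maps V (with_act W \<beta>) = lin_maps V W"
 by(simp_all add: lin_maps_def)

lemma cspace_with_act [simp]: "cspace (with_act V \<alpha>) \<longleftrightarrow> cspace V"
proof
 assume "cspace V"
 then interpret V: module CC V .
 show "cspace (with_act V \<alpha>)" by(rule cspaceI)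
   (use V.smult_closed V.smult_l_distr V.smult_r_distr V.smult_assoc1 V.smult_one V.smult_l_null in
    \<open>auto simp: V.a_ac\<close>)
next
 assume "cspace (with_act V \<alpha>)"
 then interpret V: module CC "with_act V \<alpha>" .
 show "cspace V" by(rule cspaceI)
   (use V.smult_closed V.smult_l_distr V.smult_r_distr V.smult_assoc1 V.smult_one V.smult_l_null
     V.M.a_closed V.M.zero_closed V.M.a_assoc V.M.a_comm V.M.l_zero in auto)
qed

lemma
 assumes "alg_module A V"
 shows module_cspace: "cspace V" and act_lin: "a :. A ==> act V a : lin_maps V V"
  and act_add: "v :. V ==> a :. A ==> b :. A ==> act V (a \<oplus>\<^sub>A b) v = act V a v \<oplus>\<^sub>V act V b v"
  and act_smult: "v :. V ==> a :. A ==> act V (c \<odot>\<^sub>A a) v = c \<odot>\<^sub>V act V a v"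
  and act_mult: "v :. V ==> a :. A ==> b :. A ==> act V (a \<otimes>\<^sub>A b) v = act V a (act V b v)"
  and act_one: "v :. V ==> act V \<one>\<^sub>A v = v" and act_closed: "a :. A ==> v :. V ==> act V a v :. V"
  and act_lin_alg: "v :. V ==> (%a. act V a v) : lin_maps A V"
proof -
 note M = assms[unfolded alg_module_def]
 show "cspace V" using M by blast
 show lin: "act V a : lin_maps V V" if "a :. A" for a using M that by blast
 show add: "act V (a \<oplus>\<^sub>A b) v = act V a v \<oplus>\<^sub>V act V b v"
  if "v :. V" "a :. A" "b :. A" for v a b using M that by blast
 show smult: "act V (c \<odot>\<^sub>A a) v = c \<odot>\<^sub>V act V a v" if "v :. V" "a :. A" for v a c using M that by blast
 show "act V (a \<otimes>\<^sub>A b) v = act V a (act V b v)" if "v :. V" "a :. A" "b :. A" using M that by blast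
 show "act V \<one>\<^sub>A v = v" if "v :. V" using M that by blast
 show closed: "act V a v :. V" if "a :. A" "v :. V" for a v by(rule lin_closed[OF lin]) fact+
 show "(%a. act V a v) : lin_maps A V" if "v :. V" by(rule lin_mapsI) (use that closed add smult in auto)
qed

text \<open>A representation of a monoid whose linear extension respects the relations makes the space a
  module over the quotient of the monoid algebra.\<close>

lemma
 fixes G :: "('b, 'z) monoid_scheme"
 assumes G: "monoid G" and V: "cspace V" and R: "R <= carrier (monoid_alg G) \<times> carrier (monoid_alg G)"
  and lin: "!!x. x :. G ==> \<beta> x : lin_maps V V" and one: "!!v. v :. V ==> \<beta> \<one>\<^sub>G v = v"
  and mult: "!!x y v. x :. G ==> y :. G ==> v :. V ==> \<beta> (x \<otimes>\<^sub>G y) v = \<beta> x (\<beta> y v)"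
  and rel: "!!f g v. (f, g) : R ==> v :. V ==> lin_ext V \<beta> f v = lin_ext V \<beta> g v"
 shows quot_act_class: "f :. monoid_alg G ==> v :. V ==>
   quot_act V \<beta> (alg_class (monoid_alg G) R f) v = lin_ext V \<beta> f v"
  and alg_module_quot_act: "alg_module (alg_quot (monoid_alg G) R) (with_act V (quot_act V \<beta>))"
proof -
 let ?W = "with_act V (quot_act V \<beta>)"
 interpret G: monoid G by fact
 interpret V: module CC V by fact
 let ?A = "monoid_alg G"
 interpret A: calg ?A by(rule monoid_alg_calg[OF G])
 note Ac = monoid_alg_calg[OF G]
 have el: "(%f. lin_ext V \<beta> f v) : lin_maps ?A V" if "v :. V" for v
  using lin_ext_lin[OF V, of "carrier G" \<beta> v] lin_closed[OF lin that] by simp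
 have ev: "lin_ext V \<beta> f : lin_maps V V" if "f :. ?A" for f
  by(rule lin_ext_lin_vector[OF V lin _ V]) (use that in auto)
 have ed: "lin_ext V \<beta> (delta x) v = \<beta> x v" if "x :. G" "v :. V" for x v
  by(rule lin_ext_delta[OF V]) (rule lin_closed[OF lin[OF that(1)] that(2)])
 note eqI = free_vs_lin_eqI[OF V, of _ "carrier G"]
 have em1: "lin_ext V \<beta> (delta x \<otimes>\<^sub>?A g) v = \<beta> x (lin_ext V \<beta> g v)" if "x :. G" "g :. ?A" "v :. V" for x g v
  by(rule eqI[where x = g])
   (use that in \<open>auto simp: monoid_alg_mult_delta ed mult lin_closed[OF lin] lin_closed[OF el]
    intro: lin_comp[OF A.lin_mult(2)[simplified] el[simplified]] lin_comp[OF el[simplified] lin]\<close>)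
 have em: "lin_ext V \<beta> (f \<otimes>\<^sub>?A g) v = lin_ext V \<beta> f (lin_ext V \<beta> g v)"
  if "f :. ?A" "g :. ?A" "v :. V" for f g v by(rule eqI[where x = f])
   (use that in \<open>auto simp: em1[simplified] ed lin_closed[OF ev[simplified]]
    intro: lin_comp[OF A.lin_mult(1)[simplified] el[simplified]] el[simplified]\<close>)
 let ?I = "{f \<in> carrier ?A. \<forall>v\<in>carrier V. lin_ext V \<beta> f v = \<zero>\<^sub>V}"
 have eminus: "lin_ext V \<beta> (f \<ominus>\<^sub>?A g) v = lin_ext V \<beta> f v \<ominus>\<^sub>V lin_ext V \<beta> g v"
  if "f :. ?A" "g :. ?A" "v :. V" for f g v by(rule lin_minus[OF A.cspace V el]) (use that in auto)
 have eadd: "lin_ext V \<beta> (f \<oplus>\<^sub>?A g) v = lin_ext V \<beta> f v \<oplus>\<^sub>V lin_ext V \<beta> g v"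
  if "f :. ?A" "g :. ?A" "v :. V" for f g v by(rule lin_add[OF el]) (use that in auto)
 have sub: "submodule ?I CC ?A" using A.cspace by(rule csubmoduleI)
   (use lin_zero[OF A.cspace V el] lin_smult[OF el] V.smult_r_null eadd in \<open>auto\<close>)
 have "ideal ?I ?A"
 proof (rule idealI[OF A.ring_axioms])
  show "subgroup ?I (add_monoid ?A)" by(rule submodule.axioms(1)[OF sub])
  show "x \<otimes>\<^sub>?A a : ?I" if "a : ?I" "x :. ?A" for a x using that em lin_zero[OF V V ev] A.m_closed by simp
  show "a \<otimes>\<^sub>?A x : ?I" if "a : ?I" "x :. ?A" for a x using that em lin_closed[OF ev] A.m_closed by simp
 qed
 hence I: "rel_ideal ?A R <= ?I"
 proof (rule rel_ideal_minimal[OF Ac])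
  fix f g assume fg: "(f, g) : R"
  hence c: "f :. ?A" "g :. ?A" using R by auto
  show "f \<ominus>\<^sub>?A g : ?I"
  proof (intro CollectI conjI ballI)
   show "f \<ominus>\<^sub>?A g :. ?A" using c by(rule A.minus_closed)
   show "lin_ext V \<beta> (f \<ominus>\<^sub>?A g) v = \<zero>\<^sub>V" if v: "v :. V" for v
    using eminus[OF c v] rel[OF fg v] lin_closed[OF ev v] c V.r_neg by(simp add: a_minus_def)
  qed
 qed
 have cls: "quot_act V \<beta> (alg_class ?A R f) v = lin_ext V \<beta> f v" if f: "f :. ?A" and v: "v :. V" for f v
 proof -
  let ?g = "SOME g. g : alg_class ?A R f"
  note N = rel_ideal_submodule[OF Ac R]
  have "?g : alg_class ?A R f"
   using someI[of "%g. g : alg_class ?A R f" f] coset_self[OF A.cspace N f] by(simp add: alg_class_def)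
  note g = coset_memD[OF A.cspace N f this[unfolded alg_class_def]]
  have "?g \<ominus>\<^sub>?A f : rel_ideal ?A R" using coset_eq_iff[OF A.cspace N g(1) f] g(2) by(simp add: alg_class_def)
  hence "lin_ext V \<beta> (?g \<ominus>\<^sub>?A f) v = \<zero>\<^sub>V" using I v by blast
  hence "lin_ext V \<beta> ?g v \<ominus>\<^sub>V lin_ext V \<beta> f v = \<zero>\<^sub>V" using eminus[of ?g f v] g f v by(simp add: alg_class_def)
  thus ?thesis unfolding quot_act_def
   using cspace_eq_iff_minus[OF V lin_closed[OF ev v] lin_closed[OF ev v]] g f by(simp add: alg_class_def)
 qed
 thus "f :. ?A ==> v :. V ==> quot_act V \<beta> (alg_class ?A R f) v = lin_ext V \<beta> f v" .
 note q = alg_quot_carrier[OF Ac R] alg_class_mult[OF Ac R] alg_class_one[OF Ac R]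
  lin_add[OF alg_class_lin[OF Ac R], symmetric] lin_smult[OF alg_class_lin[OF Ac R], symmetric]
 show "alg_module (alg_quot ?A R) ?W" unfolding alg_module_def
 proof (intro conjI ballI allI)
  show "act ?W a : lin_maps ?W ?W" if a: "a :. alg_quot ?A R" for a
  proof -
   obtain f where f: "f :. ?A" "a = alg_class ?A R f" using a q(1) by auto
   show ?thesis using lin_cong[OF V ev[OF f(1)]] cls[OF f(1)] f(2) by simp
  qed
 next
  fix v a b c
  assume v: "v : carrier ?W" and a: "a :. alg_quot ?A R"
  obtain f where f: "f :. ?A" "a = alg_class ?A R f" using a q(1) by auto
  show "act ?W (c \<odot>\<^sub>(alg_quot ?A R) a) v = c \<odot>\<^sub>?W act ?W a v"
   using f v q(5) cls A.smult_closed'[OF f(1)] lin_smult[OF el] by simp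
  assume b: "b :. alg_quot ?A R"
  obtain g where g: "g :. ?A" "b = alg_class ?A R g" using b q(1) by auto
  show "act ?W (a \<oplus>\<^sub>(alg_quot ?A R) b) v = act ?W a v \<oplus>\<^sub>?W act ?W b v"
   using f g v q(4) cls A.a_closed[OF f(1) g(1)] eadd by simp
  show "act ?W (a \<otimes>\<^sub>(alg_quot ?A R) b) v = act ?W a (act ?W b v)"
   using f g v q(2) cls A.m_closed[OF f(1) g(1)] em lin_closed[OF ev[OF g(1)]] by simp
 next
  fix v assume "v : carrier ?W"
  thus "act ?W \<one>\<^sub>(alg_quot ?A R) v = v" using q(3) cls[OF A.one_closed] ed one by simp
 qed (use V in auto)
qed

lemma quot_act_intertwine:
 assumes G: "monoid G" and R: "R <= carrier (monoid_alg G) \<times> carrier (monoid_alg G)"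
  and V: "cspace V" and W: "cspace W" and f: "f : lin_maps V W" and "!!b. b :. G ==> \<beta> b v :. V"
  and "!!b. b :. G ==> f (\<beta> b v) = \<gamma> b (f v)" and U: "U :. alg_quot (monoid_alg G) R"
 shows "f (quot_act V \<beta> U v) = quot_act W \<gamma> U (f v)"
proof -
 interpret V: module CC V by fact
 interpret W: module CC W by fact
 note Ac = monoid_alg_calg[OF G]
 note N = rel_ideal_submodule[OF Ac R]
 obtain u where u: "u :. monoid_alg G" "U = alg_class (monoid_alg G) R u"
  using U alg_quot_carrier[OF Ac R] by auto
 let ?g = "SOME g. g : U"
 have "?g : U"
  using someI[of "%g. g : U" u] coset_self[OF calg.cspace[OF Ac] N u(1)] u(2) by(simp add: alg_class_def)
 hence g: "?g :. free_vs (carrier G)"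
  using coset_memD(1)[OF calg.cspace[OF Ac] N u(1)] u(2) by(simp add: alg_class_def)
 note s = free_vs_support[OF g]
 have "f (lin_ext V \<beta> ?g v) = (\<Oplus>\<^sub>W b\<in>{b. ?g b ~= 0}. f (?g b \<odot>\<^sub>V \<beta> b v))" unfolding lin_ext_def
  by(rule lin_finsum[OF V W f s(1)]) (use s(3) assms(6) V.smult_closed in auto)
 also have "... = lin_ext W \<gamma> ?g (f v)" unfolding lin_ext_def
  using s(3) assms(6,7) lin_closed[OF f] W.smult_closed
  by(intro W.M.finsum_cong') (auto simp: lin_smult[OF f] simp flip: assms(7))
 finally show ?thesis by(simp add: quot_act_def)
qed

section \<open>Dirac cohomology as a functor\<close>

definition dirac_coh where "dirac_coh T D = quot_mod (T\<lparr>carrier := dirac_ker T D\<rparr>) (dirac_im_ker T D)"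

definition coh_map where "coh_map T D f = coset_map T (dirac_im_ker T D) f"

definition dirac_maps where "dirac_maps T D T' D' = {f \<in> lin_maps T T'. f ` dirac_ker T D <= dirac_ker T' D' &
   f ` dirac_im_ker T D <= dirac_im_ker T' D'}"

lemma dirac_mapsI:
 assumes "cspace T" "cspace T'" "f : lin_maps T T'" "f' : lin_maps T T'"
  and "!!x. x :. T ==> D' (f x) = f' (D x)" and "!!x. x :. T ==> f'' x :. T'"
  and "!!x. x :. T ==> f (D x) = D' (f'' x)"
 shows "f : dirac_maps T D T' D'" unfolding dirac_maps_def
proof (intro CollectI conjI subsetI)
 have ker: "f x : dirac_ker T' D'" if "x : dirac_ker T D" for x
  using that assms(5)[of x] lin_zero[OF assms(1,2,4)] lin_closed[OF assms(3)] by(auto simp: dirac_ker_def)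
 show "f : lin_maps T T'" by fact
 show "x : dirac_ker T' D'" if "x : f ` dirac_ker T D" for x using that ker by auto
 show "x : dirac_im_ker T' D'" if "x : f ` dirac_im_ker T D" for x
  using that ker assms(6,7) by(fastforce simp: dirac_im_ker_def)
qed

lemma dirac_maps_lin: "f : dirac_maps T D T' D' ==> f : lin_maps T T'" by(simp add: dirac_maps_def)

lemma dirac_maps_ker: "f : dirac_maps T D T' D' ==> x : dirac_ker T D ==> f x : dirac_ker T' D'"
 by(auto simp: dirac_maps_def)

lemma dirac_maps_comp:
 "f : dirac_maps T D T' D' ==> g : dirac_maps T' D' T'' D'' ==> (%x. g (f x)) : dirac_maps T D T'' D''"
 by(auto simp: dirac_maps_def image_subset_iff intro: lin_comp)

lemma
 assumes T: "cspace T" and D: "D : lin_maps T T"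
 shows dirac_ker_submodule: "submodule (dirac_ker T D) CC T"
  and dirac_ker_cspace: "cspace (T\<lparr>carrier := dirac_ker T D\<rparr>)"
  and dirac_im_ker_submodule: "submodule (dirac_im_ker T D) CC (T\<lparr>carrier := dirac_ker T D\<rparr>)"
  and cspace_dirac_coh: "cspace (dirac_coh T D)"
proof -
 show K: "submodule (dirac_ker T D) CC T"
  using lin_vimage_submodule[OF T T D submodule_zero[OF T]] by(simp add: dirac_ker_def)
 show C: "cspace (T\<lparr>carrier := dirac_ker T D\<rparr>)" by(rule cspace_restrict[OF T K])
 have "submodule (dirac_im_ker T D) CC T"
  unfolding dirac_im_ker_def by(rule submodule_inter[OF T lin_image_submodule[OF T T D] K])
 note E = csubmoduleD[OF T this]
 show I: "submodule (dirac_im_ker T D) CC (T\<lparr>carrier := dirac_ker T D\<rparr>)"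
  by(rule csubmoduleI[OF C]) (use E in \<open>auto simp: dirac_im_ker_def\<close>)
 show "cspace (dirac_coh T D)" unfolding dirac_coh_def by(rule cspace_quot_mod[OF C I])
qed

lemma dirac_coh_carrier: "carrier (dirac_coh T D) = (%x. dirac_im_ker T D +>\<^sub>T x) ` dirac_ker T D"
 by(simp add: dirac_coh_def quot_mod_carrier)

lemma
 assumes T: "cspace T" "D : lin_maps T T" and T': "cspace T'" "D' : lin_maps T' T'"
  and f: "f : dirac_maps T D T' D'"
 shows coh_map_class: "x : dirac_ker T D ==>
   coh_map T' D' f (dirac_im_ker T D +>\<^sub>T x) = dirac_im_ker T' D' +>\<^sub>T' f x"
  and coh_map_lin: "coh_map T' D' f : lin_maps (dirac_coh T D) (dirac_coh T' D')"
proof -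
 let ?K = "T\<lparr>carrier := dirac_ker T D\<rparr>" and ?K' = "T'\<lparr>carrier := dirac_ker T' D'\<rparr>"
 have l: "f : lin_maps ?K ?K'" using f by(intro lin_restrict_source lin_restrict_target)
   (auto simp: dirac_maps_def lin_maps_def dirac_ker_def)
 have n: "f ` dirac_im_ker T D <= dirac_im_ker T' D'" using f by(auto simp: dirac_maps_def)
 note N = dirac_ker_cspace[OF T] dirac_im_ker_submodule[OF T]
  dirac_ker_cspace[OF T'] dirac_im_ker_submodule[OF T']
 show "coh_map T' D' f (dirac_im_ker T D +>\<^sub>T x) = dirac_im_ker T' D' +>\<^sub>T' f x" if "x : dirac_ker T D"
  using coset_map_coset[OF N l n, of x] that by(simp add: coh_map_def)
 show "coh_map T' D' f : lin_maps (dirac_coh T D) (dirac_coh T' D')"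
  using coset_map_lin[OF N l n] by(simp add: coh_map_def dirac_coh_def)
qed

lemma coh_map_comp:
 assumes "cspace T" "D : lin_maps T T" "cspace T'" "D' : lin_maps T' T'" "cspace T''" "D'' : lin_maps T'' T''"
  and "f : dirac_maps T D T' D'" "g : dirac_maps T' D' T'' D''" "U :. dirac_coh T D"
 shows "coh_map T'' D'' g (coh_map T' D' f U) = coh_map T'' D'' (%x. g (f x)) U" using assms(9)
 by(auto simp: dirac_coh_carrier coh_map_class[OF assms(1-4,7)] coh_map_class[OF assms(3-6,8)]
   coh_map_class[OF assms(1,2,5,6) dirac_maps_comp[OF assms(7,8)]] dirac_maps_ker[OF assms(7)])

lemma coh_map_cong:
 assumes "cspace T" "D : lin_maps T T" "cspace T'" "D' : lin_maps T' T'"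
  and "f : dirac_maps T D T' D'" "g : dirac_maps T D T' D'"
  and "!!x. x :. T ==> f x = g x" "U :. dirac_coh T D"
 shows "coh_map T' D' f U = coh_map T' D' g U" using assms(8)
 by(auto simp: dirac_coh_carrier coh_map_class[OF assms(1-5)] coh_map_class[OF assms(1-4,6)]
   dirac_ker_def assms(7))

lemma coh_map_id:
 assumes "cspace T" "D : lin_maps T T" "f : dirac_maps T D T D"
  and "!!x. x :. T ==> f x = x" "U :. dirac_coh T D"
 shows "coh_map T D f U = U" using assms(5)
 by(auto simp: dirac_coh_carrier coh_map_class[OF assms(1,2,1,2,3)] dirac_ker_def assms(4))

lemma dirac_cohomology_simps: "omap (dirac_cohomology S D \<rho>) M =
   with_act (dirac_coh (tensor M S) (D M)) (%g. coh_map (tensor M S) (D M) (\<rho> M g))"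
 "mmap (dirac_cohomology S D \<rho>) M M' f = (\<lambda>U\<in>carrier (dirac_coh (tensor M S) (D M)).
    coh_map (tensor M' S) (D M') (tensor_map M' S f id) U)"
 by(simp_all add: dirac_cohomology_def dirac_coh_def coh_map_def[abs_def] Let_def)

text \<open>Both Dirac operators have the form \<open>D = \<Sum>\<^sub>i d\<^sub>i \<otimes> e\<^sub>i\<close> and both covering groups act by \<open>\<rho> g = u\<^sub>g \<otimes> r\<^sub>g\<close>.
 An odd element \<open>g\<close> of the Pin group satisfies \<open>r\<^sub>g e\<^sub>i = e\<^sub>w\<^sub>i r\<^sub>g\<close> only up to sign; the sign is carried by
 \<open>\<epsilon> g\<close>, the image of \<open>g\<close> under the parity automorphism.  Because \<open>u\<close> does not distinguish \<open>g\<close> from \<open>\<epsilon> g\<close>, the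
 assumptions give \<open>\<rho> g D = D \<rho> (\<epsilon> g)\<close>, and this suffices for \<open>\<rho> g\<close> to preserve the kernel and the image of \<open>D\<close>.\<close>

locale dirac_datum =
 fixes A :: "(complex, 'a, 'z) module_scheme" and G :: "('g, 'y) monoid_scheme"
  and S :: "(cliff_alg, 's) lmod" and I :: "'i set" and d :: "'i => 'a" and e :: "'i => 's => 's"
  and u :: "'g => 'a" and r :: "'g => 's => 's" and w :: "'g => 'i => 'i" and \<epsilon> :: "'g => 'g"
  and D :: "('a, 'v) lmod => ('v \<times> 's => complex) set => ('v \<times> 's => complex) set"
  and \<rho> :: "('a, 'v) lmod => 'g => ('v \<times> 's => complex) set => ('v \<times> 's => complex) set"
 assumes G: "group G" and S: "cspace S" and I: "finite I"
  and d_closed: "i : I ==> d i :. A" and e_lin: "i : I ==> e i : lin_maps S S"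
  and u_closed: "g :. G ==> u g :. A" and u_mult: "g :. G ==> h :. G ==> u (g \<otimes>\<^sub>G h) = u g \<otimes>\<^sub>A u h"
  and u_one: "u \<one>\<^sub>G = \<one>\<^sub>A" and r_lin: "g :. G ==> r g : lin_maps S S"
  and r_mult: "g :. G ==> h :. G ==> s :. S ==> r (g \<otimes>\<^sub>G h) s = r g (r h s)" and r_one: "s :. S ==> r \<one>\<^sub>G s = s"
  and w_bij: "g :. G ==> bij_betw (w g) I I"
  and \<epsilon>_closed: "g :. G ==> \<epsilon> g :. G" and \<epsilon>_\<epsilon>: "g :. G ==> \<epsilon> (\<epsilon> g) = g" and u_\<epsilon>: "g :. G ==> u (\<epsilon> g) = u g"
  and u_d: "g :. G ==> i : I ==> u g \<otimes>\<^sub>A d i = d (w g i) \<otimes>\<^sub>A u g"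
  and r_e: "g :. G ==> i : I ==> s :. S ==> r g (e i s) = e (w g i) (r (\<epsilon> g) s)"
  and D_eq: "alg_module A M ==> x :. tensor M S ==>
   D M x = (\<Oplus>\<^sub>(tensor M S)i\<in>I. tensor_map M S (act M (d i)) (e i) x)"
  and \<rho>_eq: "alg_module A M ==> g :. G ==> \<rho> M g = tensor_map M S (act M (u g)) (r g)"
begin

lemma tensor_cspace: "alg_module A M ==> cspace (tensor M S)" by(rule cspace_tensor[OF module_cspace S])

lemma D_lin:
 assumes "alg_module A M"
 shows "D M : lin_maps (tensor M S) (tensor M S)" by(rule lin_cong[OF tensor_cspace[OF assms]
    lin_finsum_map[OF tensor_cspace[OF assms] tensor_cspace[OF assms] I]])
  (auto simp: D_eq[OF assms] intro!: tensor_map_lin module_cspace[OF assms] S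
   act_lin[OF assms] d_closed e_lin)

lemma D_ptensor:
 assumes M: "alg_module A M" and "v :. M" "s :. S"
 shows "D M (ptensor M S v s) = (\<Oplus>\<^sub>(tensor M S)i\<in>I. ptensor M S (act M (d i) v) (e i s))"
proof -
 interpret T: module CC "tensor M S" by(rule tensor_cspace[OF M])
 note c = lin_closed[OF act_lin[OF M d_closed]] lin_closed[OF e_lin]
 show ?thesis by(simp add: D_eq[OF M] assms, rule T.M.finsum_cong')
   (use assms c in \<open>auto simp: tensor_map_ptensor[OF module_cspace[OF M] S module_cspace[OF M] S
    act_lin[OF M d_closed] e_lin]\<close>)
qed

lemma \<rho>_lin:
 assumes "alg_module A M" "g :. G"
 shows "\<rho> M g : lin_maps (tensor M S) (tensor M S)"
 by(auto simp: \<rho>_eq[OF assms] intro!: tensor_map_lin module_cspace[OF assms(1)] S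
   act_lin[OF assms(1)] u_closed r_lin assms)

lemma \<rho>_ptensor:
 assumes "alg_module A M" "g :. G" "v :. M" "s :. S"
 shows "\<rho> M g (ptensor M S v s) = ptensor M S (act M (u g) v) (r g s)"
 by(simp add: \<rho>_eq[OF assms(1,2)] tensor_map_ptensor[OF module_cspace[OF assms(1)] S
    module_cspace[OF assms(1)] S act_lin[OF assms(1) u_closed[OF assms(2)]] r_lin[OF assms(2)]] assms)

lemma \<rho>_mult:
 assumes M: "alg_module A M" and g: "g :. G" and h: "h :. G" and x: "x :. tensor M S"
 shows "\<rho> M (g \<otimes>\<^sub>G h) x = \<rho> M g (\<rho> M h x)"
proof (rule tensor_lin_eqI[OF module_cspace[OF M] S _ _ _ x])
 interpret G: group G by(rule G)
 show "\<rho> M (g \<otimes>\<^sub>G h) : lin_maps (tensor M S) (tensor M S)" by(intro \<rho>_lin M G.m_closed g h)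
 show "(%x. \<rho> M g (\<rho> M h x)) : lin_maps (tensor M S) (tensor M S)" by(intro lin_comp[OF \<rho>_lin \<rho>_lin] M g h)
 show "\<rho> M (g \<otimes>\<^sub>G h) (ptensor M S v s) = \<rho> M g (\<rho> M h (ptensor M S v s))" if "v :. M" "s :. S" for v s
  using that g h by(simp add: \<rho>_ptensor[OF M] act_closed[OF M u_closed] lin_closed[OF r_lin] u_mult r_mult
    act_mult[OF M] u_closed)
qed

lemma \<rho>_one:
 assumes M: "alg_module A M" and x: "x :. tensor M S"
 shows "\<rho> M \<one>\<^sub>G x = x"
proof -
 interpret G: group G by(rule G)
 show ?thesis by(simp add: \<rho>_eq[OF M G.one_closed])
   (rule tensor_map_id[OF module_cspace[OF M] S _ _ x], simp_all add: u_one act_one[OF M] r_one)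
qed

lemma \<rho>_D:
 assumes M: "alg_module A M" and g: "g :. G" and x: "x :. tensor M S"
 shows "\<rho> M g (D M x) = D M (\<rho> M (\<epsilon> g) x)"
proof (rule tensor_lin_eqI[OF module_cspace[OF M] S _ _ _ x])
 interpret T: module CC "tensor M S" by(rule tensor_cspace[OF M])
 show "(%x. \<rho> M g (D M x)) : lin_maps (tensor M S) (tensor M S)" by(intro lin_comp[OF D_lin \<rho>_lin] M g)
 show "(%x. D M (\<rho> M (\<epsilon> g) x)) : lin_maps (tensor M S) (tensor M S)"
  by(intro lin_comp[OF \<rho>_lin D_lin] M \<epsilon>_closed g)
 fix v s assume v: "v :. M" and s: "s :. S"
 note cl = act_closed[OF M u_closed] act_closed[OF M d_closed] lin_closed[OF r_lin]
  lin_closed[OF e_lin] \<epsilon>_closed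
 have b: "bij_betw (w g) I I" by(rule w_bij[OF g])
 have wI: "w g i : I" if "i : I" for i using b that bij_betwE by blast
 have "\<rho> M g (D M (ptensor M S v s)) = (\<Oplus>\<^sub>(tensor M S)i\<in>I. \<rho> M g (ptensor M S (act M (d i) v) (e i s)))"
  unfolding D_ptensor[OF M v s]
  by(rule lin_finsum[OF tensor_cspace[OF M] tensor_cspace[OF M] \<rho>_lin[OF M g] I]) (simp add: cl v s)
 also have "... = (\<Oplus>\<^sub>(tensor M S)i\<in>I. ptensor M S (act M (d (w g i)) (act M (u g) v)) (e (w g i) (r (\<epsilon> g) s)))"
 proof (rule T.M.finsum_cong')
  fix i assume i: "i : I"
  have "act M (u g) (act M (d i) v) = act M (u g \<otimes>\<^sub>A d i) v"
   by(simp add: act_mult[OF M] v u_closed g d_closed i)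
  also have "... = act M (d (w g i)) (act M (u g) v)"
   by(simp add: u_d g i act_mult[OF M] v u_closed d_closed wI)
  finally show "\<rho> M g (ptensor M S (act M (d i) v) (e i s)) =
   ptensor M S (act M (d (w g i)) (act M (u g) v)) (e (w g i) (r (\<epsilon> g) s))"
   using i by(simp add: \<rho>_ptensor[OF M g] cl v s r_e[OF g])
 qed (use wI g cl v s in auto)
 also have "... = (\<Oplus>\<^sub>(tensor M S)i\<in>w g ` I. ptensor M S (act M (d i) (act M (u g) v)) (e i (r (\<epsilon> g) s)))"
  by(rule T.M.finsum_reindex[symmetric]) (use b g cl v s wI in \<open>auto simp: bij_betw_def\<close>)
 also have "... = D M (\<rho> M (\<epsilon> g) (ptensor M S v s))"
  using b by(simp add: \<rho>_ptensor[OF M \<epsilon>_closed[OF g] v s] D_ptensor[OF M] cl v s g u_\<epsilon> bij_betw_def)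
 finally show "\<rho> M g (D M (ptensor M S v s)) = D M (\<rho> M (\<epsilon> g) (ptensor M S v s))" .
qed

lemma \<rho>_dirac_maps:
 assumes M: "alg_module A M" and g: "g :. G"
 shows "\<rho> M g : dirac_maps (tensor M S) (D M) (tensor M S) (D M)"
proof (rule dirac_mapsI[OF tensor_cspace[OF M] tensor_cspace[OF M] \<rho>_lin[OF M g] \<rho>_lin[OF M \<epsilon>_closed[OF g]]])
 show "D M (\<rho> M g x) = \<rho> M (\<epsilon> g) (D M x)" if "x :. tensor M S" for x
  using \<rho>_D[OF M \<epsilon>_closed[OF g] that] \<epsilon>_\<epsilon>[OF g] by simp
 show "\<rho> M g (D M x) = D M (\<rho> M (\<epsilon> g) x)" if "x :. tensor M S" for x by(rule \<rho>_D[OF M g that])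
 show "\<rho> M (\<epsilon> g) x :. tensor M S" if "x :. tensor M S" for x
  by(rule lin_closed[OF \<rho>_lin[OF M \<epsilon>_closed[OF g]] that])
qed

lemma tensor_map_D:
 assumes M: "alg_module A M" and M': "alg_module A M'" and f: "f : equivariant_maps (carrier A) M M'"
  and x: "x :. tensor M S"
 shows "tensor_map M' S f id (D M x) = D M' (tensor_map M' S f id x)"
proof (rule tensor_lin_eqI[OF module_cspace[OF M] S _ _ _ x])
 interpret T: module CC "tensor M' S" by(rule tensor_cspace[OF M'])
 have fl: "f : lin_maps M M'" using f by(simp add: equivariant_maps_def)
 have il: "id : lin_maps S S" by(simp add: lin_id id_def)
 note tm = tensor_map_lin[OF module_cspace[OF M] S module_cspace[OF M'] S fl il]
  tensor_map_ptensor[OF module_cspace[OF M] S module_cspace[OF M'] S fl il]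
 show "(%x. tensor_map M' S f id (D M x)) : lin_maps (tensor M S) (tensor M' S)"
  by(intro lin_comp[OF D_lin tm(1)] M)
 show "(%x. D M' (tensor_map M' S f id x)) : lin_maps (tensor M S) (tensor M' S)"
  by(intro lin_comp[OF tm(1) D_lin] M')
 fix v s assume v: "v :. M" and s: "s :. S"
 have "tensor_map M' S f id (D M (ptensor M S v s)) =
   (\<Oplus>\<^sub>(tensor M' S)i\<in>I. tensor_map M' S f id (ptensor M S (act M (d i) v) (e i s)))"
  unfolding D_ptensor[OF M v s] by(rule lin_finsum[OF tensor_cspace[OF M] tensor_cspace[OF M'] tm(1) I])
   (simp add: act_closed[OF M d_closed] lin_closed[OF e_lin] v s)
 also have "... = (\<Oplus>\<^sub>(tensor M' S)i\<in>I. ptensor M' S (act M' (d i) (f v)) (e i s))" by(rule T.M.finsum_cong')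
   (use f in \<open>auto simp: tm(2) act_closed[OF M d_closed] lin_closed[OF e_lin] v s d_closed
    act_closed[OF M' d_closed] lin_closed[OF fl] equivariant_maps_def\<close>)
 finally show "tensor_map M' S f id (D M (ptensor M S v s)) = D M' (tensor_map M' S f id (ptensor M S v s))"
  by(simp add: tm(2) v s D_ptensor[OF M'] lin_closed[OF fl])
qed

lemma tensor_map_dirac_maps:
 assumes M: "alg_module A M" and M': "alg_module A M'" and f: "f : equivariant_maps (carrier A) M M'"
 shows "tensor_map M' S f id : dirac_maps (tensor M S) (D M) (tensor M' S) (D M')"
proof -
 have fl: "f : lin_maps M M'" using f by(simp add: equivariant_maps_def)
 have il: "id : lin_maps S S" by(simp add: lin_id id_def)
 note tm = tensor_map_lin[OF module_cspace[OF M] S module_cspace[OF M'] S fl il]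
 show ?thesis by(rule dirac_mapsI[OF tensor_cspace[OF M] tensor_cspace[OF M'] tm tm,
     where f'' = "tensor_map M' S f id"]) (use tensor_map_D[OF M M' f] lin_closed[OF tm] in auto)
qed

lemma tensor_map_\<rho>:
 assumes M: "alg_module A M" and M': "alg_module A M'" and f: "f : equivariant_maps (carrier A) M M'"
  and g: "g :. G" and x: "x :. tensor M S"
 shows "tensor_map M' S f id (\<rho> M g x) = \<rho> M' g (tensor_map M' S f id x)"
proof (rule tensor_lin_eqI[OF module_cspace[OF M] S _ _ _ x])
 have fl: "f : lin_maps M M'" using f by(simp add: equivariant_maps_def)
 have il: "id : lin_maps S S" by(simp add: lin_id id_def)
 note tm = tensor_map_lin[OF module_cspace[OF M] S module_cspace[OF M'] S fl il]
  tensor_map_ptensor[OF module_cspace[OF M] S module_cspace[OF M'] S fl il]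
 show "(%x. tensor_map M' S f id (\<rho> M g x)) : lin_maps (tensor M S) (tensor M' S)"
  by(intro lin_comp[OF \<rho>_lin tm(1)] M g)
 show "(%x. \<rho> M' g (tensor_map M' S f id x)) : lin_maps (tensor M S) (tensor M' S)"
  by(intro lin_comp[OF tm(1) \<rho>_lin] M' g)
 show "tensor_map M' S f id (\<rho> M g (ptensor M S v s)) = \<rho> M' g (tensor_map M' S f id (ptensor M S v s))"
  if "v :. M" "s :. S" for v s
  using that f g by(simp add: tm(2) \<rho>_ptensor[OF M g] \<rho>_ptensor[OF M' g] act_closed[OF M u_closed]
    lin_closed[OF r_lin] lin_closed[OF fl] equivariant_maps_def u_closed)
qed

theorem dirac_cohomology_functor: "is_functor (module_cat A) (rep_cat G) (dirac_cohomology S D \<rho>)"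
proof -
 let ?HD = "dirac_cohomology S D \<rho>"
 interpret G: group G by(rule G)
 let ?H = "%M. dirac_coh (tensor M S) (D M)"
 note T = tensor_cspace
 have comp: "coh_map (tensor M'' S) (D M'') g (coh_map (tensor M' S) (D M') f U) =
   coh_map (tensor M'' S) (D M'') (%x. g (f x)) U" if "alg_module A M" "alg_module A M'" "alg_module A M''"
   "f : dirac_maps (tensor M S) (D M) (tensor M' S) (D M')"
   "g : dirac_maps (tensor M' S) (D M') (tensor M'' S) (D M'')" "U :. ?H M" for M M' M'' f g U
  by(rule coh_map_comp[OF T[OF that(1)] D_lin[OF that(1)] T[OF that(2)] D_lin[OF that(2)]
     T[OF that(3)] D_lin[OF that(3)] that(4,5,6)])
 have cong: "coh_map (tensor M' S) (D M') f U = coh_map (tensor M' S) (D M') g U"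
  if "alg_module A M" "alg_module A M'" "f : dirac_maps (tensor M S) (D M) (tensor M' S) (D M')"
   "g : dirac_maps (tensor M S) (D M) (tensor M' S) (D M')" "!!x. x :. tensor M S ==> f x = g x" "U :. ?H M"
  for M M' f g U
  by(rule coh_map_cong[OF T[OF that(1)] D_lin[OF that(1)] T[OF that(2)] D_lin[OF that(2)] that(3-6)])
 have clos: "coh_map (tensor M' S) (D M') f x :. ?H M'"
  if "f : dirac_maps (tensor M S) (D M) (tensor M' S) (D M')" "alg_module A M" "alg_module A M'"
   "x :. ?H M" for M M' f x by(rule lin_closed[OF coh_map_lin[OF T D_lin T D_lin that(1)]]) (use that in auto)
 have ob: "group_rep G (omap ?HD M)" if M: "alg_module A M" for M
  unfolding group_rep_def dirac_cohomology_simps with_act_simps lin_with_act cspace_with_act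
 proof (intro conjI ballI)
  show "cspace (?H M)" by(rule cspace_dirac_coh[OF T[OF M] D_lin[OF M]])
  show "coh_map (tensor M S) (D M) (\<rho> M g) : lin_maps (?H M) (?H M)" if "g :. G" for g
   by(rule coh_map_lin[OF T[OF M] D_lin[OF M] T[OF M] D_lin[OF M] \<rho>_dirac_maps[OF M that]])
  fix v assume v: "v :. ?H M"
  show "coh_map (tensor M S) (D M) (\<rho> M (g \<otimes>\<^sub>G h)) v =
    coh_map (tensor M S) (D M) (\<rho> M g) (coh_map (tensor M S) (D M) (\<rho> M h) v)" if "g :. G" "h :. G" for g h
   unfolding comp[OF M M M \<rho>_dirac_maps[OF M that(2)] \<rho>_dirac_maps[OF M that(1)] v]
   by(rule cong[OF M M \<rho>_dirac_maps[OF M] dirac_maps_comp[OF \<rho>_dirac_maps[OF M that(2)] \<rho>_dirac_maps[OF M that(1)]] _ v])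
    (use that \<rho>_mult[OF M that] in auto)
  show "coh_map (tensor M S) (D M) (\<rho> M \<one>\<^sub>G) v = v"
   by(rule coh_map_id[OF T[OF M] D_lin[OF M] \<rho>_dirac_maps[OF M] _ v]) (auto simp: \<rho>_one[OF M])
 qed
 have hom: "mmap ?HD M M' f \<in> equivariant_maps (carrier G) (omap ?HD M) (omap ?HD M')"
  if M: "alg_module A M" and M': "alg_module A M'" and f: "f : equivariant_maps (carrier A) M M'" for M M' f
  unfolding equivariant_maps_def dirac_cohomology_simps with_act_simps lin_with_act
 proof (intro CollectI conjI ballI IntI)
  note tf = tensor_map_dirac_maps[OF M M' f]
  show "(\<lambda>U\<in>carrier (?H M). coh_map (tensor M' S) (D M') (tensor_map M' S f id) U) : lin_maps (?H M) (?H M')"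
   by(rule lin_cong[OF cspace_dirac_coh[OF T[OF M] D_lin[OF M]]
      coh_map_lin[OF T[OF M] D_lin[OF M] T[OF M'] D_lin[OF M'] tf]]) simp
  fix g v assume g: "g :. G" and v: "v :. ?H M"
  note r = \<rho>_dirac_maps[OF M g] and r' = \<rho>_dirac_maps[OF M' g]
  have "coh_map (tensor M' S) (D M') (tensor_map M' S f id) (coh_map (tensor M S) (D M) (\<rho> M g) v) =
    coh_map (tensor M' S) (D M') (\<rho> M' g) (coh_map (tensor M' S) (D M') (tensor_map M' S f id) v)"
   unfolding comp[OF M M M' r tf v] comp[OF M M' M' tf r' v]
   by(rule cong[OF M M' dirac_maps_comp[OF r tf] dirac_maps_comp[OF tf r'] _ v])
    (rule tensor_map_\<rho>[OF M M' f g])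
  thus "(\<lambda>U\<in>carrier (?H M). coh_map (tensor M' S) (D M') (tensor_map M' S f id) U)
    (coh_map (tensor M S) (D M) (\<rho> M g) v) = coh_map (tensor M' S) (D M') (\<rho> M' g)
    ((\<lambda>U\<in>carrier (?H M). coh_map (tensor M' S) (D M') (tensor_map M' S f id) U) v)"
   using v clos[OF r M M v] by simp
 qed simp
 have idn: "mmap ?HD M M (\<lambda>v\<in>carrier M. v) = (\<lambda>v\<in>carrier (omap ?HD M). v)" if M: "alg_module A M" for M
 proof -
  have "(\<lambda>v\<in>carrier M. v) : equivariant_maps (carrier A) M M"
   using lin_cong[OF module_cspace[OF M] lin_id, of "\<lambda>v\<in>carrier M. v"]
   by(auto simp: equivariant_maps_def act_closed[OF M])
  note tf = tensor_map_dirac_maps[OF M M this]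
  show ?thesis unfolding dirac_cohomology_simps with_act_simps
   by(rule restrict_ext, rule coh_map_id[OF T[OF M] D_lin[OF M] tf],
     rule tensor_map_id[OF module_cspace[OF M] S]) simp_all
 qed
 have cmp: "mmap ?HD M M'' (compose (carrier M) g f) = compose (carrier (omap ?HD M)) (mmap ?HD M' M'' g)
    (mmap ?HD M M' f)" if M: "alg_module A M" and M': "alg_module A M'" and M'': "alg_module A M''"
   and f: "f : equivariant_maps (carrier A) M M'" and g: "g : equivariant_maps (carrier A) M' M''"
  for M M' M'' f g
 proof -
  have fl: "f : lin_maps M M'" "g : lin_maps M' M''" using f g by(auto simp: equivariant_maps_def)
  have il: "id : lin_maps S S" by(simp add: lin_id id_def)
  have gf: "compose (carrier M) g f : equivariant_maps (carrier A) M M''"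
   using f g lin_cong[OF module_cspace[OF M] lin_comp[OF fl], of "compose (carrier M) g f"]
   by(auto simp: equivariant_maps_def compose_def act_closed[OF M] lin_closed)
  note tf = tensor_map_dirac_maps[OF M M' f] and tg = tensor_map_dirac_maps[OF M' M'' g]
   and tgf = tensor_map_dirac_maps[OF M M'' gf]
  have "coh_map (tensor M'' S) (D M'') (tensor_map M'' S (compose (carrier M) g f) id) v =
   coh_map (tensor M'' S) (D M'') (tensor_map M'' S g id) (coh_map (tensor M' S) (D M') (tensor_map M' S f id) v)"
   if v: "v :. ?H M" for v unfolding comp[OF M M' M'' tf tg v]
  proof (rule cong[OF M M'' tgf dirac_maps_comp[OF tf tg] _ v])
   fix x assume x: "x :. tensor M S"
   show "tensor_map M'' S (compose (carrier M) g f) id x = tensor_map M'' S g id (tensor_map M' S f id x)"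
    unfolding tensor_map_comp[OF module_cspace[OF M] S module_cspace[OF M'] S
     module_cspace[OF M''] S fl(1) il fl(2) il x]
    by(rule tensor_map_cong[OF module_cspace[OF M] S module_cspace[OF M''] S _ il _ _ x])
     (use gf in \<open>auto simp: equivariant_maps_def compose_def\<close>)
  qed
  thus ?thesis unfolding dirac_cohomology_simps with_act_simps compose_def
   by(intro restrict_ext) (simp add: clos[OF tf M M'])
 qed
 show ?thesis unfolding is_functor_def using ob hom idn cmp by(auto simp: module_cat_def rep_cat_def)
qed

end

section \<open>The Clifford algebra and the Pin cover\<close>

declare One_nat_def [simp del]

lemma
 assumes "cspace V"
 shows scale_closed: "x :. V ==> c \<odot>\<^sub>V x :. V" and scale_plus: "x :. V ==> (a + b) \<odot>\<^sub>V x = a \<odot>\<^sub>V x \<oplus>\<^sub>V b \<odot>\<^sub>V x"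
  and scale_add: "x :. V ==> y :. V ==> c \<odot>\<^sub>V (x \<oplus>\<^sub>V y) = c \<odot>\<^sub>V x \<oplus>\<^sub>V c \<odot>\<^sub>V y"
  and scale_scale: "x :. V ==> a \<odot>\<^sub>V (b \<odot>\<^sub>V x) = (a * b) \<odot>\<^sub>V x" and scale_one: "x :. V ==> 1 \<odot>\<^sub>V x = x"
  and scale_zero: "x :. V ==> 0 \<odot>\<^sub>V x = \<zero>\<^sub>V" and scale_zero_vec: "c \<odot>\<^sub>V \<zero>\<^sub>V = \<zero>\<^sub>V"
proof -
 interpret V: module CC V by fact
 show "x :. V ==> c \<odot>\<^sub>V x :. V" using V.smult_closed[of c x] by simp
 show "x :. V ==> (a + b) \<odot>\<^sub>V x = a \<odot>\<^sub>V x \<oplus>\<^sub>V b \<odot>\<^sub>V x" using V.smult_l_distr[of a b x] by simp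
 show "x :. V ==> y :. V ==> c \<odot>\<^sub>V (x \<oplus>\<^sub>V y) = c \<odot>\<^sub>V x \<oplus>\<^sub>V c \<odot>\<^sub>V y" using V.smult_r_distr[of c x y] by simp
 show "x :. V ==> a \<odot>\<^sub>V (b \<odot>\<^sub>V x) = (a * b) \<odot>\<^sub>V x" using V.smult_assoc1[of a b x] by simp
 show "x :. V ==> 1 \<odot>\<^sub>V x = x" using V.smult_one[of x] by simp
 show "x :. V ==> 0 \<odot>\<^sub>V x = \<zero>\<^sub>V" using V.smult_l_null[of x] by simp
 show "c \<odot>\<^sub>V \<zero>\<^sub>V = \<zero>\<^sub>V" using V.smult_r_null[of c] by simp
qed

lemma monoid_lists: "monoid \<lparr>carrier = lists U, monoid.mult = (@), one = []\<rparr>" by unfold_locales auto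

lemma free_alg_calg: "calg (free_alg U)" unfolding free_alg_def by(rule monoid_alg_calg[OF monoid_lists])

lemma free_alg_simps [simp]: "carrier (free_alg U) = carrier (free_vs (lists U))"
 "ring.add (free_alg U) = (%f g x. f x + g x)" "\<zero>\<^sub>(free_alg U) = (%x. 0)"
 "c \<odot>\<^sub>(free_alg U) f = (%x. c * f x)" "\<one>\<^sub>(free_alg U) = delta []"
 "lin_maps (free_alg U) V = lin_maps (free_vs (lists U)) V"
 "lin_maps W (free_alg U) = lin_maps W (free_vs (lists U))"
 "delta xs \<otimes>\<^sub>(free_alg U) delta ys = delta (xs @ ys)" by(simp_all add: free_alg_def monoid_alg_mult_delta)

lemma free_alg_minus: "f :. free_vs (lists U) ==> g :. free_vs (lists U) ==>
  f \<ominus>\<^sub>(free_alg U) g = (%x. f x - g x)" unfolding free_alg_def by(subst monoid_alg_minus[OF monoid_lists]) auto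

subsection \<open>Involutions of quotient algebras\<close>

text \<open>A linear involution that permutes the relations and is multiplicative or antimultiplicative maps the ideal
 of relations to itself, so that it descends to the quotient.\<close>

lemma involution_rel_ideal:
 assumes A: "calg A" and R: "R <= carrier A \<times> carrier A" and \<theta>: "\<theta> : lin_maps A A"
  and mult: "!!x y. x :. A ==> y :. A ==> \<theta> (x \<otimes>\<^sub>A y) : {\<theta> x \<otimes>\<^sub>A \<theta> y, \<theta> y \<otimes>\<^sub>A \<theta> x}"
  and rel: "!!f g. (f, g) : R ==> \<theta> f \<ominus>\<^sub>A \<theta> g : rel_ideal A R"
 shows "x : rel_ideal A R ==> \<theta> x : rel_ideal A R"
proof -
 interpret A: calg A by fact
 note cs = A.cspace
 let ?J = "{x \<in> carrier A. \<theta> x : rel_ideal A R}"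
 interpret I: ideal "rel_ideal A R" A by(rule rel_ideal_ideal[OF A R])
 have sub: "submodule ?J CC A" by(rule lin_vimage_submodule[OF cs cs \<theta> rel_ideal_submodule[OF A R]])
 have "ideal ?J A"
 proof (rule idealI[OF A.ring_axioms])
  show "subgroup ?J (add_monoid A)" by(rule submodule.axioms(1)[OF sub])
  have I: "\<theta> (x \<otimes>\<^sub>A a) : rel_ideal A R & \<theta> (a \<otimes>\<^sub>A x) : rel_ideal A R"
   if a: "a :. A" "\<theta> a : rel_ideal A R" and x: "x :. A" for a x
  proof -
   have "\<theta> x \<otimes>\<^sub>A \<theta> a : rel_ideal A R" "\<theta> a \<otimes>\<^sub>A \<theta> x : rel_ideal A R"
    using I.I_l_closed[OF a(2) lin_closed[OF \<theta> x]] I.I_r_closed[OF a(2) lin_closed[OF \<theta> x]] by blast+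
   thus ?thesis using mult[OF x a(1)] mult[OF a(1) x] by(metis insertE singletonD)
  qed
  show "x \<otimes>\<^sub>A a : ?J" if "a : ?J" "x :. A" for a x using I[of a x] that A.m_closed by blast
  show "a \<otimes>\<^sub>A x : ?J" if "a : ?J" "x :. A" for a x using I[of a x] that A.m_closed by blast
 qed
 hence "rel_ideal A R <= ?J"
 proof (rule rel_ideal_minimal[OF A])
  fix f g assume fg: "(f, g) : R"
  hence c: "f :. A" "g :. A" using R by auto
  thus "f \<ominus>\<^sub>A g : ?J" using rel[OF fg] lin_minus[OF cs cs \<theta> c] A.minus_closed[OF c] by simp
 qed
 thus "x : rel_ideal A R ==> \<theta> x : rel_ideal A R" by blast
qed

lemma involution_class:
 assumes A: "calg A" and R: "R <= carrier A \<times> carrier A" and \<theta>: "\<theta> : lin_maps A A"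
  and inv: "!!x. x :. A ==> \<theta> (\<theta> x) = x" and mult: "!!x y. x :. A ==> y :. A ==>
   \<theta> (x \<otimes>\<^sub>A y) : {\<theta> x \<otimes>\<^sub>A \<theta> y, \<theta> y \<otimes>\<^sub>A \<theta> x}" and rel: "!!f g. (f, g) : R ==> \<theta> f \<ominus>\<^sub>A \<theta> g : rel_ideal A R"
  and x: "x :. A"
 shows "\<theta> ` alg_class A R x = alg_class A R (\<theta> x)"
proof -
 interpret A: calg A by fact
 note cs = A.cspace and N = rel_ideal_submodule[OF A R]
 have mem: "y : alg_class A R x \<longleftrightarrow> y :. A & y \<ominus>\<^sub>A x : rel_ideal A R" if "x :. A" for x y unfolding alg_class_def
  using coset_memD[OF cs N that] coset_eq_iff[OF cs N _ that] coset_self[OF cs N] by metis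
 have sub: "\<theta> y : alg_class A R (\<theta> x)" if "x :. A" "y : alg_class A R x" for x y
 proof -
  have "y :. A" "y \<ominus>\<^sub>A x : rel_ideal A R" using that mem by blast+
  hence "\<theta> (y \<ominus>\<^sub>A x) : rel_ideal A R" using involution_rel_ideal[OF A R \<theta> mult rel] by blast
  thus ?thesis using that(1) \<open>y :. A\<close> lin_minus[OF cs cs \<theta>] lin_closed[OF \<theta>] mem by simp
 qed
 show ?thesis
 proof (intro equalityI subsetI)
  fix z assume z: "z : alg_class A R (\<theta> x)"
  have zc: "z :. A" using z mem lin_closed[OF \<theta> x] by blast
  have "\<theta> z : alg_class A R x" using sub[OF lin_closed[OF \<theta> x] z] inv[OF x] by simp
  thus "z : \<theta> ` alg_class A R x" using inv[OF zc] by(metis imageI)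
 qed (use sub x in auto)
qed

subsection \<open>Relations in the Clifford algebra\<close>

lemma basis_vec_vecs [simp]: "basis_vec n i : vecs n" by(simp add: basis_vec_def vecs_def)

lemma restrict_vecs [simp]: "restrict f {1..n} : vecs n" by(simp add: vecs_def)

lemma free_vs_uminus: "f :. free_vs B ==> (%x. - f x) :. free_vs B"
 using free_vs_closed(3)[of f B "- 1"] by simp

lemma cliff_rels_closed: "cliff_rels n <= carrier (free_alg (vecs n)) \<times> carrier (free_alg (vecs n))"
 unfolding cliff_rels_def by(auto intro!: free_vs_closed free_vs_uminus)

lemma calg_clifford: "calg (clifford n)"
 unfolding clifford_def by(rule alg_quot_calg[OF free_alg_calg cliff_rels_closed])

abbreviation cliff_class :: "nat => ((nat => complex) list => complex) => cliff_alg" where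
 "cliff_class n == alg_class (free_alg (vecs n)) (cliff_rels n)"

lemmas clifford_class = alg_quot_carrier[OF free_alg_calg cliff_rels_closed, folded clifford_def, simplified]
 alg_class_lin[OF free_alg_calg cliff_rels_closed, folded clifford_def, simplified]
 alg_class_mult[OF free_alg_calg cliff_rels_closed, folded clifford_def, simplified]
 alg_class_one[OF free_alg_calg cliff_rels_closed, folded clifford_def, simplified]
 alg_class_rel[OF free_alg_calg cliff_rels_closed]

lemma cliff_vec_closed [simp]: "v : vecs n ==> cliff_vec n v :. clifford n"
 by(auto simp: clifford_class(1) cliff_vec_def)

lemma cliff_vec_add:
 assumes "v : vecs n" "v' : vecs n"
 shows "cliff_vec n (\<lambda>j\<in>{1..n}. v j + v' j) = cliff_vec n v \<oplus>\<^sub>(clifford n) cliff_vec n v'"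
proof -
 have "(delta [\<lambda>j\<in>{1..n}. v j + v' j], %u. delta [v] u + delta [v'] u) : cliff_rels n"
  unfolding cliff_rels_def using assms by blast
 from clifford_class(5)[OF this] show ?thesis
  using lin_add[OF clifford_class(2), of "delta [v]" n "delta [v']"] assms by(simp add: cliff_vec_def)
qed

lemma cliff_vec_smult:
 assumes "v : vecs n"
 shows "cliff_vec n (\<lambda>j\<in>{1..n}. c * v j) = c \<odot>\<^sub>(clifford n) cliff_vec n v"
proof -
 have "(delta [\<lambda>j\<in>{1..n}. c * v j], %u. c * delta [v] u) : cliff_rels n"
  unfolding cliff_rels_def using assms by blast
 from clifford_class(5)[OF this] show ?thesis using lin_smult[OF clifford_class(2), of "delta [v]" n c] assms
  by(simp add: cliff_vec_def)
qed

lemma cliff_vec_rel: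
 assumes "v : vecs n" "v' : vecs n"
 shows "cliff_vec n v \<otimes>\<^sub>(clifford n) cliff_vec n v' \<oplus>\<^sub>(clifford n) cliff_vec n v' \<otimes>\<^sub>(clifford n) cliff_vec n v =
  (- 2 * (\<Sum>j=1..n. v j * v' j)) \<odot>\<^sub>(clifford n) \<one>\<^sub>(clifford n)"
proof -
 have "(%u. delta [v, v'] u + delta [v', v] u, %u. - 2 * (\<Sum>j=1..n. v j * v' j) * delta [] u) : cliff_rels n"
  unfolding cliff_rels_def using assms by blast
 from clifford_class(5)[OF this] show ?thesis
  using lin_add[OF clifford_class(2), of "delta [v, v']" n "delta [v', v]"] assms
   lin_smult[OF clifford_class(2), of "delta []" n "- 2 * (\<Sum>j=1..n. v j * v' j)"]
  by(simp add: cliff_vec_def clifford_class(3,4))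
qed

text \<open>The parity automorphism and the transposition of the free algebra in one formula: \<open>h\<close> is the identity or the
 reversal of words.\<close>

definition signed :: "('x list => 'x list) => ('x list => complex) => 'x list => complex" where
 "signed h f = (%w. (- 1) ^ length w * f (h w))"

lemma parity_signed: "parity U = signed (%w. w) ` U"
 and cliff_transpose_signed: "cliff_transpose U = signed rev ` U"
 by(simp_all add: parity_def cliff_transpose_def signed_def[abs_def])

context
 fixes h :: "'x list => 'x list"
 assumes h: "h = (%w. w) | h = rev"
begin

lemma signed_delta: "signed h (delta w) = (%u. (- 1) ^ length w * delta (h w) u)"
 using h by(auto simp: signed_def delta_def fun_eq_iff)

lemma signed_signed [simp]: "signed h (signed h f) = f"
 using h by(auto simp: signed_def fun_eq_iff simp flip: mult.assoc power_add)

lemma signed_lin: "signed h : lin_maps (free_vs (lists U)) (free_vs (lists U))"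
proof (rule lin_mapsI)
 fix f assume f: "f :. free_vs (lists U)"
 have "{w. signed h f w ~= 0} = h ` {w. f w ~= 0}"
  using h by(auto simp: signed_def intro!: image_eqI[of _ rev "rev _"])
 thus "signed h f :. free_vs (lists U)" using free_vs_support[OF f] h by(auto simp: free_vs_carrier)
qed (auto simp: signed_def algebra_simps)

lemma signed_mult_delta:
 assumes "xs : lists U" "ys : lists U"
 shows "signed h (delta (xs @ ys)) = (if h = rev then signed h (delta ys) \<otimes>\<^sub>(free_alg U) signed h (delta xs)
  else signed h (delta xs) \<otimes>\<^sub>(free_alg U) signed h (delta ys))"
proof -
 interpret calg "free_alg U" by(rule free_alg_calg)
 have sm: "(%u. a * delta v u) \<otimes>\<^sub>(free_alg U) (%u. b * delta w u) = (%u. a * b * delta (v @ w) u)"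
  if "v : lists U" "w : lists U" for a b v w
  using smult_mult_left[of "delta v" "%u. b * delta w u" a] smult_mult_right[of "delta v" "delta w" b] that
  by(simp add: mult.assoc)
 have hl: "h w : lists U" if "w : lists U" for w using h that by auto
 show ?thesis
 proof (cases "h = rev")
  case True
  thus ?thesis unfolding signed_delta using assms hl by(simp add: sm) (simp add: power_add mult.commute)
 next
  case False
  hence "h = (%w. w)" using h by blast
  thus ?thesis using False unfolding signed_delta using assms by(simp add: sm) (simp add: power_add)
 qed
qed

lemma signed_mult:
 assumes f: "f :. free_vs (lists U)" and g: "g :. free_vs (lists U)"
 shows "signed h (f \<otimes>\<^sub>(free_alg U) g) = (if h = rev then signed h g \<otimes>\<^sub>(free_alg U) signed h f
  else signed h f \<otimes>\<^sub>(free_alg U) signed h g)"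
proof -
 interpret calg "free_alg U" by(rule free_alg_calg)
 note m = lin_mult[simplified] and s = signed_lin[of U]
 note eqI = free_vs_lin_eqI[OF cspace_free_vs, of _ "lists U" "lists U"]
 have 1: "signed h (delta xs \<otimes>\<^sub>(free_alg U) g) = (if h = rev then signed h g \<otimes>\<^sub>(free_alg U) signed h (delta xs)
  else signed h (delta xs) \<otimes>\<^sub>(free_alg U) signed h g)" if "xs : lists U" for xs
 proof (rule eqI[where x = g])
  show "(%g. signed h (delta xs \<otimes>\<^sub>(free_alg U) g)) : lin_maps (free_vs (lists U)) (free_vs (lists U))"
   by(rule lin_comp[OF m(2) s]) (use that in simp)
  show "(%g. if h = rev then signed h g \<otimes>\<^sub>(free_alg U) signed h (delta xs)
    else signed h (delta xs) \<otimes>\<^sub>(free_alg U) signed h g) : lin_maps (free_vs (lists U)) (free_vs (lists U))"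
   using lin_comp[OF s m(1)] lin_comp[OF s m(2)] lin_closed[OF s, of "delta xs"] that
   by(cases "h = rev") (simp_all del: lists_eq_set)
 qed (use g that signed_mult_delta in auto)
 show ?thesis
 proof (rule eqI[where x = f])
  show "(%f. signed h (f \<otimes>\<^sub>(free_alg U) g)) : lin_maps (free_vs (lists U)) (free_vs (lists U))"
   by(rule lin_comp[OF m(1) s]) (use g in simp)
  show "(%f. if h = rev then signed h g \<otimes>\<^sub>(free_alg U) signed h f
    else signed h f \<otimes>\<^sub>(free_alg U) signed h g) : lin_maps (free_vs (lists U)) (free_vs (lists U))"
   using lin_comp[OF s m(1)] lin_comp[OF s m(2)] lin_closed[OF s g] by(cases "h = rev") simp_all
 qed (use f 1 in auto)
qed

end

lemma signed_cliff_class: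
 assumes h: "h = (%w. w) | h = rev" and f: "f :. free_vs (lists (vecs n))"
 shows "signed h ` cliff_class n f = cliff_class n (signed h f)"
proof (rule involution_class[OF free_alg_calg cliff_rels_closed])
 let ?A = "free_alg (vecs n)" and ?I = "rel_ideal (free_alg (vecs n)) (cliff_rels n)"
 interpret A: calg ?A by(rule free_alg_calg)
 note N = rel_ideal_submodule[OF free_alg_calg cliff_rels_closed, of n]
 note s = lin_closed[OF signed_lin[OF h, of "vecs n"]]
 fix f g assume fg: "(f, g) : cliff_rels n"
 have c: "f :. free_vs (lists (vecs n))" "g :. free_vs (lists (vecs n))" using fg cliff_rels_closed by auto
 have I: "f \<ominus>\<^sub>?A g : ?I" by(rule rel_ideal_rel[OF free_alg_calg cliff_rels_closed fg])
 hence I': "(- 1) \<odot>\<^sub>?A (f \<ominus>\<^sub>?A g) : ?I" by(rule csubmoduleD(6)[OF A.cspace N])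
 have "signed h f \<ominus>\<^sub>?A signed h g = f \<ominus>\<^sub>?A g | signed h f \<ominus>\<^sub>?A signed h g = (- 1) \<odot>\<^sub>?A (f \<ominus>\<^sub>?A g)"
 proof -
  have add: "signed h (%u. a u + b u) = (%u. signed h a u + signed h b u)"
   and smult: "signed h (%u. k * a u) = (%u. k * signed h a u)"
   for a b :: "(nat => complex) list => complex" and k by(simp_all add: signed_def algebra_simps)
  have d1: "signed h (delta [v]) = (%u. - delta [v] u)" and d2: "signed h (delta [v, v']) = delta (h [v, v'])"
   and d0: "signed h (delta []) = delta []" for v v' :: "nat => complex"
   using h by(auto simp: signed_delta[OF h])
  have "(signed h f = (%u. - f u) & signed h g = (%u. - g u)) | (signed h f = f & signed h g = g)"
   using fg unfolding cliff_rels_def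
  proof (elim UnE CollectE exE conjE, goal_cases)
   case (1 v v')
   thus ?case by(simp add: add d1)
  next
   case (2 k v)
   thus ?case by(simp add: smult d1)
  next
   case (3 v v')
   have "signed h f = f" using 3 h by(auto simp: add d2)
   moreover have "signed h g = g" using 3 by(simp only: prod.inject smult d0)
   ultimately show ?case by blast
  qed
  thus ?thesis using c s[OF c(1)] s[OF c(2)] by(auto simp: free_alg_minus)
 qed
 thus "signed h f \<ominus>\<^sub>?A signed h g : ?I" using I I' by metis
qed (use signed_lin[OF h] signed_signed[OF h] signed_mult[OF h] f in auto)

lemma parity_class: "f :. free_vs (lists (vecs n)) ==>
  parity (cliff_class n f) = cliff_class n (signed (%w. w) f)"
 and cliff_transpose_class: "f :. free_vs (lists (vecs n)) ==>
  cliff_transpose (cliff_class n f) = cliff_class n (signed rev f)"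
 by(simp_all add: parity_signed cliff_transpose_signed signed_cliff_class)

lemma
 assumes x: "x :. clifford n"
 shows parity_closed [simp]: "parity x :. clifford n"
  and cliff_transpose_closed [simp]: "cliff_transpose x :. clifford n"
  and parity_parity [simp]: "parity (parity x) = x"
  and cliff_transpose_transpose [simp]: "cliff_transpose (cliff_transpose x) = x"
  and parity_transpose: "parity (cliff_transpose x) = cliff_transpose (parity x)"
  and parity_mult: "y :. clifford n ==> parity (x \<otimes>\<^sub>(clifford n) y) = parity x \<otimes>\<^sub>(clifford n) parity y"
  and cliff_transpose_mult: "y :. clifford n ==>
   cliff_transpose (x \<otimes>\<^sub>(clifford n) y) = cliff_transpose y \<otimes>\<^sub>(clifford n) cliff_transpose x"
  and parity_smult: "parity (c \<odot>\<^sub>(clifford n) x) = c \<odot>\<^sub>(clifford n) parity x"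
proof -
 interpret F: calg "free_alg (vecs n)" by(rule free_alg_calg)
 obtain f where f: "f :. free_vs (lists (vecs n))" "x = cliff_class n f"
  using x by(auto simp: clifford_class(1))
 have ne: "(\<lambda>w :: (nat => complex) list. w) ~= rev"
 proof
  assume "(\<lambda>w :: (nat => complex) list. w) = rev"
  from fun_cong[OF this, of "[%_. 0, %_. 1]"] show False by(auto simp: fun_eq_iff)
 qed
 have p: "signed (%w. w) g :. free_vs (lists (vecs n))" "signed rev g :. free_vs (lists (vecs n))"
  if "g :. free_vs (lists (vecs n))" for g using that by(auto intro!: lin_closed[OF signed_lin])
 note sm = signed_mult[of "%w. w"] signed_mult[of rev]
 show "parity x :. clifford n" "cliff_transpose x :. clifford n"
  using f p[OF f(1)] by(simp_all add: parity_class cliff_transpose_class clifford_class(1) imageI)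
 show "parity (parity x) = x" "cliff_transpose (cliff_transpose x) = x"
  using f(1) p[OF f(1)] unfolding f(2) by(simp_all add: parity_class cliff_transpose_class signed_signed)
 have "signed (%w. w) (signed rev f) = signed rev (signed (%w. w) f)" by(simp add: signed_def)
 thus "parity (cliff_transpose x) = cliff_transpose (parity x)"
  using f(1) p[OF f(1)] unfolding f(2) by(simp add: parity_class cliff_transpose_class)
 show "parity (c \<odot>\<^sub>(clifford n) x) = c \<odot>\<^sub>(clifford n) parity x"
 proof -
  have "c \<odot>\<^sub>(clifford n) x = cliff_class n (%u. c * f u)"
   using lin_smult[OF clifford_class(2) f(1), of c] f(2) by simp
  moreover have "signed (%w. w) (%u. c * f u) = (%u. c * signed (%w. w) f u)"
   by(simp add: signed_def algebra_simps)
  moreover have "cliff_class n (%u. c * signed (%w. w) f u) = c \<odot>\<^sub>(clifford n) cliff_class n (signed (%w. w) f)"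
   using lin_smult[OF clifford_class(2) p(1)[OF f(1)], of c] by simp
  ultimately show ?thesis using f by(simp add: parity_class)
 qed
 assume "y :. clifford n"
 then obtain g where g: "g :. free_vs (lists (vecs n))" "y = cliff_class n g" by(auto simp: clifford_class(1))
 have fg: "f \<otimes>\<^sub>(free_alg (vecs n)) g :. free_vs (lists (vecs n))" using F.m_closed f g by simp
 show "parity (x \<otimes>\<^sub>(clifford n) y) = parity x \<otimes>\<^sub>(clifford n) parity y"
  using f(1) g(1) fg p[OF f(1)] p[OF g(1)] ne unfolding f(2) g(2)
  by(simp add: clifford_class(3) parity_class sm(1))
 show "cliff_transpose (x \<otimes>\<^sub>(clifford n) y) = cliff_transpose y \<otimes>\<^sub>(clifford n) cliff_transpose x"
  using f(1) g(1) fg p[OF f(1)] p[OF g(1)] unfolding f(2) g(2)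
  by(simp add: clifford_class(3) cliff_transpose_class sm(2))
qed

lemma parity_one [simp]: "parity \<one>\<^sub>(clifford n) = \<one>\<^sub>(clifford n)"
 and cliff_transpose_one [simp]: "cliff_transpose \<one>\<^sub>(clifford n) = \<one>\<^sub>(clifford n)"
 by(simp_all add: clifford_class(4) parity_class cliff_transpose_class signed_delta)

lemma parity_cliff_vec: "v : vecs n ==> parity (cliff_vec n v) = (- 1) \<odot>\<^sub>(clifford n) cliff_vec n v"
 and cliff_transpose_cliff_vec:
  "v : vecs n ==> cliff_transpose (cliff_vec n v) = (- 1) \<odot>\<^sub>(clifford n) cliff_vec n v"
 using lin_smult[OF clifford_class(2), of "delta [v]" n "-1"]
 by(simp_all add: cliff_vec_def parity_class cliff_transpose_class signed_delta)

subsection \<open>Lifts of permutations\<close>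

lemma pcoords_vecs [simp]: "pcoords n w v : vecs n" by(simp add: permute_coords_def vecs_def)

lemma pcoords_comp:
 assumes "w permutes {1..n}" "w' permutes {1..n}"
 shows "pcoords n (w o w') t = pcoords n w (pcoords n w' t)"
proof -
 have "inv_into UNIV w j : {1..n}" if "j : {1..n}" for j
  using permutes_in_image[OF permutes_inv[OF assms(1)]] that by blast
 moreover have "inv_into UNIV (w o w') = inv_into UNIV w' o inv_into UNIV w"
  by(rule o_inv_distrib[OF permutes_bij[OF assms(1)] permutes_bij[OF assms(2)]])
 ultimately show ?thesis by(auto simp: permute_coords_def fun_eq_iff)
qed

lemma pcoords_id [simp]: "t : extensional {1..n} ==> pcoords n id t = t"
 by(auto simp: permute_coords_def fun_eq_iff extensional_def inv_id)

lemma vecs_extensional [simp]: "v : vecs n ==> v : extensional {1..n}" by(simp add: vecs_def PiE_def)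

lemma pcoords_basis_vec:
 assumes "w permutes {1..n}" "i : {1..n}"
 shows "pcoords n w (basis_vec n i) = basis_vec n (w i)"
proof -
 have "inv_into UNIV w j = i \<longleftrightarrow> j = w i" for j using permutes_inverses[OF assms(1)] by metis
 moreover have "inv_into UNIV w j : {1..n}" if "j : {1..n}" for j
  using permutes_in_image[OF permutes_inv[OF assms(1)]] that by blast
 ultimately show ?thesis by(auto simp: permute_coords_def basis_vec_def fun_eq_iff)
qed

text \<open>\<open>x\<close> is an element of the Pin group over \<open>w\<close>.  The conjugation condition is multiplied out, so that the lifts are
 seen to be closed under products without computing inverses, and \<open>x\<close> determines \<open>w\<close> as soon as the vectors embed
 into the Clifford algebra.\<close>

definition perm_lift :: "nat => cliff_alg => (nat => nat) => bool" where
 "perm_lift n x w \<longleftrightarrow> w permutes {1..n} & x :. clifford n &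
   x \<otimes>\<^sub>(clifford n) cliff_transpose x = \<one>\<^sub>(clifford n) & cliff_transpose x \<otimes>\<^sub>(clifford n) x = \<one>\<^sub>(clifford n) &
   (\<forall>v\<in>vecs n. parity x \<otimes>\<^sub>(clifford n) cliff_vec n v = cliff_vec n (pcoords n w v) \<otimes>\<^sub>(clifford n) x)"

lemma perm_lift_one: "perm_lift n \<one>\<^sub>(clifford n) id"
proof -
 interpret C: calg "clifford n" by(rule calg_clifford)
 show ?thesis by(auto simp: perm_lift_def permutes_id)
qed

lemma perm_lift_mult:
 assumes "perm_lift n x w" "perm_lift n y w'"
 shows "perm_lift n (x \<otimes>\<^sub>(clifford n) y) (w o w')"
proof -
 interpret C: calg "clifford n" by(rule calg_clifford)
 note X = assms(1)[unfolded perm_lift_def] and Y = assms(2)[unfolded perm_lift_def]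
 let ?C = "clifford n"
 have c: "x :. ?C" "y :. ?C" and w: "w permutes {1..n}" "w' permutes {1..n}" using X Y by auto
 note cl = c cliff_transpose_closed[OF c(1)] cliff_transpose_closed[OF c(2)] parity_closed[OF c(1)]
  parity_closed[OF c(2)]
 have "(x \<otimes>\<^sub>?C y) \<otimes>\<^sub>?C (cliff_transpose y \<otimes>\<^sub>?C cliff_transpose x) =
   x \<otimes>\<^sub>?C (y \<otimes>\<^sub>?C cliff_transpose y) \<otimes>\<^sub>?C cliff_transpose x" using cl by(simp add: C.m_assoc)
 hence 1: "(x \<otimes>\<^sub>?C y) \<otimes>\<^sub>?C (cliff_transpose y \<otimes>\<^sub>?C cliff_transpose x) = \<one>\<^sub>?C" using X Y cl by simp
 have "(cliff_transpose y \<otimes>\<^sub>?C cliff_transpose x) \<otimes>\<^sub>?C (x \<otimes>\<^sub>?C y) =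
   cliff_transpose y \<otimes>\<^sub>?C (cliff_transpose x \<otimes>\<^sub>?C x) \<otimes>\<^sub>?C y" using cl by(simp add: C.m_assoc)
 hence 2: "(cliff_transpose y \<otimes>\<^sub>?C cliff_transpose x) \<otimes>\<^sub>?C (x \<otimes>\<^sub>?C y) = \<one>\<^sub>?C" using X Y cl by simp
 have 3: "parity (x \<otimes>\<^sub>?C y) \<otimes>\<^sub>?C cliff_vec n v =
   cliff_vec n (pcoords n (w o w') v) \<otimes>\<^sub>?C (x \<otimes>\<^sub>?C y)" if v: "v : vecs n" for v
 proof -
  have "parity (x \<otimes>\<^sub>?C y) \<otimes>\<^sub>?C cliff_vec n v = parity x \<otimes>\<^sub>?C (parity y \<otimes>\<^sub>?C cliff_vec n v)"
   using cl v by(simp add: parity_mult C.m_assoc)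
  also have "... = parity x \<otimes>\<^sub>?C (cliff_vec n (pcoords n w' v) \<otimes>\<^sub>?C y)" using Y v by simp
  also have "... = parity x \<otimes>\<^sub>?C cliff_vec n (pcoords n w' v) \<otimes>\<^sub>?C y" using cl by(simp add: C.m_assoc)
  also have "... = cliff_vec n (pcoords n w (pcoords n w' v)) \<otimes>\<^sub>?C x \<otimes>\<^sub>?C y" using X by simp
  finally show ?thesis using cl by(simp add: pcoords_comp[OF w] C.m_assoc)
 qed
 show ?thesis unfolding perm_lift_def using c w 1 2 3 by(simp add: cliff_transpose_mult permutes_compose)
qed

lemma perm_lift_transpose:
 assumes "perm_lift n x w"
 shows "perm_lift n (cliff_transpose x) (inv_into UNIV w)"
proof -
 interpret C: calg "clifford n" by(rule calg_clifford)
 note X = assms[unfolded perm_lift_def]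
 let ?C = "clifford n" and ?t = "cliff_transpose x" and ?w = "inv_into UNIV w"
 have c: "x :. ?C" and w: "w permutes {1..n}" using X by auto
 note cl = c cliff_transpose_closed[OF c] parity_closed[OF c] parity_closed[OF cliff_transpose_closed[OF c]]
 have pt: "parity ?t \<otimes>\<^sub>?C parity x = \<one>\<^sub>?C" using X cl parity_mult[of ?t n x] by simp
 have "parity ?t \<otimes>\<^sub>?C cliff_vec n v = cliff_vec n (pcoords n ?w v) \<otimes>\<^sub>?C ?t" if v: "v : vecs n" for v
 proof -
  have vv: "v = pcoords n w (pcoords n ?w v)"
   using v pcoords_comp[OF w permutes_inv[OF w], of v] permutes_inv_o(1)[OF w] by simp
  have "parity ?t \<otimes>\<^sub>?C cliff_vec n v = parity ?t \<otimes>\<^sub>?C (cliff_vec n v \<otimes>\<^sub>?C (x \<otimes>\<^sub>?C ?t))" using X v cl by simp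
  also have "... = parity ?t \<otimes>\<^sub>?C ((cliff_vec n (pcoords n w (pcoords n ?w v)) \<otimes>\<^sub>?C x) \<otimes>\<^sub>?C ?t)"
   using cl v vv by(simp add: C.m_assoc)
  also have "... = parity ?t \<otimes>\<^sub>?C ((parity x \<otimes>\<^sub>?C cliff_vec n (pcoords n ?w v)) \<otimes>\<^sub>?C ?t)" using X by simp
  also have "... = (parity ?t \<otimes>\<^sub>?C parity x) \<otimes>\<^sub>?C cliff_vec n (pcoords n ?w v) \<otimes>\<^sub>?C ?t"
   using cl by(simp add: C.m_assoc)
  finally show ?thesis using pt cl by simp
 qed
 thus ?thesis unfolding perm_lift_def using X cl permutes_inv[OF w] by simp
qed

lemma perm_lift_parity_commute:
 assumes "perm_lift n x w" "v : vecs n"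
 shows "x \<otimes>\<^sub>(clifford n) cliff_vec n v = cliff_vec n (pcoords n w v) \<otimes>\<^sub>(clifford n) parity x"
proof -
 interpret C: calg "clifford n" by(rule calg_clifford)
 note X = assms(1)[unfolded perm_lift_def]
 let ?C = "clifford n"
 have c: "x :. ?C" using X by auto
 have eq: "parity (parity x \<otimes>\<^sub>?C cliff_vec n v) = parity (cliff_vec n (pcoords n w v) \<otimes>\<^sub>?C x)"
  using X assms(2) by simp
 have "(- 1) \<odot>\<^sub>?C (x \<otimes>\<^sub>?C cliff_vec n v) = (- 1) \<odot>\<^sub>?C (cliff_vec n (pcoords n w v) \<otimes>\<^sub>?C parity x)"
  using eq c assms(2) by(simp add: parity_mult parity_cliff_vec C.smult_mult_left C.smult_mult_right)
 hence "\<ominus>\<^sub>?C (x \<otimes>\<^sub>?C cliff_vec n v) = \<ominus>\<^sub>?C (cliff_vec n (pcoords n w v) \<otimes>\<^sub>?C parity x)"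
  using c assms(2) by(simp add: smult_minus_one[OF C.cspace])
 thus ?thesis using c assms(2) C.minus_minus C.m_closed cliff_vec_closed parity_closed pcoords_vecs by metis
qed

lemma perm_lift_parity:
 assumes "perm_lift n x w"
 shows "perm_lift n (parity x) w"
proof -
 interpret C: calg "clifford n" by(rule calg_clifford)
 note X = assms[unfolded perm_lift_def]
 have c: "x :. clifford n" using X by auto
 have "parity x \<otimes>\<^sub>(clifford n) cliff_transpose (parity x) = \<one>\<^sub>(clifford n)"
  "cliff_transpose (parity x) \<otimes>\<^sub>(clifford n) parity x = \<one>\<^sub>(clifford n)"
  using X parity_mult[OF c cliff_transpose_closed[OF c], symmetric]
   parity_mult[OF cliff_transpose_closed[OF c] c, symmetric]
  by(simp_all add: parity_transpose[OF c, symmetric])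
 thus ?thesis using X c perm_lift_parity_commute[OF assms] by(simp add: perm_lift_def)
qed

text \<open>The reflection in the unit vector \<open>(e\<^sub>a - e\<^sub>b) / \<surd>2\<close> exchanges the coordinates \<open>a\<close> and \<open>b\<close>.\<close>

lemma perm_lift_transposition:
 assumes "a : {1..n}" "b : {1..n}" "a ~= b"
 shows "\<exists>x. perm_lift n x (transpose a b)"
proof -
 interpret C: calg "clifford n" by(rule calg_clifford)
 let ?C = "clifford n"
 obtain c :: complex where c: "c * c = 1 / 2" using power2_csqrt[of "1/2"] unfolding power2_eq_square by blast
 define u where "u = (\<lambda>j\<in>{1..n}. if j = a then c else if j = b then - c else 0)"
 have u: "u : vecs n" by(simp add: u_def)
 let ?x = "cliff_vec n u"
 have inner: "(\<Sum>j=1..n. u j * v j) = c * (v a - v b)" for v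
 proof -
  have "(\<Sum>j=1..n. u j * v j) = (\<Sum>j\<in>{1..n}. (if j = a then c * v a else 0) + (if j = b then - c * v b else 0))"
   using assms by(intro sum.cong) (auto simp: u_def)
  thus ?thesis using assms by(simp add: sum.distrib algebra_simps)
 qed
 have uu: "(\<Sum>j=1..n. u j * u j) = 1"
 proof -
  have "u a = c" "u b = - c" using assms by(auto simp: u_def)
  moreover have "c * (c - - c) = 2 * (c * c)" by(simp add: algebra_simps)
  ultimately show ?thesis using c by(simp only: inner) simp
 qed
 have sq: "?x \<otimes>\<^sub>?C ?x = (- 1) \<odot>\<^sub>?C \<one>\<^sub>?C"
 proof -
  have x: "?x \<otimes>\<^sub>?C ?x :. ?C" using u by simp
  have "(1 + 1) \<odot>\<^sub>?C (?x \<otimes>\<^sub>?C ?x) = ?x \<otimes>\<^sub>?C ?x \<oplus>\<^sub>?C ?x \<otimes>\<^sub>?C ?x"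
   by(simp only: scale_plus[OF C.cspace x] scale_one[OF C.cspace x])
  also have "... = (- 2) \<odot>\<^sub>?C \<one>\<^sub>?C" using cliff_vec_rel[OF u u] uu by simp
  finally have "(1/2) \<odot>\<^sub>?C ((1 + 1) \<odot>\<^sub>?C (?x \<otimes>\<^sub>?C ?x)) = (1/2) \<odot>\<^sub>?C ((- 2) \<odot>\<^sub>?C \<one>\<^sub>?C)" by(rule arg_cong)
  hence "((1/2) * (1 + 1)) \<odot>\<^sub>?C (?x \<otimes>\<^sub>?C ?x) = ((1/2) * (- 2)) \<odot>\<^sub>?C \<one>\<^sub>?C"
   by(simp only: scale_scale[OF C.cspace x] scale_scale[OF C.cspace C.one_closed])
  thus ?thesis by(simp add: scale_one[OF C.cspace x])
 qed
 have one: "(- 1) \<odot>\<^sub>?C ((- 1) \<odot>\<^sub>?C \<one>\<^sub>?C) = \<one>\<^sub>?C" by(simp add: scale_scale[OF C.cspace] scale_one[OF C.cspace])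
 have refl: "parity ?x \<otimes>\<^sub>?C cliff_vec n v = cliff_vec n (pcoords n (transpose a b) v) \<otimes>\<^sub>?C ?x"
  if v: "v : vecs n" for v
 proof -
  let ?s = "\<Sum>j=1..n. u j * v j" and ?v = "cliff_vec n v"
  have pc: "pcoords n (transpose a b) v = (\<lambda>j\<in>{1..n}. v j + (\<lambda>j\<in>{1..n}. (- 2 * ?s) * u j) j)"
  proof
   fix j
   have cc: "2 * (c * z) * c = z" for z
   proof -
    have "2 * (c * z) * c = 2 * (c * c) * z" by(simp only: ac_simps)
    thus ?thesis by(simp add: c)
   qed
   have ab: "u a = c" "u b = - c" "!!j. j : {1..n} ==> j ~= a ==> j ~= b ==> u j = 0"
    using assms by(auto simp: u_def)
   have "v (transpose a b j) = v j - 2 * (c * (v a - v b)) * u j" if "j : {1..n}"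
    using that by(cases "j = a | j = b") (auto simp: ab cc)
   thus "pcoords n (transpose a b) v j = (\<lambda>j\<in>{1..n}. v j + (\<lambda>j\<in>{1..n}. (- 2 * ?s) * u j) j) j"
    by(simp add: permute_coords_def inner)
  qed
  have pv: "cliff_vec n (pcoords n (transpose a b) v) = ?v \<oplus>\<^sub>?C (- 2 * ?s) \<odot>\<^sub>?C ?x"
   unfolding pc by(simp only: cliff_vec_add[OF v restrict_vecs] cliff_vec_smult[OF u])
  have "((- 2 * ?s) \<odot>\<^sub>?C ?x) \<otimes>\<^sub>?C ?x = (2 * ?s) \<odot>\<^sub>?C \<one>\<^sub>?C"
   by(simp only: C.smult_mult_left[OF cliff_vec_closed[OF u] cliff_vec_closed[OF u]] sq
     scale_scale[OF C.cspace C.one_closed]) simp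
  hence 1: "cliff_vec n (pcoords n (transpose a b) v) \<otimes>\<^sub>?C ?x = ?v \<otimes>\<^sub>?C ?x \<oplus>\<^sub>?C (2 * ?s) \<odot>\<^sub>?C \<one>\<^sub>?C"
   using u v by(simp only: pv C.l_distr cliff_vec_closed C.smult_closed')
  have "?x \<otimes>\<^sub>?C ?v \<oplus>\<^sub>?C (?v \<otimes>\<^sub>?C ?x \<oplus>\<^sub>?C (2 * ?s) \<odot>\<^sub>?C \<one>\<^sub>?C) = (- 2 * ?s) \<odot>\<^sub>?C \<one>\<^sub>?C \<oplus>\<^sub>?C (2 * ?s) \<odot>\<^sub>?C \<one>\<^sub>?C"
   unfolding cliff_vec_rel[OF u v, symmetric] using u v by(intro C.a_assoc[symmetric]) auto
  also have "... = \<zero>\<^sub>?C" unfolding scale_plus[OF C.cspace C.one_closed, symmetric]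
   by(simp add: scale_zero[OF C.cspace C.one_closed])
  finally have "?v \<otimes>\<^sub>?C ?x \<oplus>\<^sub>?C (2 * ?s) \<odot>\<^sub>?C \<one>\<^sub>?C = \<ominus>\<^sub>?C (?x \<otimes>\<^sub>?C ?v)"
   using u v by(intro C.minus_equality[symmetric]) (auto simp: C.a_comm)
  thus ?thesis using u v 1 by(simp add: parity_cliff_vec smult_minus_one[OF C.cspace] C.l_minus)
 qed
 have xt: "?x \<otimes>\<^sub>?C cliff_transpose ?x = \<one>\<^sub>?C" "cliff_transpose ?x \<otimes>\<^sub>?C ?x = \<one>\<^sub>?C"
  unfolding cliff_transpose_cliff_vec[OF u]
   C.smult_mult_left[OF cliff_vec_closed[OF u] cliff_vec_closed[OF u]]
   C.smult_mult_right[OF cliff_vec_closed[OF u] cliff_vec_closed[OF u]] sq one by simp_all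
 have "perm_lift n ?x (transpose a b)"
  unfolding perm_lift_def using permutes_swap_id[OF assms(1,2)] cliff_vec_closed[OF u] xt refl by blast
 thus ?thesis by blast
qed

lemma perm_lift_exists:
 assumes "w permutes {1..n}"
 shows "\<exists>x. perm_lift n x w" using assms finite_atLeastAtMost[of 1 n]
proof (induction w rule: permutes_induct)
 case id
 thus ?case using perm_lift_one by blast
next
 case (swap a b p)
 thus ?case using perm_lift_transposition[of a n b] perm_lift_mult by blast
qed

text \<open>A nonzero Clifford module, here the spinor module, shows that \<open>1 \<noteq> 0\<close>.  The Clifford relation then makes
 the map from vectors to the algebra injective, because it recovers the bilinear form.\<close>

locale nontrivial_clifford =
 fixes n :: nat
 assumes nontrivial: "\<one>\<^sub>(clifford n) ~= \<zero>\<^sub>(clifford n)"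
begin

lemma cliff_vec_inject:
 assumes "v : vecs n" "v' : vecs n" "cliff_vec n v = cliff_vec n v'"
 shows "v = v'"
proof (rule ccontr)
 assume "v ~= v'"
 interpret C: calg "clifford n" by(rule calg_clifford)
 let ?C = "clifford n"
 obtain i where i: "v i ~= v' i" using \<open>v ~= v'\<close> by auto
 hence iI: "i : {1..n}" using assms(1,2) PiE_arb unfolding vecs_def by metis
 let ?b = "basis_vec n i"
 have s: "(\<Sum>j=1..n. v j * ?b j) = v i" for v :: "nat => complex"
 proof -
  have "(\<Sum>j=1..n. v j * ?b j) = (\<Sum>j\<in>{1..n}. if j = i then v i else 0)"
   by(intro sum.cong) (auto simp: basis_vec_def)
  thus ?thesis using iI by simp
 qed
 have "(- 2 * v i) \<odot>\<^sub>?C \<one>\<^sub>?C = (- 2 * v' i) \<odot>\<^sub>?C \<one>\<^sub>?C"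
  using cliff_vec_rel[of v n ?b] cliff_vec_rel[of v' n ?b] assms s by simp
 hence "(2 * v' i) \<odot>\<^sub>?C \<one>\<^sub>?C \<oplus>\<^sub>?C (- 2 * v i) \<odot>\<^sub>?C \<one>\<^sub>?C = (2 * v' i) \<odot>\<^sub>?C \<one>\<^sub>?C \<oplus>\<^sub>?C (- 2 * v' i) \<odot>\<^sub>?C \<one>\<^sub>?C" by simp
 hence z: "(2 * v' i + (- 2 * v i)) \<odot>\<^sub>?C \<one>\<^sub>?C = \<zero>\<^sub>?C" unfolding scale_plus[OF C.cspace C.one_closed, symmetric]
  by(simp add: scale_zero[OF C.cspace C.one_closed])
 let ?a = "2 * v' i + (- 2 * v i)"
 have "\<one>\<^sub>?C = (inverse ?a * ?a) \<odot>\<^sub>?C \<one>\<^sub>?C"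
 proof -
  have "?a ~= 0" using i by simp
  hence "inverse ?a * ?a = 1" by(rule left_inverse)
  thus ?thesis by(simp only: scale_one[OF C.cspace C.one_closed])
 qed
 also have "... = inverse ?a \<odot>\<^sub>?C (?a \<odot>\<^sub>?C \<one>\<^sub>?C)" by(rule scale_scale[OF C.cspace C.one_closed, symmetric])
 also have "... = \<zero>\<^sub>?C" unfolding z by(rule scale_zero_vec[OF C.cspace])
 finally show False using nontrivial by simp
qed

lemma perm_map_inject:
 assumes "w permutes {1..n}" "w' permutes {1..n}" "perm_map n w = perm_map n w'"
 shows "w = w'"
proof
 fix i
 show "w i = w' i"
 proof (cases "i : {1..n}")
  case True
  have "perm_map n w (basis_vec n i) = perm_map n w' (basis_vec n i)" using assms by simp
  hence "basis_vec n (w i) = basis_vec n (w' i)" using True assms by(simp add: perm_map_def pcoords_basis_vec)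
  from fun_cong[OF this, of "w i"] show ?thesis
   using True permutes_in_image[OF assms(1)] by(auto simp: basis_vec_def split: if_splits)
 next
  case False
  thus ?thesis using assms by(simp add: permutes_not_in)
 qed
qed

lemma perm_lift_pin:
 assumes "perm_lift n x w"
 shows "x : Pin n" "pin_proj n x = perm_map n w"
proof -
 interpret C: calg "clifford n" by(rule calg_clifford)
 note X = assms[unfolded perm_lift_def]
 let ?C = "clifford n"
 have c: "x :. ?C" using X by auto
 have U: "x : Units ?C" using X by(auto simp: Units_def intro!: bexI[of _ "cliff_transpose x"])
 have inv: "inv\<^bsub>?C\<^esub> x = cliff_transpose x" by(rule C.inv_char[symmetric, THEN sym]) (use X c in auto)
 have tw: "twisted_conj n x v = cliff_vec n (pcoords n w v)" if v: "v : vecs n" for v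
 proof -
  have "twisted_conj n x v = cliff_vec n (pcoords n w v) \<otimes>\<^sub>?C x \<otimes>\<^sub>?C cliff_transpose x"
   using X v by(simp add: twisted_conj_def inv)
  also have "... = cliff_vec n (pcoords n w v) \<otimes>\<^sub>?C (x \<otimes>\<^sub>?C cliff_transpose x)" using c by(simp add: C.m_assoc)
  finally show ?thesis using X by simp
 qed
 show "x : Pin n" using U inv tw by(auto simp: Pin_def)
 show "pin_proj n x = perm_map n w" unfolding pin_proj_def perm_map_def
  by(rule restrict_ext, rule the_equality) (auto simp: tw intro: cliff_vec_inject)
qed

lemma pin_perm_lift:
 assumes "x : Pin n" "w permutes {1..n}" "pin_proj n x = perm_map n w"
 shows "perm_lift n x w"
proof -
 interpret C: calg "clifford n" by(rule calg_clifford)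
 let ?C = "clifford n"
 have U: "x : Units ?C" and t: "cliff_transpose x = inv\<^bsub>?C\<^esub> x"
  and sub: "twisted_conj n x ` vecs n <= cliff_vec n ` vecs n" using assms(1) by(auto simp: Pin_def)
 have c: "x :. ?C" using U by auto
 have "parity x \<otimes>\<^sub>?C cliff_vec n v = cliff_vec n (pcoords n w v) \<otimes>\<^sub>?C x" if v: "v : vecs n" for v
 proof -
  have "twisted_conj n x v : cliff_vec n ` vecs n" using sub v by blast
  then obtain v' where v': "v' : vecs n" "cliff_vec n v' = twisted_conj n x v" by(metis imageE)
  have "(THE v'. v' : vecs n & cliff_vec n v' = twisted_conj n x v) = v'"
   using v' cliff_vec_inject by(intro the_equality) auto
  hence "pin_proj n x v = v'" unfolding pin_proj_def using v by simp
  hence "v' = pcoords n w v" using assms(3) v by(simp add: perm_map_def)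
  hence "cliff_vec n (pcoords n w v) \<otimes>\<^sub>?C x = twisted_conj n x v \<otimes>\<^sub>?C x" using v' by simp
  also have "... = parity x \<otimes>\<^sub>?C cliff_vec n v \<otimes>\<^sub>?C (inv\<^bsub>?C\<^esub> x \<otimes>\<^sub>?C x)"
   using c v U C.Units_inv_closed[OF U] by(simp add: twisted_conj_def C.m_assoc)
  finally show ?thesis using c v U by simp
 qed
 thus ?thesis unfolding perm_lift_def using assms(2) c U t by simp
qed

text \<open>The map of vectors induced by an element of the Pin group over a permutation is that permutation of
 coordinates; hence the covering group is described by the lifts alone.\<close>

lemma pin_cover_iff:
 assumes "!!w. w : W ==> w permutes {1..n}"
 shows "x :. pin_cover n W \<longleftrightarrow> (\<exists>w\<in>W. perm_lift n x w)"
proof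
 assume "x :. pin_cover n W"
 then obtain w where "w : W" "x : Pin n" "pin_proj n x = perm_map n w" by(auto simp: pin_cover_def)
 thus "\<exists>w\<in>W. perm_lift n x w" using pin_perm_lift assms by blast
next
 assume "\<exists>w\<in>W. perm_lift n x w"
 thus "x :. pin_cover n W" using perm_lift_pin by(auto simp: pin_cover_def)
qed

lemma cover_perm_lift:
 assumes "perm_lift n x w"
 shows "cover_perm n x = w"
proof -
 have w: "w permutes {1..n}" using assms by(simp add: perm_lift_def)
 show ?thesis unfolding cover_perm_def perm_lift_pin(2)[OF assms]
  by(rule the_equality) (simp add: w sym_group_carrier, metis w perm_map_inject sym_group_carrier)
qed

lemma perm_lift_cover_perm:
 assumes "!!w. w : W ==> w permutes {1..n}" "x :. pin_cover n W"
 shows "perm_lift n x (cover_perm n x)" "cover_perm n x : W" "cover_perm n x permutes {1..n}"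
proof -
 obtain w where w: "w : W" "perm_lift n x w" using pin_cover_iff[OF assms(1)] assms(2) by blast
 thus "perm_lift n x (cover_perm n x)" "cover_perm n x : W" "cover_perm n x permutes {1..n}"
  using cover_perm_lift[OF w(2)] assms(1)[OF w(1)] by simp_all
qed

lemma pin_cover_group:
 assumes "subgroup W (sym_group n)"
 shows "group (pin_cover n W)"
proof -
 let ?P = "pin_cover n W"
 interpret C: calg "clifford n" by(rule calg_clifford)
 note sg = sym_group_mult sym_group_one sym_group_carrier
 have W: "!!w. w : W ==> w permutes {1..n}" using subgroup.subset[OF assms] by(auto simp: sg)
 have iff: "x :. ?P \<longleftrightarrow> (\<exists>w\<in>W. perm_lift n x w)" for x by(rule pin_cover_iff) (rule W)
 have s: "monoid.mult ?P = monoid.mult (clifford n)" "\<one>\<^sub>?P = \<one>\<^sub>(clifford n)" by(simp_all add: pin_cover_def)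
 have car: "x :. clifford n" if "x :. ?P" for x using iff[THEN iffD1, OF that] by(auto simp: perm_lift_def)
 show ?thesis
 proof (rule groupI)
  show "x \<otimes>\<^sub>?P y :. ?P" if x: "x :. ?P" and y: "y :. ?P" for x y
  proof -
   obtain w w' where "w : W" "w' : W" "perm_lift n x w" "perm_lift n y w'"
    using iff[THEN iffD1, OF x] iff[THEN iffD1, OF y] by blast
   thus ?thesis unfolding s iff using subgroup.m_closed[OF assms, of w w'] perm_lift_mult[of n x w y w']
    by(intro bexI[of _ "w o w'"]) (simp_all add: sg)
  qed
  show "\<one>\<^sub>?P :. ?P" unfolding s iff using subgroup.one_closed[OF assms] perm_lift_one
   by(intro bexI[of _ id]) (simp_all add: sg)
  show "\<exists>y\<in>carrier ?P. y \<otimes>\<^sub>?P x = \<one>\<^sub>?P" if x: "x :. ?P" for x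
  proof -
   obtain w where w: "w : W" "perm_lift n x w" using iff[THEN iffD1, OF x] by blast
   have "inv_into UNIV w : W" using subgroup.m_inv_closed[OF assms w(1)] W[OF w(1)] by(simp add: sg)
   thus ?thesis using perm_lift_transpose[OF w(2)] w(2) unfolding s
    by(intro bexI[of _ "cliff_transpose x"] iff[THEN iffD2] bexI[of _ "inv_into UNIV w"])
     (simp_all add: perm_lift_def)
  qed
 qed (use car in \<open>auto simp: s C.m_assoc\<close>)
qed

end

lemma spinor_module_nontrivial:
 assumes "spinor_module n S"
 shows "nontrivial_clifford n"
proof
 have M: "alg_module (clifford n) S" using assms by(simp add: spinor_module_def)
 interpret C: calg "clifford n" by(rule calg_clifford)
 interpret S: module CC S by(rule module_cspace[OF M])
 obtain s where s: "s :. S" "s ~= \<zero>\<^sub>S" using assms S.zero_closed by(auto simp: spinor_module_def)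
 show "\<one>\<^sub>(clifford n) ~= \<zero>\<^sub>(clifford n)"
  using act_one[OF M s(1)] lin_zero[OF C.cspace module_cspace[OF M] act_lin_alg[OF M s(1)]] s by auto
qed

section \<open>Semidirect products, the torus and the reflection group\<close>

lemma semidirect_simps [simp]: "carrier (semidirect T Q \<alpha>) = carrier T \<times> carrier Q"
 "(t, q) \<otimes>\<^sub>(semidirect T Q \<alpha>) (t', q') = (t \<otimes>\<^sub>T \<alpha> q t', q \<otimes>\<^sub>Q q')" "\<one>\<^sub>(semidirect T Q \<alpha>) = (\<one>\<^sub>T, \<one>\<^sub>Q)"
 by(simp_all add: semidirect_def)

lemma semidirect_group:
 assumes "group T" "group Q" and hom: "!!q. q :. Q ==> \<alpha> q : hom T T"
  and mult: "!!q q' t. q :. Q ==> q' :. Q ==> t :. T ==> \<alpha> (q \<otimes>\<^sub>Q q') t = \<alpha> q (\<alpha> q' t)"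
  and one: "!!t. t :. T ==> \<alpha> \<one>\<^sub>Q t = t"
 shows "group (semidirect T Q \<alpha>)"
proof -
 interpret T: group T by fact
 interpret Q: group Q by fact
 have cl: "\<alpha> q t :. T" if "q :. Q" "t :. T" for q t using hom[OF that(1)] that(2) by(auto simp: hom_def)
 have m: "\<alpha> q (t \<otimes>\<^sub>T t') = \<alpha> q t \<otimes>\<^sub>T \<alpha> q t'" if "q :. Q" "t :. T" "t' :. T" for q t t'
  using hom[OF that(1)] that(2,3) by(auto simp: hom_def)
 show ?thesis
 proof (rule groupI)
  show "\<exists>y\<in>carrier (semidirect T Q \<alpha>). y \<otimes>\<^sub>(semidirect T Q \<alpha>) x = \<one>\<^sub>(semidirect T Q \<alpha>)"
   if xc: "x : carrier (semidirect T Q \<alpha>)" for x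
  proof -
   obtain t q where x: "x = (t, q)" "t :. T" "q :. Q" using xc by(cases x) auto
   have "\<alpha> (inv\<^bsub>Q\<^esub> q) (inv\<^bsub>T\<^esub> t) \<otimes>\<^sub>T \<alpha> (inv\<^bsub>Q\<^esub> q) t = \<one>\<^sub>T"
    using m[of "inv\<^bsub>Q\<^esub> q" "inv\<^bsub>T\<^esub> t" t] group_hom.hom_one[of T T "\<alpha> (inv\<^bsub>Q\<^esub> q)"] x hom[of "inv\<^bsub>Q\<^esub> q"] T.group_axioms
    by(simp add: group_hom_def group_hom_axioms_def)
   thus ?thesis using x cl by(intro bexI[of _ "(\<alpha> (inv\<^bsub>Q\<^esub> q) (inv\<^bsub>T\<^esub> t), inv\<^bsub>Q\<^esub> q)"]) auto
  qed
 qed (use cl m mult one T.m_assoc Q.m_assoc in auto)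
qed

lemma permutes_range:
 assumes "w permutes {1..n}" "i : {1..n}"
 shows "w i : {1..n}" "inv_into UNIV w i : {1..n}"
 unfolding permutes_in_image[OF assms(1)] permutes_in_image[OF permutes_inv[OF assms(1)]] by(rule assms(2))+

lemma pcoords_apply: "j : {1..n} ==> pcoords n w t j = t (inv_into UNIV w j)" by(simp add: permute_coords_def)

lemma pcoords_apply_perm:
 assumes "w permutes {1..n}" "j : {1..n}"
 shows "pcoords n w t (w j) = t j" using permutes_range(1)[OF assms] permutes_inverses(2)[OF assms(1)]
 by(simp add: pcoords_apply)

definition torus_gen :: "nat => nat => nat => int => nat => int" where
 "torus_gen m n i c = (\<lambda>j\<in>{1..n}. if j = i then c mod int m else 0)"

lemma subgroup_young: "subgroup (ysub m n a) (sym_group n)"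
proof (rule group.subgroupI[OF sym_group_is_group])
 show "ysub m n a <= carrier (sym_group n)" by(auto simp: young_subgroup_def)
 have "id : ysub m n a" by(auto simp: young_subgroup_def sym_group_carrier permutes_id)
 thus "ysub m n a ~= {}" by blast
 fix w assume w: "w : ysub m n a"
 hence p: "w permutes {1..n}" by(simp add: young_subgroup_def sym_group_carrier)
 have "inv_into UNIV w ` block a i = block a i" if "i < m" for i
 proof -
  have "w ` block a i = block a i" using w that by(simp add: young_subgroup_def)
  hence "inv_into UNIV w ` block a i = inv_into UNIV w ` w ` block a i" by simp
  thus ?thesis using permutes_inv_o(2)[OF p] by(simp add: image_comp)
 qed
 thus "inv\<^bsub>sym_group n\<^esub> w : ysub m n a" using w p by(simp add: young_subgroup_def sym_group_inv_closed)
 fix w' assume w': "w' : ysub m n a"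
 thus "w \<otimes>\<^sub>(sym_group n) w' : ysub m n a"
  using w unfolding young_subgroup_def sym_group_carrier sym_group_mult mem_Collect_eq
  by(metis permutes_compose image_comp)
qed

locale refl_params =
 fixes m n :: nat
 assumes m_pos: "m \<ge> 1"
begin

abbreviation "TT == torus m n"
abbreviation "GG == refl_group m n"

lemma torus_carrier: "carrier TT = {1..n} \<rightarrow>\<^sub>E {0..<int m}"
 using m_pos by(simp add: torus_def carrier_integer_mod_group)

lemma torus_mult: "t \<otimes>\<^sub>TT t' = (\<lambda>i\<in>{1..n}. (t i + t' i) mod int m)" and torus_one: "\<one>\<^sub>TT = (\<lambda>i\<in>{1..n}. 0)"
 by(simp_all add: torus_def)

lemma torus_group: "group TT" by(simp add: torus_def)

lemma torus_comm: "t \<otimes>\<^sub>TT t' = t' \<otimes>\<^sub>TT t" by(simp add: torus_mult add.commute)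

lemma torus_finite: "finite (carrier TT)" by(simp add: torus_carrier finite_PiE)

lemma torusD: "t :. TT ==> j : {1..n} ==> 0 <= t j & t j < int m" by(auto simp: torus_carrier PiE_def Pi_def)

lemma torusI: "(!!j. j : {1..n} ==> 0 <= f j & f j < int m) ==> (\<lambda>j\<in>{1..n}. f j) :. TT"
 by(auto simp: torus_carrier)

lemma torus_ext: "t :. TT ==> t' :. TT ==> (!!j. j : {1..n} ==> t j = t' j) ==> t = t'"
 unfolding torus_carrier by(rule PiE_ext)

lemma pcoords_torus:
 assumes "w permutes {1..n}" "t :. TT"
 shows "pcoords n w t :. TT" unfolding permute_coords_def
 by(rule torusI, rule torusD[OF assms(2) permutes_range(2)[OF assms(1)]])

lemma pcoords_hom:
 assumes "w permutes {1..n}"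
 shows "pcoords n w : hom TT TT"
proof (rule homI)
 show "pcoords n w (t \<otimes>\<^sub>TT t') = pcoords n w t \<otimes>\<^sub>TT pcoords n w t'" for t t'
  unfolding torus_mult permute_coords_def
 proof (rule restrict_ext)
  fix j assume j: "j : {1..n}"
  have "inv_into UNIV w j : {1..n}" by(rule permutes_range(2)[OF assms j])
  with j show "(\<lambda>i\<in>{1..n}. (t i + t' i) mod int m) (inv_into UNIV w j) =
    ((\<lambda>j\<in>{1..n}. t (inv_into UNIV w j)) j + (\<lambda>j\<in>{1..n}. t' (inv_into UNIV w j)) j) mod int m" by simp
 qed
qed (rule pcoords_torus[OF assms])

lemma torus_extensional: "t :. TT ==> t : extensional {1..n}" by(auto simp: torus_carrier PiE_def)

lemma refl_group_group: "group GG" unfolding refl_group_def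
 by(rule semidirect_group[OF torus_group sym_group_is_group])
  (auto simp: sym_group_carrier sym_group_mult sym_group_one pcoords_hom pcoords_comp torus_extensional)

lemma refl_group_simps: "(t, w) :. GG \<longleftrightarrow> t :. TT & w permutes {1..n}"
 "(t, w) \<otimes>\<^sub>GG (t', w') = (t \<otimes>\<^sub>TT pcoords n w t', w o w')" "\<one>\<^sub>GG = (\<one>\<^sub>TT, id)"
 by(simp_all add: refl_group_def sym_group_carrier sym_group_mult sym_group_one)

lemma torus_one_closed: "\<one>\<^sub>TT :. TT" using group.is_monoid[OF torus_group] by(rule monoid.one_closed)

lemma torus_mult_closed: "t :. TT ==> t' :. TT ==> t \<otimes>\<^sub>TT t' :. TT"
 using group.is_monoid[OF torus_group] by(rule monoid.m_closed)

lemma torus_one_mult: "t :. TT ==> \<one>\<^sub>TT \<otimes>\<^sub>TT t = t" "t :. TT ==> t \<otimes>\<^sub>TT \<one>\<^sub>TT = t"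
 using group.is_monoid[OF torus_group] by(simp_all add: monoid.l_one monoid.r_one)

lemma pcoords_one: "w permutes {1..n} ==> pcoords n w \<one>\<^sub>TT = \<one>\<^sub>TT" unfolding torus_one permute_coords_def
 by(rule restrict_ext) (use permutes_range(2)[of w n] in simp)

lemma of_perm_closed: "w permutes {1..n} ==> of_perm m n w :. GG"
 and of_torus_closed: "t :. TT ==> of_torus t :. GG"
 by(simp_all add: of_perm_def of_torus_def refl_group_simps torus_one_closed permutes_id)

lemma of_perm_mult:
 assumes "w permutes {1..n}" "w' permutes {1..n}"
 shows "of_perm m n w \<otimes>\<^sub>GG of_perm m n w' = of_perm m n (w o w')"
 using assms by(simp add: of_perm_def refl_group_simps pcoords_one torus_one_mult torus_one_closed)

lemma of_perm_id: "of_perm m n id = \<one>\<^sub>GG" by(simp add: of_perm_def refl_group_simps)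

lemma of_torus_of_perm: "t :. TT ==> of_torus t \<otimes>\<^sub>GG of_perm m n w = (t, w)"
 by(simp add: of_perm_def of_torus_def refl_group_simps torus_one_mult torus_extensional torus_one_closed)

lemma of_perm_of_torus: "t :. TT ==> w permutes {1..n} ==> of_perm m n w \<otimes>\<^sub>GG of_torus t = (pcoords n w t, w)"
 by(simp add: of_perm_def of_torus_def refl_group_simps torus_one_mult pcoords_torus)

lemma of_torus_mult: "t :. TT ==> t' :. TT ==> of_torus t \<otimes>\<^sub>GG of_torus t' = of_torus (t \<otimes>\<^sub>TT t')"
 by(simp add: of_torus_def refl_group_simps torus_extensional)

subsection \<open>Powers of the generators\<close>

lemma torus_gen_closed: "torus_gen m n i c :. TT" unfolding torus_gen_def using m_pos by(intro torusI) auto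

lemma torus_gen_mult: "torus_gen m n i c \<otimes>\<^sub>TT torus_gen m n i d = torus_gen m n i (c + d)"
 by(auto simp: torus_mult torus_gen_def mod_simps intro!: restrict_ext)

lemma g_gen_eq: "g_gen m n i = of_torus (torus_gen m n i 1)"
 by(simp add: g_gen_def of_torus_def torus_gen_def)

lemma g_gen_closed: "g_gen m n i :. GG" by(simp add: g_gen_eq of_torus_closed torus_gen_closed)

lemma g_gen_pow: "g_gen m n i [^]\<^sub>GG (c :: int) = of_torus (torus_gen m n i c)"
proof -
 interpret G: group GG by(rule refl_group_group)
 have one: "of_torus (torus_gen m n i 0) = \<one>\<^sub>GG"
  by(auto simp: of_torus_def torus_gen_def refl_group_simps torus_one)
 have nat: "g_gen m n i [^]\<^sub>GG k = of_torus (torus_gen m n i (int k))" for k :: nat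
 proof (induction k)
  case 0
  thus ?case using one by simp
 next
  case (Suc k)
  thus ?case by(simp add: g_gen_eq of_torus_mult torus_gen_closed torus_gen_mult add.commute)
 qed
 have inv: "inv\<^bsub>GG\<^esub> of_torus (torus_gen m n i d) = of_torus (torus_gen m n i (- d))" for d
  by(rule G.inv_equality) (simp_all add: of_torus_mult torus_gen_closed torus_gen_mult one of_torus_closed)
 show ?thesis
 proof (cases "c \<ge> 0")
  case True
  then obtain k where "c = int k" using nonneg_int_cases by blast
  thus ?thesis using nat[of k] by(simp add: int_pow_int)
 next
  case False
  then obtain k where "c = - int k" by(metis int_cases2 nle_le of_nat_0_le_iff)
  thus ?thesis using G.int_pow_neg_int[OF g_gen_closed, of i k] nat[of k] inv[of "int k"] by simp
 qed
qed

text \<open>The element \<open>g\<^sub>i\<^sup>c g\<^sub>j\<^sup>-\<^sup>c\<close> of the torus.\<close>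

definition pair_elt :: "nat => nat => int => nat => int" where
 "pair_elt i j c = (\<lambda>r\<in>{1..n}. if r = i then c mod int m else if r = j then (- c) mod int m else 0)"

lemma pair_elt_closed: "pair_elt i j c :. TT" unfolding pair_elt_def using m_pos by(intro torusI) auto

lemma pair_elt_eq:
 assumes "i ~= j"
 shows "torus_gen m n i c \<otimes>\<^sub>TT torus_gen m n j (- c) = pair_elt i j c"
 using assms by(auto simp: torus_mult torus_gen_def pair_elt_def intro!: restrict_ext)

lemma g_gen_pair:
 assumes "i ~= j"
 shows "g_gen m n i [^]\<^sub>GG (c :: int) \<otimes>\<^sub>GG g_gen m n j [^]\<^sub>GG (- c) = (pair_elt i j c, id)"
 by(simp add: g_gen_pow of_torus_mult torus_gen_closed pair_elt_eq[OF assms]) (simp add: of_torus_def)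

lemma swap_g_gen_pair:
 assumes ij: "i : {1..n}" "j : {1..n}" "i ~= j"
 shows "of_perm m n (transpose i j) \<otimes>\<^sub>GG g_gen m n i [^]\<^sub>GG (- int l) \<otimes>\<^sub>GG g_gen m n j [^]\<^sub>GG int l =
  (pair_elt i j (int l), transpose i j)"
proof -
 interpret G: group GG by(rule refl_group_group)
 have p: "transpose i j permutes {1..n}" using ij by(intro permutes_swap_id)
 have "g_gen m n i [^]\<^sub>GG (- int l) \<otimes>\<^sub>GG g_gen m n j [^]\<^sub>GG int l = of_torus (pair_elt i j (- int l))"
  using g_gen_pair[OF ij(3), of "- int l"] by(simp add: of_torus_def)
 moreover have "pcoords n (transpose i j) (pair_elt i j (- int l)) = pair_elt i j (int l)"
  using ij by(auto simp: permute_coords_def pair_elt_def transpose_def intro!: restrict_ext)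
 ultimately show ?thesis
  using p by(simp add: G.m_assoc of_perm_closed g_gen_closed of_perm_of_torus pair_elt_closed)
qed

lemma pair_elt_cong:
 assumes "c mod int m = d mod int m"
 shows "pair_elt i j c = pair_elt i j d"
 unfolding pair_elt_def by(rule restrict_ext) (simp only: assms mod_minus_cong[OF assms])

lemma pair_elt_swap: "i ~= j ==> pair_elt i j c = pair_elt j i (- c)"
 by(auto simp: pair_elt_def intro!: restrict_ext)

lemma permute_pair_elt:
 assumes w: "w permutes {1..n}"
 shows "pcoords n w (pair_elt i j c) = pair_elt (w i) (w j) c" unfolding permute_coords_def pair_elt_def
proof (rule restrict_ext)
 fix r assume r: "r : {1..n}"
 have "inv_into UNIV w r = x \<longleftrightarrow> r = w x" for x using permutes_inv_eq[OF w, of r x] by(simp only: eq_commute)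
 thus "(\<lambda>r\<in>{1..n}. if r = i then c mod int m else if r = j then (- c) mod int m else 0) (inv_into UNIV w r) =
   (if r = w i then c mod int m else if r = w j then (- c) mod int m else 0)"
  using permutes_range(2)[OF w r] by simp
qed

lemma pair_elt_shift:
 assumes ij: "i : {1..n}" "j : {1..n}" "i ~= j"
 shows "u \<otimes>\<^sub>TT pair_elt i j c = pair_elt i j (u i - u j + c) \<otimes>\<^sub>TT pcoords n (transpose i j) u"
 unfolding torus_mult
proof (rule restrict_ext)
 fix r assume r: "r : {1..n}"
 consider "r = i" | "r = j" | "r ~= i" "r ~= j" by blast
 thus "(u r + pair_elt i j c r) mod int m =
   (pair_elt i j (u i - u j + c) r + pcoords n (transpose i j) u r) mod int m"
  by cases (use r ij in \<open>simp_all add: pair_elt_def pcoords_apply mod_simps algebra_simps\<close>)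
qed

text \<open>The maps \<open>l \<mapsto> d \<plusminus> l\<close> permute the residues modulo \<open>m\<close>.\<close>

lemma mod_reindex:
 assumes e: "e = 1 | e = (- 1 :: int)"
 shows "bij_betw (%l. nat ((d + e * int l) mod int m)) {..<m} {..<m}"
proof -
 let ?f = "%l. nat ((d + e * int l) mod int m)"
 have m: "0 < int m" using m_pos by simp
 have sub: "?f ` {..<m} <= {..<m}" using m by(auto simp: nat_less_iff)
 have "inj_on ?f {..<m}"
 proof (rule inj_onI)
  fix l l' assume l: "l : {..<m}" "l' : {..<m}" and eq: "?f l = ?f l'"
  have "(d + e * int l) mod int m = (d + e * int l') mod int m" using eq m by(metis nat_eq_iff2 pos_mod_sign)
  hence "int m dvd e * int l - e * int l'" by(metis add_diff_cancel_left mod_eq_dvd_iff)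
  hence d: "int m dvd int l - int l'" using e by(auto simp: dvd_diff_commute)
  have "int l mod int m = int l' mod int m" using d by(simp add: mod_eq_dvd_iff)
  thus "l = l'" using l by simp
 qed
 thus ?thesis using endo_inj_surj[OF finite_lessThan sub] by(simp add: bij_betw_def)
qed

lemma torus_induct [consumes 1, case_names one mult]:
 assumes "t :. TT" "P \<one>\<^sub>TT" and step: "!!r t. r : {1..n} ==> t :. TT ==> P t ==> P (torus_gen m n r 1 \<otimes>\<^sub>TT t)"
 shows "P t" using assms(1)
proof (induction "nat (\<Sum>j=1..n. t j)" arbitrary: t rule: less_induct)
 case less
 show ?case
 proof (cases "\<exists>r\<in>{1..n}. t r ~= 0")
  case False
  hence "t = \<one>\<^sub>TT" by(intro torus_ext[OF less.prems torus_one_closed]) (auto simp: torus_one)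
  thus ?thesis using assms(2) by simp
 next
  case True
  then obtain r where r: "r : {1..n}" "t r ~= 0" by blast
  define t' where "t' = (\<lambda>j\<in>{1..n}. if j = r then t j - 1 else t j)"
  have tr: "0 < t r" using torusD[OF less.prems r(1)] r(2) by simp
  have t': "t' :. TT" unfolding t'_def by(rule torusI) (use torusD[OF less.prems] tr in force)
  have t: "t = torus_gen m n r 1 \<otimes>\<^sub>TT t'" using torusD[OF less.prems] r
   by(intro torus_ext[OF less.prems torus_mult_closed[OF torus_gen_closed t']])
    (auto simp: torus_mult torus_gen_def t'_def mod_simps)
  have "(\<Sum>j=1..n. t' j) = (\<Sum>j=1..n. t j) - 1"
  proof -
   have "(\<Sum>j=1..n. t' j) = (\<Sum>j\<in>{1..n}. t j - (if j = r then 1 else 0))" by(intro sum.cong) (auto simp: t'_def)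
   thus ?thesis using r by(simp add: sum_subtractf)
  qed
  moreover have "0 <= (\<Sum>j=1..n. t' j)" using torusD[OF t'] by(intro sum_nonneg) auto
  ultimately have "P t'" by(intro less.hyps[OF _ t']) auto
  thus ?thesis using step[OF r(1) t'] t by simp
 qed
qed

end

section \<open>Permutations preserving the classes of a monotone labelling\<close>

text \<open>The subgroup preserving the classes of \<open>\<kappa>\<close> is generated by the adjacent transpositions that it contains.  Let
 \<open>N\<close> be the largest index moved by \<open>w\<close>, and \<open>y = w N < N\<close>.  As \<open>\<kappa>\<close> is monotone, it is constant between \<open>y\<close> and \<open>N\<close>;
 composition with the transposition of \<open>y\<close> and \<open>y + 1\<close> therefore stays in the subgroup, and it brings the image of \<open>N\<close>
 closer to \<open>N\<close>.\<close>

lemma class_perm_induct [consumes 3, case_names id swap]: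
 fixes \<kappa> :: "nat => nat"
 assumes mono: "mono_on {1..n} \<kappa>" and w: "w permutes {1..n}" and pres: "!!j. j : {1..n} ==> \<kappa> (w j) = \<kappa> j"
  and id: "P id" and swap: "!!j w. 1 <= j ==> j < n ==> \<kappa> j = \<kappa> (j + 1) ==> w permutes {1..n} ==>
   (!!r. r : {1..n} ==> \<kappa> (w r) = \<kappa> r) ==> P w ==> P (transpose j (j + 1) o w)"
 shows "P w"
proof -
 define Q where "Q w \<longleftrightarrow> w permutes {1..n} & (\<forall>r\<in>{1..n}. \<kappa> (w r) = \<kappa> r)" for w
 have Qt: "Q (transpose a b o w)" if "Q w" "a : {1..n}" "b : {1..n}" "\<kappa> a = \<kappa> b" for a b w
 proof -
  have "\<kappa> (transpose a b x) = \<kappa> x" for x using that(4) by(simp add: transpose_def)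
  moreover have "transpose a b o w permutes {1..n}"
   using permutes_compose[OF _ permutes_swap_id[OF that(2,3)]] that(1) by(simp add: Q_def)
  ultimately show ?thesis using that(1) by(simp add: Q_def)
 qed
 have st: "P (transpose j (j + 1) o w)" if "1 <= j" "j < n" "\<kappa> j = \<kappa> (j + 1)" "Q w" "P w" for j w
  using that swap by(simp add: Q_def)
 have tr: "P (transpose a (a + k) o w)" if "Q w" "P w" "1 <= a" "a + k <= n" "\<kappa> a = \<kappa> (a + k)" for a k w
  using that
 proof (induction k arbitrary: a w)
  case 0
  thus ?case by simp
 next
  case (Suc k)
  have k1: "\<kappa> a = \<kappa> (a + 1)"
  proof (rule antisym)
   show "\<kappa> a <= \<kappa> (a + 1)" using Suc.prems by(intro mono_onD[OF mono]) auto
   have "\<kappa> (a + 1) <= \<kappa> (a + Suc k)" using Suc.prems by(intro mono_onD[OF mono]) auto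
   thus "\<kappa> (a + 1) <= \<kappa> a" using Suc.prems by simp
  qed
  show ?case
  proof (cases k)
   case 0
   hence e: "a + Suc k = a + 1" by simp
   show ?thesis unfolding e by(rule st[OF _ _ k1 Suc.prems(1,2)]) (use Suc.prems in auto)
  next
   case (Suc k')
   let ?w1 = "transpose a (a + 1) o w"
   let ?w2 = "transpose (a + 1) (a + 1 + k) o ?w1"
   have a: "1 <= a" "a < n" "a + 1 : {1..n}" "a : {1..n}" "a + 1 + k : {1..n}" "\<kappa> (a + 1) = \<kappa> (a + 1 + k)"
   proof -
    have e: "a + 1 + k = a + Suc k" by simp
    show "\<kappa> (a + 1) = \<kappa> (a + 1 + k)" unfolding e using Suc.prems k1 by simp
   qed (use Suc.prems in auto)
   have 1: "Q ?w1" "P ?w1" by(rule Qt[OF Suc.prems(1) a(4,3) k1]) (rule st[OF a(1,2) k1 Suc.prems(1,2)])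
   have 2: "P ?w2" by(rule Suc.IH[OF 1]) (use a Suc.prems in auto)
   have "Q ?w2" by(rule Qt[OF 1(1) a(3,5,6)])
   hence "P (transpose a (a + 1) o ?w2)" by(rule st[OF a(1,2) k1 _ 2])
   moreover have "transpose a (a + 1) o (transpose (a + 1) (a + 1 + k) o (transpose a (a + 1) o w)) =
     transpose a (a + Suc k) o w" using Suc by(auto simp: transpose_def fun_eq_iff)
   ultimately show ?thesis by(rule back_subst[of P])
  qed
 qed
 have tr': "P (transpose a b o w)" if "Q w" "P w" "a : {1..n}" "b : {1..n}" "\<kappa> a = \<kappa> b" for a b w
 proof (cases "a <= b")
  case True
  thus ?thesis using tr[of w a "b - a"] that by simp
 next
  case False
  thus ?thesis using tr[of w b "a - b"] that by(simp add: transpose_commute)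
 qed
 have "Q w ==> P w"
 proof (induction "card {x \<in> {1..n}. w x ~= x}" arbitrary: w rule: less_induct)
  case less
  show ?case
  proof (cases "\<exists>x\<in>{1..n}. w x ~= x")
   case False
   hence "w = id" using less.prems by(auto simp: Q_def fun_eq_iff permutes_not_in)
   thus ?thesis using id by simp
  next
   case True
   then obtain x where x: "x : {1..n}" "w x ~= x" by blast
   have wp: "w permutes {1..n}" using less.prems by(simp add: Q_def)
   have wx: "w x : {1..n}" by(rule permutes_range(1)[OF wp x(1)])
   define v where "v = transpose x (w x) o w"
   have Qv: "Q v" unfolding v_def by(rule Qt) (use less.prems x wx in \<open>auto simp: Q_def\<close>)
   have "v y = y" if "w y = y" for y
    using that x(2) permutes_inj[OF wp] by(auto simp: v_def transpose_def inj_eq)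
   moreover have "v x = x" by(simp add: v_def)
   ultimately have "{y \<in> {1..n}. v y ~= y} \<subset> {y \<in> {1..n}. w y ~= y}" using x by blast
   hence "card {y \<in> {1..n}. v y ~= y} < card {y \<in> {1..n}. w y ~= y}" by(intro psubset_card_mono) auto
   hence "P v" by(rule less.hyps[OF _ Qv])
   have "P (transpose x (w x) o v)" by(rule tr'[OF Qv \<open>P v\<close> x(1) wx]) (use less.prems x in \<open>auto simp: Q_def\<close>)
   moreover have "transpose x (w x) o v = w" by(auto simp: v_def fun_eq_iff)
   ultimately show ?thesis by simp
  qed
 qed
 thus ?thesis using w pres by(simp add: Q_def)
qed

section \<open>Blocks\<close>

definition color :: "nat => (nat => nat) => nat => nat" where "color m a j = (THE i. i < m & j : block a i)"

lemma block_eq: "block a i = {offset a i<..offset a i + a i}"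
 by(auto simp: block_def offset_def simp flip: lessThan_Suc_atMost)

lemma offset_Suc: "offset a (Suc i) = offset a i + a i" by(simp add: offset_def)

lemma offset_mono: "i <= j ==> offset a i <= offset a j" unfolding offset_def by(rule sum_mono2) auto

lemma block_unique:
 assumes "j : block a i" "j : block a i'"
 shows "i = i'"
proof (rule ccontr)
 assume "i ~= i'"
 then consider "Suc i <= i'" | "Suc i' <= i" by linarith
 thus False using assms offset_mono[of "Suc i" i' a] offset_mono[of "Suc i'" i a]
  by cases (auto simp: block_eq offset_Suc)
qed

lemma block_exists: "0 < j ==> j <= offset a k ==> \<exists>i<k. j : block a i"
proof (induction k)
 case 0
 thus ?case by(simp add: offset_def)
next
 case (Suc k)
 show ?case
 proof (cases "j <= offset a k")
  case True
  thus ?thesis using Suc less_SucI by blast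
 next
  case False
  hence "j : block a k" using Suc.prems by(simp add: block_eq offset_Suc)
  thus ?thesis by blast
 qed
qed

lemma color_eq: "i < m ==> j : block a i ==> color m a j = i"
 unfolding color_def by(rule the_equality) (use block_unique in blast)+

lemma finite_block [simp]: "finite (block a i)" by(simp add: block_eq)

lemma card_block: "card (block a i) = a i" by(simp add: block_eq)

context
 fixes m n :: nat and a :: "nat => nat"
 assumes a: "a : comps m n"
begin

lemma offset_comps: "offset a m = n" using a by(simp add: comps_def offset_def)

lemma color_block:
 assumes "j : {1..n}"
 shows "color m a j < m" "j : block a (color m a j)"
proof -
 obtain i where i: "i < m" "j : block a i" using block_exists[of j a m] assms by(auto simp: offset_comps)
 thus "color m a j < m" "j : block a (color m a j)" using color_eq[OF i] by simp_all
qed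

lemma block_subset: "i < m ==> block a i <= {1..n}"
 using offset_mono[of "Suc i" m a] by(auto simp: block_eq offset_Suc offset_comps)

lemma block_color_iff: "i < m ==> j : {1..n} ==> j : block a i \<longleftrightarrow> color m a j = i"
 using color_eq color_block by blast

lemma UN_blocks: "(\<Union>i<m. block a i) = {1..n}" using block_subset color_block by blast

lemma color_mono: "mono_on {1..n} (color m a)"
proof (rule mono_onI, rule ccontr)
 fix r s assume rs: "r : {1..n}" "s : {1..n}" "r <= s" "\<not> color m a r <= color m a s"
 have "offset a (Suc (color m a s)) <= offset a (color m a r)" using rs by(intro offset_mono) simp
 thus False using color_block(2)[OF rs(1)] color_block(2)[OF rs(2)] rs(3) by(auto simp: block_eq offset_Suc)
qed

text \<open>Since the block sizes are finite, a permutation that preserves the index of the block preserves each block.\<close>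

lemma young_subgroup_iff: "w : ysub m n a \<longleftrightarrow> w permutes {1..n} & (\<forall>j\<in>{1..n}. color m a (w j) = color m a j)"
proof
 assume w: "w : ysub m n a"
 hence p: "w permutes {1..n}" by(simp add: young_subgroup_def sym_group_carrier)
 moreover have "color m a (w j) = color m a j" if j: "j : {1..n}" for j
 proof -
  note c = color_block[OF j]
  have "w ` block a (color m a j) = block a (color m a j)" using w c by(simp add: young_subgroup_def)
  hence "w j : block a (color m a j)" using c by blast
  thus ?thesis by(rule color_eq[OF c(1)])
 qed
 ultimately show "w permutes {1..n} & (\<forall>j\<in>{1..n}. color m a (w j) = color m a j)" by blast
next
 assume R: "w permutes {1..n} & (\<forall>j\<in>{1..n}. color m a (w j) = color m a j)"
 have "w ` block a i = block a i" if i: "i < m" for i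
 proof (rule endo_inj_surj)
  show "w ` block a i <= block a i"
  proof
   fix x assume "x : w ` block a i"
   then obtain j where j: "j : block a i" "x = w j" by blast
   hence jn: "j : {1..n}" using block_subset[OF i] by blast
   hence "color m a x = i" using R j color_eq[OF i j(1)] by simp
   moreover have "x : {1..n}" unfolding j(2) using R jn permutes_range(1) by blast
   ultimately show "x : block a i" using block_color_iff[OF i] by blast
  qed
  show "inj_on w (block a i)" using R permutes_inj inj_on_subset by blast
 qed simp
 thus "w : ysub m n a" using R by(simp add: young_subgroup_def sym_group_carrier)
qed

lemma young_permutes: "w : ysub m n a ==> w permutes {1..n}" by(simp add: young_subgroup_iff)

end

section \<open>Characters of the torus\<close>

definition torus_chr :: "nat => complex => (nat => int) => (nat => int) => complex" where
 "torus_chr n \<eta> c t = (\<Prod>j=1..n. \<eta> powi (c j * t j))"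

text \<open>The exponents of \<open>\<mu>\<^sub>a\<close>: all characters of \<open>T\<close> are \<open>t \<mapsto> \<Prod>\<^sub>j \<eta>\<^bsup>c\<^sub>j t\<^sub>j\<^esup>\<close> for a label \<open>c\<close>, which is again an element of \<open>T\<close>.\<close>

definition label :: "nat => nat => (nat => nat) => nat => int" where
 "label m n a = (\<lambda>j\<in>{1..n}. int (color m a j))"

lemma torus_chr_commute: "torus_chr n \<eta> c t = torus_chr n \<eta> t c" by(simp add: torus_chr_def mult.commute)

lemma mu_torus_chr:
 assumes a: "a : comps m n"
 shows "mu m \<eta> a t = torus_chr n \<eta> (label m n a) t"
proof -
 have "mu m \<eta> a t = (\<Prod>i<m. \<Prod>j\<in>block a i. \<eta> powi (label m n a j * t j))" unfolding mu_def
 proof (intro prod.cong refl)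
  fix i j assume "i : {..<m}" "j : block a i"
  hence "label m n a j = int i" using color_eq[of i m j a] block_subset[OF a, of i] by(auto simp: label_def)
  thus "(\<eta> ^ i) powi t j = \<eta> powi (label m n a j * t j)" by(simp add: power_int_power)
 qed
 also have "... = (\<Prod>j\<in>(\<Union>i<m. block a i). \<eta> powi (label m n a j * t j))"
  by(rule prod.UNION_disjoint[symmetric]) (use block_unique in auto)
 finally show ?thesis by(simp add: UN_blocks[OF a] torus_chr_def)
qed

locale refl_root = refl_params +
 fixes \<eta> :: complex
 assumes primitive: "primitive_root m \<eta>"
begin

abbreviation "chr == torus_chr n \<eta>"

lemma root_nonzero: "\<eta> ~= 0"
proof
 assume "\<eta> = 0"
 thus False using primitive m_pos by(auto simp: primitive_root_def zero_power)
qed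

lemma root_power_m: "\<eta> ^ m = 1" using primitive by(simp add: primitive_root_def)

lemma root_mod: "\<eta> powi (x mod int m) = \<eta> powi x"
proof -
 have "\<eta> powi x = \<eta> powi (int m * (x div int m) + x mod int m)" by simp
 also have "... = (\<eta> powi int m) powi (x div int m) * \<eta> powi (x mod int m)"
  using root_nonzero by(simp only: power_int_add power_int_mult simp_thms)
 finally show ?thesis using root_power_m by simp
qed

lemma root_cong: "x mod int m = y mod int m ==> \<eta> powi x = \<eta> powi y"
 using root_mod[of x] root_mod[of y] by simp

lemma root_eq_one_iff: "\<eta> powi d = 1 \<longleftrightarrow> int m dvd d"
proof
 assume "int m dvd d"
 thus "\<eta> powi d = 1" using root_mod[of d] by(simp add: dvd_eq_mod_eq_0)
next
 assume 1: "\<eta> powi d = 1"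
 have mm: "0 <= d mod int m" "d mod int m < int m" using m_pos by simp_all
 have "\<eta> ^ nat (d mod int m) = 1" using 1 root_mod[of d] mm by(simp add: power_int_def split: if_splits)
 moreover have "nat (d mod int m) < m" using mm by linarith
 ultimately have "nat (d mod int m) = 0" using primitive unfolding primitive_root_def by(metis gr0I)
 thus "int m dvd d" using mm by(simp add: dvd_eq_mod_eq_0)
qed

lemma root_sum: "(\<Sum>x\<in>{0..<int m}. \<eta> powi (d * x)) = (if int m dvd d then of_nat m else 0)"
proof -
 have "(\<Sum>x\<in>{0..<int m}. \<eta> powi (d * x)) = (\<Sum>l<m. \<eta> powi (d * int l))"
  by(rule sum.reindex_bij_witness[of _ int nat]) auto
 also have "... = (\<Sum>l<m. (\<eta> powi d) ^ l)" by(simp add: power_int_mult)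
 also have "... = (if int m dvd d then of_nat m else 0)"
 proof (cases "int m dvd d")
  case True
  hence "\<eta> powi d = 1" by(simp add: root_eq_one_iff)
  thus ?thesis using True by simp
 next
  case False
  hence ne: "\<eta> powi d ~= 1" by(simp add: root_eq_one_iff)
  have "(\<eta> powi d) ^ m = \<eta> powi (d * int m)" by(simp add: power_int_mult)
  also have "... = 1" by(simp add: root_eq_one_iff)
  finally show ?thesis using False sum_gp_strict[of "\<eta> powi d" m] ne by(simp add: lessThan_atLeast0)
 qed
 finally show ?thesis .
qed

lemma chr_nonzero: "chr c t ~= 0" using root_nonzero by(simp add: torus_chr_def)

lemma chr_mult: "chr c (t \<otimes>\<^sub>TT t') = chr c t * chr c t'" unfolding torus_chr_def prod.distrib[symmetric]
proof (rule prod.cong[OF refl])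
 fix j assume "j : {1..n}"
 have "\<eta> powi (c j * ((t j + t' j) mod int m)) = \<eta> powi (c j * (t j + t' j))"
  by(rule root_cong) (simp add: mod_simps)
 also have "... = \<eta> powi (c j * t j) * \<eta> powi (c j * t' j)"
  using root_nonzero by(simp add: distrib_left power_int_add)
 finally show "\<eta> powi (c j * (t \<otimes>\<^sub>TT t') j) = \<eta> powi (c j * t j) * \<eta> powi (c j * t' j)"
  using \<open>j : {1..n}\<close> by(simp add: torus_mult)
qed

lemma chr_one: "chr c \<one>\<^sub>TT = 1" by(simp add: torus_chr_def torus_one)

lemma chr_perm:
 assumes "w permutes {1..n}"
 shows "chr (pcoords n w c) (pcoords n w t) = chr c t"
proof -
 have "chr (pcoords n w c) (pcoords n w t) = (\<Prod>j\<in>{1..n}. \<eta> powi (pcoords n w c (w j) * pcoords n w t (w j)))"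
  unfolding torus_chr_def by(rule prod.permute[OF assms, unfolded comp_def])
 also have "... = chr c t"
  unfolding torus_chr_def by(rule prod.cong[OF refl]) (simp add: pcoords_apply_perm[OF assms])
 finally show ?thesis .
qed

lemma chr_minus: "chr (%j. c j - d j) t = chr c t / chr d t" using root_nonzero
 by(simp add: torus_chr_def left_diff_distrib power_int_diff prod_dividef)

lemma chr_sum: "(\<Sum>t\<in>carrier TT. chr c t) = (if \<forall>j\<in>{1..n}. int m dvd c j then of_nat (m ^ n) else 0)"
proof -
 have "(\<Sum>t\<in>carrier TT. chr c t) = (\<Prod>j\<in>{1..n}. \<Sum>x\<in>{0..<int m}. \<eta> powi (c j * x))"
  unfolding torus_carrier torus_chr_def by(rule prod_sum_PiE[symmetric]) auto
 also have "... = (\<Prod>j\<in>{1..n}. if int m dvd c j then of_nat m else 0)" by(simp add: root_sum)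
 also have "... = (if \<forall>j\<in>{1..n}. int m dvd c j then of_nat (m ^ n) else 0)"
 proof (cases "\<forall>j\<in>{1..n}. int m dvd c j")
  case True
  thus ?thesis by simp
 next
  case False
  then obtain j where "j : {1..n}" "\<not> int m dvd c j" by blast
  thus ?thesis using False by(auto intro!: prod_zero bexI[of _ j])
 qed
 finally show ?thesis .
qed

lemma torus_dvd_diff:
 assumes "c :. TT" "d :. TT" "\<forall>j\<in>{1..n}. int m dvd c j - d j"
 shows "c = d"
proof (rule torus_ext[OF assms(1,2)])
 fix j assume j: "j : {1..n}"
 have "\<bar>c j - d j\<bar> < int m" using torusD[OF assms(1) j] torusD[OF assms(2) j] by linarith
 thus "c j = d j" using assms(3) j zdvd_not_zless[of "c j - d j"] dvd_imp_le_int[of "c j - d j" "int m"] by force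
qed

lemma chr_orthogonal:
 assumes "c :. TT" "d :. TT"
 shows "(\<Sum>t\<in>carrier TT. chr c t / chr d t) = (if c = d then of_nat (m ^ n) else 0)"
proof -
 have "(\<Sum>t\<in>carrier TT. chr c t / chr d t) = (\<Sum>t\<in>carrier TT. chr (%j. c j - d j) t)" by(simp add: chr_minus)
 thus ?thesis using torus_dvd_diff[OF assms] by(auto simp: chr_sum)
qed

text \<open>The pairing between the torus and its labels is symmetric; therefore the orthogonality relations also give
 the decomposition of the identity into the projections to isotypic parts.\<close>

lemma chr_sum_dual:
 assumes "t :. TT"
 shows "(\<Sum>c\<in>carrier TT. inverse (chr c t)) = (if t = \<one>\<^sub>TT then of_nat (m ^ n) else 0)"
proof -
 have "(\<Sum>c\<in>carrier TT. inverse (chr c t)) = (\<Sum>c\<in>carrier TT. chr \<one>\<^sub>TT c / chr t c)"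
  using chr_one by(simp add: torus_chr_commute[of n \<eta> _ t] torus_chr_commute[of n \<eta> "\<one>\<^sub>TT"] inverse_eq_divide)
 thus ?thesis using chr_orthogonal[OF torus_one_closed assms] by auto
qed

lemma label_torus:
 assumes "a : comps m n"
 shows "label m n a :. TT" unfolding label_def by(rule torusI) (use color_block(1)[OF assms] in auto)

lemma card_label:
 assumes a: "a : comps m n" and w: "w permutes {1..n}" and i: "i < m"
 shows "card {j \<in> {1..n}. pcoords n w (label m n a) j = int i} = a i"
proof -
 have "w ` block a i = {j \<in> {1..n}. pcoords n w (label m n a) j = int i}"
 proof (intro equalityI subsetI)
  fix x assume "x : w ` block a i"
  then obtain j where j: "j : block a i" "x = w j" by blast
  hence jn: "j : {1..n}" using block_subset[OF a i] by blast
  thus "x : {j \<in> {1..n}. pcoords n w (label m n a) j = int i}"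
   using permutes_range(1)[OF w jn] color_eq[OF i j(1)] j(2)
   by(simp add: pcoords_apply_perm[OF w jn] label_def)
 next
  fix x assume x: "x : {j \<in> {1..n}. pcoords n w (label m n a) j = int i}"
  hence xn: "x : {1..n}" by simp
  let ?j = "inv_into UNIV w x"
  have jn: "?j : {1..n}" by(rule permutes_range(2)[OF w xn])
  have "label m n a ?j = int i" using x pcoords_apply[OF xn, of w "label m n a"] by simp
  hence "color m a ?j = i" using jn by(simp add: label_def)
  hence "?j : block a i" using block_color_iff[OF a i jn] by simp
  moreover have "x = w ?j" using permutes_inverses(1)[OF w] by simp
  ultimately show "x : w ` block a i" by blast
 qed
 moreover have "inj_on w (block a i)" using permutes_inj[OF w] inj_on_subset by blast
 ultimately show ?thesis using card_image[of w "block a i"] by(simp add: card_block)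
qed

text \<open>The number of indices with label \<open>i\<close> is invariant under permutations and equals \<open>a\<^sub>i\<close>.\<close>

lemma orbit_unique:
 assumes a: "a : comps m n" "a' : comps m n" and w: "w permutes {1..n}" "w' permutes {1..n}"
  and eq: "pcoords n w (label m n a) = pcoords n w' (label m n a')"
 shows "a = a'" "inv_into UNIV w o w' : ysub m n a"
proof -
 have "a i = a' i" if "i < m" for i
  using card_label[OF a(1) w(1) that] card_label[OF a(2) w(2) that] eq by simp
 thus aa: "a = a'" using a by(intro PiE_ext[of _ "{..<m}" "%_. UNIV"]) (auto simp: comps_def)
 have "color m a ((inv_into UNIV w o w') j) = color m a j" if j: "j : {1..n}" for j
 proof -
  have wj: "w' j : {1..n}" by(rule permutes_range(1)[OF w(2) j])
  have "pcoords n w (label m n a) (w' j) = pcoords n w' (label m n a) (w' j)" using eq aa by simp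
  hence "label m n a (inv_into UNIV w (w' j)) = label m n a j" using pcoords_apply[OF wj, of w "label m n a"]
    pcoords_apply_perm[OF w(2) j, of "label m n a"] by(simp only:)
  thus ?thesis using permutes_range(2)[OF w(1) wj] j by(simp add: label_def)
 qed
 thus "inv_into UNIV w o w' : ysub m n a"
  using permutes_compose[OF w(2) permutes_inv[OF w(1)]] by(simp add: young_subgroup_iff[OF a(1)])
qed

text \<open>A permutation that sorts the entries of \<open>c\<close> carries \<open>c\<close> to the label of the composition counting the entries.\<close>

lemma orbit_exists:
 assumes c: "c :. TT"
 shows "\<exists>a\<in>comps m n. \<exists>w. w permutes {1..n} & c = pcoords n w (label m n a)"
proof -
 define a where "a = (\<lambda>i\<in>{..<m}. card {j \<in> {1..n}. c j = int i})"
 have "(\<Sum>i<m. a i) = card (\<Union>i<m. {j \<in> {1..n}. c j = int i})" unfolding a_def by(subst card_UN_disjoint) auto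
 also have "(\<Union>i<m. {j \<in> {1..n}. c j = int i}) = {1..n}"
 proof (intro equalityI subsetI)
  fix j assume j: "j : {1..n}"
  have "nat (c j) : {..<m}" "c j = int (nat (c j))" using torusD[OF c j] by auto
  thus "j : (\<Union>i<m. {j \<in> {1..n}. c j = int i})" using j by blast
 qed auto
 finally have a: "a : comps m n" by(auto simp: comps_def a_def)
 have cnt: "count (image_mset f (mset_set {1..n})) y = card {j \<in> {1..n}. f j = y}" for f :: "nat => int" and y
 proof -
  have "count (image_mset f (mset_set {1..n})) y = (\<Sum>x\<in>{j \<in> {1..n}. f j = y}. count (mset_set {1..n}) x)"
   unfolding count_image_mset by(rule sum.cong) auto
  thus ?thesis by simp
 qed
 have "image_mset c (mset_set {1..n}) = image_mset (label m n a) (mset_set {1..n})"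
 proof (rule multiset_eqI)
  fix y
  have lab: "pcoords n id (label m n a) = label m n a" by(rule pcoords_id) (simp add: label_def)
  show "count (image_mset c (mset_set {1..n})) y = count (image_mset (label m n a) (mset_set {1..n})) y"
  proof (cases "0 <= y & y < int m")
   case True
   then obtain i where i: "y = int i" "i < m" by(metis nonneg_int_cases of_nat_less_iff)
   thus ?thesis using card_label[OF a permutes_id i(2)] unfolding cnt lab by(simp add: a_def)
  next
   case False
   hence "{j \<in> {1..n}. c j = y} = {}" "{j \<in> {1..n}. label m n a j = y} = {}"
    using torusD[OF c] torusD[OF label_torus[OF a]] by auto
   thus ?thesis unfolding cnt by(simp only:)
  qed
 qed
 then obtain p where p: "p permutes {1..n}" "\<forall>x\<in>{1..n}. c x = label m n a (p x)"
  using image_mset_eq_implies_permutes[OF finite_atLeastAtMost] by metis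
 have ip: "inv_into UNIV p permutes {1..n}" by(rule permutes_inv[OF p(1)])
 have "c = pcoords n (inv_into UNIV p) (label m n a)" using p permutes_inv_inv[OF p(1)]
  by(intro torus_ext[OF c pcoords_torus[OF ip label_torus[OF a]]]) (simp add: pcoords_apply)
 thus ?thesis using a ip by blast
qed

lemma mu_young_invariant:
 assumes a: "a : comps m n" and w: "w : ysub m n a"
 shows "mu m \<eta> a (pcoords n w t) = mu m \<eta> a t"
proof -
 have p: "w permutes {1..n}" by(rule young_permutes[OF a w])
 have "pcoords n w (label m n a) = label m n a"
 proof (rule torus_ext[OF pcoords_torus[OF p label_torus[OF a]] label_torus[OF a]])
  fix j assume j: "j : {1..n}"
  let ?i = "inv_into UNIV w j"
  have i: "?i : {1..n}" by(rule permutes_range(2)[OF p j])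
  have "color m a (w ?i) = color m a ?i" using w i by(simp add: young_subgroup_iff[OF a])
  thus "pcoords n w (label m n a) j = label m n a j"
   using i j permutes_inverses(1)[OF p] by(simp add: pcoords_apply label_def)
 qed
 thus ?thesis using chr_perm[OF p, of "label m n a" t] by(simp add: mu_torus_chr[OF a])
qed

end

section \<open>Dirac elements\<close>

text \<open>The difference of the sums over \<open>r > i\<close> and over \<open>r < i\<close> in the Dirac operators is one sum with this sign.\<close>

definition order_sign :: "nat => nat => complex" where
 "order_sign i r = (if i < r then 1 else if r < i then - 1 else 0)"

lemma order_sign_swap: "order_sign i (transpose j (j + 1) r) =
   order_sign (transpose j (j + 1) i) r + (if r = i then 2 * order_sign i (transpose j (j + 1) i) else 0)"
 by(auto simp: order_sign_def transpose_def)

text \<open>The elements paired with the basis vectors of the Clifford algebra, for both algebras: \<open>R i r\<close> is the reflection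
 term of the pair \<open>i\<close>, \<open>r\<close>.\<close>

definition dirac_elt ::
 "(complex, 'a, 'z) module_scheme => nat => complex => (nat => 'a) => (nat => nat => 'a) => nat => 'a" where
 "dirac_elt A n k z R i = z i \<oplus>\<^sub>A (k / 2) \<odot>\<^sub>A (\<Oplus>\<^sub>A r\<in>{1..n}. order_sign i r \<odot>\<^sub>A R i r)"

lemma (in ring)
 assumes "a :. R" "b :. R" "c :. R"
 shows mult_diff_right: "a \<otimes> (b \<ominus> c) = a \<otimes> b \<ominus> a \<otimes> c" and mult_diff_left: "(b \<ominus> c) \<otimes> a = b \<otimes> a \<ominus> c \<otimes> a"
 using assms by(simp_all add: a_minus_def r_distr l_distr r_minus l_minus)

lemma (in abelian_group) diff_add_cancel_right:
 assumes "a :. G" "b :. G" "c :. G"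
 shows "(a \<ominus> b) \<oplus> (c \<oplus> b) = a \<oplus> c"
proof -
 have "(a \<ominus> b) \<oplus> (c \<oplus> b) = a \<oplus> c \<oplus> (\<ominus> b \<oplus> b)" using assms by(simp add: a_minus_def a_ac)
 thus ?thesis using assms by(simp add: l_neg)
qed

context calg
begin

lemma smult_finsum:
 assumes "finite I" "!!i. i : I ==> f i :. A"
 shows "c \<odot> (\<Oplus>i\<in>I. f i) = (\<Oplus>i\<in>I. c \<odot> f i)"
 by(rule lin_finsum[OF cspace cspace lin_const_smult[OF cspace lin_id]]) (use assms in auto)

lemma dirac_elt_closed:
 assumes "!!i. i : {1..n} ==> z i :. A" "!!i j. i : {1..n} ==> j : {1..n} ==> R i j :. A" "i : {1..n}"
 shows "dirac_elt A n k z R i :. A" using assms by(auto simp: dirac_elt_def intro!: finsum_closed)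

text \<open>Conjugation by the simple reflection \<open>u\<close> permutes the reflection terms.  Of the signs only that of the pair
 \<open>j\<close>, \<open>j + 1\<close> is reversed, and the resulting change of \<open>(k / 2) R j (j + 1)\<close> into its negative is exactly the correction in
 the Hecke relation between \<open>u\<close> and \<open>z\<^sub>j\<close>.  This is why the Dirac elements, unlike the \<open>z\<^sub>j\<close>, are permuted by the group.\<close>

lemma dirac_elt_swap:
 assumes z: "!!i. i : {1..n} ==> z i :. A" and R: "!!i j. i : {1..n} ==> j : {1..n} ==> R i j :. A"
  and u: "u :. A" "u \<otimes> u = \<one>" and j: "1 <= j" "j < n" and uR: "!!i r. i : {1..n} ==> r : {1..n} ==>
   u \<otimes> R i r = R (transpose j (j + 1) i) (transpose j (j + 1) r) \<otimes> u" and R_sym: "R j (j + 1) = R (j + 1) j"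
  and far: "!!i. i : {1..n} ==> i ~= j ==> i ~= j + 1 ==> z i \<otimes> u = u \<otimes> z i"
  and near: "z j \<otimes> u = u \<otimes> z (j + 1) \<ominus> k \<odot> (u \<otimes> R j (j + 1))" and i: "i : {1..n}"
 shows "u \<otimes> dirac_elt A n k z R i = dirac_elt A n k z R (transpose j (j + 1) i) \<otimes> u"
proof -
 let ?s = "transpose j (j + 1)" and ?N = "{1..n}"
 have jn: "j : ?N" "j + 1 : ?N" using j by auto
 have sN: "?s r : ?N" if "r : ?N" for r using that jn by(auto simp: transpose_def)
 have bs: "bij_betw ?s ?N ?N" by(rule permutes_imp_bij[OF permutes_swap_id[OF jn]])
 define E where "E i = (\<Oplus>r\<in>?N. order_sign i r \<odot> R i r)" for i
 have Ec: "E i :. A" if "i : ?N" for i using that R by(auto simp: E_def intro!: finsum_closed)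
 have Rc: "R (?s i) i :. A" using R sN i by simp
 have sum: "u \<otimes> E i = (E (?s i) \<oplus> (2 * order_sign i (?s i)) \<odot> R (?s i) i) \<otimes> u"
 proof -
  have "u \<otimes> E i = (\<Oplus>r\<in>?N. u \<otimes> (order_sign i r \<odot> R i r))"
   unfolding E_def by(rule finsum_rdistr) (use u R i in auto)
  also have "... = (\<Oplus>r\<in>?N. (order_sign i r \<odot> R (?s i) (?s r)) \<otimes> u)" by(rule finsum_cong')
    (use u R i sN uR in \<open>auto simp: smult_mult_left smult_mult_right\<close>)
  also have "... = (\<Oplus>r\<in>?N. order_sign i r \<odot> R (?s i) (?s r)) \<otimes> u"
   by(rule finsum_ldistr[symmetric]) (use u R i sN in auto)
  also have "(\<Oplus>r\<in>?N. order_sign i r \<odot> R (?s i) (?s r)) =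
    (\<Oplus>r\<in>?N. (%r. order_sign i (?s r) \<odot> R (?s i) r) (?s r))" by simp
  also have "... = (\<Oplus>r\<in>?s ` ?N. order_sign i (?s r) \<odot> R (?s i) r)"
   by(rule add.finprod_reindex[symmetric]) (use bs R i sN in \<open>auto simp: bij_betw_def\<close>)
  also have "?s ` ?N = ?N" using bs by(simp add: bij_betw_def)
  also have "(\<Oplus>r\<in>?N. order_sign i (?s r) \<odot> R (?s i) r) =
    (\<Oplus>r\<in>?N. order_sign (?s i) r \<odot> R (?s i) r \<oplus> (if i = r then (2 * order_sign i (?s i)) \<odot> R (?s i) r else \<zero>))"
  proof (rule finsum_cong')
   fix r assume r: "r : ?N"
   have Rr: "R (?s i) r :. A" using R sN i r by simp
   show "order_sign i (?s r) \<odot> R (?s i) r =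
    order_sign (?s i) r \<odot> R (?s i) r \<oplus> (if i = r then (2 * order_sign i (?s i)) \<odot> R (?s i) r else \<zero>)"
    unfolding order_sign_swap[of i j r] scale_plus[OF cspace Rr] using Rr by(auto simp: scale_zero[OF cspace])
  qed (use R sN i in auto)
  also have "... = E (?s i) \<oplus> (\<Oplus>r\<in>?N. (if i = r then (2 * order_sign i (?s i)) \<odot> R (?s i) r else \<zero>))"
   unfolding E_def by(rule finsum_addf) (use R sN i in auto)
  also have "(\<Oplus>r\<in>?N. (if i = r then (2 * order_sign i (?s i)) \<odot> R (?s i) r else \<zero>)) =
    (2 * order_sign i (?s i)) \<odot> R (?s i) i" by(rule add.finprod_singleton) (use R sN i in auto)
  finally show ?thesis .
 qed
 \<comment> \<open>the correction in the Hecke relation has coefficient \<open>k\<close> for \<open>i = j\<close>, \<open>- k\<close> for \<open>i = j + 1\<close> and \<open>0\<close> otherwise\<close>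
 have zz: "u \<otimes> z i = z (?s i) \<otimes> u \<ominus> (k * order_sign i (?s i)) \<odot> (R (?s i) i \<otimes> u)"
 proof -
  have R': "R j (j + 1) :. A" using R jn by simp
  have uRj: "u \<otimes> R j (j + 1) = R j (j + 1) \<otimes> u" using uR[OF jn] R_sym by simp
  have zc: "z j :. A" "z (j + 1) :. A" using z jn by auto
  consider "i = j" | "i = j + 1" | "i ~= j" "i ~= j + 1" by blast
  thus ?thesis
  proof cases
   case 1
   have uc: "u \<otimes> z (j + 1) :. A" "k \<odot> (u \<otimes> R j (j + 1)) :. A" using u(1) zc R' by auto
   have uu: "u \<otimes> (u \<otimes> x) \<otimes> u = x \<otimes> u" if "x :. A" for x using u that by(simp add: m_assoc[symmetric])
   have "u \<otimes> z j = u \<otimes> (z j \<otimes> u) \<otimes> u" using u zc by(simp add: m_assoc)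
   also have "... = u \<otimes> (u \<otimes> z (j + 1) \<ominus> k \<odot> (u \<otimes> R j (j + 1))) \<otimes> u" by(simp only: near)
   also have "... = u \<otimes> (u \<otimes> z (j + 1)) \<otimes> u \<ominus> u \<otimes> (k \<odot> (u \<otimes> R j (j + 1))) \<otimes> u"
    using u(1) uc by(simp add: mult_diff_right mult_diff_left del: m_assoc)
   also have "... = z (j + 1) \<otimes> u \<ominus> k \<odot> (R j (j + 1) \<otimes> u)"
    using u(1) zc R' by(simp add: smult_mult_left smult_mult_right uu)
   finally have "u \<otimes> z j = z (j + 1) \<otimes> u \<ominus> k \<odot> (R j (j + 1) \<otimes> u)" .
   moreover have "?s i = j + 1" "order_sign i (?s i) = 1" using 1 by(simp_all add: order_sign_def)
   ultimately show ?thesis using 1 R_sym by simp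
  next
   case 2
   have "u \<otimes> z (j + 1) = z j \<otimes> u \<oplus> k \<odot> (u \<otimes> R j (j + 1))"
    using u zc R' by(simp add: near a_minus_def a_assoc l_neg)
   moreover have si: "?s i = j" "order_sign i (?s i) = - 1" using 2 by(simp_all add: order_sign_def)
   moreover have "\<ominus> ((k * - 1) \<odot> (R j (j + 1) \<otimes> u)) = k \<odot> (R j (j + 1) \<otimes> u)"
    using u R' smult_minus_one[OF cspace, of "(k * - 1) \<odot> (R j (j + 1) \<otimes> u)"]
    by(simp add: scale_scale[OF cspace])
   ultimately show ?thesis using 2 uRj by(simp add: a_minus_def)
  next
   case 3
   hence si: "?s i = i" by(simp add: transpose_def)
   have "z i \<otimes> u \<ominus> (0 :: complex) \<odot> (R i i \<otimes> u) = z i \<otimes> u"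
    using R u z i by(simp add: scale_zero[OF cspace] a_minus_def)
   thus ?thesis using far[OF i 3] by(simp add: si order_sign_def)
  qed
 qed
 let ?\<delta> = "order_sign i (?s i)"
 have zc: "z i :. A" "z (?s i) :. A" using z i sN by auto
 have "u \<otimes> dirac_elt A n k z R i = u \<otimes> z i \<oplus> (k / 2) \<odot> (u \<otimes> E i)"
  using u zc Ec[OF i] by(simp add: dirac_elt_def E_def[symmetric] r_distr smult_mult_right)
 also have "... = (z (?s i) \<otimes> u \<ominus> (k * ?\<delta>) \<odot> (R (?s i) i \<otimes> u)) \<oplus>
   ((k / 2) \<odot> (E (?s i) \<otimes> u) \<oplus> (k * ?\<delta>) \<odot> (R (?s i) i \<otimes> u))" using u Ec[OF sN[OF i]] Rc
  by(simp add: zz sum l_distr smult_mult_left scale_add[OF cspace] scale_scale[OF cspace])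
 also have "... = z (?s i) \<otimes> u \<oplus> (k / 2) \<odot> (E (?s i) \<otimes> u)" using u zc Ec[OF sN[OF i]] Rc
  by(intro diff_add_cancel_right) auto
 also have "... = dirac_elt A n k z R (?s i) \<otimes> u"
  using u zc Ec[OF sN[OF i]] by(simp add: dirac_elt_def E_def[symmetric] l_distr smult_mult_left)
 finally show ?thesis .
qed

text \<open>The Hecke relation is assumed for adjacent indices of the same class only.  With one class this covers the
 reflection group, with the blocks as classes a product of symmetric groups.\<close>

lemma dirac_elt_conj:
 fixes \<kappa> :: "nat => nat"
 assumes mono: "mono_on {1..n} \<kappa>" and z: "!!i. i : {1..n} ==> z i :. A"
  and R: "!!i j. i : {1..n} ==> j : {1..n} ==> R i j :. A"
  and u: "!!w. w permutes {1..n} ==> (!!r. r : {1..n} ==> \<kappa> (w r) = \<kappa> r) ==> u w :. A" and u_id: "u id = \<one>"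
  and u_mult: "!!w w'. w permutes {1..n} ==> (!!r. r : {1..n} ==> \<kappa> (w r) = \<kappa> r) ==>
    w' permutes {1..n} ==> (!!r. r : {1..n} ==> \<kappa> (w' r) = \<kappa> r) ==> u (w o w') = u w \<otimes> u w'"
  and uR: "!!w i j. w permutes {1..n} ==> (!!r. r : {1..n} ==> \<kappa> (w r) = \<kappa> r) ==>
    i : {1..n} ==> j : {1..n} ==> u w \<otimes> R i j = R (w i) (w j) \<otimes> u w"
  and R_sym: "!!j. 1 <= j ==> j < n ==> R j (j + 1) = R (j + 1) j"
  and far: "!!j i. 1 <= j ==> j < n ==> \<kappa> j = \<kappa> (j + 1) ==> i : {1..n} ==> i ~= j ==> i ~= j + 1 ==>
    z i \<otimes> u (transpose j (j + 1)) = u (transpose j (j + 1)) \<otimes> z i"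
  and near: "!!j. 1 <= j ==> j < n ==> \<kappa> j = \<kappa> (j + 1) ==> z j \<otimes> u (transpose j (j + 1)) =
    u (transpose j (j + 1)) \<otimes> z (j + 1) \<ominus> k \<odot> (u (transpose j (j + 1)) \<otimes> R j (j + 1))"
  and w: "w permutes {1..n}" "!!r. r : {1..n} ==> \<kappa> (w r) = \<kappa> r" and i: "i : {1..n}"
 shows "u w \<otimes> dirac_elt A n k z R i = dirac_elt A n k z R (w i) \<otimes> u w"
proof -
 let ?d = "dirac_elt A n k z R"
 have dc: "?d i :. A" if "i : {1..n}" for i by(rule dirac_elt_closed) (use z R that in auto)
 have "\<forall>i\<in>{1..n}. u w \<otimes> ?d i = ?d (w i) \<otimes> u w"
 proof (rule class_perm_induct[OF mono w])
  show "\<forall>i\<in>{1..n}. u id \<otimes> ?d i = ?d (id i) \<otimes> u id" using dc by(simp add: u_id)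
 next
  fix j w
  assume swap: "1 <= j" "j < n" "\<kappa> j = \<kappa> (j + 1)" "w permutes {1..n}" "!!r. r : {1..n} ==> \<kappa> (w r) = \<kappa> r"
   "\<forall>i\<in>{1..n}. u w \<otimes> ?d i = ?d (w i) \<otimes> u w"
  let ?s = "transpose j (j + 1)"
  have jn: "j : {1..n}" "j + 1 : {1..n}" using swap by auto
  have sp: "?s permutes {1..n}" by(rule permutes_swap_id[OF jn])
  have sk: "\<kappa> (?s r) = \<kappa> r" for r using swap(3) by(simp add: transpose_def)
  have ss: "u ?s \<otimes> u ?s = \<one>" using u_mult[OF sp sk sp sk] by(simp add: u_id)
  show "\<forall>i\<in>{1..n}. u (?s o w) \<otimes> ?d i = ?d ((?s o w) i) \<otimes> u (?s o w)"
  proof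
   fix i assume i: "i : {1..n}"
   have wi: "w i : {1..n}" by(rule permutes_range(1)[OF swap(4) i])
   have swi: "?s (w i) : {1..n}" by(rule permutes_range(1)[OF sp wi])
   have c: "u ?s :. A" "u w :. A" using u[OF sp sk] u[OF swap(4,5)] by auto
   have step: "u ?s \<otimes> ?d (w i) = ?d (?s (w i)) \<otimes> u ?s"
    by(rule dirac_elt_swap[OF z R c(1) ss swap(1,2) uR[OF sp sk] R_sym[OF swap(1,2)]
       far[OF swap(1-3)] near[OF swap(1-3)] wi])
   have "u (?s o w) \<otimes> ?d i = u ?s \<otimes> (u w \<otimes> ?d i)"
    using u_mult[OF sp sk swap(4,5)] c dc[OF i] by(simp add: m_assoc)
   also have "... = u ?s \<otimes> ?d (w i) \<otimes> u w" using swap(6) i c dc[OF wi] by(simp add: m_assoc)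
   also have "... = ?d (?s (w i)) \<otimes> u (?s o w)"
    unfolding step using u_mult[OF sp sk swap(4,5)] c dc[OF swi] by(simp add: m_assoc)
   finally show "u (?s o w) \<otimes> ?d i = ?d ((?s o w) i) \<otimes> u (?s o w)" by simp
  qed
 qed
 thus ?thesis using i by blast
qed

end

section \<open>Relations in Hecke algebras\<close>

lemma free_vs_finsum:
 assumes "finite I" "!!i. i : I ==> f i :. free_vs B"
 shows "(\<Oplus>\<^sub>(free_vs B)i\<in>I. f i) = (%x. \<Sum>i\<in>I. f i x)"
proof -
 interpret F: module CC "free_vs B" by(rule cspace_free_vs)
 show ?thesis using assms by(induction I rule: finite_induct) (simp_all add: F.M.finsum_insert Pi_def)
qed

lemma free_vs_sum_closed:
 assumes "finite I" "!!i. i : I ==> f i :. free_vs B"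
 shows "(%x. \<Sum>i\<in>I. f i x) :. free_vs B" using assms by(induction I rule: finite_induct) auto

text \<open>What the algebras defined by these generators share; \<open>R\<close> may contain more relations.\<close>

locale hecke_quotient =
 fixes G :: "('g, 'y) monoid_scheme" and n :: nat and s :: "nat => 'g"
  and Y :: "nat => 'g gen list => complex" and R :: "(('g gen list => complex) \<times> ('g gen list => complex)) set"
 assumes G: "group G" and sub: "hecke_rels G n s Y <= R"
  and R_closed: "R <= carrier (free_alg (hecke_gens G n)) \<times> carrier (free_alg (hecke_gens G n))"
  and s_closed: "i : {1..<n} ==> s i :. G" and Y_closed: "i : {1..<n} ==> Y i :. free_alg (hecke_gens G n)"
begin

abbreviation "FA == free_alg (hecke_gens G n)"
abbreviation "HA == alg_quot FA R"
abbreviation "cls == alg_class FA R"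
abbreviation "gen x == cls (delta [x])"

lemma HA_calg: "calg HA" by(rule alg_quot_calg[OF free_alg_calg R_closed])

lemma cls_lin: "cls : lin_maps (free_vs (lists (hecke_gens G n))) HA"
 using alg_class_lin[OF free_alg_calg R_closed] by simp

lemma cls_mult: "x :. FA ==> y :. FA ==> cls x \<otimes>\<^sub>HA cls y = cls (x \<otimes>\<^sub>FA y)"
 by(rule alg_class_mult[OF free_alg_calg R_closed])

lemma gen_closed: "x : hecke_gens G n ==> gen x :. HA"
 unfolding alg_quot_carrier[OF free_alg_calg R_closed] by(rule imageI) simp

lemma Elt_closed: "g :. G ==> gen (Elt g) :. HA" and Z_closed: "i : {1..n} ==> gen (Z i) :. HA"
 by(rule gen_closed, simp add: hecke_gens_def)+

lemma gen_mult: "x : hecke_gens G n ==> y : hecke_gens G n ==> gen x \<otimes>\<^sub>HA gen y = cls (delta [x, y])"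
 by(subst cls_mult) simp_all

lemma cls_rel: "(f, g) : R ==> cls f = cls g" by(rule alg_class_rel[OF free_alg_calg R_closed])

lemma gens [simp]: "g :. G ==> Elt g : hecke_gens G n" "i : {1..n} ==> Z i : hecke_gens G n"
 by(auto simp: hecke_gens_def)

lemma Elt_mult:
 assumes "g :. G" "h :. G"
 shows "gen (Elt g) \<otimes>\<^sub>HA gen (Elt h) = gen (Elt (g \<otimes>\<^sub>G h))"
proof -
 have "(delta [Elt g, Elt h], delta [Elt (g \<otimes>\<^sub>G h)]) : hecke_rels G n s Y"
  unfolding hecke_rels_def using assms by(intro UnI1 CollectI exI[of _ g] exI[of _ h]) simp
 hence "(delta [Elt g, Elt h], delta [Elt (g \<otimes>\<^sub>G h)]) : R" by(rule subsetD[OF sub])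
 thus ?thesis using assms cls_rel by(simp add: gen_mult)
qed

lemma Elt_one: "gen (Elt \<one>\<^sub>G) = \<one>\<^sub>HA"
proof -
 have "(delta [Elt \<one>\<^sub>G], delta []) : R" using sub unfolding hecke_rels_def by blast
 thus ?thesis using cls_rel alg_class_one[OF free_alg_calg R_closed] by simp
qed

lemma Z_commute:
 assumes "i : {1..n}" "j : {1..n}"
 shows "gen (Z i) \<otimes>\<^sub>HA gen (Z j) = gen (Z j) \<otimes>\<^sub>HA gen (Z i)"
proof -
 have "(delta [Z i, Z j], delta [Z j, Z i]) : R" using sub assms unfolding hecke_rels_def by blast
 thus ?thesis using assms cls_rel by(simp add: gen_mult)
qed

lemma Z_far:
 assumes "i : {1..<n}" "j : {1..n}" "j ~= i" "j ~= i + 1"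
 shows "gen (Z j) \<otimes>\<^sub>HA gen (Elt (s i)) = gen (Elt (s i)) \<otimes>\<^sub>HA gen (Z j)"
proof -
 have "(delta [Z j, Elt (s i)], delta [Elt (s i), Z j]) : R" using sub assms unfolding hecke_rels_def by blast
 thus ?thesis using assms cls_rel s_closed by(simp add: gen_mult)
qed

lemma Z_near:
 assumes i: "i : {1..<n}"
 shows "gen (Z i) \<otimes>\<^sub>HA gen (Elt (s i)) = gen (Elt (s i)) \<otimes>\<^sub>HA gen (Z (i + 1)) \<ominus>\<^sub>HA cls (Y i)"
proof -
 have ii: "i : {1..n}" "i + 1 : {1..n}" using i by auto
 have rel: "(delta [Z i, Elt (s i)], %u. delta [Elt (s i), Z (i + 1)] u - Y i u) : R"
  using sub assms unfolding hecke_rels_def by blast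
 have d: "delta [Elt (s i), Z (i + 1)] :. free_vs (lists (hecke_gens G n))" using ii s_closed[OF i] by simp
 have Y: "Y i :. free_vs (lists (hecke_gens G n))" using Y_closed[OF i] by simp
 have "cls (%u. delta [Elt (s i), Z (i + 1)] u - Y i u) = cls (delta [Elt (s i), Z (i + 1)]) \<ominus>\<^sub>HA cls (Y i)"
  using lin_minus[OF cspace_free_vs calg.cspace[OF HA_calg] cls_lin d Y] free_vs_minus[OF d Y] by simp
 thus ?thesis using cls_rel[OF rel] ii s_closed[OF i] by(simp add: gen_mult)
qed

end

section \<open>The algebra of the reflection group\<close>

locale do_params = refl_params +
 fixes k :: complex
begin

abbreviation "HH == do_hecke m n k"
abbreviation "El g == do_gen m n k (Elt g)"
abbreviation "Ep w == El (of_perm m n w)"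
abbreviation "Zg i == do_gen m n k (Z i)"

definition "do_Y = (%i u. k * (\<Sum>l<m. delta
     [Elt (g_gen m n i [^]\<^sub>GG int l \<otimes>\<^sub>GG g_gen m n (i + 1) [^]\<^sub>GG (- int l))] u))"

lemma do_Y_eq: "do_Y i = (%u. k * (\<Sum>l<m. delta [Elt (pair_elt i (i + 1) (int l), id)] u))"
 using g_gen_pair[of i "i + 1"] by(simp add: do_Y_def)

lemma pair_elt_GG: "(pair_elt i j c, id) :. GG" by(simp add: refl_group_simps pair_elt_closed permutes_id)

lemma do_Y_closed: "do_Y i :. free_alg (hecke_gens GG n)" unfolding do_Y_eq
 by(auto simp: hecke_gens_def pair_elt_GG intro!: free_vs_closed free_vs_sum_closed)

lemma swap_closed: "i : {1..<n} ==> of_perm m n (transpose i (i + 1)) :. GG"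
 by(rule of_perm_closed, rule permutes_swap_id) auto

lemma do_rels_eq: "do_rels m n k = hecke_rels GG n (%i. of_perm m n (transpose i (i + 1))) do_Y \<union>
  {(delta [Z i, Elt (g_gen m n r)], delta [Elt (g_gen m n r), Z i]) | i r. i : {1..n} & r : {1..n}}"
 by(simp add: do_rels_def do_Y_def)

lemma do_rels_closed: "do_rels m n k <= carrier (free_alg (hecke_gens GG n)) \<times> carrier (free_alg (hecke_gens GG n))"
proof -
 interpret G: group GG by(rule refl_group_group)
 have Y: "do_Y i :. free_vs (lists (hecke_gens GG n))" for i using do_Y_closed by simp
 have g: "Elt g : hecke_gens GG n" if "g :. GG" for g using that by(simp add: hecke_gens_def)
 have z: "Z i : hecke_gens GG n" if "i : {1..n}" for i using that by(simp add: hecke_gens_def)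
 show ?thesis unfolding do_rels_eq hecke_rels_def
  by(auto intro!: free_vs_closed Y g z swap_closed simp: g_gen_closed)
qed

sublocale H: hecke_quotient GG n "%i. of_perm m n (transpose i (i + 1))" do_Y "do_rels m n k"
 rewrites "alg_quot (free_alg (hecke_gens GG n)) (do_rels m n k) = HH"
  and "!!x. alg_class (free_alg (hecke_gens GG n)) (do_rels m n k) (delta [x]) = do_gen m n k x"
proof -
 show "hecke_quotient GG n (%i. of_perm m n (transpose i (i + 1))) do_Y (do_rels m n k)"
  by(rule hecke_quotient.intro[OF refl_group_group _ do_rels_closed swap_closed do_Y_closed])
   (simp_all add: do_rels_eq)
qed (simp_all add: do_hecke_def do_gen_def)

sublocale A: calg HH by(rule H.HA_calg)

text \<open>The element \<open>\<Sum>\<^sub>l s\<^sub>i\<^sub>j g\<^sub>i\<^sup>-\<^sup>l g\<^sub>j\<^sup>l\<close>, written with the torus on the left.\<close>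

definition refl_sum :: "nat => nat => do_alg" where
 "refl_sum i j = (\<Oplus>\<^sub>HH l\<in>{..<m}. El (pair_elt i j (int l), transpose i j))"

lemma El_closed: "g :. GG ==> El g :. HH" by(rule H.Elt_closed)

lemma El_pair_closed: "w permutes {1..n} ==> El (pair_elt i j c, w) :. HH"
 by(rule El_closed) (simp add: refl_group_simps pair_elt_closed)

lemma refl_sum_closed: "i : {1..n} ==> j : {1..n} ==> refl_sum i j :. HH"
 unfolding refl_sum_def by(intro A.finsum_closed funcsetI El_pair_closed permutes_swap_id)

text \<open>The sum over a coset of the cyclic group generated by \<open>g\<^sub>i g\<^sub>j\<^sup>-\<^sup>1\<close> depends neither on the representative nor on
 the choice of the generator.  All invariance properties of the reflection terms rest on this.\<close>

lemma El_pair_reindex: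
 assumes w: "w permutes {1..n}" and e: "e = 1 | e = - 1"
 shows "(\<Oplus>\<^sub>HH l\<in>{..<m}. El (pair_elt i j (d + e * int l), w)) = (\<Oplus>\<^sub>HH l\<in>{..<m}. El (pair_elt i j (int l), w))"
proof -
 let ?f = "%l. nat ((d + e * int l) mod int m)"
 note b = mod_reindex[OF e, of d]
 have "(\<Oplus>\<^sub>HH l\<in>?f ` {..<m}. El (pair_elt i j (int l), w)) = (\<Oplus>\<^sub>HH l\<in>{..<m}. El (pair_elt i j (int (?f l)), w))"
  by(rule A.add.finprod_reindex) (use El_pair_closed[OF w] bij_betw_imp_inj_on[OF b] in auto)
 moreover have "pair_elt i j (int (?f l)) = pair_elt i j (d + e * int l)" for l
  by(rule pair_elt_cong) (use m_pos in simp)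
 ultimately show ?thesis unfolding bij_betw_imp_surj_on[OF b] by simp
qed

lemma refl_sum_commute:
 assumes ij: "i : {1..n}" "j : {1..n}"
 shows "refl_sum i j = refl_sum j i"
proof (cases "i = j")
 case False
 thus ?thesis using El_pair_reindex[OF permutes_swap_id[OF ij], of "- 1" j i 0]
  by(simp add: refl_sum_def pair_elt_swap[of i j] transpose_commute[of i j])
qed simp

lemma El_perm_refl_sum:
 assumes w: "w permutes {1..n}" and ij: "i : {1..n}" "j : {1..n}"
 shows "Ep w \<otimes>\<^sub>HH refl_sum i j = refl_sum (w i) (w j) \<otimes>\<^sub>HH Ep w"
proof -
 have wi: "w i : {1..n}" "w j : {1..n}" using permutes_range(1)[OF w] ij by blast+
 have sw: "w o transpose i j = transpose (w i) (w j) o w"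
  using permutes_inj[OF w] by(auto simp: transpose_def fun_eq_iff inj_eq)
 note p = permutes_swap_id[OF ij] and q = permutes_swap_id[OF wi]
 note wc = El_closed[OF of_perm_closed[OF w]]
 have "Ep w \<otimes>\<^sub>HH El (pair_elt i j c, transpose i j) =
   El (pair_elt (w i) (w j) c, transpose (w i) (w j)) \<otimes>\<^sub>HH Ep w" for c
  using w p q by(simp add: H.Elt_mult of_perm_def refl_group_simps pair_elt_closed torus_one_closed torus_one_mult
    permute_pair_elt pcoords_one sw)
 thus ?thesis unfolding refl_sum_def
  using A.finsum_rdistr[OF finite_lessThan wc, of "%l. El (pair_elt i j (int l), transpose i j)"]
   A.finsum_ldistr[OF finite_lessThan wc, of "%l. El (pair_elt (w i) (w j) (int l), transpose (w i) (w j))"]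
   El_pair_closed[OF p] El_pair_closed[OF q] by auto
qed

lemma El_torus_refl_sum:
 assumes t: "t :. TT" and ij: "i : {1..n}" "j : {1..n}" "i ~= j"
 shows "El (of_torus t) \<otimes>\<^sub>HH refl_sum i j = refl_sum i j \<otimes>\<^sub>HH El (of_torus t)"
proof -
 let ?s = "transpose i j" and ?d = "t i - t j"
 note p = permutes_swap_id[OF ij(1,2)] and tc = El_closed[OF of_torus_closed[OF t]]
 have s: "El (of_torus t) \<otimes>\<^sub>HH El (pair_elt i j c, ?s) = El (pair_elt i j (?d + 1 * c), ?s) \<otimes>\<^sub>HH El (of_torus t)" for c
  using t p pair_elt_shift[OF ij, of t c] pcoords_torus[OF p t] torus_extensional[OF torus_mult_closed[OF t pair_elt_closed]]
  by(simp add: H.Elt_mult of_torus_def refl_group_simps pair_elt_closed permutes_id torus_extensional)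
 have "El (of_torus t) \<otimes>\<^sub>HH refl_sum i j = (\<Oplus>\<^sub>HH l\<in>{..<m}. El (of_torus t) \<otimes>\<^sub>HH El (pair_elt i j (int l), ?s))"
  unfolding refl_sum_def by(rule A.finsum_rdistr[OF finite_lessThan tc]) (use El_pair_closed[OF p] in blast)
 also have "... = (\<Oplus>\<^sub>HH l\<in>{..<m}. El (pair_elt i j (?d + 1 * int l), ?s)) \<otimes>\<^sub>HH El (of_torus t)"
  unfolding s by(rule A.finsum_ldistr[OF finite_lessThan tc, symmetric]) (use El_pair_closed[OF p] in blast)
 also have "(\<Oplus>\<^sub>HH l\<in>{..<m}. El (pair_elt i j (?d + 1 * int l), ?s)) = refl_sum i j"
  unfolding refl_sum_def by(rule El_pair_reindex[OF p disjI1[OF refl]])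
 finally show ?thesis .
qed

lemma Zg_gen_commute:
 assumes "i : {1..n}" "r : {1..n}"
 shows "Zg i \<otimes>\<^sub>HH El (g_gen m n r) = El (g_gen m n r) \<otimes>\<^sub>HH Zg i"
proof -
 have "(delta [Z i, Elt (g_gen m n r)], delta [Elt (g_gen m n r), Z i]) : do_rels m n k"
  unfolding do_rels_eq using assms by blast
 from H.cls_rel[OF this] show ?thesis using assms g_gen_closed by(simp add: H.gen_mult)
qed

lemma Zg_torus_commute:
 assumes i: "i : {1..n}" and t: "t :. TT"
 shows "Zg i \<otimes>\<^sub>HH El (of_torus t) = El (of_torus t) \<otimes>\<^sub>HH Zg i" using t
proof (induction t rule: torus_induct)
 case one
 have "of_torus \<one>\<^sub>TT = \<one>\<^sub>GG" by(simp add: of_torus_def refl_group_simps)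
 thus ?case using H.Z_closed[OF i] by(simp add: H.Elt_one)
next
 case (mult r t)
 have e: "El (of_torus (torus_gen m n r 1 \<otimes>\<^sub>TT t)) = El (g_gen m n r) \<otimes>\<^sub>HH El (of_torus t)"
  by(simp add: H.Elt_mult g_gen_closed of_torus_closed mult(2) of_torus_mult torus_gen_closed g_gen_eq)
 note c = H.Z_closed[OF i] El_closed[OF g_gen_closed, of r] El_closed[OF of_torus_closed[OF mult(2)]]
 have "Zg i \<otimes>\<^sub>HH (El (g_gen m n r) \<otimes>\<^sub>HH El (of_torus t)) = El (g_gen m n r) \<otimes>\<^sub>HH (Zg i \<otimes>\<^sub>HH El (of_torus t))"
  using c by(simp add: A.m_assoc[symmetric] Zg_gen_commute[OF i mult(1)])
 thus ?case unfolding e mult(3) using c by(simp add: A.m_assoc)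
qed

text \<open>The defining relation, with the sum over \<open>l\<close> moved to the right of the reflection.\<close>

lemma Zg_near:
 assumes i: "1 <= i" "i < n"
 defines "u == Ep (transpose i (i + 1))"
 shows "Zg i \<otimes>\<^sub>HH u = u \<otimes>\<^sub>HH Zg (i + 1) \<ominus>\<^sub>HH k \<odot>\<^sub>HH (u \<otimes>\<^sub>HH refl_sum i (i + 1))"
proof -
 interpret G: group GG by(rule refl_group_group)
 let ?s = "transpose i (i + 1)"
 have ii: "i : {1..n}" "i + 1 : {1..n}" "i ~= i + 1" using i by auto
 have sp: "?s permutes {1..n}" by(rule permutes_swap_id[OF ii(1,2)])
 have dc: "delta [Elt (pair_elt i (i + 1) (int l), id)] :. free_vs (lists (hecke_gens GG n))" for l
  by(simp add: pair_elt_GG)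
 have "H.cls (do_Y i) = k \<odot>\<^sub>HH H.cls (%u. \<Sum>l<m. delta [Elt (pair_elt i (i + 1) (int l), id)] u)"
  unfolding do_Y_eq using lin_smult[OF H.cls_lin free_vs_sum_closed[OF _ dc], of "{..<m}" k] by simp
 also have "H.cls (%u. \<Sum>l<m. delta [Elt (pair_elt i (i + 1) (int l), id)] u) =
   (\<Oplus>\<^sub>HH l\<in>{..<m}. El (pair_elt i (i + 1) (int l), id))"
  using lin_finsum[OF cspace_free_vs A.cspace H.cls_lin, of "{..<m}"] dc
  by(simp add: free_vs_finsum[OF _ dc, symmetric] do_gen_def)
 also have "... = u \<otimes>\<^sub>HH refl_sum i (i + 1)"
 proof -
  have uc: "u :. HH" unfolding u_def by(rule El_closed[OF of_perm_closed[OF sp]])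
  have "u \<otimes>\<^sub>HH El (pair_elt i (i + 1) c, ?s) = El (pair_elt i (i + 1) (0 + - 1 * c), id)" for c
   using sp ii by(simp add: u_def H.Elt_mult of_perm_def refl_group_simps pair_elt_closed torus_one_closed
     torus_one_mult permute_pair_elt pair_elt_swap[of "i + 1" i])
  hence "u \<otimes>\<^sub>HH refl_sum i (i + 1) = (\<Oplus>\<^sub>HH l\<in>{..<m}. El (pair_elt i (i + 1) (0 + - 1 * int l), id))"
   unfolding refl_sum_def
   by(subst A.finsum_rdistr[OF finite_lessThan uc]) (use El_pair_closed[OF sp] in \<open>blast, simp only:\<close>)
  also have "... = (\<Oplus>\<^sub>HH l\<in>{..<m}. El (pair_elt i (i + 1) (int l), id))"
   by(rule El_pair_reindex[OF permutes_id disjI2[OF refl]])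
  finally show ?thesis ..
 qed
 finally show ?thesis using H.Z_near[of i] i unfolding u_def by simp
qed

abbreviation do_elt :: "nat => do_alg" where "do_elt == dirac_elt HH n k Zg refl_sum"

lemma do_elt_closed: "i : {1..n} ==> do_elt i :. HH"
 by(rule A.dirac_elt_closed) (auto intro: H.Z_closed refl_sum_closed)

lemma do_elt_perm:
 assumes w: "w permutes {1..n}" and i: "i : {1..n}"
 shows "Ep w \<otimes>\<^sub>HH do_elt i = do_elt (w i) \<otimes>\<^sub>HH Ep w"
proof (rule A.dirac_elt_conj[where \<kappa> = "%_. 0" and u = "%w. Ep w"])
 show "Ep (w o w') = Ep w \<otimes>\<^sub>HH Ep w'" if "w permutes {1..n}" "w' permutes {1..n}" for w w'
  using that by(simp add: H.Elt_mult of_perm_closed of_perm_mult)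
 show "Ep id = \<one>\<^sub>HH" by(simp add: of_perm_id H.Elt_one)
 show "Zg i \<otimes>\<^sub>HH Ep (transpose j (j + 1)) = Ep (transpose j (j + 1)) \<otimes>\<^sub>HH Zg i"
  if "1 <= j" "j < n" "i : {1..n}" "i ~= j" "i ~= j + 1" for i j using that by(intro H.Z_far) auto
 show "mono_on {1..n} (%_. 0 :: nat)" by(simp add: mono_on_def)
 show "refl_sum j (j + 1) = refl_sum (j + 1) j" if "1 <= j" "j < n" for j
  using refl_sum_commute[of j "j + 1"] that by simp
qed (assumption | rule H.Z_closed refl_sum_closed El_closed of_perm_closed El_perm_refl_sum Zg_near w i refl)+

text \<open>Moving a torus element \<open>t\<close> past a reflection \<open>s\<^sub>i\<^sub>j\<close> changes it by a power of \<open>g\<^sub>i g\<^sub>j\<^sup>-\<^sup>1\<close>, which the sum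
 over \<open>l\<close> absorbs.  Hence the torus commutes with the Dirac elements.\<close>

lemma do_elt_torus:
 assumes t: "t :. TT" and i: "i : {1..n}"
 shows "El (of_torus t) \<otimes>\<^sub>HH do_elt i = do_elt i \<otimes>\<^sub>HH El (of_torus t)"
proof -
 let ?S = "(\<Oplus>\<^sub>HH r\<in>{1..n}. order_sign i r \<odot>\<^sub>HH refl_sum i r)"
 let ?t = "El (of_torus t)"
 have tc: "?t :. HH" by(rule El_closed[OF of_torus_closed[OF t]])
 note Rc = refl_sum_closed[OF i]
 have "?t \<otimes>\<^sub>HH ?S = (\<Oplus>\<^sub>HH r\<in>{1..n}. ?t \<otimes>\<^sub>HH (order_sign i r \<odot>\<^sub>HH refl_sum i r))"
  by(rule A.finsum_rdistr) (use Rc tc in auto)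
 also have "... = (\<Oplus>\<^sub>HH r\<in>{1..n}. (order_sign i r \<odot>\<^sub>HH refl_sum i r) \<otimes>\<^sub>HH ?t)"
 proof (rule A.finsum_cong')
  fix r assume r: "r : {1..n}"
  show "?t \<otimes>\<^sub>HH (order_sign i r \<odot>\<^sub>HH refl_sum i r) = (order_sign i r \<odot>\<^sub>HH refl_sum i r) \<otimes>\<^sub>HH ?t"
  proof (cases "i = r")
   case True
   thus ?thesis using Rc[OF r] tc by(simp add: order_sign_def scale_zero[OF A.cspace])
  next
   case False
   thus ?thesis
    using Rc[OF r] tc El_torus_refl_sum[OF t i r] by(simp add: A.smult_mult_left A.smult_mult_right)
  qed
 qed (use Rc tc in auto)
 also have "... = ?S \<otimes>\<^sub>HH ?t" by(rule A.finsum_ldistr[symmetric]) (use Rc tc in auto)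
 finally have *: "?t \<otimes>\<^sub>HH ?S = ?S \<otimes>\<^sub>HH ?t" .
 have Sc: "?S :. HH" using Rc by(intro A.finsum_closed) auto
 show ?thesis using tc Sc H.Z_closed[OF i] Zg_torus_commute[OF i t] *
  by(simp add: dirac_elt_def A.r_distr A.l_distr A.smult_mult_left A.smult_mult_right)
qed

lemma do_elt_conj:
 assumes g: "(t, w) :. GG" and i: "i : {1..n}"
 shows "El (t, w) \<otimes>\<^sub>HH do_elt i = do_elt (w i) \<otimes>\<^sub>HH El (t, w)"
proof -
 have t: "t :. TT" and w: "w permutes {1..n}" using g by(simp_all add: refl_group_simps)
 have e: "El (t, w) = El (of_torus t) \<otimes>\<^sub>HH Ep w"
  using t w by(simp add: H.Elt_mult of_torus_closed of_perm_closed of_torus_of_perm)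
 have wi: "w i : {1..n}" by(rule permutes_range(1)[OF w i])
 note c = El_closed[OF of_torus_closed[OF t]] El_closed[OF of_perm_closed[OF w]] do_elt_closed[OF i] do_elt_closed[OF wi]
 have "El (t, w) \<otimes>\<^sub>HH do_elt i = El (of_torus t) \<otimes>\<^sub>HH (Ep w \<otimes>\<^sub>HH do_elt i)"
  unfolding e using c by(simp add: A.m_assoc)
 also have "... = El (of_torus t) \<otimes>\<^sub>HH do_elt (w i) \<otimes>\<^sub>HH Ep w"
  unfolding do_elt_perm[OF w i] using c by(simp add: A.m_assoc)
 also have "... = do_elt (w i) \<otimes>\<^sub>HH El (t, w)"
  unfolding do_elt_torus[OF t wi] e using c by(simp add: A.m_assoc)
 finally show ?thesis .
qed

lemma do_lower_eq:
 assumes i: "i : {1..n}"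
 shows "do_lower m n k i = (\<Oplus>\<^sub>HH r\<in>{1..<i}. refl_sum i r)"
 and do_upper_eq: "do_upper m n k i = (\<Oplus>\<^sub>HH r\<in>{i<..n}. refl_sum i r)"
proof -
 have *: "(\<Oplus>\<^sub>HH l\<in>{..<m}. El (of_perm m n (transpose r j) \<otimes>\<^sub>GG g_gen m n r [^]\<^sub>GG (- int l)
   \<otimes>\<^sub>GG g_gen m n j [^]\<^sub>GG int l)) = refl_sum r j" if rj: "r : {1..n}" "j : {1..n}" "r ~= j" for r j
  by(simp add: swap_g_gen_pair[OF rj] refl_sum_def)
 show "do_lower m n k i = (\<Oplus>\<^sub>HH r\<in>{1..<i}. refl_sum i r)" unfolding do_lower_def Let_def
  by(rule A.finsum_cong') (use i * refl_sum_closed refl_sum_commute[of i] in auto)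
 show "do_upper m n k i = (\<Oplus>\<^sub>HH r\<in>{i<..n}. refl_sum i r)" unfolding do_upper_def Let_def
  by(rule A.finsum_cong') (use i * refl_sum_closed in auto)
qed

end

lemma (in calg) signed_sum_split:
 assumes I: "finite I" and f: "!!r. r : I ==> f r :. A"
 shows "(\<Oplus>r\<in>I. order_sign i r \<odot> f r) = (\<Oplus>r\<in>{r \<in> I. i < r}. f r) \<ominus> (\<Oplus>r\<in>{r \<in> I. r < i}. f r)"
proof -
 define P N where "P = {r \<in> I. i < r}" and "N = {r \<in> I. r < i}"
 have sub: "P <= I" "N <= I" "P \<union> N <= I" unfolding P_def N_def by blast+
 have fin: "finite P" "finite N" using finite_subset[OF sub(1) I] finite_subset[OF sub(2) I] .
 have "\<not> (i < r & r < i)" for r by linarith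
 hence disj: "P \<inter> N = {}" unfolding P_def N_def by blast
 have fP: "f r :. A" if "r : P" for r using f sub(1) that by blast
 have fN: "f r :. A" if "r : N" for r using f sub(2) that by blast
 have sP: "order_sign i r \<odot> f r = f r" if "r : P" for r
  using that scale_one[OF cspace fP[OF that]] by(simp add: order_sign_def P_def)
 have sN: "order_sign i r \<odot> f r = (- 1) \<odot> f r" if "r : N" for r using that by(simp add: order_sign_def N_def)
 have "(\<Oplus>r\<in>I. order_sign i r \<odot> f r) = (\<Oplus>r\<in>P \<union> N. order_sign i r \<odot> f r)"
 proof (rule add.finprod_mono_neutral_cong_right[OF I sub(3)])
  fix r assume r: "r : I - (P \<union> N)"
  hence "order_sign i r = 0" "f r :. A" using f by(simp_all add: order_sign_def P_def N_def)
  thus "order_sign i r \<odot> f r = \<zero>" by(simp add: scale_zero[OF cspace])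
 qed (use f in blast)+
 also have "... = (\<Oplus>r\<in>P. order_sign i r \<odot> f r) \<oplus> (\<Oplus>r\<in>N. order_sign i r \<odot> f r)"
  using fP fN by(intro finsum_Un_disjoint[OF fin disj]) blast+
 also have "(\<Oplus>r\<in>P. order_sign i r \<odot> f r) = (\<Oplus>r\<in>P. f r)" by(rule finsum_cong'[OF refl]) (use fP sP in blast)+
 also have "(\<Oplus>r\<in>N. order_sign i r \<odot> f r) = (\<Oplus>r\<in>N. (- 1) \<odot> f r)"
  by(rule finsum_cong'[OF refl]) (use fN sN in blast)+
 also have "... = (- 1) \<odot> (\<Oplus>r\<in>N. f r)" by(rule smult_finsum[symmetric, OF fin(2) fN])
 also have "... = \<ominus> (\<Oplus>r\<in>N. f r)" by(rule smult_minus_one[OF cspace finsum_closed]) (use fN in blast)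
 finally show ?thesis by(simp add: a_minus_def P_def N_def)
qed

lemma (in do_params) do_elt_eq:
 assumes i: "i : {1..n}"
 shows "Zg i \<oplus>\<^sub>HH (k / 2) \<odot>\<^sub>HH (do_upper m n k i \<ominus>\<^sub>HH do_lower m n k i) = do_elt i"
proof -
 have "{r \<in> {1..n}. i < r} = {i<..n}" "{r \<in> {1..n}. r < i} = {1..<i}" using i by auto
 thus ?thesis using A.signed_sum_split[of "{1..n}" "refl_sum i" i] refl_sum_closed[OF i]
  by(simp add: dirac_elt_def do_lower_eq[OF i] do_upper_eq[OF i])
qed

section \<open>Dirac cohomology for the reflection group\<close>

locale dirac_params = do_params m n k + refl_root m n \<eta> for m n :: nat and k \<eta> :: complex +
 fixes S :: "(cliff_alg, 's) lmod"
 assumes spinor: "spinor_module n S"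
begin

sublocale nontrivial_clifford n by(rule spinor_module_nontrivial[OF spinor])

abbreviation "Wsp == weight_space m n k \<eta>"
abbreviation "Wmod == weight_module m n k \<eta>"
abbreviation "indF == induction_functor m n \<eta>"

lemma S_module: "alg_module (clifford n) S" using spinor by(simp add: spinor_module_def)

lemma S_cspace: "cspace S" by(rule module_cspace[OF S_module])

abbreviation "SC == sym_cover n"
abbreviation "RC == refl_cover m n"

lemma sym_permutes: "w :. sym_group n ==> w permutes {1..n}" by(simp add: sym_group_carrier)

lemma SC_group: "group SC" by(rule pin_cover_group) (rule group.subgroup_self[OF sym_group_is_group])

lemma SC_lift:
 assumes "x :. SC"
 shows "perm_lift n x (cover_perm n x)" "cover_perm n x permutes {1..n}" "x :. clifford n"
proof -
 show l: "perm_lift n x (cover_perm n x)" by(rule perm_lift_cover_perm(1)[OF sym_permutes assms])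
 show "cover_perm n x permutes {1..n}" by(rule perm_lift_cover_perm(3)[OF sym_permutes assms])
 show "x :. clifford n" using l unfolding perm_lift_def by blast
qed

lemma lift_in_SC:
 assumes "perm_lift n x w"
 shows "x :. SC"
proof -
 have "w :. sym_group n" using assms by(simp add: perm_lift_def sym_group_carrier)
 thus ?thesis using pin_cover_iff[OF sym_permutes] assms by blast
qed

lemma pin_cover_mult: "x \<otimes>\<^sub>(pin_cover n W) y = x \<otimes>\<^sub>(clifford n) y"
 and pin_cover_one: "\<one>\<^sub>(pin_cover n W) = \<one>\<^sub>(clifford n)" by(simp_all add: pin_cover_def)

lemma cover_perm_mult:
 assumes "x :. SC" "y :. SC"
 shows "cover_perm n (x \<otimes>\<^sub>(clifford n) y) = cover_perm n x o cover_perm n y"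
proof (rule cover_perm_lift)
 show "perm_lift n (x \<otimes>\<^sub>(clifford n) y) (cover_perm n x o cover_perm n y)"
  by(rule perm_lift_mult[OF SC_lift(1)[OF assms(1)] SC_lift(1)[OF assms(2)]])
qed

lemma cover_perm_one: "cover_perm n \<one>\<^sub>(clifford n) = id" by(rule cover_perm_lift[OF perm_lift_one])

lemma RC_group: "group RC" unfolding refl_cover_def
proof (rule semidirect_group[OF torus_group SC_group])
 show "pcoords n (cover_perm n x) : hom TT TT" if "x :. SC" for x by(rule pcoords_hom[OF SC_lift(2)[OF that]])
 show "pcoords n (cover_perm n (x \<otimes>\<^sub>SC y)) t = pcoords n (cover_perm n x) (pcoords n (cover_perm n y) t)"
  if "x :. SC" "y :. SC" for x y t
  by(simp add: pin_cover_mult cover_perm_mult[OF that] pcoords_comp[OF SC_lift(2) SC_lift(2)] that)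
 show "pcoords n (cover_perm n \<one>\<^sub>SC) t = t" if "t :. TT" for t
  using torus_extensional[OF that] by(simp add: pin_cover_one cover_perm_one)
qed

lemma RC_simps: "carrier RC = carrier TT \<times> carrier SC"
 "(t, x) \<otimes>\<^sub>RC (t', x') = (t \<otimes>\<^sub>TT pcoords n (cover_perm n x) t', x \<otimes>\<^sub>(clifford n) x')"
 "\<one>\<^sub>RC = (\<one>\<^sub>TT, \<one>\<^sub>(clifford n))" by(simp_all add: refl_cover_def pin_cover_mult pin_cover_one)

abbreviation "cliff_act i == act S (cliff_vec n (basis_vec n i))"

lemma cliff_act_lin: "cliff_act i : lin_maps S S" by(rule act_lin[OF S_module]) simp

lemma lift_act_cliff:
 assumes x: "perm_lift n x w" and i: "i : {1..n}" and s: "s :. S"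
 shows "act S x (cliff_act i s) = cliff_act (w i) (act S (parity x) s)"
proof -
 interpret C: calg "clifford n" by(rule calg_clifford)
 have c: "x :. clifford n" and w: "w permutes {1..n}" using x by(auto simp: perm_lift_def)
 have "act S x (cliff_act i s) = act S (x \<otimes>\<^sub>(clifford n) cliff_vec n (basis_vec n i)) s"
  using c s by(simp add: act_mult[OF S_module])
 also have "... = act S (cliff_vec n (basis_vec n (w i)) \<otimes>\<^sub>(clifford n) parity x) s"
  using perm_lift_parity_commute[OF x basis_vec_vecs] pcoords_basis_vec[OF w i] by simp
 also have "... = cliff_act (w i) (act S (parity x) s)" using c s by(simp add: act_mult[OF S_module])
 finally show ?thesis .
qed

text \<open>The conditions of a Dirac datum that concern the group and the spinor module only.\<close>

lemma pin_datum:
 assumes "group G" and d: "!!i. i : {1..n} ==> d i :. A" and pin: "!!g. g :. G ==> perm_lift n (pin g) (w g)"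
  and pin_hom: "!!g h. g :. G ==> h :. G ==> pin (g \<otimes>\<^sub>G h) = pin g \<otimes>\<^sub>(clifford n) pin h"
   "pin \<one>\<^sub>G = \<one>\<^sub>(clifford n)" and u: "!!g. g :. G ==> u g :. A"
   "!!g h. g :. G ==> h :. G ==> u (g \<otimes>\<^sub>G h) = u g \<otimes>\<^sub>A u h" "u \<one>\<^sub>G = \<one>\<^sub>A"
  and \<epsilon>: "!!g. g :. G ==> \<epsilon> g :. G & \<epsilon> (\<epsilon> g) = g & pin (\<epsilon> g) = parity (pin g) & u (\<epsilon> g) = u g"
  and u_d: "!!g i. g :. G ==> i : {1..n} ==> u g \<otimes>\<^sub>A d i = d (w g i) \<otimes>\<^sub>A u g"
  and D: "!!M x. alg_module A M ==> x :. tensor M S ==>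
   D M x = (\<Oplus>\<^sub>(tensor M S)i\<in>{1..n}. tensor_map M S (act M (d i)) (cliff_act i) x)"
  and \<rho>: "!!M g. alg_module A M ==> g :. G ==> \<rho> M g = tensor_map M S (act M (u g)) (act S (pin g))"
 shows "dirac_datum A G S {1..n} d cliff_act u (%g. act S (pin g)) w \<epsilon> D \<rho>"
proof -
 have c: "pin g :. clifford n" "w g permutes {1..n}" if "g :. G" for g
  using pin[OF that] by(simp_all add: perm_lift_def)
 show ?thesis
 proof (rule dirac_datum.intro)
  show "act S (pin g) (cliff_act i s) = cliff_act (w g i) (act S (pin (\<epsilon> g)) s)"
   if "g :. G" "i : {1..n}" "s :. S" for g i s
   using lift_act_cliff[OF pin[OF that(1)] that(2,3)] \<epsilon>[OF that(1)] by simp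
 qed (simp_all add: assms S_cspace cliff_act_lin act_lin[OF S_module] c act_mult[OF S_module] act_one[OF S_module]
   permutes_imp_bij)
qed

lemma do_datum:
 "dirac_datum HH RC S {1..n} do_elt cliff_act (%g. El (fst g, cover_perm n (snd g))) (%g. act S (snd g))
   (%g. cover_perm n (snd g)) (%g. (fst g, parity (snd g)))
   (do_dirac m n k S :: (do_alg, 'v) lmod => _) (do_cover_act m n k S)"
proof (rule pin_datum[OF RC_group do_elt_closed])
 have x: "fst g :. TT" "snd g :. SC" if "g :. RC" for g using that by(auto simp: RC_simps)
 have m: "snd (g \<otimes>\<^sub>RC h) = snd g \<otimes>\<^sub>(clifford n) snd h"
  "fst (g \<otimes>\<^sub>RC h) = fst g \<otimes>\<^sub>TT pcoords n (cover_perm n (snd g)) (fst h)" for g h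
  by(cases g; cases h; simp add: RC_simps)+
 fix g assume g: "g :. RC"
 note xl = SC_lift[OF x(2)[OF g]]
 have tx: "(fst g, cover_perm n (snd g)) :. GG" using x(1)[OF g] xl by(simp add: refl_group_simps)
 show l: "perm_lift n (snd g) (cover_perm n (snd g))" by(rule xl(1))
 show "El (fst g, cover_perm n (snd g)) :. HH" by(rule El_closed[OF tx])
 note p = perm_lift_parity[OF l]
 show "(fst g, parity (snd g)) :. RC &
   (fst (fst g, parity (snd g)), parity (snd (fst g, parity (snd g)))) = g &
   snd (fst g, parity (snd g)) = parity (snd g) &
   El (fst (fst g, parity (snd g)), cover_perm n (snd (fst g, parity (snd g)))) = El (fst g, cover_perm n (snd g))"
  using x(1)[OF g] lift_in_SC[OF p] parity_parity[OF xl(3)] cover_perm_lift[OF p] by(simp add: RC_simps)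
 show "El (fst g, cover_perm n (snd g)) \<otimes>\<^sub>HH do_elt i =
   do_elt (cover_perm n (snd g) i) \<otimes>\<^sub>HH El (fst g, cover_perm n (snd g))" if "i : {1..n}" for i
  by(rule do_elt_conj[OF tx that])
 show "do_cover_act m n k S M g = tensor_map M S (act M (El (fst g, cover_perm n (snd g)))) (act S (snd g))"
  for M :: "(do_alg, 'v) lmod" by(cases g) (simp add: do_cover_act_def)
 fix h assume h: "h :. RC"
 have ty: "(fst h, cover_perm n (snd h)) :. GG"
  using x(1)[OF h] SC_lift[OF x(2)[OF h]] by(simp add: refl_group_simps)
 show "snd (g \<otimes>\<^sub>RC h) = snd g \<otimes>\<^sub>(clifford n) snd h" by(rule m)
 show "El (fst (g \<otimes>\<^sub>RC h), cover_perm n (snd (g \<otimes>\<^sub>RC h))) =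
   El (fst g, cover_perm n (snd g)) \<otimes>\<^sub>HH El (fst h, cover_perm n (snd h))"
  using H.Elt_mult[OF tx ty] cover_perm_mult[OF x(2)[OF g] x(2)[OF h]] by(simp add: m refl_group_simps)
next
 show "El (fst \<one>\<^sub>RC, cover_perm n (snd \<one>\<^sub>RC)) = \<one>\<^sub>HH"
  using H.Elt_one by(simp add: RC_simps cover_perm_one refl_group_simps)
 fix M :: "(do_alg, 'v) lmod" and x
 assume M: "alg_module HH M" and x: "x :. tensor M S"
 interpret T: module CC "tensor M S" by(rule cspace_tensor[OF module_cspace[OF M] S_cspace])
 show "do_dirac m n k S M x = (\<Oplus>\<^sub>(tensor M S)i\<in>{1..n}. tensor_map M S (act M (do_elt i)) (cliff_act i) x)"
  unfolding do_dirac_def Let_def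
 proof (rule T.M.finsum_cong'[OF refl])
  show "(%i. tensor_map M S (act M (do_elt i)) (cliff_act i) x) : {1..n} \<rightarrow> carrier (tensor M S)"
   by(intro funcsetI lin_closed[OF tensor_map_lin[OF module_cspace[OF M] S_cspace
      module_cspace[OF M] S_cspace act_lin[OF M do_elt_closed] cliff_act_lin] x])
 qed (simp add: do_elt_eq)
qed (simp_all only: RC_simps snd_conv)

end

section \<open>Graded Hecke algebras of symmetric groups\<close>

lemma graded_hecke_quotient:
 "hecke_quotient (sym_group d) d (%i. transpose i (i + 1)) (%i u. c * delta [] u) (graded_rels c d)"
proof (rule hecke_quotient.intro[OF sym_group_is_group])
 show "hecke_rels (sym_group d) d (%i. transpose i (i + 1)) (%i u. c * delta [] u) <= graded_rels c d"
  by(simp add: graded_rels_def)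
 have s: "transpose i (i + 1) :. sym_group d" if "i : {1..<d}" for i
  using that permutes_swap_id[of i "{1..d}" "i + 1"] by(simp add: sym_group_carrier)
 thus "transpose i (i + 1) :. sym_group d" if "i : {1..<d}" for i using that .
 have g: "Elt w : hecke_gens (sym_group d) d" if "w :. sym_group d" for w
  using that by(simp add: hecke_gens_def)
 have z: "Z i : hecke_gens (sym_group d) d" if "i : {1..d}" for i using that by(simp add: hecke_gens_def)
 interpret G: group "sym_group d" by(rule sym_group_is_group)
 show "graded_rels c d <= carrier (free_alg (hecke_gens (sym_group d) d)) \<times> carrier (free_alg (hecke_gens (sym_group d) d))"
  unfolding graded_rels_def hecke_rels_def by(auto intro!: free_vs_closed g z s)
 show "(%u. c * delta [] u) :. free_alg (hecke_gens (sym_group d) d)" by(simp add: free_vs_closed)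
qed

context
 fixes c :: complex and d :: nat
begin

interpretation H: hecke_quotient "sym_group d" d "%i. transpose i (i + 1)" "%i u. c * delta [] u" "graded_rels c d"
 rewrites "alg_quot (free_alg (hecke_gens (sym_group d) d)) (graded_rels c d) = graded_hecke c d"
  and "!!x. alg_class (free_alg (hecke_gens (sym_group d) d)) (graded_rels c d) (delta [x]) = graded_gen c d x"
 by(rule graded_hecke_quotient) (simp_all add: graded_hecke_def graded_gen_def)

lemma graded_calg: "calg (graded_hecke c d)" by(rule H.HA_calg)

lemma graded_Elt_closed: "w permutes {1..d} ==> graded_gen c d (Elt w) :. graded_hecke c d"
 and graded_Z_closed: "i : {1..d} ==> graded_gen c d (Z i) :. graded_hecke c d"
 using H.Elt_closed H.Z_closed by(simp_all add: sym_group_carrier)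

lemma graded_Elt_mult: "w permutes {1..d} ==> w' permutes {1..d} ==>
  graded_gen c d (Elt w) \<otimes>\<^sub>(graded_hecke c d) graded_gen c d (Elt w') = graded_gen c d (Elt (w o w'))"
 using H.Elt_mult by(simp add: sym_group_carrier sym_group_mult)

lemma graded_Elt_one: "graded_gen c d (Elt id) = \<one>\<^sub>(graded_hecke c d)"
 using H.Elt_one by(simp add: sym_group_one)

lemma graded_Z_far: "1 <= i ==> i < d ==> j : {1..d} ==> j ~= i ==> j ~= i + 1 ==>
  graded_gen c d (Z j) \<otimes>\<^sub>(graded_hecke c d) graded_gen c d (Elt (transpose i (i + 1))) =
  graded_gen c d (Elt (transpose i (i + 1))) \<otimes>\<^sub>(graded_hecke c d) graded_gen c d (Z j)" by(rule H.Z_far) auto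

lemma graded_Z_near:
 assumes "1 <= i" "i < d"
 shows "graded_gen c d (Z i) \<otimes>\<^sub>(graded_hecke c d) graded_gen c d (Elt (transpose i (i + 1))) =
  graded_gen c d (Elt (transpose i (i + 1))) \<otimes>\<^sub>(graded_hecke c d) graded_gen c d (Z (i + 1))
   \<ominus>\<^sub>(graded_hecke c d) c \<odot>\<^sub>(graded_hecke c d) \<one>\<^sub>(graded_hecke c d)"
proof -
 have d: "delta [] :. free_vs (lists (hecke_gens (sym_group d) d))" by simp
 have "H.cls (%u. c * delta [] u) = c \<odot>\<^sub>(graded_hecke c d) \<one>\<^sub>(graded_hecke c d)"
  using lin_smult[OF H.cls_lin d, of c] alg_class_one[OF free_alg_calg H.R_closed]
  by(simp add: graded_hecke_def)
 thus ?thesis using H.Z_near[of i] assms by simp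
qed

end

section \<open>Tensor products of algebras\<close>

lemma product_monoid:
 assumes "!!i. i : I ==> monoid (G i)"
 shows "monoid (product_group I G)"
proof (rule monoidI)
 let ?P = "product_group I G"
 note m = monoid.m_closed[OF assms] monoid.one_closed[OF assms] monoid.m_assoc[OF assms]
  monoid.l_one[OF assms] monoid.r_one[OF assms]
 show "x \<otimes>\<^sub>?P y :. ?P" if "x :. ?P" "y :. ?P" for x y using that m by(simp add: PiE_iff)
 show "\<one>\<^sub>?P :. ?P" using m by simp
 show "x \<otimes>\<^sub>?P y \<otimes>\<^sub>?P z = x \<otimes>\<^sub>?P (y \<otimes>\<^sub>?P z)" if "x :. ?P" "y :. ?P" "z :. ?P" for x y z
  using that m by(auto simp: PiE_iff intro!: restrict_ext)
 show "\<one>\<^sub>?P \<otimes>\<^sub>?P x = x" if "x :. ?P" for x using that m by(auto simp: PiE_iff extensional_def fun_eq_iff)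
 show "x \<otimes>\<^sub>?P \<one>\<^sub>?P = x" if "x :. ?P" for x using that m by(auto simp: PiE_iff extensional_def fun_eq_iff)
qed

locale tensor_algebra =
 fixes I :: "'i set" and A :: "'i => (complex, 'a, 'z) module_scheme"
 assumes factor: "i : I ==> calg (A i)"
begin

abbreviation "PG == product_group I A"
abbreviation "MA == monoid_alg PG"
abbreviation "TA == tensor_alg I A"
abbreviation "pt == pure_tensor I A"
abbreviation "tf == tensor_factor I A"

lemma factor_monoid: "i : I ==> monoid (A i)" using calg.axioms(1)[OF factor] by(rule ring.is_monoid)

lemma PG_monoid: "monoid PG" by(rule product_monoid) (rule factor_monoid)

lemma MA_calg: "calg MA" by(rule monoid_alg_calg[OF PG_monoid])

lemma fun_upd_PG: "t : (\<Pi>\<^sub>E i\<in>I. carrier (A i)) ==> i : I ==> x :. A i ==> t(i := x) : (\<Pi>\<^sub>E i\<in>I. carrier (A i))"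
 by(auto simp: PiE_iff extensional_def)

lemma factor_closed: "i : I ==> x :. A i ==> y :. A i ==> x \<oplus>\<^sub>(A i) y :. A i"
 "i : I ==> x :. A i ==> c \<odot>\<^sub>(A i) x :. A i"
 using scale_closed[OF calg.cspace[OF factor]] abelian_monoid.a_closed[OF abelian_group.axioms(1)[OF
   ring.is_abelian_group[OF calg.axioms(1)[OF factor]]]] by blast+

lemma multilinear_rels_closed: "multilinear_rels I A <= carrier MA \<times> carrier MA"
proof -
 have d: "delta (t(i := x)) :. MA" if "t : (\<Pi>\<^sub>E i\<in>I. carrier (A i))" "i : I" "x :. A i" for t i x
  using fun_upd_PG[OF that] by simp
 have s: "(%u. delta (t(i := x)) u + delta (t(i := y)) u) :. MA"
  if "t : (\<Pi>\<^sub>E i\<in>I. carrier (A i))" "i : I" "x :. A i" "y :. A i" for t i x y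
  using calg.axioms(1)[OF MA_calg, THEN ring.ring_simprules(1), OF d[OF that(1-3)] d[OF that(1,2,4)]] by simp
 have c: "(%u. b * delta (t(i := x)) u) :. MA" if "t : (\<Pi>\<^sub>E i\<in>I. carrier (A i))" "i : I" "x :. A i" for t i x b
  using scale_closed[OF calg.cspace[OF MA_calg] d[OF that], of b] by simp
 show ?thesis
 proof
  fix f assume "f : multilinear_rels I A"
  then consider (add) t i x y where "f = (delta (t(i := x \<oplus>\<^sub>(A i) y)), %u. delta (t(i := x)) u + delta (t(i := y)) u)"
    "t : (\<Pi>\<^sub>E i\<in>I. carrier (A i))" "i : I" "x :. A i" "y :. A i"
   | (scale) t i b x where "f = (delta (t(i := b \<odot>\<^sub>(A i) x)), %u. b * delta (t(i := x)) u)"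
    "t : (\<Pi>\<^sub>E i\<in>I. carrier (A i))" "i : I" "x :. A i" unfolding multilinear_rels_def by blast
  thus "f : carrier MA \<times> carrier MA"
  proof cases
   case add
   thus ?thesis
    using d[OF add(2,3) factor_closed(1)[OF add(3-5)]] s[OF add(2-5)] by(simp only: mem_Times_iff fst_conv snd_conv)
  next
   case scale
   thus ?thesis
    using d[OF scale(2,3) factor_closed(2)[OF scale(3,4)]] c[OF scale(2-4)] by(simp only: mem_Times_iff fst_conv snd_conv)
  qed
 qed
qed

lemma TA_calg: "calg TA" unfolding tensor_alg_def by(rule alg_quot_calg[OF MA_calg multilinear_rels_closed])

lemma pt_closed:
 assumes "!!i. i : I ==> t i :. A i"
 shows "pt t :. TA"
 unfolding pure_tensor_def tensor_alg_def alg_quot_carrier[OF MA_calg multilinear_rels_closed]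
proof (rule imageI)
 have "restrict t I :. PG" using assms by simp
 thus "delta (restrict t I) :. MA" by simp
qed

lemma pt_cong: "(!!i. i : I ==> t i = t' i) ==> pt t = pt t'" unfolding pure_tensor_def by(metis restrict_ext)

lemma pt_mult:
 assumes "!!i. i : I ==> t i :. A i" "!!i. i : I ==> t' i :. A i"
 shows "pt t \<otimes>\<^sub>TA pt t' = pt (%i. t i \<otimes>\<^sub>(A i) t' i)"
proof -
 have c: "delta (restrict t I) :. MA" "delta (restrict t' I) :. MA" using assms by simp_all
 have "restrict t I \<otimes>\<^sub>PG restrict t' I = (\<lambda>i\<in>I. t i \<otimes>\<^sub>(A i) t' i)" by(simp cong: restrict_cong)
 thus ?thesis unfolding pure_tensor_def tensor_alg_def alg_class_mult[OF MA_calg multilinear_rels_closed c]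
   monoid_alg_mult_delta by(simp only:)
qed

lemma pt_one: "pt (%i. \<one>\<^sub>(A i)) = \<one>\<^sub>TA"
 unfolding pure_tensor_def tensor_alg_def alg_class_one[OF MA_calg multilinear_rels_closed] by simp

lemma tf_slot_closed: "i : I ==> x :. A i ==> r : I ==> (if r = i then x else \<one>\<^sub>(A r)) :. A r"
 using monoid.one_closed[OF factor_monoid] by simp

lemma tf_closed: "i : I ==> x :. A i ==> tf i x :. TA"
 unfolding tensor_factor_def by(rule pt_closed) (rule tf_slot_closed)

lemma tf_mult:
 assumes "i : I" "x :. A i" "y :. A i"
 shows "tf i x \<otimes>\<^sub>TA tf i y = tf i (x \<otimes>\<^sub>(A i) y)" unfolding tensor_factor_def
 by(rule trans[OF pt_mult[OF tf_slot_closed[OF assms(1,2)] tf_slot_closed[OF assms(1,3)]] pt_cong])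
  (auto simp: monoid.l_one[OF factor_monoid monoid.one_closed[OF factor_monoid]])

lemma tf_one: "tf i \<one>\<^sub>(A i) = \<one>\<^sub>TA" unfolding tensor_factor_def pt_one[symmetric] by(rule pt_cong) simp

lemma tf_commute:
 assumes "i : I" "j : I" "i ~= j" "x :. A i" "y :. A j"
 shows "tf i x \<otimes>\<^sub>TA tf j y = tf j y \<otimes>\<^sub>TA tf i x"
proof -
 let ?x = "%r. if r = i then x else \<one>\<^sub>(A r)" and ?y = "%r. if r = j then y else \<one>\<^sub>(A r)"
 have "pt ?x \<otimes>\<^sub>TA pt ?y = pt (%r. ?x r \<otimes>\<^sub>(A r) ?y r)"
  by(rule pt_mult[OF tf_slot_closed[OF assms(1,4)] tf_slot_closed[OF assms(2,5)]])
 also have "... = pt (%r. ?y r \<otimes>\<^sub>(A r) ?x r)"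
 proof (rule pt_cong)
  fix r assume r: "r : I"
  note one = monoid.l_one[OF factor_monoid[OF r]] monoid.r_one[OF factor_monoid[OF r]]
   monoid.one_closed[OF factor_monoid[OF r]]
  consider "r = i" | "r = j" | "r ~= i" "r ~= j" by blast
  thus "?x r \<otimes>\<^sub>(A r) ?y r = ?y r \<otimes>\<^sub>(A r) ?x r" by cases (use assms(3-5) one in simp_all)
 qed
 also have "... = pt ?y \<otimes>\<^sub>TA pt ?x"
  by(rule pt_mult[symmetric, OF tf_slot_closed[OF assms(2,5)] tf_slot_closed[OF assms(1,4)]])
 finally show ?thesis unfolding tensor_factor_def .
qed

lemma tf_lin:
 assumes i: "i : I"
 shows "tf i : lin_maps (A i) TA"
proof (rule lin_mapsI)
 note lin = alg_class_lin[OF MA_calg multilinear_rels_closed]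
 let ?t = "\<lambda>r\<in>I. \<one>\<^sub>(A r)"
 have t: "?t : (\<Pi>\<^sub>E i\<in>I. carrier (A i))" using monoid.one_closed[OF factor_monoid] by simp
 have eq: "(\<lambda>r\<in>I. if r = i then x else \<one>\<^sub>(A r)) = ?t(i := x)" for x using i by(auto simp: fun_eq_iff)
 have tf: "tf i x = alg_class MA (multilinear_rels I A) (delta (?t(i := x)))" for x
  unfolding tensor_factor_def pure_tensor_def eq ..
 have d: "delta (?t(i := x)) :. MA" if "x :. A i" for x using fun_upd_PG[OF t i that] by simp
 fix x assume x: "x :. A i"
 show "tf i x :. TA" by(rule tf_closed[OF i x])
 have "(delta (?t(i := c \<odot>\<^sub>(A i) x)), %u. c * delta (?t(i := x)) u) : multilinear_rels I A" for c
  unfolding multilinear_rels_def using t i x by blast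
 from alg_class_rel[OF MA_calg multilinear_rels_closed this]
 show "tf i (c \<odot>\<^sub>(A i) x) = c \<odot>\<^sub>TA tf i x" for c
  unfolding tf tensor_alg_def lin_smult[OF lin d[OF x], symmetric] by simp
 fix y assume y: "y :. A i"
 have "(delta (?t(i := x \<oplus>\<^sub>(A i) y)), %u. delta (?t(i := x)) u + delta (?t(i := y)) u) : multilinear_rels I A"
  unfolding multilinear_rels_def using t i x y by blast
 from alg_class_rel[OF MA_calg multilinear_rels_closed this]
 show "tf i (x \<oplus>\<^sub>(A i) y) = tf i x \<oplus>\<^sub>TA tf i y"
  unfolding tf tensor_alg_def lin_add[OF lin d[OF x] d[OF y], symmetric] by simp
qed

end

section \<open>Dirac cohomology for Young subgroups\<close>

lemma block_part_in:
 fixes w :: "nat => nat"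
 assumes "w ` {o'<..o' + d} = {o'<..o' + d}" "1 <= j" "j <= d"
 shows "o' < w (j + o')" "w (j + o') <= o' + d"
proof -
 have "j + o' : {o'<..o' + d}" using assms(2,3) unfolding greaterThanAtMost_iff by simp
 hence "w (j + o') : w ` {o'<..o' + d}" by(rule imageI)
 hence "w (j + o') : {o'<..o' + d}" using assms(1) by(simp only:)
 thus "o' < w (j + o')" "w (j + o') <= o' + d" by simp_all
qed

lemma block_part_permutes:
 assumes w: "w ` {o'<..o' + d} = {o'<..o' + d}" and inj: "inj w"
 shows "block_part o' d w permutes {1..d}"
proof (rule bij_imp_permutes)
 have sub: "block_part o' d w ` {1..d} <= {1..d}"
 proof
  fix y assume "y : block_part o' d w ` {1..d}"
  then obtain j where j: "1 <= j" "j <= d" "y = w (j + o') - o'" by(auto simp: block_part_def)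
  thus "y : {1..d}" using block_part_in[OF w j(1,2)] by auto
 qed
 have "inj_on (block_part o' d w) {1..d}"
 proof (rule inj_onI)
  fix i j assume ij: "i : {1..d}" "j : {1..d}" "block_part o' d w i = block_part o' d w j"
  have "w (i + o') = w (j + o')"
   using ij block_part_in[OF w, of i] block_part_in[OF w, of j] by(simp add: block_part_def)
  thus "i = j" using inj by(simp add: inj_eq)
 qed
 thus "bij_betw (block_part o' d w) {1..d} {1..d}" using endo_inj_surj[OF _ sub] by(simp add: bij_betw_def)
 show "block_part o' d w x = x" if "x \<notin> {1..d}" for x using that by(auto simp: block_part_def)
qed

lemma block_part_comp:
 assumes "w' ` {o'<..o' + d} = {o'<..o' + d}"
 shows "block_part o' d (w o w') = block_part o' d w o block_part o' d w'"
proof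
 fix j
 show "block_part o' d (w o w') j = (block_part o' d w o block_part o' d w') j"
 proof (cases "1 <= j & j <= d")
  case True
  hence "o' < w' (j + o')" "w' (j + o') <= o' + d" using block_part_in[OF assms, of j] by auto
  hence "1 <= w' (j + o') - o' & w' (j + o') - o' <= d" "w' (j + o') - o' + o' = w' (j + o')" by linarith+
  thus ?thesis using True unfolding block_part_def o_def by simp
 next
  case False
  thus ?thesis by(auto simp: block_part_def)
 qed
qed

lemma block_part_id: "block_part o' d id = id" by(auto simp: block_part_def fun_eq_iff)

locale young_params = dirac_params +
 fixes a :: "nat => nat"
 assumes a_comps: "a : comps m n"
begin

abbreviation "YH == young_hecke m k a"
abbreviation "YC == young_cover m n a"
abbreviation "col == color m a"
abbreviation "ofs i == offset a i"
abbreviation "FH == factors m k a"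
abbreviation "mk == of_nat m * k"
abbreviation "Yp == young_perm m k a"

sublocale T: tensor_algebra "{..<m}" FH
 rewrites "tensor_alg {..<m} FH = YH"
 by(rule tensor_algebra.intro) (simp_all only: graded_calg young_hecke_def)

sublocale Y: calg YH by(rule T.TA_calg)

lemma young_image: "w : ysub m n a ==> i < m ==> w ` {ofs i<..ofs i + a i} = {ofs i<..ofs i + a i}"
 by(simp add: young_subgroup_def block_eq)

lemma young_part_permutes: "w : ysub m n a ==> i < m ==> block_part (ofs i) (a i) w permutes {1..a i}"
 by(rule block_part_permutes[OF young_image]) (auto dest: young_permutes[OF a_comps] permutes_inj)

lemma Yp_slot: "w : ysub m n a ==> i : {..<m} ==>
  graded_gen mk (a i) (Elt (block_part (ofs i) (a i) w)) :. FH i"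
 by(intro graded_Elt_closed young_part_permutes) auto

lemma Yp_closed: "w : ysub m n a ==> Yp w :. YH" unfolding young_perm_def by(rule T.pt_closed) (rule Yp_slot)

lemma Yp_mult:
 assumes "w : ysub m n a" "w' : ysub m n a"
 shows "Yp w \<otimes>\<^sub>YH Yp w' = Yp (w o w')"
proof -
 let ?e = "%w i. graded_gen mk (a i) (Elt (block_part (ofs i) (a i) w))"
 have "Yp w \<otimes>\<^sub>YH Yp w' = T.pt (%i. ?e w i \<otimes>\<^sub>(FH i) ?e w' i)"
  unfolding young_perm_def by(rule T.pt_mult; rule Yp_slot[OF assms(1)] Yp_slot[OF assms(2)])
 also have "... = T.pt (?e (w o w'))"
 proof (rule T.pt_cong)
  fix i assume "i : {..<m}"
  hence i: "i < m" by simp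
  show "?e w i \<otimes>\<^sub>(FH i) ?e w' i = ?e (w o w') i" unfolding block_part_comp[OF young_image[OF assms(2) i]]
   by(rule graded_Elt_mult[OF young_part_permutes[OF assms(1) i] young_part_permutes[OF assms(2) i]])
 qed
 finally show ?thesis by(simp only: young_perm_def)
qed

lemma Yp_id: "Yp id = \<one>\<^sub>YH" unfolding young_perm_def T.pt_one[symmetric]
 by(rule T.pt_cong) (simp add: block_part_id graded_Elt_one)

lemma young_iff: "w : ysub m n a \<longleftrightarrow> w permutes {1..n} & (\<forall>j\<in>{1..n}. col (w j) = col j)"
 by(rule young_subgroup_iff[OF a_comps])

lemma young_comp: "w : ysub m n a ==> w' : ysub m n a ==> w o w' : ysub m n a"
 using subgroup.m_closed[OF subgroup_young] by(simp add: sym_group_mult)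

lemma young_swap:
 assumes "i : {1..n}" "j : {1..n}" "col i = col j"
 shows "transpose i j : ysub m n a"
proof -
 have "col (transpose i j r) = col r" for r using assms(3) by(cases "r = i"; cases "r = j") simp_all
 thus ?thesis unfolding young_iff using permutes_swap_id[OF assms(1,2)] by blast
qed

definition young_pos :: "nat => nat" where "young_pos j = j - ofs (col j)"

lemma young_pos:
 assumes "j : {1..n}"
 shows "col j < m" "1 <= young_pos j" "young_pos j <= a (col j)" "ofs (col j) + young_pos j = j"
proof -
 show "col j < m" by(rule color_block(1)[OF a_comps assms])
 have "ofs (col j) < j" "j <= ofs (col j) + a (col j)"
  using color_block(2)[OF a_comps assms] unfolding block_eq greaterThanAtMost_iff by blast+
 thus "1 <= young_pos j" "young_pos j <= a (col j)" "ofs (col j) + young_pos j = j"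
  unfolding young_pos_def by linarith+
qed

lemma same_color_pos:
 assumes "i : {1..n}" "j : {1..n}" "col i = col j" "young_pos i = young_pos j"
 shows "i = j"
proof -
 have "i = ofs (col j) + young_pos j" using young_pos(4)[OF assms(1)] by(simp only: assms(3,4))
 thus ?thesis using young_pos(4)[OF assms(2)] by(simp only:)
qed

definition Yz :: "nat => young_alg" where "Yz j = young_z m k a (col j) j"

lemma Yz_eq: "Yz j = T.tf (col j) (graded_gen mk (a (col j)) (Z (young_pos j)))"
 by(simp add: Yz_def young_z_def young_pos_def)

lemma Z_slot: "j : {1..n} ==> graded_gen mk (a (col j)) (Z (young_pos j)) :. FH (col j)"
 using young_pos[of j] by(intro graded_Z_closed) auto

lemma Yz_closed: "j : {1..n} ==> Yz j :. YH"
 unfolding Yz_eq by(rule T.tf_closed) (use young_pos Z_slot in auto)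

lemma block_part_swap_same:
 assumes "i : {1..n}" "j : {1..n}" "col i = col j"
 shows "block_part (ofs (col i)) (a (col i)) (transpose i j) = transpose (young_pos i) (young_pos j)"
proof
 fix r
 let ?o = "ofs (col i)"
 have i: "i = young_pos i + ?o" and j: "j = young_pos j + ?o"
  using young_pos(4)[OF assms(1)] young_pos(4)[OF assms(2)] assms(3) by auto
 show "block_part ?o (a (col i)) (transpose i j) r = transpose (young_pos i) (young_pos j) r"
 proof (cases "1 <= r & r <= a (col i)")
  case True
  have "transpose i j (r + ?o) = transpose (young_pos i) (young_pos j) r + ?o"
  proof -
   have "transpose (young_pos i + ?o) (young_pos j + ?o) (r + ?o) = transpose (young_pos i) (young_pos j) r + ?o"
    by(auto simp: transpose_def)
   thus ?thesis using i j by metis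
  qed
  thus ?thesis using True by(simp add: block_part_def)
 next
  case False
  hence "r ~= young_pos i" "r ~= young_pos j"
   using young_pos(2,3)[OF assms(1)] young_pos(2,3)[OF assms(2)] assms(3) by auto
  thus ?thesis using False by(auto simp: block_part_def)
 qed
qed

lemma block_part_swap_other:
 assumes "i : {1..n}" "j : {1..n}" "col i = col j" "c < m" "c ~= col i"
 shows "block_part (ofs c) (a c) (transpose i j) = id"
proof
 fix r
 have "r + ofs c ~= i" "r + ofs c ~= j" if "1 <= r & r <= a c"
 proof -
  have "r + ofs c : block a c" using that by(auto simp: block_eq)
  hence "col (r + ofs c) = c" by(rule color_eq[OF assms(4)])
  thus "r + ofs c ~= i" "r + ofs c ~= j" using assms(3,5) by auto
 qed
 thus "block_part (ofs c) (a c) (transpose i j) r = id r" by(simp add: block_part_def)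
qed

lemma Yp_swap:
 assumes "i : {1..n}" "j : {1..n}" "col i = col j"
 shows "Yp (transpose i j) =
  T.tf (col i) (graded_gen mk (a (col i)) (Elt (transpose (young_pos i) (young_pos j))))"
 unfolding young_perm_def tensor_factor_def
proof (rule T.pt_cong)
 fix c assume "c : {..<m}"
 hence c: "c < m" by simp
 show "graded_gen mk (a c) (Elt (block_part (ofs c) (a c) (transpose i j))) = (if c = col i
   then graded_gen mk (a (col i)) (Elt (transpose (young_pos i) (young_pos j))) else \<one>\<^sub>(FH c))"
 proof (cases "c = col i")
  case True
  thus ?thesis using block_part_swap_same[OF assms] by simp
 next
  case False
  thus ?thesis using block_part_swap_other[OF assms c False] graded_Elt_one by simp
 qed
qed

lemma young_s_eq:
 assumes "i < m" "j : block a i" "r : block a i"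
 shows "young_s m k a i j r = Yp (transpose j r)"
proof -
 have "j : {1..n}" "r : {1..n}" using subsetD[OF block_subset[OF a_comps assms(1)]] assms(2,3) by blast+
 moreover have "col j = i" "col r = i" using color_eq[OF assms(1)] assms(2,3) by blast+
 ultimately show ?thesis by(simp add: Yp_swap young_s_def young_pos_def)
qed

text \<open>Reflections exchanging different blocks are absent; the factor \<open>m\<close> is the number of summands of the corresponding
 term for the reflection group.\<close>

definition YR :: "nat => nat => young_alg" where
 "YR i j = (if col i = col j then of_nat m \<odot>\<^sub>YH Yp (transpose i j) else \<zero>\<^sub>YH)"

lemma YR_closed: "i : {1..n} ==> j : {1..n} ==> YR i j :. YH" by(simp add: YR_def Yp_closed young_swap)

abbreviation young_elt :: "nat => young_alg" where "young_elt == dirac_elt YH n k Yz YR"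

lemma young_elt_closed: "i : {1..n} ==> young_elt i :. YH"
 by(rule Y.dirac_elt_closed) (auto intro: Yz_closed YR_closed)

lemma Yp_YR:
 assumes w: "w : ysub m n a" and i: "i : {1..n}" and j: "j : {1..n}"
 shows "Yp w \<otimes>\<^sub>YH YR i j = YR (w i) (w j) \<otimes>\<^sub>YH Yp w"
proof -
 have p: "w permutes {1..n}" and c: "col (w i) = col i" "col (w j) = col j" using w i j by(auto simp: young_iff)
 have wi: "w i : {1..n}" "w j : {1..n}" using permutes_range(1)[OF p] i j by blast+
 show ?thesis
 proof (cases "col i = col j")
  case True
  have sw: "w o transpose i j = transpose (w i) (w j) o w"
   using permutes_inj[OF p] by(auto simp: transpose_def fun_eq_iff inj_eq)
  have s: "transpose i j : ysub m n a" "transpose (w i) (w j) : ysub m n a"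
   using young_swap i j wi True c by simp_all
  show ?thesis using True c Yp_closed[OF w] Yp_closed[OF s(1)] Yp_closed[OF s(2)]
   by(simp add: YR_def Y.smult_mult_left Y.smult_mult_right Yp_mult w s sw)
 next
  case False
  thus ?thesis using c Yp_closed[OF w] by(simp add: YR_def)
 qed
qed

lemma adjacent_same_color:
 assumes "1 <= j" "j < n" "col j = col (j + 1)"
 shows "young_pos (j + 1) = young_pos j + 1" "young_pos j < a (col j)" "col j < m" "1 <= young_pos j"
proof -
 have jn: "j : {1..n}" "j + 1 : {1..n}" using assms by auto
 note p = young_pos[OF jn(1)] and p' = young_pos[OF jn(2)]
 note q = p'[folded assms(3)]
 show e: "young_pos (j + 1) = young_pos j + 1" using p(4) q(4) by linarith
 show "young_pos j < a (col j)" using q(3) e by linarith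
 show "col j < m" "1 <= young_pos j" using p by simp_all
qed

lemma Yz_far:
 assumes j: "1 <= j" "j < n" "col j = col (j + 1)" and i: "i : {1..n}" "i ~= j" "i ~= j + 1"
 shows "Yz i \<otimes>\<^sub>YH Yp (transpose j (j + 1)) = Yp (transpose j (j + 1)) \<otimes>\<^sub>YH Yz i"
proof -
 have jn: "j : {1..n}" "j + 1 : {1..n}" using j by auto
 note adj = adjacent_same_color[OF j]
 have e: "Yp (transpose j (j + 1)) =
   T.tf (col j) (graded_gen mk (a (col j)) (Elt (transpose (young_pos j) (young_pos j + 1))))"
  using Yp_swap[OF jn j(3)] adj(1) by simp
 have sc: "graded_gen mk (a (col j)) (Elt (transpose (young_pos j) (young_pos j + 1))) :. FH (col j)"
  using adj by(intro graded_Elt_closed permutes_swap_id) auto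
 show ?thesis
 proof (cases "col i = col j")
  case True
  have ne: "young_pos i ~= young_pos j" "young_pos i ~= young_pos j + 1"
   using same_color_pos[OF i(1) jn(1)] same_color_pos[OF i(1) jn(2)] i True j(3) adj(1) by auto
  have zc: "graded_gen mk (a (col j)) (Z (young_pos i)) :. FH (col j)" using Z_slot[OF i(1)] True by simp
  have "young_pos i : {1..a (col j)}" using young_pos(2,3)[OF i(1)] True by auto
  from graded_Z_far[OF adj(4,2) this ne] show ?thesis
   unfolding e Yz_eq True using adj(3) sc zc by(simp add: T.tf_mult)
 next
  case False
  thus ?thesis
   unfolding e Yz_eq using adj(3) young_pos(1)[OF i(1)] sc Z_slot[OF i(1)] by(intro T.tf_commute) auto
 qed
qed

lemma Yz_near:
 assumes j: "1 <= j" "j < n" "col j = col (j + 1)"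
 shows "Yz j \<otimes>\<^sub>YH Yp (transpose j (j + 1)) = Yp (transpose j (j + 1)) \<otimes>\<^sub>YH Yz (j + 1)
  \<ominus>\<^sub>YH k \<odot>\<^sub>YH (Yp (transpose j (j + 1)) \<otimes>\<^sub>YH YR j (j + 1))"
proof -
 let ?s = "transpose j (j + 1)" and ?c = "col j" and ?p = "young_pos j"
 have jn: "j : {1..n}" "j + 1 : {1..n}" using j by auto
 note adj = adjacent_same_color[OF j]
 let ?e = "graded_gen mk (a ?c) (Elt (transpose ?p (?p + 1)))" and ?z = "graded_gen mk (a ?c) (Z ?p)"
  and ?z' = "graded_gen mk (a ?c) (Z (?p + 1))"
 have c: "?c : {..<m}" using adj by simp
 have e: "Yp ?s = T.tf ?c ?e" using Yp_swap[OF jn j(3)] adj(1) by simp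
 have z: "Yz j = T.tf ?c ?z" "Yz (j + 1) = T.tf ?c ?z'" using j(3) adj(1) by(simp_all add: Yz_eq)
 have cl: "?e :. FH ?c" "?z :. FH ?c" "?z' :. FH ?c"
  using adj by(auto intro!: graded_Elt_closed permutes_swap_id graded_Z_closed)
 interpret F: calg "FH ?c" by(rule graded_calg)
 have s: "?s : ysub m n a" by(rule young_swap[OF jn j(3)])
 have "Yp ?s \<otimes>\<^sub>YH YR j (j + 1) = of_nat m \<odot>\<^sub>YH \<one>\<^sub>YH"
  using j(3) Yp_closed[OF s] Yp_mult[OF s s] by(simp add: YR_def Y.smult_mult_right Yp_id)
 hence "k \<odot>\<^sub>YH (Yp ?s \<otimes>\<^sub>YH YR j (j + 1)) = mk \<odot>\<^sub>YH \<one>\<^sub>YH" by(simp add: scale_scale[OF Y.cspace] mult.commute)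
 moreover have "Yz j \<otimes>\<^sub>YH Yp ?s = T.tf ?c (?z \<otimes>\<^sub>(FH ?c) ?e)" unfolding e z by(rule T.tf_mult[OF c cl(2,1)])
 moreover have "?z \<otimes>\<^sub>(FH ?c) ?e = ?e \<otimes>\<^sub>(FH ?c) ?z' \<ominus>\<^sub>(FH ?c) mk \<odot>\<^sub>(FH ?c) \<one>\<^sub>(FH ?c)"
  by(rule graded_Z_near[OF adj(4,2)])
 moreover have "T.tf ?c (?e \<otimes>\<^sub>(FH ?c) ?z' \<ominus>\<^sub>(FH ?c) mk \<odot>\<^sub>(FH ?c) \<one>\<^sub>(FH ?c)) = Yp ?s \<otimes>\<^sub>YH Yz (j + 1) \<ominus>\<^sub>YH mk \<odot>\<^sub>YH \<one>\<^sub>YH"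
  unfolding e z T.tf_mult[OF c cl(1,3)] T.tf_one[of ?c, symmetric]
  using lin_minus[OF F.cspace Y.cspace T.tf_lin[OF c], of "?e \<otimes>\<^sub>(FH ?c) ?z'" "mk \<odot>\<^sub>(FH ?c) \<one>\<^sub>(FH ?c)"]
   lin_smult[OF T.tf_lin[OF c] F.one_closed, of mk] cl F.m_closed F.smult_closed' F.one_closed by simp
 ultimately show ?thesis by simp
qed

lemma young_elt_conj:
 assumes w: "w : ysub m n a" and i: "i : {1..n}"
 shows "Yp w \<otimes>\<^sub>YH young_elt i = young_elt (w i) \<otimes>\<^sub>YH Yp w"
proof (rule Y.dirac_elt_conj[where \<kappa> = col and u = Yp])
 show "mono_on {1..n} col" by(rule color_mono[OF a_comps])
 show "Yp w :. YH" if "w permutes {1..n}" "!!r. r : {1..n} ==> col (w r) = col r" for w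
  using Yp_closed young_iff that by blast
 show "Yp (w o w') = Yp w \<otimes>\<^sub>YH Yp w'" if "w permutes {1..n}" "!!r. r : {1..n} ==> col (w r) = col r"
   "w' permutes {1..n}" "!!r. r : {1..n} ==> col (w' r) = col r" for w w'
  by(rule Yp_mult[symmetric]) (use young_iff that in blast)+
 show "Yp w \<otimes>\<^sub>YH YR i j = YR (w i) (w j) \<otimes>\<^sub>YH Yp w"
  if "w permutes {1..n}" "!!r. r : {1..n} ==> col (w r) = col r" "i : {1..n}" "j : {1..n}" for w i j
  by(rule Yp_YR) (use young_iff that in blast)+
 show "YR j (j + 1) = YR (j + 1) j" for j unfolding YR_def transpose_commute[of j] by(simp only: eq_commute)
 show "w permutes {1..n}" "!!r. r : {1..n} ==> col (w r) = col r" using w young_iff by blast+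
qed (assumption | rule Yz_closed YR_closed Yp_id Yz_far Yz_near i)+

lemma YC_group: "group YC" by(rule pin_cover_group[OF subgroup_young])

lemma YC_lift:
 assumes "x :. YC"
 shows "perm_lift n x (cover_perm n x)" "cover_perm n x : ysub m n a" "x :. clifford n" "x :. SC"
proof -
 show l: "perm_lift n x (cover_perm n x)" "cover_perm n x : ysub m n a"
  using perm_lift_cover_perm[OF young_permutes[OF a_comps] assms] by blast+
 thus "x :. clifford n" "x :. SC" using lift_in_SC by(auto simp: perm_lift_def)
qed

lemma lift_in_YC: "perm_lift n x w ==> w : ysub m n a ==> x :. YC"
 using pin_cover_iff[OF young_permutes[OF a_comps]] by blast

text \<open>The sums over the blocks become one sum over all \<open>r\<close>, because the other terms vanish and the order within a block
 is the order of the indices.\<close>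

lemma young_elt_eq:
 assumes i: "i < m" and j: "j : block a i"
 shows "young_z m k a i j \<oplus>\<^sub>YH (of_nat m * k / 2) \<odot>\<^sub>YH (\<Oplus>\<^sub>YH r\<in>{r \<in> block a i. r > j}. young_s m k a i j r)
      \<ominus>\<^sub>YH (of_nat m * k / 2) \<odot>\<^sub>YH (\<Oplus>\<^sub>YH r\<in>{r \<in> block a i. r < j}. young_s m k a i j r) = young_elt j"
proof -
 have jn: "j : {1..n}" using block_subset[OF a_comps i] j by blast
 have cj: "col j = i" by(rule color_eq[OF i j])
 have sum: "(\<Oplus>\<^sub>YH r\<in>{r \<in> {1..n}. Q r}. YR j r) =
   of_nat m \<odot>\<^sub>YH (\<Oplus>\<^sub>YH r\<in>{r \<in> block a i. Q r}. young_s m k a i j r)" for Q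
 proof -
  have b: "r : {1..n} & col r = i" if "r : block a i" for r
   using block_subset[OF a_comps i] color_eq[OF i that] that by blast
  have fin: "finite {r \<in> {1..n}. Q r}" "finite {r \<in> block a i. Q r}" by simp_all
  have sub: "{r \<in> block a i. Q r} <= {r \<in> {1..n}. Q r}" using b by blast
  have sc: "young_s m k a i j r :. YH" if "r : {r \<in> block a i. Q r}" for r
   using that young_s_eq[OF i j, of r] Yp_closed[OF young_swap[OF jn, of r]] b[of r] cj by simp
  have "(\<Oplus>\<^sub>YH r\<in>{r \<in> {1..n}. Q r}. YR j r) = (\<Oplus>\<^sub>YH r\<in>{r \<in> block a i. Q r}. YR j r)"
  proof (rule Y.add.finprod_mono_neutral_cong_right[OF fin(1) sub])
   fix r assume "r : {r \<in> {1..n}. Q r} - {r \<in> block a i. Q r}"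
   hence "col r ~= i" using color_block(2)[OF a_comps, of r] by auto
   thus "YR j r = \<zero>\<^sub>YH" using cj by(simp add: YR_def)
  qed (use YR_closed[OF jn] in auto)
  also have "... = (\<Oplus>\<^sub>YH r\<in>{r \<in> block a i. Q r}. of_nat m \<odot>\<^sub>YH young_s m k a i j r)"
  proof (rule Y.finsum_cong'[OF refl])
   fix r assume r: "r : {r \<in> block a i. Q r}"
   thus "YR j r = of_nat m \<odot>\<^sub>YH young_s m k a i j r"
    using young_s_eq[OF i j, of r] b[of r] cj by(simp add: YR_def)
  qed (use sc in auto)
  also have "... = of_nat m \<odot>\<^sub>YH (\<Oplus>\<^sub>YH r\<in>{r \<in> block a i. Q r}. young_s m k a i j r)"
   by(rule Y.smult_finsum[symmetric, OF fin(2) sc])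
  finally show ?thesis .
 qed
 let ?S = "%Q. \<Oplus>\<^sub>YH r\<in>{r \<in> block a i. Q r}. young_s m k a i j r"
 have Sc: "?S Q :. YH" for Q
 proof (intro Y.finsum_closed funcsetI)
  fix r assume "r : {r \<in> block a i. Q r}"
  hence r: "r : block a i" by simp
  hence "r : {1..n}" "col r = i" using block_subset[OF a_comps i] color_eq[OF i r] by auto
  thus "young_s m k a i j r :. YH" using young_s_eq[OF i j r] Yp_closed[OF young_swap[OF jn]] cj by simp
 qed
 have zc: "young_z m k a i j :. YH" using Yz_closed[OF jn] cj by(simp add: Yz_def)
 have diff: "c \<odot>\<^sub>YH (x \<ominus>\<^sub>YH y) = c \<odot>\<^sub>YH x \<ominus>\<^sub>YH c \<odot>\<^sub>YH y" if "x :. YH" "y :. YH" for c x y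
  by(rule lin_minus[OF Y.cspace Y.cspace lin_const_smult[OF Y.cspace lin_id] that])
 have "young_elt j = Yz j \<oplus>\<^sub>YH (k / 2) \<odot>\<^sub>YH (of_nat m \<odot>\<^sub>YH ?S (%r. j < r) \<ominus>\<^sub>YH of_nat m \<odot>\<^sub>YH ?S (%r. r < j))"
  using Y.signed_sum_split[of "{1..n}" "YR j" j] YR_closed[OF jn] sum[of "%r. j < r"] sum[of "%r. r < j"]
  by(simp only: dirac_elt_def finite_atLeastAtMost simp_thms)
 also have "... = young_z m k a i j \<oplus>\<^sub>YH (of_nat m * k / 2) \<odot>\<^sub>YH ?S (%r. j < r)
   \<ominus>\<^sub>YH (of_nat m * k / 2) \<odot>\<^sub>YH ?S (%r. r < j)" using Sc[of "%r. j < r"] Sc[of "%r. r < j"] zc cj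
 proof -
  let ?P = "?S (%r. j < r)" and ?N = "?S (%r. r < j)"
  have PN: "?P :. YH" "?N :. YH" by(rule Sc)+
  have sc: "b \<odot>\<^sub>YH ?P :. YH" "b \<odot>\<^sub>YH ?N :. YH" for b using PN by(simp_all add: Y.smult_closed')
  have "(k / 2) \<odot>\<^sub>YH (of_nat m \<odot>\<^sub>YH ?P \<ominus>\<^sub>YH of_nat m \<odot>\<^sub>YH ?N) =
    (of_nat m * k / 2) \<odot>\<^sub>YH ?P \<ominus>\<^sub>YH (of_nat m * k / 2) \<odot>\<^sub>YH ?N"
   unfolding diff[OF sc(1) sc(2)] scale_scale[OF Y.cspace PN(1)] scale_scale[OF Y.cspace PN(2)]
   by(simp add: mult.commute)
  moreover have "Yz j = young_z m k a i j" using cj by(simp add: Yz_def)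
  ultimately show ?thesis using Y.a_assoc[OF zc sc(1) Y.a_inv_closed[OF sc(2)]] by(simp add: a_minus_def)
 qed
 finally show ?thesis ..
qed

lemma young_datum:
 "dirac_datum YH YC S {1..n} young_elt cliff_act (%x. Yp (cover_perm n x)) (act S) (cover_perm n) parity
   (young_dirac m n k a S :: (young_alg, 'v) lmod => _) (young_cover_act m n k a S)"
proof (rule pin_datum[OF YC_group young_elt_closed])
 fix x assume x: "x :. YC"
 note xl = YC_lift[OF x]
 note p = perm_lift_parity[OF xl(1)]
 show "parity x :. YC & parity (parity x) = x & parity x = parity x &
   Yp (cover_perm n (parity x)) = Yp (cover_perm n x)"
  using lift_in_YC[OF p xl(2)] parity_parity[OF xl(3)] cover_perm_lift[OF p] by simp
 show "Yp (cover_perm n x) \<otimes>\<^sub>YH young_elt i = young_elt (cover_perm n x i) \<otimes>\<^sub>YH Yp (cover_perm n x)"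
  if "i : {1..n}" for i by(rule young_elt_conj[OF xl(2) that])
 show "young_cover_act m n k a S M x = tensor_map M S (act M (Yp (cover_perm n x))) (act S x)"
  for M :: "(young_alg, 'v) lmod" by(intro ext) (simp add: young_cover_act_def)
 fix y assume y: "y :. YC"
 note yl = YC_lift[OF y]
 show "Yp (cover_perm n (x \<otimes>\<^sub>YC y)) = Yp (cover_perm n x) \<otimes>\<^sub>YH Yp (cover_perm n y)"
  by(simp add: pin_cover_mult cover_perm_mult[OF xl(4) yl(4)] Yp_mult[OF xl(2) yl(2)])
next
 fix M :: "(young_alg, 'v) lmod" and x
 assume M: "alg_module YH M" and x: "x :. tensor M S"
 interpret T': module CC "tensor M S" by(rule cspace_tensor[OF module_cspace[OF M] S_cspace])
 let ?f = "%j. tensor_map M S (act M (young_elt j)) (cliff_act j) x"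
 have f: "?f j :. tensor M S" if "j : {1..n}" for j
  by(rule lin_closed[OF tensor_map_lin[OF module_cspace[OF M] S_cspace
      module_cspace[OF M] S_cspace act_lin[OF M young_elt_closed[OF that]] cliff_act_lin] x])
 have fb: "?f j :. tensor M S" if "i < m" "j : block a i" for i j
  using f block_subset[OF a_comps that(1)] that(2) by blast
 have "(\<Oplus>\<^sub>(tensor M S)j\<in>{1..n}. ?f j) = (\<Oplus>\<^sub>(tensor M S)i\<in>{..<m}. \<Oplus>\<^sub>(tensor M S)j\<in>block a i. ?f j)"
  unfolding UN_blocks[OF a_comps, symmetric]
 proof (rule T'.M.add.finprod_UN_disjoint)
  show "pairwise (%i j. disjnt (block a i) (block a j)) {..<m}"
   using block_unique by(auto simp: pairwise_def disjnt_def)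
 qed (use fb in auto)
 also have "... = young_dirac m n k a S M x" unfolding young_dirac_def Let_def
 proof (rule T'.M.finsum_cong'[OF refl])
  fix i assume i: "i : {..<m}"
  show "(\<Oplus>\<^sub>(tensor M S)j\<in>block a i. ?f j) = (\<Oplus>\<^sub>(tensor M S)j\<in>block a i. tensor_map M S (act M (young_z m k a i j
      \<oplus>\<^sub>YH (of_nat m * k / 2) \<odot>\<^sub>YH (\<Oplus>\<^sub>YH r\<in>{r \<in> block a i. r > j}. young_s m k a i j r)
      \<ominus>\<^sub>YH (of_nat m * k / 2) \<odot>\<^sub>YH (\<Oplus>\<^sub>YH r\<in>{r \<in> block a i. r < j}. young_s m k a i j r)))
     (act S (cliff_vec n (basis_vec n j))) x)"
   by(rule T'.M.finsum_cong'[OF refl]) (use i fb young_elt_eq in auto)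
 next
  show "(%i. \<Oplus>\<^sub>(tensor M S)j\<in>block a i. tensor_map M S (act M (young_z m k a i j
      \<oplus>\<^sub>YH (of_nat m * k / 2) \<odot>\<^sub>YH (\<Oplus>\<^sub>YH r\<in>{r \<in> block a i. r > j}. young_s m k a i j r)
      \<ominus>\<^sub>YH (of_nat m * k / 2) \<odot>\<^sub>YH (\<Oplus>\<^sub>YH r\<in>{r \<in> block a i. r < j}. young_s m k a i j r)))
     (act S (cliff_vec n (basis_vec n j))) x) : {..<m} \<rightarrow> carrier (tensor M S)"
   using fb young_elt_eq by(intro funcsetI T'.M.finsum_closed) simp
 qed
 finally show "young_dirac m n k a S M x = (\<Oplus>\<^sub>(tensor M S)j\<in>{1..n}. ?f j)" ..
qed (simp_all add: YC_lift Yp_closed pin_cover_mult pin_cover_one cover_perm_one Yp_id)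

end

section \<open>Weight spaces\<close>

lemma cspace_finsum_smult:
 assumes V: "cspace V" and I: "finite I" and v: "v :. V"
 shows "(\<Oplus>\<^sub>V i\<in>I. f i \<odot>\<^sub>V v) = (\<Sum>i\<in>I. f i) \<odot>\<^sub>V v"
proof -
 interpret V: module CC V by(rule V)
 show ?thesis using I
 proof (induction I)
  case empty
  show ?case using scale_zero[OF V v] by simp
 next
  case (insert i I)
  have "(\<Oplus>\<^sub>V i\<in>insert i I. f i \<odot>\<^sub>V v) = f i \<odot>\<^sub>V v \<oplus>\<^sub>V (\<Oplus>\<^sub>V i\<in>I. f i \<odot>\<^sub>V v)"
   using insert.hyps v scale_closed[OF V] by(intro V.M.finsum_insert) auto
  thus ?case using insert scale_plus[OF V v] by simp
 qed
qed

lemma cspace_minus_smult: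
 assumes V: "cspace V" and v: "v :. V"
 shows "x \<ominus>\<^sub>V c \<odot>\<^sub>V v = x \<oplus>\<^sub>V (- c) \<odot>\<^sub>V v"
 unfolding a_minus_def smult_minus_one[OF V scale_closed[OF V v], symmetric] scale_scale[OF V v] by simp

lemma foldr_lin: "(!!x. x : set xs ==> f x : lin_maps V V) ==> foldr f xs : lin_maps V V"
proof (induction xs)
 case Nil
 thus ?case using lin_id[of V] by(simp add: id_def)
next
 case (Cons x xs)
 thus ?case using lin_comp[of "foldr f xs" V V "f x" V] by(simp add: o_def)
qed

lemma foldr_intertwine:
 assumes "!!x v. x : set xs ==> v : U ==> f x v : U & h (f x v) = g x (h v)" "v : U"
 shows "foldr f xs v : U & h (foldr f xs v) = foldr g xs (h v)" using assms by(induction xs) auto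

lemma block_shift_id: "block_shift o' d id = id" by(auto simp: block_shift_def fun_eq_iff)

lemma block_shift_in:
 assumes w: "w permutes {1..d}" and j: "o' < j" "j <= o' + d"
 shows "o' < block_shift o' d w j" "block_shift o' d w j <= o' + d" "block_shift o' d w j = w (j - o') + o'"
proof -
 have "j - o' : {1..d}" using j unfolding atLeastAtMost_iff by linarith
 hence "w (j - o') : {1..d}" by(rule permutes_range(1)[OF w])
 hence b: "1 <= w (j - o')" "w (j - o') <= d" unfolding atLeastAtMost_iff by blast+
 show e: "block_shift o' d w j = w (j - o') + o'" using j by(simp add: block_shift_def)
 show "o' < block_shift o' d w j" "block_shift o' d w j <= o' + d" unfolding e using b by linarith+
qed

lemma block_shift_comp:
 assumes w': "w' permutes {1..d}"
 shows "block_shift o' d (w o w') = block_shift o' d w o block_shift o' d w'"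
proof
 fix j
 show "block_shift o' d (w o w') j = (block_shift o' d w o block_shift o' d w') j"
 proof (cases "o' < j & j <= o' + d")
  case True
  note b = block_shift_in[OF w' True[THEN conjunct1] True[THEN conjunct2]]
  have "block_shift o' d w (block_shift o' d w' j) = w (block_shift o' d w' j - o') + o'"
   using b(1,2) unfolding block_shift_def[of o' d w] by simp
  also have "... = w (w' (j - o')) + o'" unfolding b(3) by simp
  finally show ?thesis using True by(simp add: block_shift_def[of o' d "w o w'"])
 next
  case False
  hence "block_shift o' d u j = j" for u unfolding block_shift_def by meson
  thus ?thesis by simp
 qed
qed

lemma block_shift_permutes:
 assumes w: "w permutes {1..d}"
 shows "block_shift o' d w permutes {o'<..o' + d}"
proof -
 note i = permutes_inv[OF w]
 have "block_shift o' d w o block_shift o' d (inv_into UNIV w) = id"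
  "block_shift o' d (inv_into UNIV w) o block_shift o' d w = id"
  by(simp_all add: block_shift_comp[symmetric] i w permutes_inv_o[OF w] block_shift_id)
 hence "bij (block_shift o' d w)" by(rule o_bij[rotated])
 moreover have "block_shift o' d w j = j" if "j \<notin> {o'<..o' + d}" for j
  using that unfolding block_shift_def greaterThanAtMost_iff by meson
 ultimately show ?thesis unfolding permutes_def bij_iff by blast
qed

lemma block_shift_swap:
 assumes "r : {1..d}" "r' : {1..d}"
 shows "block_shift o' d (transpose r r') = transpose (o' + r) (o' + r')"
proof
 fix j
 show "block_shift o' d (transpose r r') j = transpose (o' + r) (o' + r') j"
 proof (cases "o' < j & j <= o' + d")
  case True
  define p where "p = j - o'"
  have j: "j = o' + p" using True unfolding p_def by linarith
  have "transpose r r' p + o' = transpose (o' + r) (o' + r') (o' + p)"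
   by(cases "p = r"; cases "p = r'") (simp_all add: transpose_def)
  thus ?thesis using True unfolding j block_shift_def by simp
 next
  case False
  hence "j ~= o' + r" "j ~= o' + r'" using assms unfolding atLeastAtMost_iff by linarith+
  moreover have "block_shift o' d (transpose r r') j = j" using False unfolding block_shift_def by meson
  ultimately show ?thesis by simp
 qed
qed

context refl_root
begin

lemma chr_torus_gen:
 assumes "i : {1..n}"
 shows "chr c (torus_gen m n i d) = \<eta> powi (c i * d)"
proof -
 have "chr c (torus_gen m n i d) = (\<Prod>j\<in>{1..n}. if j = i then \<eta> powi (c i * d) else 1)" unfolding torus_chr_def
 proof (rule prod.cong[OF refl])
  fix j assume j: "j : {1..n}"
  show "\<eta> powi (c j * torus_gen m n i d j) = (if j = i then \<eta> powi (c i * d) else 1)"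
  proof (cases "j = i")
   case True
   have "\<eta> powi (c i * (d mod int m)) = \<eta> powi (c i * d)" by(rule root_cong) (simp add: mod_simps)
   thus ?thesis using True j by(simp add: torus_gen_def)
  next
   case False
   thus ?thesis using j by(simp add: torus_gen_def)
  qed
 qed
 thus ?thesis using assms by simp
qed

lemma pair_elt_sum:
 assumes a: "a : comps m n" and ij: "i : {1..n}" "j : {1..n}" "i ~= j"
 shows "(\<Sum>l<m. mu m \<eta> a (pair_elt i j (- int l))) = (if color m a i = color m a j then of_nat m else 0)"
proof -
 let ?d = "int (color m a j) - int (color m a i)"
 have "mu m \<eta> a (pair_elt i j (- int l)) = \<eta> powi (?d * int l)" for l
 proof -
  have "mu m \<eta> a (pair_elt i j (- int l)) =
    \<eta> powi (int (color m a i) * - int l) * \<eta> powi (int (color m a j) * int l)"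
   using ij by(simp add: mu_torus_chr[OF a] pair_elt_eq[symmetric] chr_mult chr_torus_gen label_def)
  also have "... = \<eta> powi (?d * int l)"
   using root_nonzero by(simp add: power_int_add[symmetric] algebra_simps)
  finally show ?thesis .
 qed
 hence "(\<Sum>l<m. mu m \<eta> a (pair_elt i j (- int l))) = (\<Sum>x\<in>{0..<int m}. \<eta> powi (?d * x))"
  by(intro sum.reindex_bij_witness[of _ nat int]) auto
 also have "... = (if int m dvd ?d then of_nat m else 0)" by(rule root_sum)
 also have "int m dvd ?d \<longleftrightarrow> color m a i = color m a j"
 proof
  assume d: "int m dvd ?d"
  have "\<bar>?d\<bar> < int m" using color_block(1)[OF a ij(1)] color_block(1)[OF a ij(2)] by linarith
  hence "?d = 0" using d zdvd_not_zless[of "\<bar>?d\<bar>" "int m"] by(metis dvd_abs_iff zero_less_abs_iff)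
  thus "color m a i = color m a j" by simp
 qed simp
 finally show ?thesis .
qed

end

context young_params
begin

lemma young_block_pos:
 assumes i: "i < m" and r: "r : {1..a i}"
 shows "ofs i + r : {1..n}" "col (ofs i + r) = i"
proof -
 have b: "ofs i + r : block a i" using r unfolding block_eq by simp
 show "ofs i + r : {1..n}" using block_subset[OF a_comps i] b by blast
 show "col (ofs i + r) = i" by(rule color_eq[OF i b])
qed

lemma block_shift_young:
 assumes i: "i < m" and w: "w permutes {1..a i}"
 shows "block_shift (ofs i) (a i) w : ysub m n a" unfolding young_iff
proof
 let ?u = "block_shift (ofs i) (a i) w"
 have p: "?u permutes block a i" unfolding block_eq by(rule block_shift_permutes[OF w])
 show "?u permutes {1..n}" by(rule permutes_subset[OF p block_subset[OF a_comps i]])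
 show "\<forall>j\<in>{1..n}. col (?u j) = col j"
 proof
  fix j assume "j : {1..n}"
  show "col (?u j) = col j"
  proof (cases "j : block a i")
   case True
   hence "?u j : block a i" using permutes_in_image[OF p] by blast
   thus ?thesis using color_eq[OF i] True by simp
  next
   case False
   thus ?thesis using permutes_not_in[OF p] by simp
  qed
 qed
qed

lemma block_shift_commute:
 assumes i: "i < m" "i' < m" "i ~= i'" and w: "w permutes {1..a i}" "w' permutes {1..a i'}"
 shows "block_shift (ofs i) (a i) w o block_shift (ofs i') (a i') w' =
  block_shift (ofs i') (a i') w' o block_shift (ofs i) (a i) w"
proof
 let ?u = "block_shift (ofs i) (a i) w" and ?u' = "block_shift (ofs i') (a i') w'"
 have p: "?u permutes block a i" "?u' permutes block a i'"
  unfolding block_eq by(rule block_shift_permutes[OF w(1)], rule block_shift_permutes[OF w(2)])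
 have disj: "j \<notin> block a i'" if "j : block a i" for j using block_unique[OF that, of i'] i(3) by blast
 fix j
 consider "j : block a i" | "j : block a i'" | "j \<notin> block a i" "j \<notin> block a i'" by blast
 thus "(?u o ?u') j = (?u' o ?u) j"
 proof cases
  case 1
  hence "?u j : block a i" using permutes_in_image[OF p(1)] by blast
  thus ?thesis using permutes_not_in[OF p(2) disj] 1 by simp
 next
  case 2
  hence "?u' j : block a i'" using permutes_in_image[OF p(2)] by blast
  hence "?u j = j" "?u (?u' j) = ?u' j" using permutes_not_in[OF p(1)] disj 2 by blast+
  thus ?thesis by simp
 next
  case 3
  thus ?thesis using permutes_not_in[OF p(1)] permutes_not_in[OF p(2)] by simp
 qed
qed

text \<open>A permutation of one block commutes with the \<open>z\<^sub>j\<close> of all other blocks, because it is a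
 product of adjacent transpositions within its block.\<close>

lemma Zg_block_shift_commute:
 assumes i: "i < m" and w: "w permutes {1..a i}" and j: "j : {1..n}" "col j ~= i"
 shows "Zg j \<otimes>\<^sub>HH Ep (block_shift (ofs i) (a i) w) = Ep (block_shift (ofs i) (a i) w) \<otimes>\<^sub>HH Zg j"
proof -
 let ?s = "block_shift (ofs i) (a i)"
 have zc: "Zg j :. HH" by(rule H.Z_closed[OF j(1)])
 have mono: "mono_on {1..a i} (%_. 0 :: nat)" by(simp add: mono_on_def)
 have "w permutes {1..a i} & Zg j \<otimes>\<^sub>HH Ep (?s w) = Ep (?s w) \<otimes>\<^sub>HH Zg j"
 proof (rule class_perm_induct[OF mono w])
  show "id permutes {1..a i} & Zg j \<otimes>\<^sub>HH Ep (?s id) = Ep (?s id) \<otimes>\<^sub>HH Zg j"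
   using zc by(simp add: block_shift_id of_perm_id H.Elt_one permutes_id)
 next
  fix r and w :: "nat => nat"
  assume swap: "1 <= r" "r < a i" "w permutes {1..a i} & Zg j \<otimes>\<^sub>HH Ep (?s w) = Ep (?s w) \<otimes>\<^sub>HH Zg j"
  note w = swap(3)[THEN conjunct1] and IH = swap(3)[THEN conjunct2]
  have r: "r : {1..a i}" "r + 1 : {1..a i}" using swap(1,2) by simp_all
  have t: "transpose r (r + 1) permutes {1..a i}" by(rule permutes_swap_id[OF r])
  have e: "?s (transpose r (r + 1)) = transpose (ofs i + r) (ofs i + r + 1)"
   using block_shift_swap[OF r] by(simp add: add.assoc)
  have p: "?s (transpose r (r + 1)) permutes {1..n}" "?s w permutes {1..n}"
   using young_permutes[OF a_comps block_shift_young[OF i t]]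
    young_permutes[OF a_comps block_shift_young[OF i w]] by blast+
  note c = El_closed[OF of_perm_closed[OF p(1)]] El_closed[OF of_perm_closed[OF p(2)]]
  have m: "El (of_perm m n (?s (transpose r (r + 1) o w))) =
    El (of_perm m n (?s (transpose r (r + 1)))) \<otimes>\<^sub>HH Ep (?s w)"
   by(simp only: block_shift_comp[OF w] H.Elt_mult[OF of_perm_closed[OF p(1)] of_perm_closed[OF p(2)]]
     of_perm_mult[OF p])
  note y1 = young_block_pos[OF i r(1)] and y2 = young_block_pos[OF i r(2)]
  have "ofs i + r : {1..<n}" using y1(1) y2(1) by simp
  moreover have "j ~= ofs i + r" "j ~= ofs i + r + 1" using j(2) y1(2) y2(2) by(auto simp: add.assoc)
  ultimately have far: "Zg j \<otimes>\<^sub>HH El (of_perm m n (?s (transpose r (r + 1)))) =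
    El (of_perm m n (?s (transpose r (r + 1)))) \<otimes>\<^sub>HH Zg j" unfolding e by(rule H.Z_far[OF _ j(1)])
  have "Zg j \<otimes>\<^sub>HH El (of_perm m n (?s (transpose r (r + 1) o w))) =
    El (of_perm m n (?s (transpose r (r + 1) o w))) \<otimes>\<^sub>HH Zg j"
   unfolding m A.m_assoc[OF zc c, symmetric] far A.m_assoc[OF c(1) zc c(2)] IH
   by(rule A.m_assoc[symmetric, OF c zc])
  thus "transpose r (r + 1) o w permutes {1..a i} & Zg j \<otimes>\<^sub>HH El (of_perm m n (?s (transpose r (r + 1) o w))) =
    El (of_perm m n (?s (transpose r (r + 1) o w))) \<otimes>\<^sub>HH Zg j" using permutes_compose[OF w t] by blast
 qed (rule refl)
 thus ?thesis by blast
qed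

end

locale weight_params = young_params m n k \<eta> S a
 for m n :: nat and k \<eta> :: complex and S :: "(cliff_alg, 's) lmod" and a :: "nat => nat" +
 fixes M :: "(do_alg, 'v) lmod"
 assumes M: "alg_module HH M"
begin

abbreviation "WS == Wsp a M"
abbreviation "W == M\<lparr>carrier := WS\<rparr>"
abbreviation "gact == block_gen_act m n k a M"
abbreviation "Gens i == hecke_gens (sym_group (a i)) (a i)"

lemma M_cspace: "cspace M" by(rule module_cspace[OF M])

sublocale M: module CC M by(rule M_cspace)

lemma WS_carrier: "v : WS ==> v :. M"
 and WS_act: "v : WS ==> t :. TT ==> act M (El (of_torus t)) v = mu m \<eta> a t \<odot>\<^sub>M v"
 by(simp_all add: weight_space_def)

lemma WS_I: "v :. M ==> (!!t. t :. TT ==> act M (El (of_torus t)) v = mu m \<eta> a t \<odot>\<^sub>M v) ==> v : WS"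
 by(simp add: weight_space_def)

lemma torus_act_lin: "t :. TT ==> act M (El (of_torus t)) : lin_maps M M"
 by(rule act_lin[OF M El_closed[OF of_torus_closed]])

lemma WS_submodule: "submodule WS CC M"
proof (rule csubmoduleI[OF M_cspace])
 show "WS <= carrier M" using WS_carrier by blast
 show "\<zero>\<^sub>M : WS" using lin_zero[OF M_cspace M_cspace torus_act_lin] scale_zero_vec[OF M_cspace]
  by(intro WS_I) simp_all
 show "u \<oplus>\<^sub>M v : WS" if "u : WS" "v : WS" for u v
  using that lin_add[OF torus_act_lin] scale_add[OF M_cspace] WS_carrier WS_act by(intro WS_I) simp_all
 show "c \<odot>\<^sub>M v : WS" if "v : WS" for c v
  using that lin_smult[OF torus_act_lin] scale_scale[OF M_cspace] scale_closed[OF M_cspace] WS_carrier WS_act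
  by(intro WS_I) (simp_all add: mult.commute)
qed

lemma W_cspace: "cspace W" by(rule cspace_restrict[OF M_cspace WS_submodule])

text \<open>An algebra element preserves the weight space if it commutes with the torus up to a
  twist that fixes the character.\<close>

lemma act_weight_lin:
 assumes x: "x :. HH" and comm: "!!t. t :. TT ==> \<exists>t'\<in>carrier TT.
   El (of_torus t) \<otimes>\<^sub>HH x = x \<otimes>\<^sub>HH El (of_torus t') & mu m \<eta> a t' = mu m \<eta> a t"
 shows "act M x : lin_maps W W"
proof (rule lin_mapsI)
 fix v assume "v :. W"
 hence v: "v : WS" by simp
 note vM = WS_carrier[OF v]
 have "act M x v : WS"
 proof (rule WS_I)
  show "act M x v :. M" by(rule act_closed[OF M x vM])
  fix t assume t: "t :. TT"
  obtain t' where t': "t' :. TT" "El (of_torus t) \<otimes>\<^sub>HH x = x \<otimes>\<^sub>HH El (of_torus t')"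
   "mu m \<eta> a t' = mu m \<eta> a t" using comm[OF t] by blast
  have "act M (El (of_torus t)) (act M x v) = act M x (act M (El (of_torus t')) v)"
   using act_mult[OF M vM El_closed[OF of_torus_closed[OF t]] x]
    act_mult[OF M vM x El_closed[OF of_torus_closed[OF t'(1)]]] t'(2) by simp
  thus "act M (El (of_torus t)) (act M x v) = mu m \<eta> a t \<odot>\<^sub>M act M x v"
   using WS_act[OF v t'(1)] t'(3) lin_smult[OF act_lin[OF M x] vM] by simp
 qed
 thus "act M x v :. W" by simp
qed (use lin_add[OF act_lin[OF M x]] lin_smult[OF act_lin[OF M x]] WS_carrier in simp_all)

lemma Zg_weight_lin: "j : {1..n} ==> act M (Zg j) : lin_maps W W"
 by(rule act_weight_lin[OF H.Z_closed]) (use Zg_torus_commute in metis)+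

lemma perm_weight_lin:
 assumes w: "w : ysub m n a"
 shows "act M (Ep w) : lin_maps W W"
proof (rule act_weight_lin)
 note p = young_permutes[OF a_comps w]
 show "Ep w :. HH" by(rule El_closed[OF of_perm_closed[OF p]])
 fix t assume t: "t :. TT"
 let ?t = "pcoords n (inv_into UNIV w) t"
 have t': "?t :. TT" by(rule pcoords_torus[OF permutes_inv[OF p] t])
 have e: "pcoords n w ?t = t"
  using pcoords_comp[OF p permutes_inv[OF p], of t] torus_extensional[OF t] permutes_inv_o(1)[OF p] by simp
 have "El (of_torus t) \<otimes>\<^sub>HH Ep w = Ep w \<otimes>\<^sub>HH El (of_torus ?t)"
  by(simp only: H.Elt_mult of_torus_closed[OF t] of_torus_closed[OF t'] of_perm_closed[OF p]
    of_torus_of_perm[OF t] of_perm_of_torus[OF t' p] e)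
 thus "\<exists>t'\<in>carrier TT. El (of_torus t) \<otimes>\<^sub>HH Ep w = Ep w \<otimes>\<^sub>HH El (of_torus t') & mu m \<eta> a t' = mu m \<eta> a t"
  using t' mu_young_invariant[OF a_comps w, of ?t] e by metis
qed

text \<open>On a weight space the sum over \<open>l\<close> of \<open>g\<^sub>i\<^sup>l g\<^sub>j\<^sup>-\<^sup>l\<close> is \<open>m\<close> or \<open>0\<close>, according to whether \<open>g\<^sub>i\<close>
 and \<open>g\<^sub>j\<close> have the same eigenvalue.\<close>

lemma refl_sum_weight:
 assumes ij: "i : {1..n}" "j : {1..n}" "i ~= j" and v: "v : WS"
 shows "act M (refl_sum i j) v = (if col i = col j then of_nat m else 0) \<odot>\<^sub>M act M (Ep (transpose i j)) v"
proof -
 let ?s = "transpose i j"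
 have p: "?s permutes {1..n}" by(rule permutes_swap_id[OF ij(1,2)])
 note vM = WS_carrier[OF v]
 have sc: "Ep ?s :. HH" by(rule El_closed[OF of_perm_closed[OF p]])
 have sv: "act M (Ep ?s) v :. M" by(rule act_closed[OF M sc vM])
 have one: "act M (El (pair_elt i j (int l), ?s)) v =
   mu m \<eta> a (pair_elt i j (- int l)) \<odot>\<^sub>M act M (Ep ?s) v" for l
 proof -
  let ?t = "pair_elt i j (- int l)"
  have "pcoords n ?s ?t = pair_elt i j (int l)"
   using ij(3) by(simp add: permute_pair_elt[OF p] pair_elt_swap[of j i])
  hence "El (pair_elt i j (int l), ?s) = Ep ?s \<otimes>\<^sub>HH El (of_torus ?t)"
   using H.Elt_mult[OF of_perm_closed[OF p] of_torus_closed[OF pair_elt_closed]]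
    of_perm_of_torus[OF pair_elt_closed p] by simp
  thus ?thesis using act_mult[OF M vM sc El_closed[OF of_torus_closed[OF pair_elt_closed]]]
    WS_act[OF v pair_elt_closed] lin_smult[OF act_lin[OF M sc] vM] by simp
 qed
 have "act M (refl_sum i j) v = (\<Oplus>\<^sub>M l\<in>{..<m}. act M (El (pair_elt i j (int l), ?s)) v)" unfolding refl_sum_def
  by(rule lin_finsum[OF A.cspace M_cspace act_lin_alg[OF M vM] finite_lessThan]) (rule El_pair_closed[OF p])
 also have "... = (\<Sum>l<m. mu m \<eta> a (pair_elt i j (- int l))) \<odot>\<^sub>M act M (Ep ?s) v"
  unfolding one by(rule cspace_finsum_smult[OF M_cspace finite_lessThan sv])
 finally show ?thesis unfolding pair_elt_sum[OF a_comps ij] .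
qed

lemma gact_closed:
 assumes "i < m" "x : Gens i"
 shows "gact i x : lin_maps W W"
 using assms perm_weight_lin[OF block_shift_young[OF assms(1)]] Zg_weight_lin[OF young_block_pos(1)[OF assms(1)]]
 by(auto simp: hecke_gens_def sym_group_carrier)

lemma word_lin: "i < m ==> ws : lists (Gens i) ==> foldr (gact i) ws : lin_maps W W"
 by(rule foldr_lin) (use gact_closed in blast)

lemma act_act: "v : WS ==> x :. HH ==> y :. HH ==> act M x (act M y v) = act M (x \<otimes>\<^sub>HH y) v"
 using act_mult[OF M WS_carrier] by simp

lemma near_weight:
 assumes j: "1 <= j" "j < n" "col j = col (j + 1)" and v: "v : WS"
 shows "act M (Zg j) (act M (Ep (transpose j (j + 1))) v) =
  act M (Ep (transpose j (j + 1))) (act M (Zg (j + 1)) v) \<oplus>\<^sub>M (- mk) \<odot>\<^sub>M v"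
proof -
 let ?s = "transpose j (j + 1)"
 let ?e = "Ep ?s"
 have jn: "j : {1..n}" "j + 1 : {1..n}" using j by auto
 have p: "?s permutes {1..n}" by(rule permutes_swap_id[OF jn])
 have c: "?e :. HH" "Zg j :. HH" "Zg (j + 1) :. HH" "refl_sum j (j + 1) :. HH"
  using El_closed[OF of_perm_closed[OF p]] H.Z_closed[OF jn(1)] H.Z_closed[OF jn(2)] refl_sum_closed[OF jn]
  by blast+
 note vM = WS_carrier[OF v]
 note ec = act_closed[OF M c(1) vM]
 have ee: "?e \<otimes>\<^sub>HH ?e = \<one>\<^sub>HH"
  by(simp add: H.Elt_mult of_perm_closed[OF p] of_perm_mult[OF p p] of_perm_id H.Elt_one)
 have "act M (?e \<otimes>\<^sub>HH refl_sum j (j + 1)) v = of_nat m \<odot>\<^sub>M act M ?e (act M ?e v)"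
  using act_mult[OF M vM c(1,4)] refl_sum_weight[OF jn _ v] j(3) lin_smult[OF act_lin[OF M c(1)] ec] by simp
 also have "act M ?e (act M ?e v) = v" using act_act[OF v c(1,1)] ee act_one[OF M vM] by simp
 finally have R: "act M (?e \<otimes>\<^sub>HH refl_sum j (j + 1)) v = of_nat m \<odot>\<^sub>M v" .
 have mc: "?e \<otimes>\<^sub>HH Zg (j + 1) :. HH" "?e \<otimes>\<^sub>HH refl_sum j (j + 1) :. HH" using c by(auto intro: A.m_closed)
 have "act M (Zg j) (act M ?e v) = act M (?e \<otimes>\<^sub>HH Zg (j + 1) \<ominus>\<^sub>HH k \<odot>\<^sub>HH (?e \<otimes>\<^sub>HH refl_sum j (j + 1))) v"
  unfolding act_act[OF v c(2,1)] Zg_near[OF j(1,2)] ..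
 also have "... = act M (?e \<otimes>\<^sub>HH Zg (j + 1)) v \<ominus>\<^sub>M k \<odot>\<^sub>M (of_nat m \<odot>\<^sub>M v)"
  using lin_minus[OF A.cspace M_cspace act_lin_alg[OF M vM] mc(1) A.smult_closed'[OF mc(2)]]
   act_smult[OF M vM mc(2)] R by simp
 also have "... = act M ?e (act M (Zg (j + 1)) v) \<oplus>\<^sub>M (- mk) \<odot>\<^sub>M v"
  by(simp add: act_act[OF v c(1,3)] scale_scale[OF M_cspace vM] cspace_minus_smult[OF M_cspace vM]
    mult.commute)
 finally show ?thesis .
qed

text \<open>The \<open>z\<^sub>j\<close> and the permutations of one block satisfy on the weight space the relations of the graded Hecke
 algebra with parameter \<open>m k\<close>: within a block the sum over \<open>l\<close> acts by \<open>m\<close>.\<close>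

lemma graded_rels_weight:
 assumes i: "i < m" and fg: "(f, g) : graded_rels mk (a i)" and v: "v : WS"
 shows "lin_ext W (foldr (gact i)) f v = lin_ext W (foldr (gact i)) g v"
proof -
 let ?L = "%f. lin_ext W (foldr (gact i)) f v"
 let ?s = "block_shift (ofs i) (a i)"
 have vW: "v :. W" using v by simp
 have wc: "foldr (gact i) ws v :. W" if "ws : lists (Gens i)" for ws
  by(rule lin_closed[OF word_lin[OF i that] vW])
 have L: "?L : lin_maps (free_vs (lists (Gens i))) W" by(rule lin_ext_lin[OF W_cspace]) (rule wc)
 have Ld: "?L (delta ws) = foldr (gact i) ws v" if "ws : lists (Gens i)" for ws
  by(rule lin_ext_delta[OF W_cspace]) (rule wc[OF that])
 have yp: "?s w permutes {1..n}" if "w permutes {1..a i}" for w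
  by(rule young_permutes[OF a_comps block_shift_young[OF i that]])
 note pc = El_closed[OF of_perm_closed[OF yp]]
 have E: "Elt w : Gens i" if "w permutes {1..a i}" for w using that by(simp add: hecke_gens_def sym_group_carrier)
 have Zi: "Z r : Gens i" if "r : {1..a i}" for r using that by(simp add: hecke_gens_def)
 have sw: "transpose r (r + 1) permutes {1..a i}" "r : {1..a i}" "r + 1 : {1..a i}"
   "?s (transpose r (r + 1)) = transpose (ofs i + r) (ofs i + r + 1)" "ofs i + r : {1..<n}"
   "1 <= ofs i + r" "ofs i + r < n" "col (ofs i + r) = col (ofs i + r + 1)" if "r : {1..<a i}" for r
 proof -
  show r: "r : {1..a i}" "r + 1 : {1..a i}" using that by auto
  show "transpose r (r + 1) permutes {1..a i}" by(rule permutes_swap_id[OF r])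
  show "?s (transpose r (r + 1)) = transpose (ofs i + r) (ofs i + r + 1)"
   using block_shift_swap[OF r] by(simp add: add.assoc)
  show "ofs i + r : {1..<n}" "1 <= ofs i + r" "ofs i + r < n"
   using young_block_pos(1)[OF i r(1)] young_block_pos(1)[OF i r(2)] by auto
  show "col (ofs i + r) = col (ofs i + r + 1)"
   using young_block_pos(2)[OF i r(1)] young_block_pos(2)[OF i r(2)] by(simp add: add.assoc)
 qed
 consider (mult) u w where "f = delta [Elt u, Elt w]" "g = delta [Elt (u o w)]" "u permutes {1..a i}" "w permutes {1..a i}"
  | (one) "f = delta [Elt id]" "g = delta []"
  | (comm) r r' where "f = delta [Z r, Z r']" "g = delta [Z r', Z r]" "r : {1..a i}" "r' : {1..a i}"
  | (far) r j where "f = delta [Z j, Elt (transpose r (r + 1))]" "g = delta [Elt (transpose r (r + 1)), Z j]"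
    "r : {1..<a i}" "j : {1..a i}" "j ~= r" "j ~= r + 1"
  | (near) r where "f = delta [Z r, Elt (transpose r (r + 1))]"
    "g = (%u. delta [Elt (transpose r (r + 1)), Z (r + 1)] u - mk * delta [] u)" "r : {1..<a i}"
  using fg unfolding graded_rels_def hecke_rels_def sym_group_mult sym_group_one sym_group_carrier by blast
 thus ?thesis
 proof cases
  case mult
  have "act M (Ep (?s u)) (act M (Ep (?s w)) v) = act M (Ep (?s (u o w))) v"
   using act_act[OF v pc[OF mult(3)] pc[OF mult(4)]]
   by(simp add: H.Elt_mult of_perm_closed yp mult(3,4) of_perm_mult block_shift_comp[OF mult(4)])
  thus ?thesis
   using E[OF mult(3)] E[OF mult(4)] E[OF permutes_compose[OF mult(4,3)]] by(simp add: mult(1,2) Ld)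
 next
  case one
  thus ?thesis
   using E[OF permutes_id] act_one[OF M WS_carrier[OF v]] by(simp add: Ld block_shift_id of_perm_id H.Elt_one)
 next
  case comm
  note z = young_block_pos(1)[OF i comm(3)] young_block_pos(1)[OF i comm(4)]
  have "act M (Zg (ofs i + r)) (act M (Zg (ofs i + r')) v) = act M (Zg (ofs i + r')) (act M (Zg (ofs i + r)) v)"
   unfolding act_act[OF v H.Z_closed[OF z(1)] H.Z_closed[OF z(2)]]
    act_act[OF v H.Z_closed[OF z(2)] H.Z_closed[OF z(1)]] H.Z_commute[OF z] ..
  thus ?thesis using comm Zi by(simp add: Ld)
 next
  case far
  note s = sw[OF far(3)]
  note z = young_block_pos(1)[OF i far(4)]
  have "Zg (ofs i + j) \<otimes>\<^sub>HH El (of_perm m n (?s (transpose r (r + 1)))) =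
    El (of_perm m n (?s (transpose r (r + 1)))) \<otimes>\<^sub>HH Zg (ofs i + j)"
   unfolding s(4) by(rule H.Z_far[OF s(5) z]) (use far(5,6) in simp_all)
  hence "act M (Zg (ofs i + j)) (act M (El (of_perm m n (?s (transpose r (r + 1))))) v) =
    act M (El (of_perm m n (?s (transpose r (r + 1))))) (act M (Zg (ofs i + j)) v)"
   using act_act[OF v H.Z_closed[OF z] pc[OF s(1)]] act_act[OF v pc[OF s(1)] H.Z_closed[OF z]] by simp
  thus ?thesis using E[OF s(1)] Zi[OF far(4)] by(simp add: far(1,2) Ld)
 next
  case near
  note s = sw[OF near(3)]
  have l: "[Z r, Elt (transpose r (r + 1))] : lists (Gens i)" "[Elt (transpose r (r + 1)), Z (r + 1)] : lists (Gens i)"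
   using E[OF s(1)] Zi[OF s(2)] Zi[OF s(3)] by simp_all
  have g: "g = (%u. delta [Elt (transpose r (r + 1)), Z (r + 1)] u + (- mk) * delta [] u)"
   unfolding near(2) by simp
  have d: "delta [Elt (transpose r (r + 1)), Z (r + 1)] :. free_vs (lists (Gens i))"
   "delta [] :. free_vs (lists (Gens i))" using l(2) by simp_all
  have "?L g = ?L (delta [Elt (transpose r (r + 1)), Z (r + 1)]) \<oplus>\<^sub>M (- mk) \<odot>\<^sub>M ?L (delta [])"
   using lin_add[OF L d(1) scale_closed[OF cspace_free_vs d(2), of "- mk"]]
    lin_smult[OF L d(2), of "- mk"] unfolding g by simp
  also have "... = act M (Ep (transpose (ofs i + r) (ofs i + r + 1))) (act M (Zg (ofs i + r + 1)) v)
    \<oplus>\<^sub>M (- mk) \<odot>\<^sub>M v" unfolding Ld[OF l(2)] Ld[OF lists.Nil] by(simp add: s(4)[simplified] add.assoc)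
  also have "... = act M (Zg (ofs i + r)) (act M (Ep (transpose (ofs i + r) (ofs i + r + 1))) v)"
   by(rule near_weight[OF s(6-8) v, symmetric])
  also have "... = ?L f" unfolding near(1) Ld[OF l(1)] by(simp add: s(4)[simplified])
  finally show ?thesis ..
 qed
qed

end

section \<open>The functor to weight spaces\<close>

lemma foldr_commuting:
 assumes "distinct xs"
  and "!!i v. i : set xs ==> v : U ==> f i v : U" "!!i v. i : set xs ==> v : U ==> g i v : U"
  and "!!i j v. i : set xs ==> j : set xs ==> i ~= j ==> v : U ==> g j (f i v) = f i (g j v)" and "v : U"
 shows "foldr f xs (foldr g xs v) = foldr (%i v. f i (g i v)) xs v" using assms
proof (induction xs)
 case Nil
 thus ?case by simp
next
 case (Cons x xs)
 have "foldr g xs v : U" using foldr_intertwine[of xs U g "%v. v" g v] Cons.prems by auto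
 moreover have "f i u : U & g x (f i u) = f i (g x u)" if "i : set xs" "u : U" for i u
  using Cons.prems(2)[of i u] Cons.prems(4)[of i x u] Cons.prems(1) that by auto
 ultimately have "g x (foldr f xs (foldr g xs v)) = foldr f xs (g x (foldr g xs v))"
  using foldr_intertwine[of xs U f "g x" f "foldr g xs v"] by blast
 moreover have "foldr f xs (foldr g xs v) = foldr (%i v. f i (g i v)) xs v" using Cons by simp
 ultimately show ?case by simp
qed

lemma foldr_fixed: "(!!i. i : set xs ==> f i v = v) ==> foldr f xs v = v" by(induction xs) auto

lemma act_dirac_elt:
 assumes A: "calg A" and V: "alg_module A V" and v: "v :. V"
  and z: "z i :. A" and R: "!!r. r : {1..n} ==> R i r :. A"
 shows "act V (dirac_elt A n k z R i) v =
  act V (z i) v \<oplus>\<^sub>V (k / 2) \<odot>\<^sub>V (\<Oplus>\<^sub>V r\<in>{1..n}. order_sign i r \<odot>\<^sub>V act V (R i r) v)"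
proof -
 interpret A: calg A by(rule A)
 interpret V: module CC V by(rule module_cspace[OF V])
 have c: "order_sign i r \<odot>\<^sub>A R i r :. A" if "r : {1..n}" for r using R[OF that] by simp
 have s: "(\<Oplus>\<^sub>A r\<in>{1..n}. order_sign i r \<odot>\<^sub>A R i r) :. A" using c by(intro A.finsum_closed) auto
 have "act V (\<Oplus>\<^sub>A r\<in>{1..n}. order_sign i r \<odot>\<^sub>A R i r) v = (\<Oplus>\<^sub>V r\<in>{1..n}. act V (order_sign i r \<odot>\<^sub>A R i r) v)"
  by(rule lin_finsum[OF A.cspace module_cspace[OF V] act_lin_alg[OF V v] finite_atLeastAtMost c])
 also have "... = (\<Oplus>\<^sub>V r\<in>{1..n}. order_sign i r \<odot>\<^sub>V act V (R i r) v)"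
  using act_smult[OF V v R] scale_closed[OF module_cspace[OF V] act_closed[OF V R v]]
  by(intro V.M.finsum_cong') auto
 finally show ?thesis
  using act_add[OF V v z A.smult_closed'[OF s]] act_smult[OF V v s] by(simp add: dirac_elt_def)
qed

context weight_params
begin

abbreviation "\<rho> i == quot_act W (foldr (gact i))"
abbreviation "Words i == \<lparr>carrier = lists (Gens i), monoid.mult = (@), one = []\<rparr>"

lemma FH_eq: "FH i = alg_quot (monoid_alg (Words i)) (graded_rels mk (a i))"
 by(simp add: graded_hecke_def free_alg_def)

lemma graded_rels_closed:
 "graded_rels mk (a i) <= carrier (monoid_alg (Words i)) \<times> carrier (monoid_alg (Words i))"
 using hecke_quotient.R_closed[OF graded_hecke_quotient, of mk "a i"] unfolding free_alg_def .

lemma factor_module: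
 assumes i: "i < m"
 shows "alg_module (FH i) (with_act W (\<rho> i))" unfolding FH_eq
proof (rule alg_module_quot_act[OF monoid_lists W_cspace graded_rels_closed])
 show "foldr (gact i) x : lin_maps W W" if "x :. Words i" for x using word_lin[OF i] that by simp
 show "lin_ext W (foldr (gact i)) f v = lin_ext W (foldr (gact i)) g v"
  if "(f, g) : graded_rels mk (a i)" "v :. W" for f g v using graded_rels_weight[OF i that(1)] that(2) by simp
qed simp_all

lemma factor_gen:
 assumes i: "i < m" and x: "x : Gens i" and v: "v : WS"
 shows "\<rho> i (graded_gen mk (a i) x) v = gact i x v"
proof -
 have d: "delta [x] :. monoid_alg (Words i)" using x by simp
 have l: "[x] : lists (Gens i)" using x by simp
 have "\<rho> i (alg_class (monoid_alg (Words i)) (graded_rels mk (a i)) (delta [x])) v =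
   lin_ext W (foldr (gact i)) (delta [x]) v"
 proof (rule quot_act_class[OF monoid_lists W_cspace graded_rels_closed _ _ _ _ d])
  show "foldr (gact i) x : lin_maps W W" if "x :. Words i" for x using word_lin[OF i] that by simp
  show "lin_ext W (foldr (gact i)) f v = lin_ext W (foldr (gact i)) g v"
   if "(f, g) : graded_rels mk (a i)" "v :. W" for f g v
   using graded_rels_weight[OF i that(1)] that(2) by simp
 qed (use v in simp_all)
 also have "... = foldr (gact i) [x] v"
  using lin_closed[OF word_lin[OF i l], of v] v by(intro lin_ext_delta[OF W_cspace]) simp
 finally show ?thesis by(simp add: graded_gen_def free_alg_def)
qed

lemma factor_lin: "i < m ==> x :. FH i ==> \<rho> i x : lin_maps W W" using act_lin[OF factor_module] by simp

text \<open>Commutation with the generators passes to words, and by linearity to the whole factor.\<close>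

lemma factor_intertwine:
 assumes i: "i < m" and V: "cspace V" and h: "h : lin_maps W V"
  and comm: "!!x v. x : Gens i ==> v : WS ==> h (gact i x v) = g x (h v)" and v: "v : WS" and x: "x :. FH i"
 shows "h (\<rho> i x v) = quot_act V (foldr g) x (h v)"
proof (rule quot_act_intertwine[OF monoid_lists graded_rels_closed W_cspace V h _ _ x[unfolded FH_eq]])
 fix ws assume ws: "ws :. Words i"
 show "foldr (gact i) ws v :. W" using lin_closed[OF word_lin[OF i], of ws v] ws v by simp
 have "gact i x u : WS & h (gact i x u) = g x (h u)" if "x : set ws" "u : WS" for x u
  using lin_closed[OF gact_closed[OF i], of x u] comm that ws by auto
 thus "h (foldr (gact i) ws v) = foldr g ws (h v)" using foldr_intertwine[of ws WS "gact i" h g v] v by blast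
qed

lemma Gens_cases:
 assumes "x : Gens i"
 obtains (E) w where "x = Elt w" "w permutes {1..a i}" | (Z) r where "x = Z r" "r : {1..a i}"
 using assms by(auto simp: hecke_gens_def sym_group_carrier)

lemma gens_commute:
 assumes i: "i < m" "i' < m" "i ~= i'" and x: "x : Gens i" "y : Gens i'" and v: "v : WS"
 shows "gact i x (gact i' y v) = gact i' y (gact i x v)"
proof -
 have EZ_comm: "gact i (Elt w) (gact i' (Z r) v) = gact i' (Z r) (gact i (Elt w) v)"
  if i: "i < m" "i' < m" "i ~= i'" and w: "w permutes {1..a i}" and r: "r : {1..a i'}" for i i' w r
 proof -
  note z = young_block_pos[OF i(2) r]
  have c: "Ep (block_shift (ofs i) (a i) w) :. HH" "Zg (ofs i' + r) :. HH"
   using El_closed[OF of_perm_closed[OF young_permutes[OF a_comps block_shift_young[OF i(1) w]]]]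
    H.Z_closed[OF z(1)] by blast+
  show ?thesis
   using Zg_block_shift_commute[OF i(1) w z(1)] z(2) i(3) by(simp add: act_act[OF v c] act_act[OF v c(2,1)])
 qed
 consider (EE) w w' where "x = Elt w" "y = Elt w'" "w permutes {1..a i}" "w' permutes {1..a i'}"
  | (EZ) w r where "x = Elt w" "y = Z r" "w permutes {1..a i}" "r : {1..a i'}"
  | (ZE) w r where "x = Z r" "y = Elt w" "w permutes {1..a i'}" "r : {1..a i}"
  | (ZZ) r r' where "x = Z r" "y = Z r'" "r : {1..a i}" "r' : {1..a i'}" using x by(elim Gens_cases) blast+
 thus ?thesis
 proof cases
  case EE
  let ?u = "block_shift (ofs i) (a i) w" and ?u' = "block_shift (ofs i') (a i') w'"
  have p: "?u permutes {1..n}" "?u' permutes {1..n}"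
   using young_permutes[OF a_comps block_shift_young[OF i(1) EE(3)]]
    young_permutes[OF a_comps block_shift_young[OF i(2) EE(4)]] by blast+
  note c = El_closed[OF of_perm_closed[OF p(1)]] El_closed[OF of_perm_closed[OF p(2)]]
  have "Ep ?u \<otimes>\<^sub>HH Ep ?u' = Ep ?u' \<otimes>\<^sub>HH Ep ?u" using block_shift_commute[OF i EE(3,4)]
   by(simp add: H.Elt_mult of_perm_closed p of_perm_mult)
  thus ?thesis unfolding EE(1,2) by(simp add: act_act[OF v c] act_act[OF v c(2,1)])
 next
  case EZ
  show ?thesis unfolding EZ(1,2) by(rule EZ_comm[OF i EZ(3,4)])
 next
  case ZE
  show ?thesis unfolding ZE(1,2) by(rule EZ_comm[OF i(2,1) i(3)[symmetric] ZE(3,4), symmetric])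
 next
  case ZZ
  note z = young_block_pos(1)[OF i(1) ZZ(3)] young_block_pos(1)[OF i(2) ZZ(4)]
  note c = H.Z_closed[OF z(1)] H.Z_closed[OF z(2)]
  show ?thesis unfolding ZZ(1,2) using H.Z_commute[OF z] by(simp add: act_act[OF v c] act_act[OF v c(2,1)])
 qed
qed

text \<open>Different factors commute because their generators do; the principle is applied to each of the two factors in turn.\<close>

lemma factor_commute:
 assumes i: "i < m" "i' < m" "i ~= i'" and x: "x :. FH i" "y :. FH i'" and v: "v : WS"
 shows "\<rho> i x (\<rho> i' y v) = \<rho> i' y (\<rho> i x v)"
proof (rule factor_intertwine[OF i(2) W_cspace factor_lin[OF i(1) x(1)] _ v x(2)])
 fix z u assume z: "z : Gens i'" and u: "u : WS"
 show "\<rho> i x (gact i' z u) = gact i' z (\<rho> i x u)"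
  by(rule factor_intertwine[OF i(1) W_cspace gact_closed[OF i(2) z] _ u x(1), symmetric])
   (rule gens_commute[OF i(2,1) i(3)[symmetric] z])
qed

abbreviation "tuple_act == (%t. foldr (%i. \<rho> i (t i)) [0..<m])"

lemma PG_factor: "t :. T.PG ==> i < m ==> t i :. FH i" by(auto simp: PiE_iff)

lemma tuple_lin: "(!!i. i < m ==> t i :. FH i) ==> tuple_act t : lin_maps W W"
 by(rule foldr_lin) (simp add: factor_lin)

lemma tuple_cong: "(!!i. i < m ==> t i = t' i) ==> tuple_act t v = tuple_act t' v" by(rule foldr_cong) auto

lemma factor_one: "i < m ==> v : WS ==> \<rho> i \<one>\<^sub>(FH i) v = v" using act_one[OF factor_module, of i v] by simp

lemma tuple_split:
 assumes i: "i < m"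
 shows "tuple_act (t(i := x)) v = foldr (%j. \<rho> j (t j)) [0..<i] (\<rho> i x (foldr (%j. \<rho> j (t j)) [Suc i..<m] v))"
proof -
 have l: "[0..<m] = [0..<i] @ i # [Suc i..<m]"
  using upt_add_eq_append[of 0 i "m - i"] upt_conv_Cons[OF i] i by simp
 have "foldr (%j. \<rho> j ((t(i := x)) j)) [0..<i] u = foldr (%j. \<rho> j (t j)) [0..<i] u"
  "foldr (%j. \<rho> j ((t(i := x)) j)) [Suc i..<m] u = foldr (%j. \<rho> j (t j)) [Suc i..<m] u" for u
  by(rule foldr_cong; simp)+
 thus ?thesis unfolding l foldr_append foldr.simps o_apply by simp
qed

lemma tuple_slot_lin:
 assumes i: "i < m" and t: "!!j. j < m ==> t j :. FH j" and v: "v : WS"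
 shows "(%x. tuple_act (t(i := x)) v) : lin_maps (FH i) W"
proof -
 let ?P = "foldr (%j. \<rho> j (t j)) [0..<i]" and ?u = "foldr (%j. \<rho> j (t j)) [Suc i..<m] v"
 have P: "?P : lin_maps W W" by(rule foldr_lin) (use factor_lin t i in auto)
 have "foldr (%j. \<rho> j (t j)) [Suc i..<m] : lin_maps W W" by(rule foldr_lin) (use factor_lin t in auto)
 hence u: "?u :. W" by(rule lin_closed) (use v in simp)
 have "(%x. \<rho> i x ?u) : lin_maps (FH i) W" using act_lin_alg[OF factor_module[OF i], of ?u] u by simp
 from lin_comp[OF this P] show ?thesis unfolding tuple_split[OF i] .
qed

lemma tuple_rels:
 assumes fg: "(f, g) : multilinear_rels {..<m} FH" and v: "v :. W"
 shows "lin_ext W tuple_act f v = lin_ext W tuple_act g v"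
proof -
 let ?L = "%f. lin_ext W tuple_act f v"
 have vW: "v : WS" using v by simp
 have c: "tuple_act t v :. W" if "t :. T.PG" for t
  by(rule lin_closed[OF tuple_lin v]) (rule PG_factor[OF that])
 have L: "?L : lin_maps (free_vs (carrier T.PG)) W" by(rule lin_ext_lin[OF W_cspace]) (rule c)
 have Ld: "?L (delta t) = tuple_act t v" if "t :. T.PG" for t
  by(rule lin_ext_delta[OF W_cspace]) (rule c[OF that])
 have up: "t(i := x) :. T.PG" if "t : (\<Pi>\<^sub>E i\<in>{..<m}. carrier (FH i))" "i < m" "x :. FH i" for t i x
  using T.fun_upd_PG[OF that(1), of i x] that(2,3) by simp
 have dc: "delta t :. free_vs (carrier T.PG)" if "t :. T.PG" for t using that by simp
 consider (add) t i x y where "f = delta (t(i := x \<oplus>\<^sub>(FH i) y))" "g = (%u. delta (t(i := x)) u + delta (t(i := y)) u)"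
   "t : (\<Pi>\<^sub>E i\<in>{..<m}. carrier (FH i))" "i < m" "x :. FH i" "y :. FH i"
  | (scale) t i c x where "f = delta (t(i := c \<odot>\<^sub>(FH i) x))" "g = (%u. c * delta (t(i := x)) u)"
   "t : (\<Pi>\<^sub>E i\<in>{..<m}. carrier (FH i))" "i < m" "x :. FH i" using fg unfolding multilinear_rels_def by blast
 thus ?thesis
 proof cases
  case add
  have t: "t j :. FH j" if "j < m" for j using add(3) that by auto
  have s: "x \<oplus>\<^sub>(FH i) y :. FH i" using T.factor_closed(1)[of i x y] add(4-6) by simp
  note u = up[OF add(3,4) add(5)] up[OF add(3,4) add(6)] up[OF add(3,4) s]
  have "?L g = tuple_act (t(i := x)) v \<oplus>\<^sub>W tuple_act (t(i := y)) v"
   using lin_add[OF L dc[OF u(1)] dc[OF u(2)]] Ld[OF u(1)] Ld[OF u(2)] unfolding add(2) by simp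
  also have "... = tuple_act (t(i := x \<oplus>\<^sub>(FH i) y)) v"
   by(rule lin_add[OF tuple_slot_lin[OF add(4) t vW] add(5,6), symmetric])
  also have "... = ?L f" unfolding add(1) by(rule Ld[OF u(3), symmetric])
  finally show ?thesis ..
 next
  case scale
  have t: "t j :. FH j" if "j < m" for j using scale(3) that by auto
  have s: "c \<odot>\<^sub>(FH i) x :. FH i" using T.factor_closed(2)[of i x c] scale(4,5) by simp
  note u = up[OF scale(3-5)] up[OF scale(3,4) s]
  have "?L g = c \<odot>\<^sub>W tuple_act (t(i := x)) v"
   using lin_smult[OF L dc[OF u(1)], of c] Ld[OF u(1)] unfolding scale(2) by simp
  also have "... = tuple_act (t(i := c \<odot>\<^sub>(FH i) x)) v"
   by(rule lin_smult[OF tuple_slot_lin[OF scale(4) t vW] scale(5), symmetric])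
  also have "... = ?L f" unfolding scale(1) by(rule Ld[OF u(2), symmetric])
  finally show ?thesis ..
 qed
qed

text \<open>The action of a tuple is the composite of the actions of its entries.  It is multiplicative because the actions of
 different factors commute.\<close>

lemma tuple_mult:
 assumes t: "t :. T.PG" "t' :. T.PG" and v: "v :. W"
 shows "tuple_act (t \<otimes>\<^sub>T.PG t') v = tuple_act t (tuple_act t' v)"
proof -
 note f = PG_factor[OF t(1)] and f' = PG_factor[OF t(2)]
 have cl: "\<rho> i x u : WS" if "i < m" "x :. FH i" "u : WS" for i x u
  using lin_closed[OF factor_lin[OF that(1,2)], of u] that(3) by simp
 have inv: "foldr (%i v. \<rho> i (t i) (\<rho> i (t' i) v)) xs v : WS" if "set xs <= {..<m}" for xs
  using that v by(induction xs) (auto intro!: cl f f')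
 have step: "foldr (%i. \<rho> i ((t \<otimes>\<^sub>T.PG t') i)) xs v = foldr (%i v. \<rho> i (t i) (\<rho> i (t' i) v)) xs v"
  if "set xs <= {..<m}" for xs using that
 proof (induction xs)
  case (Cons i xs)
  hence i: "i < m" and xs: "set xs <= {..<m}" by auto
  let ?u = "foldr (%i v. \<rho> i (t i) (\<rho> i (t' i) v)) xs v"
  have "(t \<otimes>\<^sub>T.PG t') i = t i \<otimes>\<^sub>(FH i) t' i" using i by simp
  thus ?case
   using Cons.IH[OF xs] act_mult[OF factor_module[OF i] _ f[OF i] f'[OF i], of ?u] inv[OF xs] by simp
 qed simp
 have "tuple_act (t \<otimes>\<^sub>T.PG t') v = foldr (%i v. \<rho> i (t i) (\<rho> i (t' i) v)) [0..<m] v" by(rule step) auto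
 also have "... = tuple_act t (tuple_act t' v)" by(rule foldr_commuting[where U = WS, symmetric])
   (use cl f f' v factor_commute in auto)
 finally show ?thesis .
qed

abbreviation "WMod == Wmod a M"

lemma WMod_eq: "WMod = with_act W (quot_act W tuple_act)" by(simp add: weight_module_def Let_def)

lemma YH_eq: "YH = alg_quot (monoid_alg T.PG) (multilinear_rels {..<m} FH)"
 by(simp add: young_hecke_def tensor_alg_def)

lemma tuple_one: "v :. W ==> tuple_act \<one>\<^sub>T.PG v = v" by(rule foldr_fixed) (simp add: factor_one)

lemma WMod_module: "alg_module YH WMod" unfolding YH_eq WMod_eq
proof (rule alg_module_quot_act[OF T.PG_monoid W_cspace T.multilinear_rels_closed])
 show "tuple_act t : lin_maps W W" if "t :. T.PG" for t by(rule tuple_lin) (rule PG_factor[OF that])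
qed (rule tuple_one tuple_mult tuple_rels; assumption)+

lemma WMod_simps: "carrier WMod = WS" "ring.add WMod = ring.add M" "\<zero>\<^sub>WMod = \<zero>\<^sub>M"
 "module.smult WMod = module.smult M" by(simp_all add: WMod_eq)

lemma WMod_inclusion: "(%v. v) : lin_maps WMod M"
 using lin_inclusion[of WS M] WS_carrier by(simp add: WMod_eq subsetI)

lemma act_pt:
 assumes t: "!!i. i < m ==> t i :. FH i" and v: "v : WS"
 shows "act WMod (T.pt t) v = tuple_act t v"
proof -
 have r: "restrict t {..<m} :. T.PG" using t by simp
 hence d: "delta (restrict t {..<m}) :. monoid_alg T.PG" by simp
 have vW: "v :. W" using v by simp
 have "act WMod (T.pt t) v = lin_ext W tuple_act (delta (restrict t {..<m})) v"
  unfolding WMod_eq with_act_simps pure_tensor_def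
 proof (rule quot_act_class[OF T.PG_monoid W_cspace T.multilinear_rels_closed _ _ _ _ d vW])
  show "tuple_act t : lin_maps W W" if "t :. T.PG" for t by(rule tuple_lin) (rule PG_factor[OF that])
 qed (rule tuple_one tuple_mult tuple_rels; assumption)+
 also have "... = tuple_act (restrict t {..<m}) v"
  by(rule lin_ext_delta[OF W_cspace]) (rule lin_closed[OF tuple_lin[OF PG_factor[OF r]] vW])
 also have "... = tuple_act t v" by(rule tuple_cong) simp
 finally show ?thesis .
qed

lemma act_tf:
 assumes i: "i < m" and x: "x :. FH i" and v: "v : WS"
 shows "act WMod (T.tf i x) v = \<rho> i x v"
proof -
 let ?t = "%j. \<one>\<^sub>(FH j)"
 have e: "(%r. if r = i then x else \<one>\<^sub>(FH r)) = ?t(i := x)" by auto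
 have "act WMod (T.tf i x) v = tuple_act (?t(i := x)) v" unfolding tensor_factor_def e
  by(rule act_pt[OF _ v]) (use x T.tf_slot_closed[of i x] i in \<open>simp add: e[symmetric] del: fun_upd_apply\<close>)
 also have "... = foldr (%j. \<rho> j (?t j)) [0..<i] (\<rho> i x (foldr (%j. \<rho> j (?t j)) [Suc i..<m] v))"
  by(rule tuple_split[OF i])
 also have "foldr (%j. \<rho> j (?t j)) [Suc i..<m] v = v" by(rule foldr_fixed) (simp add: factor_one v)
 also have "foldr (%j. \<rho> j (?t j)) [0..<i] (\<rho> i x v) = \<rho> i x v"
 proof (rule foldr_fixed)
  have "\<rho> i x v : WS" using lin_closed[OF factor_lin[OF i x], of v] v by simp
  thus "\<rho> j (?t j) (\<rho> i x v) = \<rho> i x v" if "j : set [0..<i]" for j using factor_one that i by simp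
 qed
 finally show ?thesis .
qed

lemma act_Yz:
 assumes j: "j : {1..n}" and v: "v : WS"
 shows "act WMod (Yz j) v = act M (Zg j) v"
proof -
 note p = young_pos[OF j]
 have "Z (young_pos j) : Gens (col j)" using p(2,3) by(simp add: hecke_gens_def)
 thus ?thesis using act_tf[OF p(1) Z_slot[OF j] v] factor_gen[OF p(1) _ v] p(4) by(simp add: Yz_eq)
qed

lemma act_Yp_swap:
 assumes ij: "i : {1..n}" "j : {1..n}" "col i = col j" and v: "v : WS"
 shows "act WMod (Yp (transpose i j)) v = act M (Ep (transpose i j)) v"
proof -
 note p = young_pos[OF ij(1)] and q = young_pos[OF ij(2), folded ij(3)]
 have r: "young_pos i : {1..a (col i)}" "young_pos j : {1..a (col i)}" using p q by simp_all
 note s = permutes_swap_id[OF r]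
 have "Elt (transpose (young_pos i) (young_pos j)) : Gens (col i)"
  using s by(simp add: hecke_gens_def sym_group_carrier)
 thus ?thesis
  using act_tf[OF p(1) graded_Elt_closed[OF s] v] factor_gen[OF p(1) _ v] block_shift_swap[OF r, of "ofs (col i)"]
  by(simp add: Yp_swap[OF ij] p(4) q(4))
qed

lemma act_Yp:
 assumes w: "w : ysub m n a" and v: "v : WS"
 shows "act WMod (Yp w) v = act M (Ep w) v"
proof -
 have p: "w permutes {1..n}" "!!j. j : {1..n} ==> col (w j) = col j" using w young_iff by blast+
 have "w : ysub m n a & act WMod (Yp w) v = act M (Ep w) v"
 proof (rule class_perm_induct[OF color_mono[OF a_comps] p])
  show "id : ysub m n a & act WMod (Yp id) v = act M (Ep id) v"
   using act_one[OF WMod_module, of v] act_one[OF M, of v] v WS_carrier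
   by(simp add: young_iff permutes_id Yp_id of_perm_id H.Elt_one WMod_simps)
 next
  fix j and u :: "nat => nat"
  assume j: "1 <= j" "j < n" "col j = col (j + 1)"
   and IH: "u : ysub m n a & act WMod (Yp u) v = act M (Ep u) v"
  have jn: "j : {1..n}" "j + 1 : {1..n}" using j by auto
  let ?s = "transpose j (j + 1)"
  have u: "u : ysub m n a" using IH by blast
  have s: "?s : ysub m n a" by(rule young_swap[OF jn j(3)])
  note ps = young_permutes[OF a_comps s] and pu = young_permutes[OF a_comps u]
  note sc = El_closed[OF of_perm_closed[OF ps]] and uc = El_closed[OF of_perm_closed[OF pu]]
  have uv: "act M (Ep u) v : WS" using lin_closed[OF perm_weight_lin[OF u], of v] v by simp
  have "act WMod (Yp (?s o u)) v = act WMod (Yp ?s) (act WMod (Yp u) v)"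
   using act_mult[OF WMod_module _ Yp_closed[OF s] Yp_closed[OF u], of v] v Yp_mult[OF s u] by(simp add: WMod_simps)
  also have "... = act M (Ep ?s) (act M (Ep u) v)" using IH act_Yp_swap[OF jn j(3) uv] by simp
  also have "... = act M (Ep (?s o u)) v"
   unfolding act_act[OF v sc uc] H.Elt_mult[OF of_perm_closed[OF ps] of_perm_closed[OF pu]] of_perm_mult[OF ps pu] ..
  finally show "?s o u : ysub m n a & act WMod (Yp (?s o u)) v = act M (Ep (?s o u)) v"
   using young_comp[OF s u] by blast
 qed
 thus ?thesis by blast
qed

text \<open>The elements defining the two Dirac operators act in the same way on a weight space.\<close>

lemma act_young_elt:
 assumes i: "i : {1..n}" and v: "v : WS"
 shows "act WMod (young_elt i) v = act M (do_elt i) v"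
proof -
 note vM = WS_carrier[OF v]
 have vW: "v :. WMod" using v by(simp add: WMod_simps)
 note Wc = module_cspace[OF WMod_module]
 have R: "order_sign i r \<odot>\<^sub>M act WMod (YR i r) v = order_sign i r \<odot>\<^sub>M act M (refl_sum i r) v"
  if r: "r : {1..n}" for r
 proof (cases "i = r")
  case True
  have "act WMod (YR i r) v :. M"
   using act_closed[OF WMod_module YR_closed[OF i r] vW] WS_carrier by(simp add: WMod_simps)
  thus ?thesis using act_closed[OF M refl_sum_closed[OF i r] vM] True
   by(simp add: order_sign_def scale_zero[OF M_cspace])
 next
  case False
  have "act WMod (YR i r) v = (if col i = col r then of_nat m else 0) \<odot>\<^sub>M act M (Ep (transpose i r)) v"
  proof (cases "col i = col r")
   case True
   thus ?thesis
    using act_smult[OF WMod_module vW Yp_closed[OF young_swap[OF i r True]]] act_Yp_swap[OF i r True v]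
    by(simp add: YR_def WMod_simps)
  next
   case False
   have "act WMod \<zero>\<^sub>YH v = \<zero>\<^sub>M"
    using lin_zero[OF Y.cspace Wc act_lin_alg[OF WMod_module vW]] by(simp add: WMod_simps)
   moreover have "act M (Ep (transpose i r)) v :. M"
    by(rule act_closed[OF M El_closed[OF of_perm_closed[OF permutes_swap_id[OF i r]]] vM])
   ultimately show ?thesis using False by(simp add: YR_def scale_zero[OF M_cspace])
  qed
  thus ?thesis using refl_sum_weight[OF i r False v] by simp
 qed
 have c: "order_sign i r \<odot>\<^sub>WMod act WMod (YR i r) v :. WMod" if "r : {1..n}" for r
  by(rule scale_closed[OF Wc act_closed[OF WMod_module YR_closed[OF i that] vW]])
 have "(\<Oplus>\<^sub>WMod r\<in>{1..n}. order_sign i r \<odot>\<^sub>WMod act WMod (YR i r) v) =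
   (\<Oplus>\<^sub>M r\<in>{1..n}. order_sign i r \<odot>\<^sub>WMod act WMod (YR i r) v)"
  by(rule lin_finsum[OF Wc M_cspace WMod_inclusion finite_atLeastAtMost c])
 also have "... = (\<Oplus>\<^sub>M r\<in>{1..n}. order_sign i r \<odot>\<^sub>M act M (refl_sum i r) v)" by(rule M.M.finsum_cong'[OF refl])
   (use R scale_closed[OF M_cspace act_closed[OF M refl_sum_closed[OF i] vM]] in \<open>auto simp: WMod_simps\<close>)
 finally show ?thesis using act_dirac_elt[where z = Yz and R = YR and i = i and n = n and k = k,
    OF T.TA_calg WMod_module vW Yz_closed[OF i] YR_closed[OF i]]
   act_dirac_elt[where z = Zg and R = refl_sum and i = i and n = n and k = k,
    OF H.HA_calg M vM H.Z_closed[OF i] refl_sum_closed[OF i]] act_Yz[OF i v] by(simp add: WMod_simps)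
qed

end

text \<open>A map commuting with the big algebra commutes on weight spaces with the generators of each factor, hence with the
 tensor product.\<close>

lemma (in young_params) weight_hom:
 fixes M M' :: "(do_alg, 'v) lmod"
 assumes M: "alg_module HH M" and M': "alg_module HH M'" and f: "f : equivariant_maps (carrier HH) M M'"
 shows "restrict f (Wsp a M) \<in> equivariant_maps (carrier YH) (Wmod a M) (Wmod a M')"
proof -
 interpret U: weight_params m n k \<eta> S a M by unfold_locales (rule M)
 interpret V: weight_params m n k \<eta> S a M' by unfold_locales (rule M')
 let ?h = "restrict f U.WS"
 have fl: "f : lin_maps M M'" and fe: "!!x v. x :. HH ==> v :. M ==> f (act M x v) = act M' x (f v)"
  using f by(auto simp: equivariant_maps_def)
 have fW: "f v : V.WS" if "v : U.WS" for v
 proof (rule V.WS_I)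
  show "f v :. M'" by(rule lin_closed[OF fl U.WS_carrier[OF that]])
  show "act M' (El (of_torus t)) (f v) = mu m \<eta> a t \<odot>\<^sub>M' f v" if "t :. TT" for t
   using fe[OF El_closed[OF of_torus_closed[OF that]] U.WS_carrier[OF \<open>v : U.WS\<close>]]
    U.WS_act[OF \<open>v : U.WS\<close> that] lin_smult[OF fl U.WS_carrier[OF \<open>v : U.WS\<close>]] by simp
 qed
 have h: "?h : lin_maps U.W V.W"
 proof (rule lin_mapsI)
  fix u assume u: "u :. U.W"
  show "?h u :. V.W" using u fW by simp
  show "?h (c \<odot>\<^sub>U.W u) = c \<odot>\<^sub>V.W ?h u" for c
   using u lin_smult[OF fl U.WS_carrier] csubmoduleD(6)[OF U.M_cspace U.WS_submodule] by simp
  fix v assume v: "v :. U.W"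
  show "?h (u \<oplus>\<^sub>U.W v) = ?h u \<oplus>\<^sub>V.W ?h v"
   using u v lin_add[OF fl U.WS_carrier U.WS_carrier] csubmoduleD(3)[OF U.M_cspace U.WS_submodule] by simp
 qed
 have g: "?h (U.gact i x v) = V.gact i x (?h v)" if "i < m" "x : U.Gens i" "v : U.WS" for i x v
 proof -
  have "U.gact i x v : U.WS" using lin_closed[OF U.gact_closed[OF that(1,2)], of v] that(3) by simp
  moreover have "f (U.gact i x v) = V.gact i x (f v)"
  proof -
   from that(2) show ?thesis
   proof (cases rule: U.Gens_cases)
    case E
    thus ?thesis
     using fe[OF El_closed[OF of_perm_closed[OF young_permutes[OF a_comps block_shift_young[OF that(1) E(2)]]]]
      U.WS_carrier[OF that(3)]] by simp
   next
    case Z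
    thus ?thesis
     using fe[OF H.Z_closed[OF young_block_pos(1)[OF that(1) Z(2)]] U.WS_carrier[OF that(3)]] by simp
   qed
  qed
  ultimately show ?thesis using that(3) by simp
 qed
 have \<rho>: "?h (U.\<rho> i x v) = V.\<rho> i x (?h v)" if "i < m" "x :. FH i" "v : U.WS" for i x v
  by(rule U.factor_intertwine[OF that(1) V.W_cspace h g[OF that(1)] that(3,2)])
 have eq: "?h (act U.WMod x v) = act V.WMod x (?h v)" if x: "x :. YH" and v: "v : U.WS" for x v
  unfolding U.WMod_eq V.WMod_eq with_act_simps
 proof (rule quot_act_intertwine[OF T.PG_monoid T.multilinear_rels_closed U.W_cspace V.W_cspace h _ _ x[unfolded U.YH_eq]])
  fix t assume t: "t :. T.PG"
  have vW: "v :. U.W" using v by simp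
  show "U.tuple_act t v :. U.W" by(rule lin_closed[OF U.tuple_lin[OF U.PG_factor[OF t]] vW])
  have "U.\<rho> i (t i) u : U.WS & ?h (U.\<rho> i (t i) u) = V.\<rho> i (t i) (?h u)"
   if "i : set [0..<m]" "u : U.WS" for i u
  proof -
   have i: "i < m" using that(1) by simp
   have "u :. U.W" using that(2) by simp
   from lin_closed[OF U.factor_lin[OF i U.PG_factor[OF t i]] this]
   show ?thesis using \<rho>[OF i U.PG_factor[OF t i] that(2)] by(simp del: restrict_apply)
  qed
  from foldr_intertwine[of "[0..<m]" U.WS "%i. U.\<rho> i (t i)" ?h "%i. V.\<rho> i (t i)" v, OF this v]
  show "?h (U.tuple_act t v) = V.tuple_act t (?h v)" by blast
 qed
 show ?thesis unfolding equivariant_maps_def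
  using h eq by(simp add: U.WMod_simps U.WMod_eq V.WMod_eq del: restrict_apply)
qed

lemma (in dirac_params) weight_functor_is_functor:
 "is_functor (module_cat HH :: ((do_alg, 'v) lmod, 'v => 'v) cat)
   (prod_cat (comps m n) (%a. module_cat (young_hecke m k a))) (weight_functor m n k \<eta>)"
proof -
 have Y: "young_params m n \<eta> S a" if "a : comps m n" for a by unfold_locales (rule that)
 have W: "weight_params m n k \<eta> S a M" if "a : comps m n" "alg_module HH M" for a and M :: "(do_alg, 'v) lmod"
  by(rule weight_params.intro[OF Y[OF that(1)]], unfold_locales) (rule that(2))
 show ?thesis unfolding is_functor_def prod_cat_def module_cat_def weight_functor_def cat.simps functr.simps
 proof (intro conjI ballI)
  fix U :: "(do_alg, 'v) lmod" assume U: "U : {V. alg_module HH V}"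
  show "(\<lambda>a\<in>comps m n. Wmod a U) : (\<Pi>\<^sub>E a\<in>comps m n. {V. alg_module (young_hecke m k a) V})"
   using weight_params.WMod_module[OF W] U by auto
  have sub: "Wsp a U <= carrier U" for a by(auto simp: weight_space_def)
  have car: "carrier (Wmod a U) = Wsp a U" for a by(simp add: weight_module_def Let_def)
  show "(\<lambda>a\<in>comps m n. restrict (\<lambda>v\<in>carrier U. v) (Wsp a U)) =
    (\<lambda>a\<in>comps m n. \<lambda>v\<in>carrier ((\<lambda>a\<in>comps m n. Wmod a U) a). v)"
   using sub by(intro restrict_ext) (auto simp: car fun_eq_iff restrict_def)
  fix V :: "(do_alg, 'v) lmod" assume V: "V : {V. alg_module HH V}"
  fix f assume f: "f : equivariant_maps (carrier HH) U V"
  show "(\<lambda>a\<in>comps m n. restrict f (Wsp a U)) \<in> (\<Pi>\<^sub>E a\<in>comps m n. equivariant_maps (carrier (young_hecke m k a))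
     ((\<lambda>a\<in>comps m n. Wmod a U) a) ((\<lambda>a\<in>comps m n. Wmod a V) a))"
   using young_params.weight_hom[OF Y] U V f by auto
  have h: "restrict f (Wsp a U) \<in> equivariant_maps (carrier (young_hecke m k a)) (Wmod a U) (Wmod a V)"
   if "a : comps m n" for a using young_params.weight_hom[OF Y[OF that]] U V f by simp
  have fw: "f v : Wsp a V" if "a : comps m n" "v : Wsp a U" for a v
  proof -
   have "restrict f (Wsp a U) : lin_maps (Wmod a U) (Wmod a V)"
    using h[OF that(1)] unfolding equivariant_maps_def by blast
   from lin_closed[OF this, of v] show ?thesis using that(2) by(simp add: weight_module_def Let_def)
  qed
  fix N :: "(do_alg, 'v) lmod" and g assume N: "N : {V. alg_module HH V}" and g: "g : equivariant_maps (carrier HH) V N"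
  show "(\<lambda>a\<in>comps m n. restrict (compose (carrier U) g f) (Wsp a U)) =
    (\<lambda>a\<in>comps m n. compose (carrier ((\<lambda>a\<in>comps m n. Wmod a U) a)) ((\<lambda>a\<in>comps m n. restrict g (Wsp a V)) a)
     ((\<lambda>a\<in>comps m n. restrict f (Wsp a U)) a))"
  proof (rule restrict_ext)
   fix a assume a: "a : comps m n"
   show "restrict (compose (carrier U) g f) (Wsp a U) = compose (carrier ((\<lambda>a\<in>comps m n. Wmod a U) a))
     ((\<lambda>a\<in>comps m n. restrict g (Wsp a V)) a) ((\<lambda>a\<in>comps m n. restrict f (Wsp a U)) a)"
   proof
    fix v
    show "restrict (compose (carrier U) g f) (Wsp a U) v = compose (carrier ((\<lambda>a\<in>comps m n. Wmod a U) a))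
      ((\<lambda>a\<in>comps m n. restrict g (Wsp a V)) a) ((\<lambda>a\<in>comps m n. restrict f (Wsp a U)) a) v"
     using a sub[of a] fw[OF a, of v] by(cases "v : Wsp a U") (auto simp: compose_def car)
   qed
  qed
 qed
qed

section \<open>Induced representations\<close>

lemma dir_sum_simps [simp]: "carrier (dir_sum I V) = (\<Pi>\<^sub>E i\<in>I. carrier (V i))"
 "x \<oplus>\<^sub>(dir_sum I V) y = (\<lambda>i\<in>I. x i \<oplus>\<^sub>(V i) y i)" "\<zero>\<^sub>(dir_sum I V) = (\<lambda>i\<in>I. \<zero>\<^sub>(V i))"
 "c \<odot>\<^sub>(dir_sum I V) x = (\<lambda>i\<in>I. c \<odot>\<^sub>(V i) x i)" by(simp_all add: dir_sum_def)

lemma cspace_dir_sum: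
 assumes V: "!!i. i : I ==> cspace (V i)"
 shows "cspace (dir_sum I V)"
proof -
 let ?D = "dir_sum I V"
 have ag: "abelian_group (V i)" if "i : I" for i by(rule module.axioms(2)[OF V[OF that]])
 note c = abelian_groupE[OF ag] scale_closed[OF V] scale_plus[OF V] scale_add[OF V]
  scale_scale[OF V] scale_one[OF V] scale_zero[OF V]
 have m: "x i :. V i" if "x :. ?D" "i : I" for x i using that by auto
 have e: "x = y" if "x : extensional I" "y : extensional I" "!!i. i : I ==> x i = y i" for x y :: "_ => 'b"
  by(rule extensionalityI[OF that])
 have x: "x : extensional I" if "x :. ?D" for x using that by(auto simp: PiE_def)
 show ?thesis
 proof (rule cspaceI)
  fix x y assume xy: "x :. ?D" "y :. ?D"
  note mx = m[OF xy(1)] and my = m[OF xy(2)]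
  show "x \<oplus>\<^sub>?D y :. ?D" using mx my c(1) by simp
  show "x \<oplus>\<^sub>?D y = y \<oplus>\<^sub>?D x" unfolding dir_sum_simps by(rule restrict_ext) (rule c(4)[OF _ mx my])
  show "\<zero>\<^sub>?D \<oplus>\<^sub>?D x = x" by(rule e[OF _ x[OF xy(1)]]) (simp_all add: c(5) mx)
  show "b \<odot>\<^sub>?D x :. ?D" for b using mx scale_closed[OF V] by simp
  show "(a + b) \<odot>\<^sub>?D x = a \<odot>\<^sub>?D x \<oplus>\<^sub>?D b \<odot>\<^sub>?D x" for a b
   unfolding dir_sum_simps by(rule restrict_ext) (simp add: scale_plus[OF V mx])
  show "a \<odot>\<^sub>?D (x \<oplus>\<^sub>?D y) = a \<odot>\<^sub>?D x \<oplus>\<^sub>?D a \<odot>\<^sub>?D y" for a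
   unfolding dir_sum_simps by(rule restrict_ext) (simp add: scale_add[OF V mx my])
  show "(a * b) \<odot>\<^sub>?D x = a \<odot>\<^sub>?D (b \<odot>\<^sub>?D x)" for a b
   unfolding dir_sum_simps by(rule restrict_ext) (simp add: scale_scale[OF V mx])
  show "1 \<odot>\<^sub>?D x = x" by(rule e[OF _ x[OF xy(1)]]) (simp_all add: scale_one[OF V mx])
  show "0 \<odot>\<^sub>?D x = \<zero>\<^sub>?D" unfolding dir_sum_simps by(rule restrict_ext) (simp add: scale_zero[OF V mx])
  fix z assume z: "z :. ?D"
  show "x \<oplus>\<^sub>?D y \<oplus>\<^sub>?D z = x \<oplus>\<^sub>?D (y \<oplus>\<^sub>?D z)"
   unfolding dir_sum_simps by(rule restrict_ext) (simp add: c(3)[OF _ mx my m[OF z]])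
 next
  show "\<zero>\<^sub>?D :. ?D" using c(2) by simp
 qed
qed

lemma
 assumes "group_rep G V"
 shows group_rep_cspace: "cspace V" and rep_lin: "g :. G ==> act V g : lin_maps V V"
  and rep_mult: "v :. V ==> g :. G ==> h :. G ==> act V (g \<otimes>\<^sub>G h) v = act V g (act V h v)"
  and rep_one: "v :. V ==> act V \<one>\<^sub>G v = v" and rep_closed: "g :. G ==> v :. V ==> act V g v :. V"
 using assms unfolding group_rep_def by(auto intro: lin_closed)

lemma dir_sum_group_rep:
 assumes V: "!!i. i : I ==> group_rep G (V i)"
 shows "group_rep G (with_act (dir_sum I V) (%g x. \<lambda>i\<in>I. act (V i) g (x i)))"
 unfolding group_rep_def with_act_simps lin_with_act cspace_with_act
proof (intro conjI ballI)
 show "cspace (dir_sum I V)" by(rule cspace_dir_sum[OF group_rep_cspace[OF V]])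
 have m: "x i :. V i" if "x :. dir_sum I V" "i : I" for x i using that by auto
 fix g assume g: "g :. G"
 show "(%x. \<lambda>i\<in>I. act (V i) g (x i)) : lin_maps (dir_sum I V) (dir_sum I V)"
 proof (rule lin_mapsI)
  fix x assume x: "x :. dir_sum I V"
  show "(\<lambda>i\<in>I. act (V i) g (x i)) :. dir_sum I V" using rep_closed[OF V _ m[OF x]] g by simp
  show "(\<lambda>i\<in>I. act (V i) g ((c \<odot>\<^sub>(dir_sum I V) x) i)) = c \<odot>\<^sub>(dir_sum I V) (\<lambda>i\<in>I. act (V i) g (x i))" for c
   unfolding dir_sum_simps by(rule restrict_ext) (use lin_smult[OF rep_lin[OF V g] m[OF x]] in simp)
  fix y assume y: "y :. dir_sum I V"
  show "(\<lambda>i\<in>I. act (V i) g ((x \<oplus>\<^sub>(dir_sum I V) y) i)) =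
    (\<lambda>i\<in>I. act (V i) g (x i)) \<oplus>\<^sub>(dir_sum I V) (\<lambda>i\<in>I. act (V i) g (y i))" unfolding dir_sum_simps
   by(rule restrict_ext) (use lin_add[OF rep_lin[OF V g] m[OF x] m[OF y]] in simp)
 qed
next
 fix x assume x: "x :. dir_sum I V"
 hence m: "i : I ==> x i :. V i" for i by auto
 show "(\<lambda>i\<in>I. act (V i) (g \<otimes>\<^sub>G h) (x i)) = (\<lambda>i\<in>I. act (V i) g ((\<lambda>i\<in>I. act (V i) h (x i)) i))"
  if "g :. G" "h :. G" for g h by(rule restrict_ext) (use rep_mult[OF V m that] in simp)
 show "(\<lambda>i\<in>I. act (V i) \<one>\<^sub>G (x i)) = x"
  by(rule extensionalityI[of _ I]) (use x rep_one[OF V m] in \<open>auto simp: PiE_def\<close>)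
qed

lemma induced_simps [simp]: "carrier (induced G H N) = {f \<in> carrier G \<rightarrow>\<^sub>E carrier N.
   \<forall>g\<in>carrier G. \<forall>h\<in>H. f (g \<otimes>\<^sub>G h) = act N (inv\<^bsub>G\<^esub> h) (f g)}"
 "f \<oplus>\<^sub>(induced G H N) f' = (\<lambda>g\<in>carrier G. f g \<oplus>\<^sub>N f' g)" "c \<odot>\<^sub>(induced G H N) f = (\<lambda>g\<in>carrier G. c \<odot>\<^sub>N f g)"
 "act (induced G H N) x f = (\<lambda>g\<in>carrier G. f (inv\<^bsub>G\<^esub> x \<otimes>\<^sub>G g))" by(simp_all add: induced_def dir_sum_def)

lemma induced_group_rep:
 assumes G: "group G" and N: "cspace N" and H: "H <= carrier G"
  and lin: "!!h. h : H ==> act N (inv\<^bsub>G\<^esub> h) : lin_maps N N"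
 shows "group_rep G (induced G H N)"
proof -
 let ?J = "induced G H N"
 interpret G: group G by(rule G)
 interpret N: module CC N by(rule N)
 let ?D = "dir_sum (carrier G) (%_. N)" and ?C = "carrier ?J"
 have D: "cspace ?D" by(rule cspace_dir_sum) (rule N)
 have m: "f g :. N" if "f : ?C" "g :. G" for f g using that by auto
 have t: "f (g \<otimes>\<^sub>G h) = act N (inv\<^bsub>G\<^esub> h) (f g)" if "f : ?C" "g :. G" "h : H" for f g h using that by simp
 have I: "f : ?C" if "f : carrier G \<rightarrow>\<^sub>E carrier N"
  "!!g h. g :. G ==> h : H ==> f (g \<otimes>\<^sub>G h) = act N (inv\<^bsub>G\<^esub> h) (f g)" for f using that by simp
 have Hm: "g \<otimes>\<^sub>G h :. G" if "g :. G" "h : H" for g h using that H by auto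
 have sub: "submodule ?C CC ?D"
 proof (rule csubmoduleI[OF D])
  show "?C <= carrier ?D" by auto
  show "\<zero>\<^sub>?D : ?C" by(rule I) (use lin_zero[OF N N lin] Hm in auto)
  show "f \<oplus>\<^sub>?D f' : ?C" if f: "f : ?C" "f' : ?C" for f f'
   by(rule I) (use m[OF f(1)] m[OF f(2)] t[OF f(1)] t[OF f(2)] Hm lin_add[OF lin] in auto)
  show "c \<odot>\<^sub>?D f : ?C" if f: "f : ?C" for c f
   by(rule I) (use m[OF f] t[OF f] Hm lin_smult[OF lin] scale_closed[OF N] in auto)
 qed
 have C: "cspace ?J"
  using cspace_restrict[OF D sub] unfolding induced_def cspace_with_act induced_simps(1)[unfolded induced_def] .
 have ac: "act ?J x f : ?C" if x: "x :. G" and f: "f : ?C" for x f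
 proof (rule I)
  show "act ?J x f : carrier G \<rightarrow>\<^sub>E carrier N" using m[OF f] x by simp
  show "act ?J x f (g \<otimes>\<^sub>G h) = act N (inv\<^bsub>G\<^esub> h) (act ?J x f g)" if g: "g :. G" and h: "h : H" for g h
   using t[OF f G.m_closed[OF G.inv_closed[OF x] g] h] Hm[OF g h] g h H x
   by(simp add: G.m_assoc subsetD[OF H])
 qed
 have e: "f = f'" if "f : extensional (carrier G)" "f' : extensional (carrier G)"
  "!!g. g :. G ==> f g = f' g" for f f' :: "_ => 'c" by(rule extensionalityI[OF that])
 show ?thesis unfolding group_rep_def
 proof (intro conjI ballI)
  show "cspace ?J" by(rule C)
  fix x assume x: "x :. G"
  show "act ?J x : lin_maps ?J ?J" by(rule lin_mapsI, rule ac[OF x]) (use x in \<open>auto intro!: restrict_ext\<close>)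
 next
  fix f assume f: "f : ?C"
  show "act ?J (x \<otimes>\<^sub>G y) f = act ?J x (act ?J y f)" if "x :. G" "y :. G" for x y unfolding induced_simps
   by(rule restrict_ext) (use that in \<open>simp add: G.inv_mult_group G.m_assoc\<close>)
  show "act ?J \<one>\<^sub>G f = f" by(rule e) (use f in \<open>auto simp: PiE_def\<close>)
 qed
qed

section \<open>The functor back to the reflection group\<close>

context dirac_params
begin

abbreviation "wp g == cover_perm n (snd g)"
abbreviation "HC a == carrier TT \<times> carrier (young_cover m n a)"
abbreviation "IND a N == induced RC (HC a) (mu_twist m \<eta> a N)"

sublocale RC: group RC by(rule RC_group)

lemma young_paramsI: "a : comps m n ==> young_params m n \<eta> S a" by unfold_locales

lemma RC_snd: "g :. RC ==> snd g :. SC" and RC_fst: "g :. RC ==> fst g :. TT" by(auto simp: RC_simps)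

lemma wp_permutes: "g :. RC ==> wp g permutes {1..n}" by(rule SC_lift(2)[OF RC_snd])

lemma wp_mult: "g :. RC ==> h :. RC ==> wp (g \<otimes>\<^sub>RC h) = wp g o wp h"
 using cover_perm_mult[OF RC_snd RC_snd, of g h] by(cases g; cases h) (simp add: RC_simps)

lemma wp_one: "wp \<one>\<^sub>RC = id" by(simp add: RC_simps cover_perm_one)

lemma wp_inv:
 assumes g: "g :. RC"
 shows "wp (inv\<^bsub>RC\<^esub> g) = inv_into UNIV (wp g)"
proof (rule inv_unique_comp[symmetric])
 show "wp g o wp (inv\<^bsub>RC\<^esub> g) = id" "wp (inv\<^bsub>RC\<^esub> g) o wp g = id"
  using wp_mult[OF g RC.inv_closed[OF g]] wp_mult[OF RC.inv_closed[OF g] g] g wp_one by simp_all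
qed

lemma HC_iff:
 assumes a: "a : comps m n"
 shows "g : HC a \<longleftrightarrow> g :. RC & wp g : ysub m n a"
proof -
 note Y = young_paramsI[OF a]
 obtain t x where gx: "g = (t, x)" by(cases g)
 have "x :. young_cover m n a \<longleftrightarrow> x :. SC & cover_perm n x : ysub m n a"
  using young_params.YC_lift[OF Y, of x] young_params.lift_in_YC[OF Y, of x] SC_lift(1) by blast
 thus ?thesis unfolding gx RC_simps by auto
qed

lemma HC_inv:
 assumes a: "a : comps m n" and h: "h : HC a"
 shows "inv\<^bsub>RC\<^esub> h : HC a"
proof -
 have hc: "h :. RC" and w: "wp h : ysub m n a" using h HC_iff[OF a] by blast+
 have "inv\<^bsub>sym_group n\<^esub> (wp h) : ysub m n a" by(rule subgroup.m_inv_closed[OF subgroup_young w])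
 moreover have "wp h :. sym_group n" using wp_permutes[OF hc] by(simp add: sym_group_carrier)
 ultimately have "wp (inv\<^bsub>RC\<^esub> h) : ysub m n a" using wp_inv[OF hc] by(simp add: sym_group_inv_equality)
 thus ?thesis using HC_iff[OF a] RC.inv_closed[OF hc] by blast
qed

lemma HC_sub: "a : comps m n ==> HC a <= carrier RC" using HC_iff by blast

lemma mu_twist_simps [simp]:
 "carrier (mu_twist m \<eta> a N) = carrier N" "ring.add (mu_twist m \<eta> a N) = ring.add N"
 "\<zero>\<^sub>(mu_twist m \<eta> a N) = \<zero>\<^sub>N" "module.smult (mu_twist m \<eta> a N) = module.smult N"
 "act (mu_twist m \<eta> a N) (t, x) v = mu m \<eta> a t \<odot>\<^sub>N act N x v" by(simp_all add: mu_twist_def)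

lemma mu_twist_lin:
 assumes N: "group_rep (young_cover m n a) N" and h: "h : HC a"
 shows "act (mu_twist m \<eta> a N) h : lin_maps N N"
proof -
 obtain t x where hx: "h = (t, x)" by(cases h)
 have x: "x :. young_cover m n a" using h hx by simp
 have "act (mu_twist m \<eta> a N) (t, x) = (%v. mu m \<eta> a t \<odot>\<^sub>N act N x v)" by(rule ext) simp
 thus ?thesis unfolding hx using lin_const_smult[OF group_rep_cspace[OF N] rep_lin[OF N x]] by simp
qed

lemma lin_mu_twist: "lin_maps (mu_twist m \<eta> a N) (mu_twist m \<eta> a N) = lin_maps N N" by(simp add: lin_maps_def)

lemma IND_rep:
 assumes a: "a : comps m n" and N: "group_rep (young_cover m n a) N"
 shows "group_rep RC (IND a N)"
proof (rule induced_group_rep[OF RC_group _ HC_sub[OF a]])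
 show "cspace (mu_twist m \<eta> a N)" using group_rep_cspace[OF N] by(simp add: mu_twist_def)
 show "act (mu_twist m \<eta> a N) (inv\<^bsub>RC\<^esub> h) : lin_maps (mu_twist m \<eta> a N) (mu_twist m \<eta> a N)" if "h : HC a" for h
  unfolding lin_mu_twist by(rule mu_twist_lin[OF N HC_inv[OF a that]])
qed

abbreviation "back N == dir_sum (comps m n) (%a. IND a (N a))"
abbreviation "back_rep N == with_act (back N) (%x F. \<lambda>a\<in>comps m n. act (IND a (N a)) x (F a))"

lemma induction_functor_simps: "omap indF N = back_rep N" "mmap indF N N' f =
   (\<lambda>F\<in>carrier (back N). \<lambda>a\<in>comps m n. \<lambda>g\<in>carrier RC. f a (F a g))"
 by(simp_all add: induction_functor_def Let_def)

lemma back_rep_rep: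
 assumes "!!a. a : comps m n ==> group_rep (young_cover m n a) (N a)"
 shows "group_rep RC (back_rep N)" by(rule dir_sum_group_rep) (rule IND_rep[OF _ assms])

lemma back_memD:
 assumes "F :. back N" "a : comps m n"
 shows "g :. RC ==> F a g :. N a"
  "g :. RC ==> h : HC a ==> F a (g \<otimes>\<^sub>RC h) = act (mu_twist m \<eta> a (N a)) (inv\<^bsub>RC\<^esub> h) (F a g)"
  "F a : extensional (carrier RC)"
proof -
 have "F a :. IND a (N a)" using assms(1)[unfolded dir_sum_simps(1)] assms(2) by(rule PiE_mem)
 thus "g :. RC ==> F a g :. N a"
  "g :. RC ==> h : HC a ==> F a (g \<otimes>\<^sub>RC h) = act (mu_twist m \<eta> a (N a)) (inv\<^bsub>RC\<^esub> h) (F a g)"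
  "F a : extensional (carrier RC)" unfolding induced_simps mu_twist_simps PiE_def by blast+
qed

lemma back_memI:
 assumes "!!a g. a : comps m n ==> g :. RC ==> f a g :. N a"
  and "!!a g h. a : comps m n ==> g :. RC ==> h : HC a ==>
   f a (g \<otimes>\<^sub>RC h) = act (mu_twist m \<eta> a (N a)) (inv\<^bsub>RC\<^esub> h) (f a g)"
 shows "(\<lambda>a\<in>comps m n. \<lambda>g\<in>carrier RC. f a g) :. back N"
proof -
 have "(\<lambda>g\<in>carrier RC. f a g) :. IND a (N a)" if a: "a : comps m n" for a
 proof -
  have "g \<otimes>\<^sub>RC h :. RC" if "g :. RC" "h : HC a" for g h using RC.m_closed that HC_sub[OF a] by blast
  thus ?thesis using assms[OF a] unfolding induced_simps by simp
 qed
 thus ?thesis by simp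
qed

lemma back_eqI:
 assumes "F :. back N" "F' :. back N" and "!!a g. a : comps m n ==> g :. RC ==> F a g = F' a g"
 shows "F = F'"
proof (rule PiE_ext)
 show "F : (\<Pi>\<^sub>E a\<in>comps m n. carrier (IND a (N a)))" "F' : (\<Pi>\<^sub>E a\<in>comps m n. carrier (IND a (N a)))"
  using assms(1,2) by(simp_all only: dir_sum_simps)
 show "F a = F' a" if a: "a : comps m n" for a
  by(rule extensionalityI[OF back_memD(3)[OF assms(1) a] back_memD(3)[OF assms(2) a] assms(3)[OF a]])
qed

lemma back_hom:
 assumes N: "!!a. a : comps m n ==> group_rep (young_cover m n a) (N a)"
  and N': "!!a. a : comps m n ==> group_rep (young_cover m n a) (N' a)"
  and f: "!!a. a : comps m n ==> f a : equivariant_maps (carrier (young_cover m n a)) (N a) (N' a)"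
  and F: "F :. back N"
 shows "(\<lambda>a\<in>comps m n. \<lambda>g\<in>carrier RC. f a (F a g)) :. back N'"
proof (rule back_memI)
 fix a g assume a: "a : comps m n" and g: "g :. RC"
 have fl: "f a : lin_maps (N a) (N' a)" using f[OF a] by(simp add: equivariant_maps_def)
 note m = back_memD[OF F a]
 show "f a (F a g) :. N' a" by(rule lin_closed[OF fl m(1)[OF g]])
 fix h assume h: "h : HC a"
 obtain t x where i: "inv\<^bsub>RC\<^esub> h = (t, x)" by(cases "inv\<^bsub>RC\<^esub> h")
 have x: "x :. young_cover m n a" using HC_inv[OF a h] i by simp
 have "f a (act (N a) x (F a g)) = act (N' a) x (f a (F a g))"
  using f[OF a] x m(1)[OF g] by(simp add: equivariant_maps_def)
 thus "f a (F a (g \<otimes>\<^sub>RC h)) = act (mu_twist m \<eta> a (N' a)) (inv\<^bsub>RC\<^esub> h) (f a (F a g))"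
  using lin_smult[OF fl rep_closed[OF N[OF a] x m(1)[OF g]]] by(simp add: m(2)[OF g h] i)
qed

theorem induction_functor_is_functor:
 "is_functor (prod_cat (comps m n) (%a. rep_cat (young_cover m n a))) (rep_cat RC) indF"
 unfolding is_functor_def prod_cat_def rep_cat_def cat.simps
proof (intro conjI ballI)
 fix N :: "(nat => nat) => (cliff_alg, 'w) lmod"
 assume "N : (\<Pi>\<^sub>E a\<in>comps m n. {V. group_rep (young_cover m n a) V})"
 hence N: "!!a. a : comps m n ==> group_rep (young_cover m n a) (N a)" by auto
 note R = back_rep_rep[of N, OF N]
 show "omap indF N : {V. group_rep RC V}" unfolding induction_functor_simps using R by simp
 show "mmap indF N N (\<lambda>a\<in>comps m n. \<lambda>v\<in>carrier (N a). v) = (\<lambda>v\<in>carrier (omap indF N). v)"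
  unfolding induction_functor_simps with_act_simps
 proof (rule restrict_ext)
  fix F assume F: "F :. back N"
  have "(\<lambda>a\<in>comps m n. \<lambda>g\<in>carrier RC. F a g) :. back N"
   by(rule back_memI) (rule back_memD[OF F], assumption+)+
  moreover have "(\<lambda>a\<in>comps m n. \<lambda>g\<in>carrier RC. (\<lambda>a\<in>comps m n. \<lambda>v\<in>carrier (N a). v) a (F a g)) =
    (\<lambda>a\<in>comps m n. \<lambda>g\<in>carrier RC. F a g)" by(intro restrict_ext) (use back_memD(1)[OF F] in simp)
  ultimately show "(\<lambda>a\<in>comps m n. \<lambda>g\<in>carrier RC. (\<lambda>a\<in>comps m n. \<lambda>v\<in>carrier (N a). v) a (F a g)) = F"
   using back_eqI[OF _ F] by simp
 qed
 fix N' :: "(nat => nat) => (cliff_alg, 'w) lmod"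
 assume "N' : (\<Pi>\<^sub>E a\<in>comps m n. {V. group_rep (young_cover m n a) V})"
 hence N': "!!a. a : comps m n ==> group_rep (young_cover m n a) (N' a)" by auto
 fix f assume "f : (\<Pi>\<^sub>E a\<in>comps m n. equivariant_maps (carrier (young_cover m n a)) (N a) (N' a))"
 hence f: "!!a. a : comps m n ==> f a : equivariant_maps (carrier (young_cover m n a)) (N a) (N' a)" by auto
 hence fl: "!!a. a : comps m n ==> f a : lin_maps (N a) (N' a)" by(simp add: equivariant_maps_def)
 let ?f = "%F. \<lambda>a\<in>comps m n. \<lambda>g\<in>carrier RC. f a (F a g)"
 have fb: "?f F :. back N'" if "F :. back N" for F by(rule back_hom[OF N N' f that])
 have lin: "restrict ?f (carrier (back N)) : lin_maps (back N) (back N')"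
 proof (rule lin_cong[OF cspace_dir_sum[OF group_rep_cspace[OF IND_rep[OF _ N]]] lin_mapsI])
  fix F assume F: "F :. back N"
  show "?f F :. back N'" by(rule fb[OF F])
  show "?f (c \<odot>\<^sub>(back N) F) = c \<odot>\<^sub>(back N') ?f F" for c unfolding dir_sum_simps
   by(intro restrict_ext) (use back_memD(1)[OF F] lin_smult[OF fl] in \<open>simp cong: restrict_cong\<close>)
  fix F' assume F': "F' :. back N"
  show "?f (F \<oplus>\<^sub>(back N) F') = ?f F \<oplus>\<^sub>(back N') ?f F'" unfolding dir_sum_simps by(intro restrict_ext)
    (use back_memD(1)[OF F] back_memD(1)[OF F'] lin_add[OF fl] in \<open>simp cong: restrict_cong\<close>)
 qed simp_all
 show "mmap indF N N' f : equivariant_maps (carrier RC) (omap indF N) (omap indF N')"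
  unfolding induction_functor_simps equivariant_maps_def with_act_simps lin_with_act
 proof (intro CollectI IntI conjI ballI)
  show "restrict ?f (carrier (back N)) : lin_maps (back N) (back N')" by(rule lin)
  show "restrict ?f (carrier (back N)) : extensional (carrier (back N))" by(rule restrict_extensional)
  fix x F assume x: "x :. RC" and F: "F :. back N"
  have xF: "(\<lambda>a\<in>comps m n. act (IND a (N a)) x (F a)) :. back N" using rep_closed[OF R x, of F] F by simp
  have "?f (\<lambda>a\<in>comps m n. act (IND a (N a)) x (F a)) = (\<lambda>a\<in>comps m n. act (IND a (N' a)) x (?f F a))"
   by(intro restrict_ext) (use x in \<open>simp cong: restrict_cong\<close>)
  thus "restrict ?f (carrier (back N)) (\<lambda>a\<in>comps m n. act (IND a (N a)) x (F a)) =
    (\<lambda>a\<in>comps m n. act (IND a (N' a)) x (restrict ?f (carrier (back N)) F a))"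
   unfolding restrict_apply'[OF xF] restrict_apply'[OF F] .
 qed
 fix N'' :: "(nat => nat) => (cliff_alg, 'w) lmod" and g
 assume "N'' : (\<Pi>\<^sub>E a\<in>comps m n. {V. group_rep (young_cover m n a) V})"
 show "mmap indF N N'' (\<lambda>a\<in>comps m n. compose (carrier (N a)) (g a) (f a)) =
   compose (carrier (omap indF N)) (mmap indF N' N'' g) (mmap indF N N' f)"
  unfolding induction_functor_simps with_act_simps compose_def
 proof (rule restrict_ext)
  fix F assume F: "F :. back N"
  have "(\<lambda>a\<in>comps m n. \<lambda>x\<in>carrier RC. (\<lambda>a\<in>comps m n. \<lambda>v\<in>carrier (N a). g a (f a v)) a (F a x)) =
   (\<lambda>a\<in>comps m n. \<lambda>x\<in>carrier RC. g a (?f F a x))" by(intro restrict_ext) (use back_memD(1)[OF F] in simp)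
  thus "(\<lambda>a\<in>comps m n. \<lambda>x\<in>carrier RC. (\<lambda>a\<in>comps m n. \<lambda>v\<in>carrier (N a). g a (f a v)) a (F a x)) =
   restrict (%F. \<lambda>a\<in>comps m n. \<lambda>x\<in>carrier RC. g a (F a x)) (carrier (back N')) (restrict ?f (carrier (back N)) F)"
   unfolding restrict_apply'[OF F] restrict_apply'[OF fb[OF F]] .
 qed
qed

end

section \<open>Clifford theory for the torus\<close>

lemma cspace_finsum_swap:
 assumes V: "cspace V" and C: "finite C" and T: "finite T" and v: "!!t. t : T ==> v t :. V"
 shows "(\<Oplus>\<^sub>V c\<in>C. \<Oplus>\<^sub>V t\<in>T. f c t \<odot>\<^sub>V v t) = (\<Oplus>\<^sub>V t\<in>T. (\<Sum>c\<in>C. f c t) \<odot>\<^sub>V v t)"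
proof -
 interpret V: module CC V by(rule V)
 have c: "x \<odot>\<^sub>V v t :. V" if "t : T" for x t by(rule scale_closed[OF V v[OF that]])
 have s: "(\<Oplus>\<^sub>V t\<in>T. f c t \<odot>\<^sub>V v t) :. V" for c using c by(intro V.M.finsum_closed) auto
 show ?thesis using C
 proof (induction C)
  case empty
  have "(\<Oplus>\<^sub>V t\<in>T. 0 \<odot>\<^sub>V v t) = (\<Oplus>\<^sub>V t\<in>T. \<zero>\<^sub>V)" using v by(intro V.M.finsum_cong') (auto simp: scale_zero[OF V])
  thus ?case by simp
 next
  case (insert c C)
  have "(\<Oplus>\<^sub>V c\<in>insert c C. \<Oplus>\<^sub>V t\<in>T. f c t \<odot>\<^sub>V v t) = (\<Oplus>\<^sub>V t\<in>T. f c t \<odot>\<^sub>V v t) \<oplus>\<^sub>V (\<Oplus>\<^sub>V t\<in>T. (\<Sum>c\<in>C. f c t) \<odot>\<^sub>V v t)"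
   using insert s by simp
  also have "... = (\<Oplus>\<^sub>V t\<in>T. f c t \<odot>\<^sub>V v t \<oplus>\<^sub>V (\<Sum>c\<in>C. f c t) \<odot>\<^sub>V v t)"
   using c by(intro V.M.finsum_addf[symmetric]) auto
  also have "... = (\<Oplus>\<^sub>V t\<in>T. (\<Sum>c\<in>insert c C. f c t) \<odot>\<^sub>V v t)"
   using c insert.hyps by(intro V.M.finsum_cong') (auto simp: scale_plus[OF V v])
  finally show ?case .
 qed
qed

lemma finsum_single:
 assumes V: "cspace V" and C: "finite C" "c : C" and f: "!!x. x : C ==> f x :. V"
  and z: "!!x. x : C ==> x ~= c ==> f x = \<zero>\<^sub>V"
 shows "(\<Oplus>\<^sub>V x\<in>C. f x) = f c"
proof -
 interpret V: module CC V by(rule V)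
 have "(\<Oplus>\<^sub>V x\<in>C. f x) = (\<Oplus>\<^sub>V x\<in>C. if c = x then f x else \<zero>\<^sub>V)" using f z by(intro V.M.finsum_cong') auto
 also have "... = f c" by(rule V.M.finsum_singleton[OF C(2,1)]) (use f in auto)
 finally show ?thesis .
qed

lemma smult_eq_zeroD:
 assumes V: "cspace V" and v: "v :. V" and e: "b \<odot>\<^sub>V v = c \<odot>\<^sub>V v" "b ~= c"
 shows "v = \<zero>\<^sub>V"
proof -
 interpret V: module CC V by(rule V)
 have c: "x \<odot>\<^sub>V v :. V" for x by(rule scale_closed[OF V v])
 have "(b - c) \<odot>\<^sub>V v = b \<odot>\<^sub>V v \<oplus>\<^sub>V (- c) \<odot>\<^sub>V v" using scale_plus[OF V v, of b "- c"] by simp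
 also have "... = \<zero>\<^sub>V" unfolding e(1) using scale_plus[OF V v, of c "- c"] scale_zero[OF V v] by simp
 finally have "(1 / (b - c)) \<odot>\<^sub>V ((b - c) \<odot>\<^sub>V v) = \<zero>\<^sub>V" using scale_zero_vec[OF V] by simp
 thus ?thesis using e(2) by(simp add: scale_scale[OF V v] scale_one[OF V v])
qed

text \<open>A representation \<open>V\<close> of the cover of the reflection group together with representations \<open>N a\<close>, which the maps
 \<open>\<phi> a\<close> and \<open>\<psi> a\<close> identify with the isotypic parts of \<open>V\<close> for the characters \<open>\<mu>\<^sub>a\<close> of the torus.\<close>

locale clifford_correspondence = dirac_params m n k \<eta> S
 for m n :: nat and k \<eta> :: complex and S :: "(cliff_alg, 's) lmod" +
 fixes V :: "((nat => int) \<times> cliff_alg, 'v) lmod" and N :: "(nat => nat) => (cliff_alg, 'w) lmod"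
  and \<psi> :: "(nat => nat) => 'v => 'w" and \<phi> :: "(nat => nat) => 'w => 'v"
 assumes V: "group_rep RC V" and N: "a : comps m n ==> group_rep (young_cover m n a) (N a)"
  and \<psi>_lin: "a : comps m n ==> \<psi> a : lin_maps V (N a)" and \<phi>_lin: "a : comps m n ==> \<phi> a : lin_maps (N a) V"
  and \<psi>_\<phi>: "a : comps m n ==> u :. N a ==> \<psi> a (\<phi> a u) = u"
  and \<phi>_\<psi>: "a : comps m n ==> v :. V ==> \<phi> a (\<psi> a v) =
   (\<Oplus>\<^sub>V t\<in>carrier TT. (inverse (mu m \<eta> a t) / of_nat (m ^ n)) \<odot>\<^sub>V act V (t, \<one>\<^sub>(clifford n)) v)"
  and \<psi>_act: "a : comps m n ==> x :. young_cover m n a ==> v :. V ==>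
   \<psi> a (act V (\<one>\<^sub>TT, x) v) = act (N a) x (\<psi> a v)" and \<psi>_torus: "a : comps m n ==> t :. TT ==> v :. V ==>
   \<psi> a (act V (t, \<one>\<^sub>(clifford n)) v) = mu m \<eta> a t \<odot>\<^sub>(N a) \<psi> a v"
  and \<phi>_torus: "a : comps m n ==> t :. TT ==> u :. N a ==>
   act V (t, \<one>\<^sub>(clifford n)) (\<phi> a u) = mu m \<eta> a t \<odot>\<^sub>V \<phi> a u"
begin

abbreviation "lab == label m n"
abbreviation "tor t == (t :: nat => int, \<one>\<^sub>(clifford n))"

lemma V_cspace: "cspace V" by(rule group_rep_cspace[OF V])

sublocale VM: module CC V by(rule V_cspace)

lemma one_SC: "\<one>\<^sub>(clifford n) :. SC" by(rule lift_in_SC[OF perm_lift_one])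

lemma tor_closed: "t :. TT ==> tor t :. RC" using one_SC by(simp add: RC_simps)

lemma tor_commute:
 assumes g: "g :. RC" and t: "t :. TT"
 shows "tor (pcoords n (wp g) t) \<otimes>\<^sub>RC g = g \<otimes>\<^sub>RC tor t"
proof -
 interpret C: calg "clifford n" by(rule calg_clifford)
 obtain s x where gx: "g = (s, x)" by(cases g)
 have s: "s :. TT" and x: "x :. clifford n" using RC_fst[OF g] SC_lift(3)[OF RC_snd[OF g]] gx by simp_all
 have "pcoords n (cover_perm n \<one>\<^sub>(clifford n)) s = s"
  using torus_extensional[OF s] by(simp add: cover_perm_one)
 thus ?thesis using x by(simp add: gx RC_simps torus_comm)
qed

text \<open>The vectors on which the torus acts by the character with label \<open>c\<close>.\<close>

definition has_chr :: "(nat => int) => 'v => bool" where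
 "has_chr c v \<longleftrightarrow> (\<forall>t\<in>carrier TT. act V (tor t) v = chr c t \<odot>\<^sub>V v)"

lemma has_chr_act:
 assumes g: "g :. RC" and v: "v :. V" and c: "has_chr c v"
 shows "has_chr (pcoords n (wp g) c) (act V g v)" unfolding has_chr_def
proof
 fix t assume t: "t :. TT"
 note w = wp_permutes[OF g]
 let ?t = "pcoords n (inv_into UNIV (wp g)) t"
 have t': "?t :. TT" by(rule pcoords_torus[OF permutes_inv[OF w] t])
 have e: "pcoords n (wp g) ?t = t"
  using pcoords_comp[OF w permutes_inv[OF w], of t] torus_extensional[OF t] permutes_inv_o(1)[OF w] by simp
 have "act V (tor t) (act V g v) = act V g (act V (tor ?t) v)"
  using tor_commute[OF g t'] rep_mult[OF V v tor_closed[OF t] g] rep_mult[OF V v g tor_closed[OF t']] e by simp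
 also have "... = chr c ?t \<odot>\<^sub>V act V g v" using c t' lin_smult[OF rep_lin[OF V g] v] by(simp add: has_chr_def)
 also have "chr c ?t = chr (pcoords n (wp g) c) t" using chr_perm[OF w, of c ?t] e by simp
 finally show "act V (tor t) (act V g v) = chr (pcoords n (wp g) c) t \<odot>\<^sub>V act V g v" .
qed

text \<open>By orthogonality of characters only the isotypic part of \<open>\<mu>\<^sub>a\<close> is seen by \<open>\<psi> a\<close>.\<close>

lemma \<psi>_has_chr:
 assumes a: "a : comps m n" and v: "v :. V" and c: "c :. TT" "has_chr c v" "c ~= lab a"
 shows "\<psi> a v = \<zero>\<^sub>(N a)"
proof -
 have l: "lab a :. TT" by(rule label_torus[OF a])
 have "\<exists>t\<in>carrier TT. chr c t ~= chr (lab a) t"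
 proof (rule ccontr)
  assume "\<not> ?thesis"
  hence "(\<Sum>t\<in>carrier TT. chr c t / chr (lab a) t) = (\<Sum>t\<in>carrier TT. 1)"
   by(intro sum.cong) (auto simp: chr_nonzero)
  hence "(of_nat (card (carrier TT)) :: complex) = 0" using chr_orthogonal[OF c(1) l] c(3) by simp
  hence "carrier TT = {}" using torus_finite by simp
  thus False using l by simp
 qed
 then obtain t where t: "t :. TT" "chr c t ~= chr (lab a) t" by blast
 have pc: "\<psi> a v :. N a" by(rule lin_closed[OF \<psi>_lin[OF a] v])
 have "chr c t \<odot>\<^sub>(N a) \<psi> a v = chr (lab a) t \<odot>\<^sub>(N a) \<psi> a v"
  using \<psi>_torus[OF a t(1) v] c(2) t(1) lin_smult[OF \<psi>_lin[OF a] v] mu_torus_chr[OF a]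
  by(simp add: has_chr_def)
 thus ?thesis by(rule smult_eq_zeroD[OF group_rep_cspace[OF N[OF a]] pc _ t(2)])
qed

lemma \<psi>_HC:
 assumes a: "a : comps m n" and h: "h : HC a" and v: "v :. V"
 shows "\<psi> a (act V h v) = act (mu_twist m \<eta> a (N a)) h (\<psi> a v)"
proof -
 obtain t x where hx: "h = (t, x)" by(cases h)
 have t: "t :. TT" and x: "x :. young_cover m n a" using h hx by simp_all
 have xc: "x :. clifford n" and xs: "(\<one>\<^sub>TT, x) :. RC"
  using young_params.YC_lift(3,4)[OF young_paramsI[OF a] x] torus_one_closed by(simp_all add: RC_simps)
 interpret C: calg "clifford n" by(rule calg_clifford)
 have h: "h = tor t \<otimes>\<^sub>RC (\<one>\<^sub>TT, x)" using t xc torus_one_closed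
  by(simp add: hx RC_simps cover_perm_one torus_extensional torus_one_mult)
 have "\<psi> a (act V h v) = mu m \<eta> a t \<odot>\<^sub>(N a) act (N a) x (\<psi> a v)"
  unfolding h rep_mult[OF V v tor_closed[OF t] xs] \<psi>_torus[OF a t rep_closed[OF V xs v]] \<psi>_act[OF a x v] ..
 thus ?thesis by(simp only: hx mu_twist_simps)
qed

text \<open>The map dual to Frobenius reciprocity: the value at \<open>g\<close> is the component of \<open>v\<close> in \<open>g\<close> times the isotypic part of \<open>\<mu>\<^sub>a\<close>.\<close>

definition \<theta> :: "'v => (nat => nat) => (nat => int) \<times> cliff_alg => 'w" where
 "\<theta> = (\<lambda>v\<in>carrier V. \<lambda>a\<in>comps m n. \<lambda>g\<in>carrier RC. \<psi> a (act V (inv\<^bsub>RC\<^esub> g) v))"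

lemma \<theta>_apply: "v :. V ==> a : comps m n ==> g :. RC ==> \<theta> v a g = \<psi> a (act V (inv\<^bsub>RC\<^esub> g) v)"
 by(simp add: \<theta>_def)

lemma \<theta>_closed:
 assumes v: "v :. V"
 shows "\<theta> v :. back N" unfolding \<theta>_def restrict_apply'[OF v]
proof (rule back_memI)
 fix a g assume a: "a : comps m n" and g: "g :. RC"
 note gi = RC.inv_closed[OF g]
 show "\<psi> a (act V (inv\<^bsub>RC\<^esub> g) v) :. N a" by(rule lin_closed[OF \<psi>_lin[OF a] rep_closed[OF V gi v]])
 fix h assume h: "h : HC a"
 have hc: "h :. RC" using h HC_sub[OF a] by blast
 show "\<psi> a (act V (inv\<^bsub>RC\<^esub> (g \<otimes>\<^sub>RC h)) v) = act (mu_twist m \<eta> a (N a)) (inv\<^bsub>RC\<^esub> h) (\<psi> a (act V (inv\<^bsub>RC\<^esub> g) v))"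
  unfolding RC.inv_mult_group[OF g hc] rep_mult[OF V v RC.inv_closed[OF hc] gi]
  by(rule \<psi>_HC[OF a HC_inv[OF a h] rep_closed[OF V gi v]])
qed

lemma \<theta>_lin: "\<theta> : lin_maps V (back N)"
proof (rule lin_mapsI)
 fix v assume v: "v :. V"
 show "\<theta> v :. back N" by(rule \<theta>_closed[OF v])
 note c = rep_closed[OF V RC.inv_closed]
 have B: "cspace (back N)" by(rule cspace_dir_sum[OF group_rep_cspace[OF IND_rep[OF _ N]]])
 show "\<theta> (b \<odot>\<^sub>V v) = b \<odot>\<^sub>(back N) \<theta> v" for b
 proof (rule back_eqI[OF \<theta>_closed[OF scale_closed[OF V_cspace v]] scale_closed[OF B \<theta>_closed[OF v]]])
  fix a g assume a: "a : comps m n" and g: "g :. RC"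
  show "\<theta> (b \<odot>\<^sub>V v) a g = (b \<odot>\<^sub>(back N) \<theta> v) a g"
   using a g v scale_closed[OF V_cspace v] lin_smult[OF rep_lin[OF V RC.inv_closed[OF g]] v]
    lin_smult[OF \<psi>_lin[OF a] c[OF g v]] by(simp add: \<theta>_apply)
 qed
 fix u assume u: "u :. V"
 show "\<theta> (v \<oplus>\<^sub>V u) = \<theta> v \<oplus>\<^sub>(back N) \<theta> u"
 proof (rule back_eqI[OF \<theta>_closed[OF VM.M.a_closed[OF v u]]])
  show "\<theta> v \<oplus>\<^sub>(back N) \<theta> u :. back N"
   by(rule abelian_groupE(1)[OF module.axioms(2)[OF B] \<theta>_closed[OF v] \<theta>_closed[OF u]])
  fix a g assume a: "a : comps m n" and g: "g :. RC"
  show "\<theta> (v \<oplus>\<^sub>V u) a g = (\<theta> v \<oplus>\<^sub>(back N) \<theta> u) a g"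
   using a g v u VM.M.a_closed[OF v u] lin_add[OF rep_lin[OF V RC.inv_closed[OF g]] v u]
    lin_add[OF \<psi>_lin[OF a] c[OF g v] c[OF g u]] by(simp add: \<theta>_apply)
 qed
qed

lemma \<theta>_equivariant: "\<theta> : equivariant_maps (carrier RC) V (back_rep N)"
 unfolding equivariant_maps_def lin_with_act with_act_simps
proof (intro CollectI IntI conjI ballI \<theta>_lin)
 show "\<theta> : extensional (carrier V)" by(simp add: \<theta>_def)
 fix x v assume x: "x :. RC" and v: "v :. V"
 note R = back_rep_rep[of N, OF N]
 show "\<theta> (act V x v) = (\<lambda>a\<in>comps m n. act (IND a (N a)) x (\<theta> v a))"
 proof (rule back_eqI[OF \<theta>_closed[OF rep_closed[OF V x v]]])
  show "(\<lambda>a\<in>comps m n. act (IND a (N a)) x (\<theta> v a)) :. back N"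
   using rep_closed[OF R x, of "\<theta> v"] \<theta>_closed[OF v] by simp
  fix a g assume a: "a : comps m n" and g: "g :. RC"
  have "inv\<^bsub>RC\<^esub> (inv\<^bsub>RC\<^esub> x \<otimes>\<^sub>RC g) = inv\<^bsub>RC\<^esub> g \<otimes>\<^sub>RC x" using x g by(simp add: RC.inv_mult_group)
  thus "\<theta> (act V x v) a g = (\<lambda>a\<in>comps m n. act (IND a (N a)) x (\<theta> v a)) a g"
   using a g x v rep_closed[OF V x v] rep_mult[OF V v RC.inv_closed[OF g] x] by(simp add: \<theta>_apply)
 qed
qed

text \<open>If \<open>\<theta> z = 0\<close>, then the projection of \<open>z\<close> to the isotypic part of every character vanishes,
 since each character is a permutation of one of the \<open>\<mu>\<^sub>a\<close>; but \<open>z\<close> is the sum of its projections.\<close>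

lemma \<theta>_kernel:
 assumes z: "z :. V" and 0: "!!a g. a : comps m n ==> g :. RC ==> \<psi> a (act V (inv\<^bsub>RC\<^esub> g) z) = \<zero>\<^sub>(N a)"
 shows "z = \<zero>\<^sub>V"
proof -
 let ?f = "%c t. inverse (chr c t) / of_nat (m ^ n)"
 let ?v = "%t. act V (tor t) z"
 have vc: "?v t :. V" if "t :. TT" for t by(rule rep_closed[OF V tor_closed[OF that] z])
 have P: "(\<Oplus>\<^sub>V t\<in>carrier TT. ?f c t \<odot>\<^sub>V ?v t) = \<zero>\<^sub>V" if c: "c :. TT" for c
 proof -
  obtain a w where a: "a : comps m n" and w: "w permutes {1..n}" "c = pcoords n w (lab a)"
   using orbit_exists[OF c] by blast
  obtain x where x: "perm_lift n x w" using perm_lift_exists[OF w(1)] by blast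
  define g where "g = (\<one>\<^sub>TT, x)"
  have g: "g :. RC" using lift_in_SC[OF x] torus_one_closed by(simp add: g_def RC_simps)
  have wg: "wp g = w" using cover_perm_lift[OF x] by(simp add: g_def)
  note gi = RC.inv_closed[OF g]
  define y where "y = act V (inv\<^bsub>RC\<^esub> g) z"
  have y: "y :. V" unfolding y_def by(rule rep_closed[OF V gi z])
  have gy: "act V g y = z" unfolding y_def using rep_mult[OF V z g gi] rep_one[OF V z] g by simp
  let ?p = "pcoords n w"
  have move: "act V g (b \<odot>\<^sub>V act V (tor t) y) = b \<odot>\<^sub>V ?v (?p t)" if t: "t :. TT" for t b
  proof -
   have p: "?p t :. TT" by(rule pcoords_torus[OF w(1) t])
   have "act V g (act V (tor t) y) = act V (tor (?p t)) (act V g y)"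
    using rep_mult[OF V y g tor_closed[OF t]] rep_mult[OF V y tor_closed[OF p] g] tor_commute[OF g t] wg by simp
   thus ?thesis using lin_smult[OF rep_lin[OF V g] rep_closed[OF V tor_closed[OF t] y]] gy by simp
  qed
  have "\<zero>\<^sub>V = act V g (\<phi> a (\<psi> a y))"
   using 0[OF a g] lin_zero[OF group_rep_cspace[OF N[OF a]] V_cspace \<phi>_lin[OF a]]
    lin_zero[OF V_cspace V_cspace rep_lin[OF V g]] by(simp add: y_def)
  also have "... = (\<Oplus>\<^sub>V t\<in>carrier TT. act V g (?f (lab a) t \<odot>\<^sub>V act V (tor t) y))"
   unfolding \<phi>_\<psi>[OF a y] mu_torus_chr[OF a]
   by(rule lin_finsum[OF V_cspace V_cspace rep_lin[OF V g] torus_finite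
      scale_closed[OF V_cspace rep_closed[OF V tor_closed y]]])
  also have "... = (\<Oplus>\<^sub>V t\<in>carrier TT. ?f c (?p t) \<odot>\<^sub>V ?v (?p t))"
  proof (rule VM.M.finsum_cong'[OF refl])
   fix t assume t: "t :. TT"
   show "act V g (?f (lab a) t \<odot>\<^sub>V act V (tor t) y) = ?f c (?p t) \<odot>\<^sub>V ?v (?p t)"
    unfolding move[OF t] w(2) chr_perm[OF w(1)] ..
  qed (use vc pcoords_torus[OF w(1)] scale_closed[OF V_cspace] in blast)
  also have "... = (\<Oplus>\<^sub>V t\<in>?p ` carrier TT. ?f c t \<odot>\<^sub>V ?v t)"
  proof (rule VM.M.finsum_reindex[symmetric])
   show "(%t. ?f c t \<odot>\<^sub>V ?v t) : ?p ` carrier TT \<rightarrow> carrier V"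
    using vc pcoords_torus[OF w(1)] scale_closed[OF V_cspace] by blast
   show "inj_on ?p (carrier TT)"
   proof (rule inj_onI)
    fix s t assume st: "s :. TT" "t :. TT" "?p s = ?p t"
    show "s = t"
    proof (rule torus_ext[OF st(1,2)])
     fix j assume "j : {1..n}"
     thus "s j = t j" using pcoords_apply_perm[OF w(1), of j] st(3) by metis
    qed
   qed
  qed
  also have "?p ` carrier TT = carrier TT"
  proof
   show "?p ` carrier TT <= carrier TT" using pcoords_torus[OF w(1)] by blast
   show "carrier TT <= ?p ` carrier TT"
   proof
    fix t assume t: "t :. TT"
    have "t = ?p (pcoords n (inv_into UNIV w) t)"
     using pcoords_comp[OF w(1) permutes_inv[OF w(1)], of t] torus_extensional[OF t]
      permutes_inv_o(1)[OF w(1)] by simp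
    thus "t : ?p ` carrier TT" using pcoords_torus[OF permutes_inv[OF w(1)] t] by blast
   qed
  qed
  finally show ?thesis by simp
 qed
 have "(\<Oplus>\<^sub>V c\<in>carrier TT. \<Oplus>\<^sub>V t\<in>carrier TT. ?f c t \<odot>\<^sub>V ?v t) = (\<Oplus>\<^sub>V c\<in>carrier TT. \<zero>\<^sub>V)"
  by(rule VM.M.finsum_cong'[OF refl]) (blast intro: VM.M.zero_closed, rule P)
 hence "\<zero>\<^sub>V = (\<Oplus>\<^sub>V c\<in>carrier TT. \<Oplus>\<^sub>V t\<in>carrier TT. ?f c t \<odot>\<^sub>V ?v t)" by simp
 also have "... = (\<Oplus>\<^sub>V t\<in>carrier TT. (\<Sum>c\<in>carrier TT. ?f c t) \<odot>\<^sub>V ?v t)"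
  by(rule cspace_finsum_swap[OF V_cspace torus_finite torus_finite vc])
 also have "... = (\<Sum>c\<in>carrier TT. ?f c \<one>\<^sub>TT) \<odot>\<^sub>V ?v \<one>\<^sub>TT"
 proof (rule finsum_single[OF V_cspace torus_finite torus_one_closed])
  fix t assume t: "t :. TT"
  show "(\<Sum>c\<in>carrier TT. ?f c t) \<odot>\<^sub>V ?v t :. V" by(rule scale_closed[OF V_cspace vc[OF t]])
  assume "t ~= \<one>\<^sub>TT"
  hence "(\<Sum>c\<in>carrier TT. ?f c t) = 0" unfolding sum_divide_distrib[symmetric] chr_sum_dual[OF t] by simp
  thus "(\<Sum>c\<in>carrier TT. ?f c t) \<odot>\<^sub>V ?v t = \<zero>\<^sub>V" using scale_zero[OF V_cspace vc[OF t]] by simp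
 qed
 also have "(\<Sum>c\<in>carrier TT. ?f c \<one>\<^sub>TT) = 1"
  unfolding sum_divide_distrib[symmetric] chr_sum_dual[OF torus_one_closed] using m_pos by simp
 also have "1 \<odot>\<^sub>V ?v \<one>\<^sub>TT = z" using rep_one[OF V z] scale_one[OF V_cspace z] by(simp add: RC_simps)
 finally show ?thesis ..
qed

text \<open>A preimage of \<open>F\<close> is the sum of \<open>g\<^sub>c (\<phi>\<^sub>a (F\<^sub>a g\<^sub>c))\<close> over the characters \<open>c\<close> of the torus, where
 \<open>g\<^sub>c\<close> moves \<open>\<mu>\<^sub>a\<close> to \<open>c\<close>: in degree \<open>(b, g)\<close> only the summand of the character \<open>g \<mu>\<^sub>b\<close> survives.\<close>

lemma \<theta>_surj:
 assumes F: "F :. back N"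
 shows "\<exists>v\<in>carrier V. \<theta> v = F"
proof -
 have "\<forall>c\<in>carrier TT. \<exists>p. fst p : comps m n & snd p :. RC & c = pcoords n (wp (snd p)) (lab (fst p))"
 proof
  fix c assume c: "c :. TT"
  obtain a w where a: "a : comps m n" and w: "w permutes {1..n}" "c = pcoords n w (lab a)"
   using orbit_exists[OF c] by blast
  obtain x where x: "perm_lift n x w" using perm_lift_exists[OF w(1)] by blast
  have "(\<one>\<^sub>TT, x) :. RC" "wp (\<one>\<^sub>TT, x) = w"
   using lift_in_SC[OF x] torus_one_closed cover_perm_lift[OF x] by(simp_all add: RC_simps)
  thus "\<exists>p. fst p : comps m n & snd p :. RC & c = pcoords n (wp (snd p)) (lab (fst p))"
   using a w(2) by(intro exI[of _ "(a, \<one>\<^sub>TT, x)"]) simp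
 qed
 from bchoice[OF this] obtain p where p: "!!c. c :. TT ==> fst (p c) : comps m n"
  "!!c. c :. TT ==> snd (p c) :. RC"
  "!!c. c :. TT ==> c = pcoords n (wp (snd (p c))) (lab (fst (p c)))" by blast
 define u where "u c = \<phi> (fst (p c)) (F (fst (p c)) (snd (p c)))" for c
 define y where "y c = act V (snd (p c)) (u c)" for c
 have Fc: "F (fst (p c)) (snd (p c)) :. N (fst (p c))" if "c :. TT" for c
  by(rule back_memD(1)[OF F p(1)[OF that] p(2)[OF that]])
 have u: "u c :. V" if "c :. TT" for c
  unfolding u_def by(rule lin_closed[OF \<phi>_lin[OF p(1)[OF that]] Fc[OF that]])
 have y: "y c :. V" if "c :. TT" for c unfolding y_def by(rule rep_closed[OF V p(2)[OF that] u[OF that]])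
 have yc: "has_chr c (y c)" if c: "c :. TT" for c
 proof -
  have "has_chr (lab (fst (p c))) (u c)"
   unfolding has_chr_def u_def using \<phi>_torus[OF p(1)[OF c] _ Fc[OF c]] mu_torus_chr[OF p(1)[OF c]] by simp
  from has_chr_act[OF p(2)[OF c] u[OF c] this] show ?thesis unfolding y_def p(3)[OF c, symmetric] .
 qed
 define x where "x = (\<Oplus>\<^sub>V c\<in>carrier TT. y c)"
 have x: "x :. V" unfolding x_def using y by(intro VM.M.finsum_closed) auto
 have "\<theta> x = F"
 proof (rule back_eqI[OF \<theta>_closed[OF x] F])
  fix b g assume b: "b : comps m n" and g: "g :. RC"
  note gi = RC.inv_closed[OF g] and w = wp_permutes[OF g]
  note Nb = group_rep_cspace[OF N[OF b]]
  define d where "d = pcoords n (wp g) (lab b)"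
  have d: "d :. TT" unfolding d_def by(rule pcoords_torus[OF w label_torus[OF b]])
  let ?\<psi> = "%v. \<psi> b (act V (inv\<^bsub>RC\<^esub> g) v)"
  have lin: "?\<psi> : lin_maps V (N b)" by(rule lin_comp[OF rep_lin[OF V gi] \<psi>_lin[OF b]])
  have "\<theta> x b g = ?\<psi> x" by(rule \<theta>_apply[OF x b g])
  also have "... = (\<Oplus>\<^sub>(N b)c\<in>carrier TT. ?\<psi> (y c))"
   unfolding x_def by(rule lin_finsum[OF V_cspace Nb lin torus_finite y])
  also have "... = ?\<psi> (y d)"
  proof (rule finsum_single[OF Nb torus_finite d])
   fix c assume c: "c :. TT"
   show "?\<psi> (y c) :. N b" by(rule lin_closed[OF lin y[OF c]])
   assume cd: "c ~= d"
   let ?c = "pcoords n (wp (inv\<^bsub>RC\<^esub> g)) c"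
   have "?c ~= lab b"
   proof
    assume "?c = lab b"
    hence "d = pcoords n (wp g) (pcoords n (inv_into UNIV (wp g)) c)" by(simp add: d_def wp_inv[OF g])
    hence "d = c"
     using pcoords_comp[OF w permutes_inv[OF w], of c] torus_extensional[OF c] permutes_inv_o(1)[OF w] by simp
    thus False using cd by simp
   qed
   thus "?\<psi> (y c) = \<zero>\<^sub>(N b)"
    by(rule \<psi>_has_chr[OF b rep_closed[OF V gi y[OF c]] pcoords_torus[OF wp_permutes[OF gi] c]
       has_chr_act[OF gi y[OF c] yc[OF c]]])
  qed
  also have "... = F b g"
  proof -
   note o = orbit_unique[OF b p(1)[OF d] w wp_permutes[OF p(2)[OF d]], folded d_def, OF p(3)[OF d]]
   note q = p(2)[OF d]
   have pb: "fst (p d) = b" by(rule o(1)[symmetric])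
   define h where "h = inv\<^bsub>RC\<^esub> g \<otimes>\<^sub>RC snd (p d)"
   have hc: "h :. RC" unfolding h_def using gi q by simp
   have "wp h : ysub m n b" using o(2) wp_mult[OF gi q] wp_inv[OF g] by(simp add: h_def)
   hence h: "h : HC b" using HC_iff[OF b] hc by blast
   have "?\<psi> (y d) = \<psi> b (act V h (u d))" unfolding y_def h_def using rep_mult[OF V u[OF d] gi q] by simp
   also have "... = act (mu_twist m \<eta> b (N b)) h (F b (snd (p d)))"
    using \<psi>_HC[OF b h u[OF d]] \<psi>_\<phi>[OF b] Fc[OF d] unfolding u_def pb by simp
   also have "... = F b (snd (p d) \<otimes>\<^sub>RC inv\<^bsub>RC\<^esub> h)" using back_memD(2)[OF F b q HC_inv[OF b h]] hc by simp
   also have "snd (p d) \<otimes>\<^sub>RC inv\<^bsub>RC\<^esub> h = g"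
    unfolding h_def using g q by(simp add: RC.inv_mult_group RC.m_assoc[symmetric])
   finally show ?thesis .
  qed
  finally show "\<theta> x b g = F b g" .
 qed
 thus ?thesis using x by blast
qed

theorem \<theta>_bij: "bij_betw \<theta> (carrier V) (carrier (back N))" unfolding bij_betw_def
proof
 show "inj_on \<theta> (carrier V)"
 proof (rule inj_onI)
  fix u v assume u: "u :. V" and v: "v :. V" and e: "\<theta> u = \<theta> v"
  have "u \<ominus>\<^sub>V v = \<zero>\<^sub>V"
  proof (rule \<theta>_kernel[OF VM.M.minus_closed[OF u v]])
   fix a g assume a: "a : comps m n" and g: "g :. RC"
   note gi = RC.inv_closed[OF g] and Na = group_rep_cspace[OF N[OF a]]
   interpret Na: module CC "N a" by(rule Na)
   have lin: "(%v. \<psi> a (act V (inv\<^bsub>RC\<^esub> g) v)) : lin_maps V (N a)"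
    by(rule lin_comp[OF rep_lin[OF V gi] \<psi>_lin[OF a]])
   have "\<psi> a (act V (inv\<^bsub>RC\<^esub> g) u) = \<psi> a (act V (inv\<^bsub>RC\<^esub> g) v)"
    using \<theta>_apply[OF u a g] \<theta>_apply[OF v a g] e by simp
   thus "\<psi> a (act V (inv\<^bsub>RC\<^esub> g) (u \<ominus>\<^sub>V v)) = \<zero>\<^sub>(N a)" using lin_minus[OF V_cspace Na lin u v] lin_closed[OF lin v]
    by(simp add: a_minus_def Na.M.r_neg)
  qed
  thus "u = v" using cspace_eq_iff_minus[OF V_cspace u v] by blast
 qed
 show "\<theta> ` carrier V = carrier (back N)" using \<theta>_closed \<theta>_surj by blast
qed

end

section \<open>Cohomology of weight spaces\<close>

lemma ptensor_lin_left: "cspace V ==> cspace S ==> s :. S ==> (%v. ptensor V S v s) : lin_maps V (tensor V S)"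
 by(rule lin_mapsI) (simp_all add: ptensor_add_left ptensor_smult_left)

lemma coh_class_lin:
 assumes T: "cspace T" "D : lin_maps T T"
 shows "(%x. dirac_im_ker T D +>\<^sub>T x) : lin_maps (T\<lparr>carrier := dirac_ker T D\<rparr>) (dirac_coh T D)"
 using coset_lin[OF dirac_ker_cspace[OF T] dirac_im_ker_submodule[OF T]] by(simp add: dirac_coh_def)

text \<open>Passing to cohomology is linear in the map.\<close>

lemma coh_map_finsum:
 assumes T: "cspace T" "D : lin_maps T T" and T': "cspace T'" "D' : lin_maps T' T'"
  and I: "finite I" and f: "f : dirac_maps T D T' D'" and g: "!!i. i : I ==> g i : dirac_maps T D T' D'"
  and eq: "!!x. x :. T ==> f x = (\<Oplus>\<^sub>T' i\<in>I. c i \<odot>\<^sub>T' g i x)" and U: "U :. dirac_coh T D"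
 shows "coh_map T' D' f U = (\<Oplus>\<^sub>(dirac_coh T' D')i\<in>I. c i \<odot>\<^sub>(dirac_coh T' D') coh_map T' D' (g i) U)"
proof -
 let ?K = "T'\<lparr>carrier := dirac_ker T' D'\<rparr>" and ?H = "dirac_coh T' D'" and ?N = "dirac_im_ker T' D'"
 note K = dirac_ker_cspace[OF T'] and H = cspace_dirac_coh[OF T']
 interpret H: module CC ?H by(rule H)
 obtain x where x: "x : dirac_ker T D" "U = dirac_im_ker T D +>\<^sub>T x" using U by(auto simp: dirac_coh_carrier)
 have xT: "x :. T" using x(1) by(simp add: dirac_ker_def)
 have gk: "g i x :. ?K" if "i : I" for i using dirac_maps_ker[OF g[OF that] x(1)] by simp
 have ck: "c i \<odot>\<^sub>?K g i x :. ?K" if "i : I" for i by(rule scale_closed[OF K gk[OF that]])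
 note cl = coh_class_lin[OF T']
 have sub: "dirac_ker T' D' <= carrier T'" by(auto simp: dirac_ker_def)
 have "(\<Oplus>\<^sub>?K i\<in>I. c i \<odot>\<^sub>?K g i x) = (\<Oplus>\<^sub>T' i\<in>I. c i \<odot>\<^sub>?K g i x)"
  by(rule lin_finsum[OF K T'(1) lin_inclusion[OF sub] I ck])
 hence fx: "f x = (\<Oplus>\<^sub>?K i\<in>I. c i \<odot>\<^sub>?K g i x)" using eq[OF xT] by simp
 have "coh_map T' D' f U = ?N +>\<^sub>T' f x" unfolding x(2) by(rule coh_map_class[OF T T' f x(1)])
 also have "... = (\<Oplus>\<^sub>?H i\<in>I. ?N +>\<^sub>T' (c i \<odot>\<^sub>?K g i x))" unfolding fx by(rule lin_finsum[OF K H cl I ck])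
 also have "... = (\<Oplus>\<^sub>?H i\<in>I. c i \<odot>\<^sub>?H coh_map T' D' (g i) U)"
 proof (rule H.M.finsum_cong'[OF refl])
  show "(%i. c i \<odot>\<^sub>?H coh_map T' D' (g i) U) : I \<rightarrow> carrier ?H"
   using scale_closed[OF H lin_closed[OF coh_map_lin[OF T T' g] U]] by blast
  show "?N +>\<^sub>T' (c i \<odot>\<^sub>?K g i x) = c i \<odot>\<^sub>?H coh_map T' D' (g i) U" if i: "i : I" for i
   unfolding lin_smult[OF cl gk[OF i]] x(2) coh_map_class[OF T T' g[OF i] x(1)] ..
 qed
 finally show ?thesis .
qed

lemma coh_map_smult:
 assumes T: "cspace T" "D : lin_maps T T" and T': "cspace T'" "D' : lin_maps T' T'"
  and f: "f : dirac_maps T D T' D'" and g: "g : dirac_maps T D T' D'"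
  and eq: "!!x. x :. T ==> f x = c \<odot>\<^sub>T' g x" and U: "U :. dirac_coh T D"
 shows "coh_map T' D' f U = c \<odot>\<^sub>(dirac_coh T' D') coh_map T' D' g U"
proof -
 interpret T': module CC T' by(rule T'(1))
 interpret H: module CC "dirac_coh T' D'" by(rule cspace_dirac_coh[OF T'])
 have gc: "c \<odot>\<^sub>T' g x :. T'" if "x :. T" for x
  by(rule scale_closed[OF T'(1) lin_closed[OF dirac_maps_lin[OF g] that]])
 have "coh_map T' D' f U = (\<Oplus>\<^sub>(dirac_coh T' D')i\<in>{()}. c \<odot>\<^sub>(dirac_coh T' D') coh_map T' D' g U)"
  by(rule coh_map_finsum[OF T T' _ f g _ U]) (use eq gc in auto)
 thus ?thesis using scale_closed[OF cspace_dirac_coh[OF T'] lin_closed[OF coh_map_lin[OF T T' g] U]] by simp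
qed

context dirac_params
begin

text \<open>The projection to the isotypic part of \<open>\<mu>\<^sub>a\<close>.\<close>

definition wproj :: "(nat => nat) => (do_alg, 'v) lmod => 'v => 'v" where
 "wproj a M v = (\<Oplus>\<^sub>M t\<in>carrier TT. (inverse (mu m \<eta> a t) / of_nat (m ^ n)) \<odot>\<^sub>M act M (El (of_torus t)) v)"

abbreviation "WM a M == Wmod a M"

definition coh_proj where "coh_proj a M = coh_map (tensor (WM a M) S) (young_dirac m n k a S (WM a M))
   (tensor_map (WM a M) S (wproj a M) id)"

definition coh_incl where
 "coh_incl a M = coh_map (tensor M S) (do_dirac m n k S M) (tensor_map M S (%v. v) id)"

end

context weight_params
begin

sublocale DO: dirac_datum HH RC S "{1..n}" do_elt cliff_act "%g. El (fst g, cover_perm n (snd g))" "%g. act S (snd g)"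
   "%g. cover_perm n (snd g)" "%g. (fst g, parity (snd g))"
   "do_dirac m n k S :: (do_alg, 'v) lmod => _" "do_cover_act m n k S" by(rule do_datum)

sublocale YD: dirac_datum YH YC S "{1..n}" young_elt cliff_act "%x. Yp (cover_perm n x)" "act S" "cover_perm n" parity
   "young_dirac m n k a S :: (young_alg, 'v) lmod => _" "young_cover_act m n k a S" by(rule young_datum)

abbreviation "cf t == inverse (mu m \<eta> a t) / of_nat (m ^ n)"
abbreviation "tact t == act M (El (of_torus t))"
abbreviation "pr == wproj a M"
abbreviation "TM == tensor M S"
abbreviation "TW == tensor WMod S"
abbreviation "DM == do_dirac m n k S M"
abbreviation "DW == young_dirac m n k a S WMod"
abbreviation "J == tensor_map M S (%v. v) id"
abbreviation "Q == tensor_map WMod S pr id"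

lemma W_csp: "cspace WMod" by(rule module_cspace[OF WMod_module])

lemma tact_closed: "t :. TT ==> v :. M ==> tact t v :. M" by(rule lin_closed[OF torus_act_lin])

lemma cf_tact_closed: "t :. TT ==> v :. M ==> c \<odot>\<^sub>M tact t v :. M"
 by(rule scale_closed[OF M_cspace tact_closed])

lemma pr_lin_M: "pr : lin_maps M M"
proof -
 have "(%v. \<Oplus>\<^sub>M t\<in>carrier TT. cf t \<odot>\<^sub>M tact t v) : lin_maps M M"
  by(rule lin_finsum_map[OF M_cspace M_cspace torus_finite lin_const_smult[OF M_cspace torus_act_lin]])
 thus ?thesis by(simp add: wproj_def[abs_def])
qed

text \<open>The projection commutes with every element that commutes with the torus up to a permutation
  of the torus preserving \<open>\<mu>\<^sub>a\<close>.\<close>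

lemma pr_commute:
 assumes x: "x :. HH" and v: "v :. M" and b: "bij_betw \<sigma> (carrier TT) (carrier TT)"
  and c: "!!t. t :. TT ==> x \<otimes>\<^sub>HH El (of_torus t) = El (of_torus (\<sigma> t)) \<otimes>\<^sub>HH x"
  and mu: "!!t. t :. TT ==> mu m \<eta> a (\<sigma> t) = mu m \<eta> a t"
 shows "act M x (pr v) = pr (act M x v)"
proof -
 note xv = act_closed[OF M x v]
 have s: "\<sigma> t :. TT" if "t :. TT" for t using bij_betwE[OF b] that by blast
 have "act M x (pr v) = (\<Oplus>\<^sub>M t\<in>carrier TT. act M x (cf t \<odot>\<^sub>M tact t v))" unfolding wproj_def
  by(rule lin_finsum[OF M_cspace M_cspace act_lin[OF M x] torus_finite cf_tact_closed[OF _ v]])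
 also have "... = (\<Oplus>\<^sub>M t\<in>carrier TT. cf (\<sigma> t) \<odot>\<^sub>M tact (\<sigma> t) (act M x v))"
 proof (rule M.M.finsum_cong'[OF refl])
  show "(%t. cf (\<sigma> t) \<odot>\<^sub>M tact (\<sigma> t) (act M x v)) : carrier TT \<rightarrow> carrier M"
   using cf_tact_closed[OF s xv] by blast
  fix t assume t: "t :. TT"
  note e = El_closed[OF of_torus_closed[OF t]] and e' = El_closed[OF of_torus_closed[OF s[OF t]]]
  have "act M x (tact t v) = tact (\<sigma> t) (act M x v)"
   using act_mult[OF M v x e] act_mult[OF M v e' x] c[OF t] by simp
  thus "act M x (cf t \<odot>\<^sub>M tact t v) = cf (\<sigma> t) \<odot>\<^sub>M tact (\<sigma> t) (act M x v)"
   using lin_smult[OF act_lin[OF M x] tact_closed[OF t v]] mu[OF t] by simp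
 qed
 also have "... = (\<Oplus>\<^sub>M t\<in>\<sigma> ` carrier TT. cf t \<odot>\<^sub>M tact t (act M x v))"
  by(rule M.M.finsum_reindex[symmetric, OF _ bij_betw_imp_inj_on[OF b]])
   (use cf_tact_closed[OF s xv] in blast)
 also have "... = pr (act M x v)" unfolding bij_betw_imp_surj_on[OF b] wproj_def ..
 finally show ?thesis .
qed

lemma id_bij: "bij_betw (%t. t) (carrier TT) (carrier TT)" by(simp add: bij_betw_def)

lemma pr_torus:
 assumes s: "s :. TT" and v: "v :. M"
 shows "tact s (pr v) = mu m \<eta> a s \<odot>\<^sub>M pr v"
proof -
 interpret TT: group TT by(rule torus_group)
 note sl = torus_act_lin[OF s]
 have "tact s (pr v) = (\<Oplus>\<^sub>M t\<in>carrier TT. tact s (cf t \<odot>\<^sub>M tact t v))" unfolding wproj_def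
  by(rule lin_finsum[OF M_cspace M_cspace sl torus_finite cf_tact_closed[OF _ v]])
 also have "... = (\<Oplus>\<^sub>M t\<in>carrier TT. mu m \<eta> a s \<odot>\<^sub>M (cf (s \<otimes>\<^sub>TT t) \<odot>\<^sub>M tact (s \<otimes>\<^sub>TT t) v))"
 proof (rule M.M.finsum_cong'[OF refl])
  show "(%t. mu m \<eta> a s \<odot>\<^sub>M (cf (s \<otimes>\<^sub>TT t) \<odot>\<^sub>M tact (s \<otimes>\<^sub>TT t) v)) : carrier TT \<rightarrow> carrier M"
   using scale_closed[OF M_cspace cf_tact_closed[OF torus_mult_closed[OF s] v]] by blast
  fix t assume t: "t :. TT"
  note st = torus_mult_closed[OF s t]
  have "tact s (tact t v) = tact (s \<otimes>\<^sub>TT t) v"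
   using act_mult[OF M v El_closed[OF of_torus_closed[OF s]] El_closed[OF of_torus_closed[OF t]]]
   by(simp add: H.Elt_mult of_torus_closed s t of_torus_mult)
  moreover have "inverse (mu m \<eta> a t) = mu m \<eta> a s * inverse (mu m \<eta> a (s \<otimes>\<^sub>TT t))"
   by(simp add: mu_torus_chr[OF a_comps] chr_mult chr_nonzero)
  ultimately show "tact s (cf t \<odot>\<^sub>M tact t v) = mu m \<eta> a s \<odot>\<^sub>M (cf (s \<otimes>\<^sub>TT t) \<odot>\<^sub>M tact (s \<otimes>\<^sub>TT t) v)"
   using lin_smult[OF sl tact_closed[OF t v]] scale_scale[OF M_cspace tact_closed[OF st v]] by simp
 qed
 also have "... = mu m \<eta> a s \<odot>\<^sub>M (\<Oplus>\<^sub>M t\<in>carrier TT. cf (s \<otimes>\<^sub>TT t) \<odot>\<^sub>M tact (s \<otimes>\<^sub>TT t) v)"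
  by(rule lin_finsum[OF M_cspace M_cspace lin_const_smult[OF M_cspace lin_id] torus_finite, symmetric])
   (rule cf_tact_closed[OF torus_mult_closed[OF s] v])
 also have "(\<Oplus>\<^sub>M t\<in>carrier TT. cf (s \<otimes>\<^sub>TT t) \<odot>\<^sub>M tact (s \<otimes>\<^sub>TT t) v) =
   (\<Oplus>\<^sub>M t\<in>(%t. s \<otimes>\<^sub>TT t) ` carrier TT. cf t \<odot>\<^sub>M tact t v)"
  by(rule M.M.finsum_reindex[symmetric, OF _ TT.inj_on_cmult[OF s]])
   (use cf_tact_closed[OF torus_mult_closed[OF s] v] in blast)
 also have "... = pr v" unfolding TT.surj_const_mult[OF s] wproj_def ..
 finally show ?thesis .
qed

lemma pr_WS: "v :. M ==> pr v : WS" by(rule WS_I[OF lin_closed[OF pr_lin_M] pr_torus])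

lemma pr_lin: "pr : lin_maps M WMod"
proof (rule lin_mapsI)
 show "pr v :. WMod" if "v :. M" for v using pr_WS[OF that] by(simp add: WMod_simps)
qed (simp_all add: WMod_simps lin_add[OF pr_lin_M] lin_smult[OF pr_lin_M])

lemma pr_id:
 assumes v: "v : WS"
 shows "pr v = v"
proof -
 note vM = WS_carrier[OF v]
 have "pr v = (\<Oplus>\<^sub>M t\<in>carrier TT. (cf t * mu m \<eta> a t) \<odot>\<^sub>M v)" unfolding wproj_def
  by(rule M.M.finsum_cong'[OF refl])
   (use WS_act[OF v] scale_scale[OF M_cspace vM] scale_closed[OF M_cspace vM] in auto)
 also have "... = (\<Sum>t\<in>carrier TT. cf t * mu m \<eta> a t) \<odot>\<^sub>M v"
  by(rule cspace_finsum_smult[OF M_cspace torus_finite vM])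
 also have "(\<Sum>t\<in>carrier TT. cf t * mu m \<eta> a t) =
   (\<Sum>t\<in>carrier TT. chr (label m n a) t / chr (label m n a) t) / of_nat (m ^ n)"
  unfolding sum_divide_distrib by(intro sum.cong refl) (simp add: mu_torus_chr[OF a_comps] field_simps)
 also have "... = 1" using chr_orthogonal[OF label_torus[OF a_comps] label_torus[OF a_comps]] m_pos by simp
 finally show ?thesis by(simp add: scale_one[OF M_cspace vM])
qed

lemma pr_do_elt:
 assumes i: "i : {1..n}" and v: "v :. M"
 shows "act M (do_elt i) (pr v) = pr (act M (do_elt i) v)"
 by(rule pr_commute[OF do_elt_closed[OF i] v id_bij]) (simp_all add: do_elt_torus[OF _ i])

lemma pr_perm:
 assumes w: "w : ysub m n a" and v: "v :. M"
 shows "act M (Ep w) (pr v) = pr (act M (Ep w) v)"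
proof (rule pr_commute[OF _ v])
 note p = young_permutes[OF a_comps w] and ip = permutes_inv[OF young_permutes[OF a_comps w]]
 show "Ep w :. HH" by(rule El_closed[OF of_perm_closed[OF p]])
 have e: "pcoords n w (pcoords n (inv_into UNIV w) t) = t"
  "pcoords n (inv_into UNIV w) (pcoords n w t) = t" if "t :. TT" for t
  using pcoords_comp[OF p ip, of t] pcoords_comp[OF ip p, of t] torus_extensional[OF that]
   permutes_inv_o[OF p] by simp_all
 show "bij_betw (pcoords n w) (carrier TT) (carrier TT)"
  by(rule bij_betw_byWitness[where f' = "pcoords n (inv_into UNIV w)"])
   (use e pcoords_torus[OF p] pcoords_torus[OF ip] in auto)
 fix t assume t: "t :. TT"
 note t' = pcoords_torus[OF p t]
 show "Ep w \<otimes>\<^sub>HH El (of_torus t) = El (of_torus (pcoords n w t)) \<otimes>\<^sub>HH Ep w"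
  by(simp only: H.Elt_mult of_torus_closed[OF t] of_torus_closed[OF t'] of_perm_closed[OF p]
    of_torus_of_perm[OF t'] of_perm_of_torus[OF t p])
 show "mu m \<eta> a (pcoords n w t) = mu m \<eta> a t" by(rule mu_young_invariant[OF a_comps w])
qed

lemma id_lin: "id : lin_maps S S" by(simp add: lin_id id_def)

lemma J_lin: "J : lin_maps TW TM"
 and J_pt: "v :. WMod ==> s :. S ==> J (ptensor WMod S v s) = ptensor M S v s" and Q_lin: "Q : lin_maps TM TW"
 and Q_pt: "v :. M ==> s :. S ==> Q (ptensor M S v s) = ptensor WMod S (pr v) s"
 using tensor_map_lin[OF W_csp S_cspace M_cspace S_cspace WMod_inclusion id_lin]
  tensor_map_ptensor[OF W_csp S_cspace M_cspace S_cspace WMod_inclusion id_lin]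
  tensor_map_lin[OF M_cspace S_cspace W_csp S_cspace pr_lin id_lin]
  tensor_map_ptensor[OF M_cspace S_cspace W_csp S_cspace pr_lin id_lin] by simp_all

lemma pt_W: "v : WS ==> v :. WMod" and pt_WM: "v :. WMod ==> v : WS" by(simp_all add: WMod_simps)

lemmas TM_cspace = DO.tensor_cspace[OF M] and TW_cspace = YD.tensor_cspace[OF WMod_module]
lemmas DM_lin = DO.D_lin[OF M] and DW_lin = YD.D_lin[OF WMod_module]

text \<open>The Dirac elements of both algebras agree on the weight space, so the inclusion \<open>J\<close> intertwines the operators.\<close>

lemma J_D:
 assumes x: "x :. TW"
 shows "J (DW x) = DM (J x)"
proof (rule tensor_lin_eqI[OF W_csp S_cspace lin_comp[OF DW_lin J_lin] lin_comp[OF J_lin DM_lin] _ x])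
 interpret TM: module CC TM by(rule TM_cspace)
 fix v s assume v: "v :. WMod" and s: "s :. S"
 note vS = pt_WM[OF v] and vM = WS_carrier[OF pt_WM[OF v]]
 note e = lin_closed[OF cliff_act_lin s]
 note yc = act_closed[OF WMod_module young_elt_closed v]
 have "J (DW (ptensor WMod S v s)) = (\<Oplus>\<^sub>TM i\<in>{1..n}. J (ptensor WMod S (act WMod (young_elt i) v) (cliff_act i s)))"
  unfolding YD.D_ptensor[OF WMod_module v s]
  by(rule lin_finsum[OF TW_cspace TM_cspace J_lin finite_atLeastAtMost ptensor_closed[OF yc e]])
 also have "... = (\<Oplus>\<^sub>TM i\<in>{1..n}. ptensor M S (act M (do_elt i) v) (cliff_act i s))"
  by(rule TM.M.finsum_cong'[OF refl])
   (use J_pt[OF yc e] act_young_elt[OF _ vS] act_closed[OF M do_elt_closed vM] e in \<open>auto intro!: ptensor_closed\<close>)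
 also have "... = DM (J (ptensor WMod S v s))"
  unfolding J_pt[OF v s] by(rule DO.D_ptensor[OF M vM s, symmetric])
 finally show "J (DW (ptensor WMod S v s)) = DM (J (ptensor WMod S v s))" .
qed

text \<open>The projection commutes with the Dirac elements of the reflection group, because these commute with the torus;
 so \<open>Q\<close>, induced by it, intertwines the operators as well.\<close>

lemma Q_D:
 assumes x: "x :. TM"
 shows "Q (DM x) = DW (Q x)"
proof (rule tensor_lin_eqI[OF M_cspace S_cspace lin_comp[OF DM_lin Q_lin] lin_comp[OF Q_lin DW_lin] _ x])
 interpret TW: module CC TW by(rule TW_cspace)
 fix v s assume v: "v :. M" and s: "s :. S"
 note e = lin_closed[OF cliff_act_lin s]
 note dc = act_closed[OF M do_elt_closed v]
 note pv = pr_WS[OF v] and pc = pt_W[OF pr_WS[OF v]]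
 have "Q (DM (ptensor M S v s)) = (\<Oplus>\<^sub>TW i\<in>{1..n}. Q (ptensor M S (act M (do_elt i) v) (cliff_act i s)))"
  unfolding DO.D_ptensor[OF M v s]
  by(rule lin_finsum[OF TM_cspace TW_cspace Q_lin finite_atLeastAtMost ptensor_closed[OF dc e]])
 also have "... = (\<Oplus>\<^sub>TW i\<in>{1..n}. ptensor WMod S (act WMod (young_elt i) (pr v)) (cliff_act i s))"
  by(rule TW.M.finsum_cong'[OF refl])
   (use Q_pt[OF dc e] act_young_elt[OF _ pv] pr_do_elt[OF _ v] act_closed[OF WMod_module young_elt_closed pc] e
    in \<open>auto intro!: ptensor_closed\<close>)
 also have "... = DW (Q (ptensor M S v s))"
  unfolding Q_pt[OF v s] by(rule YD.D_ptensor[OF WMod_module pc s, symmetric])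
 finally show "Q (DM (ptensor M S v s)) = DW (Q (ptensor M S v s))" .
qed

lemma J_dirac: "J : dirac_maps TW DW TM DM"
proof (rule dirac_mapsI[OF TW_cspace TM_cspace J_lin J_lin])
 show "DM (J x) = J (DW x)" if "x :. TW" for x by(rule J_D[OF that, symmetric])
 show "J x :. TM" if "x :. TW" for x by(rule lin_closed[OF J_lin that])
qed (rule J_D)

lemma Q_dirac: "Q : dirac_maps TM DM TW DW"
proof (rule dirac_mapsI[OF TM_cspace TW_cspace Q_lin Q_lin])
 show "DW (Q x) = Q (DM x)" if "x :. TM" for x by(rule Q_D[OF that, symmetric])
 show "Q x :. TW" if "x :. TM" for x by(rule lin_closed[OF Q_lin that])
qed (rule Q_D)

lemma Q_J:
 assumes x: "x :. TW"
 shows "Q (J x) = x"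
proof (rule tensor_lin_eqI[OF W_csp S_cspace lin_comp[OF J_lin Q_lin] lin_id _ x])
 fix v s assume v: "v :. WMod" and s: "s :. S"
 show "Q (J (ptensor WMod S v s)) = ptensor WMod S v s"
  using J_pt[OF v s] Q_pt[OF WS_carrier[OF pt_WM[OF v]] s] pr_id[OF pt_WM[OF v]] by simp
qed

abbreviation "rM == do_cover_act m n k S M"
abbreviation "tr t == (t :: nat => int, \<one>\<^sub>(clifford n))"

lemma tr_closed: "t :. TT ==> tr t :. RC" using lift_in_SC[OF perm_lift_one] by(simp add: RC_simps)

lemma rM_torus_pt:
 assumes t: "t :. TT" and v: "v :. M" and s: "s :. S"
 shows "rM (tr t) (ptensor M S v s) = ptensor M S (tact t v) s"
 using DO.\<rho>_ptensor[OF M tr_closed[OF t] v s] act_one[OF S_module s] by(simp add: cover_perm_one of_torus_def)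

text \<open>On the tensor product with the spinors the torus acts through the first factor only; the projection is
 the same average as on the module.\<close>

lemma J_Q:
 assumes x: "x :. TM"
 shows "J (Q x) = (\<Oplus>\<^sub>TM t\<in>carrier TT. cf t \<odot>\<^sub>TM rM (tr t) x)"
proof (rule tensor_lin_eqI[OF M_cspace S_cspace lin_comp[OF Q_lin J_lin] _ _ x])
 interpret TM: module CC TM by(rule TM_cspace)
 show "(%x. \<Oplus>\<^sub>TM t\<in>carrier TT. cf t \<odot>\<^sub>TM rM (tr t) x) : lin_maps TM TM"
  by(rule lin_finsum_map[OF TM_cspace TM_cspace torus_finite
     lin_const_smult[OF TM_cspace DO.\<rho>_lin[OF M tr_closed]]])
 fix v s assume v: "v :. M" and s: "s :. S"
 have "J (Q (ptensor M S v s)) = ptensor M S (pr v) s"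
  unfolding Q_pt[OF v s] by(rule J_pt[OF pt_W[OF pr_WS[OF v]] s])
 also have "... = (\<Oplus>\<^sub>TM t\<in>carrier TT. ptensor M S (cf t \<odot>\<^sub>M tact t v) s)" unfolding wproj_def
  by(rule lin_finsum[OF M_cspace TM_cspace ptensor_lin_left[OF M_cspace S_cspace s] torus_finite
     cf_tact_closed[OF _ v]])
 also have "... = (\<Oplus>\<^sub>TM t\<in>carrier TT. cf t \<odot>\<^sub>TM rM (tr t) (ptensor M S v s))"
 proof (rule TM.M.finsum_cong'[OF refl])
  show "(%t. cf t \<odot>\<^sub>TM rM (tr t) (ptensor M S v s)) : carrier TT \<rightarrow> carrier TM"
   using scale_closed[OF TM_cspace lin_closed[OF DO.\<rho>_lin[OF M tr_closed] ptensor_closed[OF v s]]] by blast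
  fix t assume t: "t :. TT"
  show "ptensor M S (cf t \<odot>\<^sub>M tact t v) s = cf t \<odot>\<^sub>TM rM (tr t) (ptensor M S v s)"
   unfolding rM_torus_pt[OF t v s] by(rule ptensor_smult_left[OF M_cspace S_cspace tact_closed[OF t v] s])
 qed
 finally show "J (Q (ptensor M S v s)) = (\<Oplus>\<^sub>TM t\<in>carrier TT. cf t \<odot>\<^sub>TM rM (tr t) (ptensor M S v s))" .
qed

lemma Q_cover:
 assumes y: "y :. YC" and x: "x :. TM"
 shows "Q (rM (\<one>\<^sub>TT, y) x) = young_cover_act m n k a S WMod y (Q x)"
proof -
 note yl = YC_lift[OF y]
 have g: "(\<one>\<^sub>TT, y) :. RC" using yl(4) torus_one_closed by(simp add: RC_simps)
 let ?w = "cover_perm n y"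
 have ec: "Ep ?w :. HH" by(rule El_closed[OF of_perm_closed[OF young_permutes[OF a_comps yl(2)]]])
 show ?thesis
 proof (rule tensor_lin_eqI[OF M_cspace S_cspace lin_comp[OF DO.\<rho>_lin[OF M g] Q_lin]
    lin_comp[OF Q_lin YD.\<rho>_lin[OF WMod_module y]] _ x])
  fix v s assume v: "v :. M" and s: "s :. S"
  have sc: "act S y s :. S" by(rule act_closed[OF S_module yl(3) s])
  have "Q (rM (\<one>\<^sub>TT, y) (ptensor M S v s)) = Q (ptensor M S (act M (Ep ?w) v) (act S y s))"
   using DO.\<rho>_ptensor[OF M g v s] by(simp add: of_perm_def)
  also have "... = ptensor WMod S (act WMod (Yp ?w) (pr v)) (act S y s)"
   using Q_pt[OF act_closed[OF M ec v] sc] pr_perm[OF yl(2) v] act_Yp[OF yl(2) pr_WS[OF v]] by simp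
  also have "... = young_cover_act m n k a S WMod y (Q (ptensor M S v s))"
   unfolding Q_pt[OF v s] by(rule YD.\<rho>_ptensor[OF WMod_module y pt_W[OF pr_WS[OF v]] s, symmetric])
  finally show "Q (rM (\<one>\<^sub>TT, y) (ptensor M S v s)) = young_cover_act m n k a S WMod y (Q (ptensor M S v s))" .
 qed
qed

lemma Q_torus:
 assumes t: "t :. TT" and x: "x :. TM"
 shows "Q (rM (tr t) x) = mu m \<eta> a t \<odot>\<^sub>TW Q x"
proof (rule tensor_lin_eqI[OF M_cspace S_cspace lin_comp[OF DO.\<rho>_lin[OF M tr_closed[OF t]] Q_lin]
   lin_const_smult[OF TW_cspace Q_lin] _ x])
 fix v s assume v: "v :. M" and s: "s :. S"
 have "tact t (pr v) = pr (tact t v)"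
 proof (rule pr_commute[OF El_closed[OF of_torus_closed[OF t]] v id_bij])
  show "El (of_torus t) \<otimes>\<^sub>HH El (of_torus t') = El (of_torus t') \<otimes>\<^sub>HH El (of_torus t)" if "t' :. TT" for t'
   using that t by(simp add: H.Elt_mult of_torus_closed of_torus_mult torus_comm[of t])
 qed simp
 hence "pr (tact t v) = mu m \<eta> a t \<odot>\<^sub>WMod pr v" using pr_torus[OF t v] by(simp add: WMod_simps)
 thus "Q (rM (tr t) (ptensor M S v s)) = mu m \<eta> a t \<odot>\<^sub>TW Q (ptensor M S v s)"
  using rM_torus_pt[OF t v s] Q_pt[OF tact_closed[OF t v] s] Q_pt[OF v s]
   ptensor_smult_left[OF W_csp S_cspace pt_W[OF pr_WS[OF v]] s] by simp
qed

lemma J_torus: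
 assumes t: "t :. TT" and x: "x :. TW"
 shows "rM (tr t) (J x) = mu m \<eta> a t \<odot>\<^sub>TM J x"
proof (rule tensor_lin_eqI[OF W_csp S_cspace lin_comp[OF J_lin DO.\<rho>_lin[OF M tr_closed[OF t]]]
   lin_const_smult[OF TM_cspace J_lin] _ x])
 fix v s assume v: "v :. WMod" and s: "s :. S"
 note vM = WS_carrier[OF pt_WM[OF v]]
 show "rM (tr t) (J (ptensor WMod S v s)) = mu m \<eta> a t \<odot>\<^sub>TM J (ptensor WMod S v s)"
  using J_pt[OF v s] rM_torus_pt[OF t vM s] WS_act[OF pt_WM[OF v] t] ptensor_smult_left[OF M_cspace S_cspace vM s]
  by simp
qed

abbreviation "HM == dirac_coh TM DM"
abbreviation "HW == dirac_coh TW DW"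

lemmas cM = TM_cspace DM_lin and cW = TW_cspace DW_lin

lemma coh_proj_eq: "coh_proj a M = coh_map TW DW Q" and coh_incl_eq: "coh_incl a M = coh_map TM DM J"
 by(simp_all add: coh_proj_def coh_incl_def)

lemma coh_proj_lin: "coh_proj a M : lin_maps HM HW" and coh_incl_lin: "coh_incl a M : lin_maps HW HM"
 unfolding coh_proj_eq coh_incl_eq by(rule coh_map_lin[OF cM cW Q_dirac], rule coh_map_lin[OF cW cM J_dirac])

lemma coh_proj_incl:
 assumes u: "u :. HW"
 shows "coh_proj a M (coh_incl a M u) = u"
 unfolding coh_proj_eq coh_incl_eq coh_map_comp[OF cW cM cW J_dirac Q_dirac u]
 by(rule coh_map_id[OF cW dirac_maps_comp[OF J_dirac Q_dirac] Q_J u])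

lemma coh_incl_proj:
 assumes u: "u :. HM"
 shows "coh_incl a M (coh_proj a M u) = (\<Oplus>\<^sub>HM t\<in>carrier TT. cf t \<odot>\<^sub>HM coh_map TM DM (rM (tr t)) u)"
 unfolding coh_proj_eq coh_incl_eq coh_map_comp[OF cM cW cM Q_dirac J_dirac u]
 by(rule coh_map_finsum[OF cM cM torus_finite dirac_maps_comp[OF Q_dirac J_dirac]
    DO.\<rho>_dirac_maps[OF M tr_closed] J_Q u])

lemma coh_proj_cover:
 assumes y: "y :. YC" and u: "u :. HM"
 shows "coh_proj a M (coh_map TM DM (rM (\<one>\<^sub>TT, y)) u) =
  coh_map TW DW (young_cover_act m n k a S WMod y) (coh_proj a M u)"
proof -
 have g: "(\<one>\<^sub>TT, y) :. RC" using YC_lift(4)[OF y] torus_one_closed by(simp add: RC_simps)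
 note r = DO.\<rho>_dirac_maps[OF M g] and r' = YD.\<rho>_dirac_maps[OF WMod_module y]
 show ?thesis
  unfolding coh_proj_eq coh_map_comp[OF cM cM cW r Q_dirac u] coh_map_comp[OF cM cW cW Q_dirac r' u]
  by(rule coh_map_cong[OF cM cW dirac_maps_comp[OF r Q_dirac] dirac_maps_comp[OF Q_dirac r'] Q_cover[OF y] u])
qed

lemma coh_proj_torus:
 assumes t: "t :. TT" and u: "u :. HM"
 shows "coh_proj a M (coh_map TM DM (rM (tr t)) u) = mu m \<eta> a t \<odot>\<^sub>HW coh_proj a M u"
proof -
 note r = DO.\<rho>_dirac_maps[OF M tr_closed[OF t]]
 show ?thesis unfolding coh_proj_eq coh_map_comp[OF cM cM cW r Q_dirac u]
  by(rule coh_map_smult[OF cM cW dirac_maps_comp[OF r Q_dirac] Q_dirac Q_torus[OF t] u])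
qed

lemma coh_incl_torus:
 assumes t: "t :. TT" and u: "u :. HW"
 shows "coh_map TM DM (rM (tr t)) (coh_incl a M u) = mu m \<eta> a t \<odot>\<^sub>HM coh_incl a M u"
proof -
 note r = DO.\<rho>_dirac_maps[OF M tr_closed[OF t]]
 show ?thesis unfolding coh_incl_eq coh_map_comp[OF cW cM cM J_dirac r u]
  by(rule coh_map_smult[OF cW cM dirac_maps_comp[OF J_dirac r] J_dirac J_torus[OF t] u])
qed

end

section \<open>The natural isomorphism\<close>

lemma functor_comp_is_functor: "is_functor C D F ==> is_functor D E G ==> is_functor C E (functor_comp G F)"
 unfolding is_functor_def functor_comp_def functr.simps by simp

lemma prod_functor_is_functor:
 assumes "!!i. i : I ==> is_functor (C i) (D i) (F i)"
 shows "is_functor (prod_cat I C) (prod_cat I D) (prod_functor I F)"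
 unfolding is_functor_def prod_cat_def prod_functor_def cat.simps functr.simps
proof (intro conjI ballI)
 note f = assms[unfolded is_functor_def]
 fix U assume U: "U : (\<Pi>\<^sub>E i\<in>I. Ob (C i))"
 show "(\<lambda>i\<in>I. omap (F i) (U i)) : (\<Pi>\<^sub>E i\<in>I. Ob (D i))" using f PiE_mem[OF U] by simp
 show "(\<lambda>i\<in>I. mmap (F i) (U i) (U i) ((\<lambda>i\<in>I. Idn (C i) (U i)) i)) =
   (\<lambda>i\<in>I. Idn (D i) ((\<lambda>i\<in>I. omap (F i) (U i)) i))" by(rule restrict_ext) (use f PiE_mem[OF U] in simp)
 fix V assume V: "V : (\<Pi>\<^sub>E i\<in>I. Ob (C i))"
 fix g assume g: "g : (\<Pi>\<^sub>E i\<in>I. Hom (C i) (U i) (V i))"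
 show "(\<lambda>i\<in>I. mmap (F i) (U i) (V i) (g i)) \<in>
   (\<Pi>\<^sub>E i\<in>I. Hom (D i) ((\<lambda>i\<in>I. omap (F i) (U i)) i) ((\<lambda>i\<in>I. omap (F i) (V i)) i))"
  using f PiE_mem[OF U] PiE_mem[OF V] PiE_mem[OF g] by simp
 fix W h assume W: "W : (\<Pi>\<^sub>E i\<in>I. Ob (C i))" and h: "h : (\<Pi>\<^sub>E i\<in>I. Hom (C i) (V i) (W i))"
 show "(\<lambda>i\<in>I. mmap (F i) (U i) (W i) ((\<lambda>i\<in>I. Cmp (C i) (U i) (V i) (W i) (h i) (g i)) i)) =
   (\<lambda>i\<in>I. Cmp (D i) ((\<lambda>i\<in>I. omap (F i) (U i)) i) ((\<lambda>i\<in>I. omap (F i) (V i)) i) ((\<lambda>i\<in>I. omap (F i) (W i)) i)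
    ((\<lambda>i\<in>I. mmap (F i) (V i) (W i) (h i)) i) ((\<lambda>i\<in>I. mmap (F i) (U i) (V i) (g i)) i))"
 proof (rule restrict_ext)
  fix i assume i: "i : I"
  show "mmap (F i) (U i) (W i) ((\<lambda>i\<in>I. Cmp (C i) (U i) (V i) (W i) (h i) (g i)) i) =
   Cmp (D i) ((\<lambda>i\<in>I. omap (F i) (U i)) i) ((\<lambda>i\<in>I. omap (F i) (V i)) i) ((\<lambda>i\<in>I. omap (F i) (W i)) i)
    ((\<lambda>i\<in>I. mmap (F i) (V i) (W i) (h i)) i) ((\<lambda>i\<in>I. mmap (F i) (U i) (V i) (g i)) i)"
   using f[OF i] PiE_mem[OF U i] PiE_mem[OF V i] PiE_mem[OF W i] PiE_mem[OF g i] PiE_mem[OF h i] i by simp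
 qed
qed

lemma (in young_params) coh_proj_natural:
 fixes M M' :: "(do_alg, 'v) lmod"
 assumes M: "alg_module HH M" and M': "alg_module HH M'" and f: "f : equivariant_maps (carrier HH) M M'"
  and u: "u :. dirac_coh (tensor M S) (do_dirac m n k S M)"
 shows "coh_proj a M' (coh_map (tensor M' S) (do_dirac m n k S M') (tensor_map M' S f id) u) =
  coh_map (tensor (WM a M') S) (young_dirac m n k a S (WM a M'))
   (tensor_map (WM a M') S (restrict f (Wsp a M)) id) (coh_proj a M u)"
proof -
 interpret U: weight_params m n k \<eta> S a M by unfold_locales (rule M)
 interpret V: weight_params m n k \<eta> S a M' by unfold_locales (rule M')
 let ?h = "restrict f U.WS"
 let ?F = "tensor_map M' S f id" and ?H = "tensor_map V.WMod S ?h id"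
 note hom = weight_hom[OF M M' f]
 have fl: "f : lin_maps M M'" and fe: "!!x v. x :. HH ==> v :. M ==> f (act M x v) = act M' x (f v)"
  using f by(auto simp: equivariant_maps_def)
 have hl: "?h : lin_maps U.WMod V.WMod" using hom unfolding equivariant_maps_def by blast
 note F = U.DO.tensor_map_dirac_maps[OF M M' f]
  and H = U.YD.tensor_map_dirac_maps[OF U.WMod_module V.WMod_module hom]
 have pr: "V.pr (f v) = f (U.pr v)" if v: "v :. M" for v
 proof -
  have "f (U.pr v) = (\<Oplus>\<^sub>M' t\<in>carrier TT. f (U.cf t \<odot>\<^sub>M U.tact t v))" unfolding wproj_def
   by(rule lin_finsum[OF U.M_cspace V.M_cspace fl torus_finite U.cf_tact_closed[OF _ v]])
  also have "... = V.pr (f v)" unfolding wproj_def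
  proof (rule V.M.M.finsum_cong'[OF refl])
   show "(%t. U.cf t \<odot>\<^sub>M' V.tact t (f v)) : carrier TT \<rightarrow> carrier M'"
    using V.cf_tact_closed[OF _ lin_closed[OF fl v]] by blast
   show "f (U.cf t \<odot>\<^sub>M U.tact t v) = U.cf t \<odot>\<^sub>M' V.tact t (f v)" if t: "t :. TT" for t
    unfolding lin_smult[OF fl U.tact_closed[OF t v]] fe[OF El_closed[OF of_torus_closed[OF t]] v] ..
  qed
  finally show ?thesis ..
 qed
 have comm: "V.Q (?F x) = ?H (U.Q x)" if x: "x :. U.TM" for x
 proof (rule tensor_lin_eqI[OF U.M_cspace S_cspace _ _ _ x])
  note Fl = dirac_maps_lin[OF F] and Hl = dirac_maps_lin[OF H]
  show "(%x. V.Q (?F x)) : lin_maps U.TM V.TW" by(rule lin_comp[OF Fl V.Q_lin])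
  show "(%x. ?H (U.Q x)) : lin_maps U.TM V.TW" by(rule lin_comp[OF U.Q_lin Hl])
  fix v s assume v: "v :. M" and s: "s :. S"
  have "V.Q (?F (ptensor M S v s)) = ptensor V.WMod S (V.pr (f v)) s"
   using tensor_map_ptensor[OF U.M_cspace S_cspace V.M_cspace S_cspace fl U.id_lin v s]
    V.Q_pt[OF lin_closed[OF fl v] s] by simp
  also have "... = ptensor V.WMod S (?h (U.pr v)) s" using pr[OF v] U.pr_WS[OF v] by simp
  also have "... = ?H (U.Q (ptensor M S v s))"
   using tensor_map_ptensor[OF U.W_csp S_cspace V.W_csp S_cspace hl U.id_lin U.pt_W[OF U.pr_WS[OF v]] s]
    U.Q_pt[OF v s] by(simp del: restrict_apply)
  finally show "V.Q (?F (ptensor M S v s)) = ?H (U.Q (ptensor M S v s))" .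
 qed
 show ?thesis unfolding U.coh_proj_eq V.coh_proj_eq coh_map_comp[OF U.cM V.cM V.cW F V.Q_dirac u]
   coh_map_comp[OF U.cM U.cW V.cW U.Q_dirac H u]
  by(rule coh_map_cong[OF U.cM V.cW dirac_maps_comp[OF F V.Q_dirac] dirac_maps_comp[OF U.Q_dirac H] comm u])
qed

context dirac_params
begin

abbreviation "young_coh a == dirac_cohomology S (young_dirac m n k a S) (young_cover_act m n k a S)"
abbreviation "HD == do_cohomology m n k S"
abbreviation "HYF == functor_comp (young_cohomology m n k S) (weight_functor m n k \<eta>)"

lemma HYF_omap: "a : comps m n ==> omap HYF M a = omap (young_coh a) (WM a M)"
 by(simp add: functor_comp_def young_cohomology_def prod_functor_def weight_functor_def)

lemma HYF_mmap: "a : comps m n ==> mmap HYF M M' f a =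
  mmap (young_coh a) (WM a M) (WM a M') (restrict f (Wsp a M))"
 by(simp add: functor_comp_def young_cohomology_def prod_functor_def weight_functor_def)

lemma do_cohomology_functor: "is_functor (module_cat HH) (rep_cat RC) HD"
 unfolding do_cohomology_def by(rule dirac_datum.dirac_cohomology_functor[OF do_datum])

lemma young_cohomology_functor: "is_functor (prod_cat (comps m n) (%a. module_cat (young_hecke m k a)))
  (prod_cat (comps m n) (%a. rep_cat (young_cover m n a))) (young_cohomology m n k S)"
 unfolding young_cohomology_def by(rule prod_functor_is_functor)
  (rule dirac_datum.dirac_cohomology_functor[OF young_params.young_datum[OF young_paramsI]])

definition iso :: "(do_alg, 'v) lmod => ('v \<times> 's => complex) set set =>
  (nat => nat) => (nat => int) \<times> cliff_alg => ('v \<times> 's => complex) set set" where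
 "iso M = (\<lambda>x\<in>carrier (omap HD M). \<lambda>a\<in>comps m n. \<lambda>g\<in>carrier RC. coh_proj a M (act (omap HD M) (inv\<^bsub>RC\<^esub> g) x))"

text \<open>Cohomology turns the identities between \<open>J\<close> and \<open>Q\<close> into the assumptions of the Clifford correspondence.\<close>

lemma iso_equivariant_bij:
 fixes M :: "(do_alg, 'v) lmod"
 assumes M: "alg_module HH M"
 shows "iso M : equivariant_maps (carrier RC) (omap HD M) (back_rep (omap HYF M))"
  and "bij_betw (iso M) (carrier (omap HD M)) (carrier (back (omap HYF M)))"
proof -
 have HD: "omap HD M = with_act (dirac_coh (tensor M S) (do_dirac m n k S M))
   (%g. coh_map (tensor M S) (do_dirac m n k S M) (do_cover_act m n k S M g))"
  by(simp add: do_cohomology_def dirac_cohomology_simps)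
 have HY: "omap HYF M a = with_act (dirac_coh (tensor (WM a M) S) (young_dirac m n k a S (WM a M)))
   (%g. coh_map (tensor (WM a M) S) (young_dirac m n k a S (WM a M)) (young_cover_act m n k a S (WM a M) g))"
  if "a : comps m n" for a unfolding HYF_omap[OF that] by(rule dirac_cohomology_simps)
 have W: "weight_params m n k \<eta> S a M" if a: "a : comps m n" for a
  by(rule weight_params.intro[OF young_paramsI[OF a]], unfold_locales) (rule M)
 have rM: "group_rep RC (omap HD M)"
  using do_cohomology_functor M unfolding is_functor_def module_cat_def rep_cat_def cat.simps by blast
 have rY: "group_rep (young_cover m n a) (omap HYF M a)" if a: "a : comps m n" for a
 proof -
  have "is_functor (module_cat (young_hecke m k a)) (rep_cat (young_cover m n a))
    (young_coh a :: ((young_alg, 'v) lmod, _, _, _) functr)"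
   by(rule dirac_datum.dirac_cohomology_functor[OF young_params.young_datum[OF young_paramsI[OF a]]])
  thus ?thesis
   using weight_params.WMod_module[OF W[OF a]] unfolding HYF_omap[OF a] is_functor_def module_cat_def rep_cat_def cat.simps
   by blast
 qed
 interpret C: clifford_correspondence m n k \<eta> S "omap HD M" "omap HYF M" "%a. coh_proj a M" "%a. coh_incl a M"
 proof unfold_locales
  show "group_rep RC (omap HD M)" by(rule rM)
  fix a assume a: "a : comps m n"
  interpret U: weight_params m n k \<eta> S a M by(rule W[OF a])
  show "group_rep (young_cover m n a) (omap HYF M a)" by(rule rY[OF a])
  show "coh_proj a M : lin_maps (omap HD M) (omap HYF M a)"
   using U.coh_proj_lin unfolding HD HY[OF a] by(simp add: lin_maps_def)
  show "coh_incl a M : lin_maps (omap HYF M a) (omap HD M)"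
   using U.coh_incl_lin unfolding HD HY[OF a] by(simp add: lin_maps_def)
  show "coh_proj a M (coh_incl a M u) = u" if "u :. omap HYF M a" for u
   using U.coh_proj_incl that unfolding HY[OF a] with_act_simps .
  show "act (omap HD M) (t, \<one>\<^sub>(clifford n)) (coh_incl a M u) = mu m \<eta> a t \<odot>\<^sub>(omap HD M) coh_incl a M u"
   if "t :. TT" "u :. omap HYF M a" for t u using U.coh_incl_torus that unfolding HD HY[OF a] with_act_simps .
  fix v assume v: "v :. omap HD M"
  hence v': "v :. U.HM" unfolding HD with_act_simps .
  have fs: "finsum (omap HD M) = finsum U.HM" unfolding HD by(intro ext) (simp add: finsum_def finprod_def)
  show "coh_incl a M (coh_proj a M v) = (\<Oplus>\<^sub>(omap HD M)t\<in>carrier TT.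
    (inverse (mu m \<eta> a t) / of_nat (m ^ n)) \<odot>\<^sub>(omap HD M) act (omap HD M) (t, \<one>\<^sub>(clifford n)) v)"
   unfolding U.coh_incl_proj[OF v'] fs unfolding HD with_act_simps ..
  show "coh_proj a M (act (omap HD M) (\<one>\<^sub>TT, x) v) = act (omap HYF M a) x (coh_proj a M v)"
   if "x :. young_cover m n a" for x
   unfolding HD HY[OF a] with_act_simps by(rule U.coh_proj_cover[OF that v'])
  show "coh_proj a M (act (omap HD M) (t, \<one>\<^sub>(clifford n)) v) = mu m \<eta> a t \<odot>\<^sub>(omap HYF M a) coh_proj a M v"
   if "t :. TT" for t unfolding HD HY[OF a] with_act_simps by(rule U.coh_proj_torus[OF that v'])
 qed
 have "C.\<theta> = iso M" by(simp add: C.\<theta>_def iso_def)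
 thus "iso M : equivariant_maps (carrier RC) (omap HD M) (back_rep (omap HYF M))"
  "bij_betw (iso M) (carrier (omap HD M)) (carrier (back (omap HYF M)))"
  using C.\<theta>_equivariant C.\<theta>_bij by simp_all
qed

text \<open>A homomorphism of modules commutes with the averages over the torus and hence with the isomorphism.\<close>

lemma iso_natural:
 fixes M M' :: "(do_alg, 'v) lmod"
 assumes M: "alg_module HH M" and M': "alg_module HH M'" and f: "f : equivariant_maps (carrier HH) M M'"
  and x: "x :. omap HD M"
 shows "iso M' (mmap HD M M' f x) = mmap (functor_comp indF HYF) M M' f (iso M x)"
proof -
 have HD: "omap HD M = with_act (dirac_coh (tensor M S) (do_dirac m n k S M))
   (%g. coh_map (tensor M S) (do_dirac m n k S M) (do_cover_act m n k S M g))" for M :: "(do_alg, 'v) lmod"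
  by(simp add: do_cohomology_def dirac_cohomology_simps)
 have rM: "group_rep RC (omap HD M)"
  and hom: "mmap HD M M' f : equivariant_maps (carrier RC) (omap HD M) (omap HD M')"
  using do_cohomology_functor M M' f unfolding is_functor_def module_cat_def rep_cat_def cat.simps by blast+
 have xf: "mmap HD M M' f x :. omap HD M'"
  using hom x unfolding equivariant_maps_def by(blast intro: lin_closed)
 have ix: "iso M x :. back (omap HYF M)"
  by(rule bij_betwE[OF iso_equivariant_bij(2)[OF M], rule_format, OF x])
 have "coh_proj a M' (act (omap HD M') (inv\<^bsub>RC\<^esub> g) (mmap HD M M' f x)) = mmap HYF M M' f a (iso M x a g)"
  if a: "a : comps m n" and g: "g :. RC" for a g
 proof -
  define y where "y = act (omap HD M) (inv\<^bsub>RC\<^esub> g) x"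
  have y: "y :. omap HD M" unfolding y_def by(rule rep_closed[OF rM RC.inv_closed[OF g] x])
  hence y': "y :. dirac_coh (tensor M S) (do_dirac m n k S M)" unfolding HD with_act_simps .
  interpret U: weight_params m n k \<eta> S a M
   by(rule weight_params.intro[OF young_paramsI[OF a]], unfold_locales) (rule M)
  have "act (omap HD M') (inv\<^bsub>RC\<^esub> g) (mmap HD M M' f x) = mmap HD M M' f y"
   using hom RC.inv_closed[OF g] x unfolding equivariant_maps_def y_def by simp
  also have "... = coh_map (tensor M' S) (do_dirac m n k S M') (tensor_map M' S f id) y"
   using y' by(simp add: do_cohomology_def dirac_cohomology_simps)
  finally have "coh_proj a M' (act (omap HD M') (inv\<^bsub>RC\<^esub> g) (mmap HD M M' f x)) =
    coh_map (tensor (WM a M') S) (young_dirac m n k a S (WM a M'))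
     (tensor_map (WM a M') S (restrict f (Wsp a M)) id) (coh_proj a M y)"
   using U.coh_proj_natural[OF M M' f y'] by simp
  also have "... = mmap HYF M M' f a (coh_proj a M y)" unfolding HYF_mmap[OF a] dirac_cohomology_simps
   by(rule restrict_apply'[symmetric]) (rule lin_closed[OF U.coh_proj_lin y'])
  also have "coh_proj a M y = iso M x a g" using x a g by(simp add: iso_def y_def)
  finally show ?thesis .
 qed
 hence "iso M' (mmap HD M M' f x) = (\<lambda>a\<in>comps m n. \<lambda>g\<in>carrier RC. mmap HYF M M' f a (iso M x a g))"
  unfolding iso_def[of M'] restrict_apply'[OF xf] by(intro restrict_ext) simp
 also have "... = mmap (functor_comp indF HYF) M M' f (iso M x)"
  using ix unfolding functor_comp_def[of "indF"] functr.simps induction_functor_simps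
  by(simp only: restrict_apply')
 finally show ?thesis .
qed

theorem cohomology_commutes: "naturally_isomorphic (module_cat HH :: ((do_alg, 'v) lmod, 'v => 'v) cat) RC HD
  (functor_comp indF HYF)" unfolding naturally_isomorphic_def
proof (intro conjI exI[of _ iso] ballI)
 show "is_functor (module_cat HH) (rep_cat RC) HD" by(rule do_cohomology_functor)
 show "is_functor (module_cat HH) (rep_cat RC) (functor_comp indF HYF)"
  by(rule functor_comp_is_functor[OF functor_comp_is_functor[OF weight_functor_is_functor
      young_cohomology_functor] induction_functor_is_functor])
 have o: "omap (functor_comp indF HYF) M = back_rep (omap HYF M)" for M :: "(do_alg, 'v) lmod"
  by(simp only: functor_comp_def[of "indF"] functr.simps induction_functor_simps)
 fix M :: "(do_alg, 'v) lmod" assume "M : Ob (module_cat HH)"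
 hence M: "alg_module HH M" by(simp add: module_cat_def)
 show "iso M : equivariant_maps (carrier RC) (omap HD M) (omap (functor_comp indF HYF) M)"
  unfolding o by(rule iso_equivariant_bij(1)[OF M])
 show "bij_betw (iso M) (carrier (omap HD M)) (carrier (omap (functor_comp indF HYF) M))"
  unfolding o with_act_simps by(rule iso_equivariant_bij(2)[OF M])
 fix M' :: "(do_alg, 'v) lmod" and f x
 assume "M' : Ob (module_cat HH)" and f: "f : Hom (module_cat HH) M M'" and x: "x :. omap HD M"
 hence M': "alg_module HH M'" and f': "f : equivariant_maps (carrier HH) M M'" by(simp_all add: module_cat_def)
 show "iso M' (mmap HD M M' f x) = mmap (functor_comp indF HYF) M M' f (iso M x)"
  by(rule iso_natural[OF M M' f' x])
qed

end

theorem corollary6p8: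
 fixes m n :: nat and k \<eta> :: complex and S :: "(cliff_alg, 's) lmod"
 assumes "m \<ge> 1" and "n \<ge> 1" and "primitive_root m \<eta>" and "spinor_module n S"
 shows "let DO_mod = (module_cat (do_hecke m n k) :: ((do_alg, 'v) lmod, 'v \<Rightarrow> 'v) cat);
     Young_mod = prod_cat (comps m n) (\<lambda>a. module_cat (young_hecke m k a));
     Young_rep = prod_cat (comps m n) (\<lambda>a. rep_cat (young_cover m n a)); F = weight_functor m n k \<eta>;
     H_DO = do_cohomology m n k S; H_Young = young_cohomology m n k S; F_inv = induction_functor m n \<eta>
   in is_functor DO_mod Young_mod F \<and> is_functor Young_mod Young_rep H_Young \<and>
    is_functor Young_rep (rep_cat (refl_cover m n)) F_inv \<and>
    is_functor DO_mod (rep_cat (refl_cover m n)) H_DO \<and>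
    naturally_isomorphic DO_mod (refl_cover m n) H_DO (functor_comp F_inv (functor_comp H_Young F))"
proof -
 interpret dirac_params m n k \<eta> S using assms(1,3,4) by unfold_locales
 show ?thesis unfolding Let_def
  by (intro conjI weight_functor_is_functor young_cohomology_functor induction_functor_is_functor
    do_cohomology_functor cohomology_commutes)
qed

end
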